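(* Let $(G,\mathcal X)$ be a self-similar groupoid action. Then, for each abelian group $A$, there is a long exact sequence in homology $$\cdots\to H_{n+1}(\mathscr G_{\mathcal X},A)\to H_n(G_{\mathrm{reg}},A)\xrightarrow{\ \mathrm{id}-H_n(\mathcal X_{\mathrm{reg}},A)\ }H_n(G,A)\to H_n(\mathscr G_{\mathcal X},A)\to\cdots$$ where $\mathcal X_{\mathrm{reg}}\colon G_{\mathrm{reg}}\to G$ is the restriction of $\mathcal X$ to $G_{\mathrm{reg}}$.
   Context: A self-similar groupoid action $(G,\mathcal X)$ is a discrete groupoid $G$ (unit space $G^0$) with an étale correspondence $\mathcal X\colon G\to G$: a set $\mathcal X$ with anchor maps $r,s\colon\mathcal X\to G^0$, and commuting left (anchor $r$) and right (anchor $s$) actions of $G$, the right action being free. A vertex $v\in G^0$ is regular if $0<|r^{-1}(v)/G|<\infty$, otherwise singular. $G_{\mathrm{reg}}$ is the restriction of $G$ to the (invariant) set of regular vertices and $\mathcal X_{\mathrm{reg}}=\{x\in\mathcal X:r(x)\text{ regular}\}$. Graph picture: choose a transversal $E\subseteq\mathcal X$ for $\mathcal X/G$, so each $x\in\mathcal X$ is uniquely $eh$ with $e\in E$, $h\in G$. With $E^0=G^0$ and $r,s$ restricted to $E$, $E$ is a directed graph; for $s(g)=r(e)$ write $ge=g(e)\,g|_e$ with $g(e)\in E$, $g|_e\in G$. Paths are $e_1\cdots e_n$ with $s(e_i)=r(e_{i+1})$, vertices being paths of length $0$; $E^+$ is the set of finite paths. Extend by $g(s(g))=r(g)$, $g|_{s(g)}=g$,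 $g(ep)=g(e)g|_e(p)$, $g|_{ep}=(g|_e)|_p$, and to infinite paths. The boundary path space $\partial E$ consists of all infinite paths and finite paths with singular source, with basis $p\partial E\setminus\bigcup_{e\in F}pe\partial E$ ($F$ a finite set of edges with range $s(p)$). Groupoid $\mathscr G_{\mathcal X}$ (independent of $E$ up to isomorphism): let $S$ consist of $0$ and triples $(p,g,q)$, $p,q\in E^+$, $g\in G$, $s(p)=r(g)$, $s(q)=s(g)$, with product $(p,g,q)(p',h,q')=(p\,g(t),g|_th,q')$ if $p'=qt$, $=(p,g\,h|_{h^{-1}(t)},q'h^{-1}(t))$ if $q=p't$, $0$ otherwise; nonzero idempotents are $(p,s(p),p)$. $(p,g,q)$ acts as $q\partial E\to p\partial E$, $qw\mapsto p\,g(w)$. $\mathscr G_{\mathcal X}$ is the ample groupoid of classes $[a,w]$, $w\in\mathrm{dom}(a)$, where $[a,w]=[b,w']$ iff $w=w'$ and $ae=be$ for some idempotent $e$ with $w\in\mathrm{dom}(e)$; $[a,b(w)][b,w]=[ab,w]$; basic open sets $\{[a,w]:w\in U\}$, $U\subseteq\mathrm{dom}(a)$ open. Homology of an ample groupoid $\mathscr G$ with coefficients in $A$: homology of $C_n(\mathscr G,A)=A\mathscr G^n$ (functions on composable $n$-tuples to $A$ spanned by $a1_U$, $U$ compact open Hausdorff; $\mathscr G^0$ = units), $\partial_n=\sum_{i=0}^n(-1)^i(d_i)_*$, with $d_0$ dropping $g_1$, $d_i$ multiplying $g_ig_{i+1}$ for $1\le i\le n-1$, $d_n$ dropping $g_n$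 (for $n=1$: $d_0$ = source, $d_1$ = range), $f_*(h)(y)=\sum_{f(x)=y}h(x)$. Discrete groupoids are a special case. The map $\mathrm{id}\colon H_n(G_{\mathrm{reg}},A)\to H_n(G,A)$ is induced by the inclusion. The map $H_n(\mathcal X_{\mathrm{reg}},A)$ is the map induced by the proper correspondence $\mathcal X_{\mathrm{reg}}$; concretely it is induced by the chain map $C_n(G_{\mathrm{reg}})\to C_n(G)$, $(g_1,\dots,g_n)\mapsto\sum_{e\in E,\,r(e)=s(g_n)}(g_1|_{g_2\cdots g_n(e)},\dots,g_{n-1}|_{g_n(e)},g_n|_e)$ (for $n=0$: $v\mapsto\sum_{r(e)=v}s(e)$), tensored with $A$, and is independent of $E$. *)

theory Defs
  imports "HOL-Algebra.Elementary_Groups" "HOL-Analysis.Analysis" "HOL-Library.Stream"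
begin

section \<open>Groupoids\<close>

text \<open>
  The unit space is a subset of the set of arrows; \<open>mul G g h\<close> is the product \<open>gh\<close>,
  meaningful when \<open>src G g = rng G h\<close>.
\<close>

record 'g groupoid =
  Arr :: "'g set"
  src :: "'g \<Rightarrow> 'g"
  rng :: "'g \<Rightarrow> 'g"
  mul :: "'g \<Rightarrow> 'g \<Rightarrow> 'g"
  ginv :: "'g \<Rightarrow> 'g"
  Top :: "'g topology"

definition unit_space :: "'g groupoid \<Rightarrow> 'g set" where
  "unit_space G = src G ` Arr G"

locale groupoid =
  fixes G :: "'g groupoid"
  assumes src_unit: "g \<in> Arr G \<Longrightarrow>
      src G g \<in> Arr G \<and> src G (src G g) = src G g \<and> rng G (src G g) = src G g"
    and rng_unit: "g \<in> Arr G \<Longrightarrow>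
      rng G g \<in> Arr G \<and> src G (rng G g) = rng G g \<and> rng G (rng G g) = rng G g"
    and mul_closed: "\<lbrakk>g \<in> Arr G; h \<in> Arr G; src G g = rng G h\<rbrakk> \<Longrightarrow>
      mul G g h \<in> Arr G \<and> src G (mul G g h) = src G h \<and> rng G (mul G g h) = rng G g"
    and mul_assoc: "\<lbrakk>g \<in> Arr G; h \<in> Arr G; k \<in> Arr G; src G g = rng G h; src G h = rng G k\<rbrakk> \<Longrightarrow>
      mul G (mul G g h) k = mul G g (mul G h k)"
    and mul_unit: "g \<in> Arr G \<Longrightarrow> mul G g (src G g) = g \<and> mul G (rng G g) g = g"
    and ginv_closed: "g \<in> Arr G \<Longrightarrow>
      ginv G g \<in> Arr G \<and> src G (ginv G g) = rng G g \<and> rng G (ginv G g) = src G g"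
    and mul_ginv: "g \<in> Arr G \<Longrightarrow> mul G (ginv G g) g = src G g \<and> mul G g (ginv G g) = rng G g"

locale discrete_groupoid = groupoid +
  assumes discrete: "Top G = discrete_topology (Arr G)"

definition restriction :: "'g groupoid \<Rightarrow> 'g set \<Rightarrow> 'g groupoid" where
  "restriction G V =
     (let B = {g \<in> Arr G. src G g \<in> V \<and> rng G g \<in> V}
      in G\<lparr>Arr := B, Top := subtopology (Top G) B\<rparr>)"


section \<open>Groupoid homology\<close>

text \<open>
  Composable \<open>n\<close>-tuples are lists of length \<open>n\<close>, except that an element \<open>u\<close> of the unit space
  (degree \<open>0\<close>) is the one-element list \<open>[u]\<close>.  Degrees are never mixed, so the overlap with
  degree \<open>1\<close> is harmless.
\<close>

definition nerve :: "'g groupoid \<Rightarrow> nat \<Rightarrow> 'g list set" where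
  "nerve G n =
     (if n = 0 then {[u] |u. u \<in> unit_space G}
      else {gs. length gs = n \<and> set gs \<subseteq> Arr G \<and>
                (\<forall>i. Suc i < n \<longrightarrow> src G (gs ! i) = rng G (gs ! Suc i))})"

definition nerve_topology :: "'g groupoid \<Rightarrow> nat \<Rightarrow> 'g list topology" where
  "nerve_topology G n =
     pullback_topology (nerve G n) (\<lambda>gs. \<lambda>i\<in>{..<max 1 n}. gs ! i)
       (product_topology (\<lambda>_. Top G) {..<max 1 n})"

text \<open>List positions start at \<open>0\<close>, so the arrow \<open>g\<^sub>i\<close> of a tuple is \<open>gs ! (i - 1)\<close>.\<close>

definition face :: "'g groupoid \<Rightarrow> nat \<Rightarrow> nat \<Rightarrow> 'g list \<Rightarrow> 'g list" where
  "face G n i gs =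
     (if n = 1 then (if i = 0 then [src G (hd gs)] else [rng G (hd gs)])
      else if i = 0 then tl gs
      else if i = n then butlast gs
      else take (i - 1) gs @ [mul G (gs ! (i - 1)) (gs ! i)] @ drop (i + 1) gs)"

definition fun_group :: "('b \<Rightarrow> 'a::ab_group_add) monoid" where
  "fun_group = \<lparr>carrier = UNIV, monoid.mult = (\<lambda>f g x. f x + g x), monoid.one = (\<lambda>_. 0)\<rparr>"

text \<open>
  Chains are functions on all lists that vanish off the nerve.  The coefficient group \<open>A\<close> is
  the type \<open>'a\<close>, passed as a type token.
\<close>

definition chain_group ::
    "'a::ab_group_add itself \<Rightarrow> 'g groupoid \<Rightarrow> nat \<Rightarrow> ('g list \<Rightarrow> 'a) monoid" where
  "chain_group A G n =
     subgroup_generated fun_group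
       {(\<lambda>x. if x \<in> U then a else 0) |a U.
          compactin (nerve_topology G n) U \<and> openin (nerve_topology G n) U \<and>
          Hausdorff_space (subtopology (nerve_topology G n) U)}"

text \<open>
  For chains \<open>h\<close> and the face maps the sum has finitely many nonzero terms; only these are
  summed.
\<close>

definition pushforward :: "'b set \<Rightarrow> ('b \<Rightarrow> 'c) \<Rightarrow> ('b \<Rightarrow> 'a::ab_group_add) \<Rightarrow> 'c \<Rightarrow> 'a" where
  "pushforward B f h y = (\<Sum>x | x \<in> B \<and> f x = y \<and> h x \<noteq> 0. h x)"

definition boundary :: "'g groupoid \<Rightarrow> nat \<Rightarrow> ('g list \<Rightarrow> 'a::ab_group_add) \<Rightarrow> 'g list \<Rightarrow> 'a" where
  "boundary G n h y =
     (if n = 0 then 0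
      else \<Sum>i\<le>n. if even i then pushforward (nerve G n) (face G n i) h y
                   else - pushforward (nerve G n) (face G n i) h y)"

definition cycles :: "'a::ab_group_add itself \<Rightarrow> 'g groupoid \<Rightarrow> nat \<Rightarrow> ('g list \<Rightarrow> 'a) set" where
  "cycles A G n = {c \<in> carrier (chain_group A G n). boundary G n c = (\<lambda>_. 0)}"

definition boundaries :: "'a::ab_group_add itself \<Rightarrow> 'g groupoid \<Rightarrow> nat \<Rightarrow> ('g list \<Rightarrow> 'a) set" where
  "boundaries A G n = boundary G (Suc n) ` carrier (chain_group A G (Suc n))"

definition homology ::
    "'a::ab_group_add itself \<Rightarrow> 'g groupoid \<Rightarrow> nat \<Rightarrow> ('g list \<Rightarrow> 'a) set monoid" where
  "homology A G n = (chain_group A G n)\<lparr>carrier := cycles A G n\<rparr> Mod boundaries A G n"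

text \<open>
  The map on homology classes induced by a chain map \<open>\<phi>\<close> with values in the chains of \<open>H\<close>:
  the class \<open>Y = [c]\<close> goes to the coset \<open>B + \<phi>(Y)\<close> of the group \<open>B\<close> of boundaries,
  which is \<open>[\<phi>(c)]\<close>.
\<close>

definition homology_map ::
    "'a::ab_group_add itself \<Rightarrow> 'h groupoid \<Rightarrow> nat \<Rightarrow> (('g list \<Rightarrow> 'a) \<Rightarrow> 'h list \<Rightarrow> 'a)
      \<Rightarrow> ('g list \<Rightarrow> 'a) set \<Rightarrow> ('h list \<Rightarrow> 'a) set" where
  "homology_map A H n \<phi> Y = boundaries A H n <#>\<^bsub>chain_group A H n\<^esub> (\<phi> ` Y)"


section \<open>Self-similar groupoid actions\<close>

record ('g, 'x) correspondence =
  Pts :: "'x set"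
  ranc :: "'x \<Rightarrow> 'g"
  sanc :: "'x \<Rightarrow> 'g"
  lact :: "'g \<Rightarrow> 'x \<Rightarrow> 'x"
  ract :: "'x \<Rightarrow> 'g \<Rightarrow> 'x"

locale self_similar_action = discrete_groupoid G
  for G :: "'g groupoid" +
  fixes X :: "('g, 'x) correspondence"
  assumes anchors: "x \<in> Pts X \<Longrightarrow> ranc X x \<in> unit_space G \<and> sanc X x \<in> unit_space G"
    and lact_closed: "\<lbrakk>g \<in> Arr G; x \<in> Pts X; src G g = ranc X x\<rbrakk> \<Longrightarrow>
      lact X g x \<in> Pts X \<and> ranc X (lact X g x) = rng G g \<and> sanc X (lact X g x) = sanc X x"
    and lact_unit: "x \<in> Pts X \<Longrightarrow> lact X (ranc X x) x = x"
    and lact_mul: "\<lbrakk>g \<in> Arr G; h \<in> Arr G; x \<in> Pts X; src G g = rng G h; src G h = ranc X x\<rbrakk> \<Longrightarrow>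
      lact X (mul G g h) x = lact X g (lact X h x)"
    and ract_closed: "\<lbrakk>x \<in> Pts X; g \<in> Arr G; sanc X x = rng G g\<rbrakk> \<Longrightarrow>
      ract X x g \<in> Pts X \<and> ranc X (ract X x g) = ranc X x \<and> sanc X (ract X x g) = src G g"
    and ract_unit: "x \<in> Pts X \<Longrightarrow> ract X x (sanc X x) = x"
    and ract_mul: "\<lbrakk>x \<in> Pts X; g \<in> Arr G; h \<in> Arr G; sanc X x = rng G g; src G g = rng G h\<rbrakk> \<Longrightarrow>
      ract X x (mul G g h) = ract X (ract X x g) h"
    and lact_ract: "\<lbrakk>g \<in> Arr G; x \<in> Pts X; h \<in> Arr G; src G g = ranc X x; sanc X x = rng G h\<rbrakk> \<Longrightarrow>
      ract X (lact X g x) h = lact X g (ract X x h)"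
    and ract_free: "\<lbrakk>x \<in> Pts X; g \<in> Arr G; sanc X x = rng G g; ract X x g = x\<rbrakk> \<Longrightarrow>
      g \<in> unit_space G"
begin

definition right_orbit :: "'x \<Rightarrow> 'x set" where
  "right_orbit x = {ract X x g |g. g \<in> Arr G \<and> sanc X x = rng G g}"

definition regular :: "'g \<Rightarrow> bool" where
  "regular v \<longleftrightarrow> v \<in> unit_space G \<and>
     (let Q = right_orbit ` {x \<in> Pts X. ranc X x = v} in finite Q \<and> Q \<noteq> {})"

definition G_reg :: "'g groupoid" where
  "G_reg = restriction G {v. regular v}"

definition X_reg :: "'x set" where
  "X_reg = {x \<in> Pts X. regular (ranc X x)}"

definition transversal :: "'x set \<Rightarrow> bool" where
  "transversal E \<longleftrightarrow> E \<subseteq> Pts X \<and> (\<forall>x \<in> Pts X. \<exists>!e. e \<in> E \<and> e \<in> right_orbit x)"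

end


section \<open>The graph picture\<close>

text \<open>
  A finite path is a pair of its range vertex and its list of edges, so that the paths of
  length \<open>0\<close> are the vertices.
\<close>

type_synonym ('g, 'x) fpath = "'g \<times> 'x list"

datatype ('g, 'x) bpath = FinP "('g, 'x) fpath" | InfP "'x stream"

text \<open>The inverse semigroup \<open>S\<close> consists of the zero \<open>None\<close> and triples.\<close>

type_synonym ('g, 'x) semi = "(('g, 'x) fpath \<times> 'g \<times> ('g, 'x) fpath) option"

locale graph_picture = self_similar_action G X
  for G :: "'g groupoid" and X :: "('g, 'x) correspondence" +
  fixes E :: "'x set"
  assumes transversal_E: "transversal E"
begin

text \<open>The decomposition \<open>x = eh\<close> with \<open>e = edge x\<close> in \<open>E\<close> and \<open>h = arrow x\<close> in \<open>G\<close>.\<close>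

definition edge :: "'x \<Rightarrow> 'x" where
  "edge x = (THE e. e \<in> E \<and> e \<in> right_orbit x)"

definition arrow :: "'x \<Rightarrow> 'g" where
  "arrow x = (THE h. h \<in> Arr G \<and> sanc X (edge x) = rng G h \<and> ract X (edge x) h = x)"

text \<open>\<open>edge_act g e\<close> is \<open>g(e)\<close> and \<open>edge_res g e\<close> is \<open>g|\<^sub>e\<close>.\<close>

definition edge_act :: "'g \<Rightarrow> 'x \<Rightarrow> 'x" where
  "edge_act g e = edge (lact X g e)"

definition edge_res :: "'g \<Rightarrow> 'x \<Rightarrow> 'g" where
  "edge_res g e = arrow (lact X g e)"

primrec list_act :: "'g \<Rightarrow> 'x list \<Rightarrow> 'x list" where
  "list_act g [] = []"
| "list_act g (e # es) = edge_act g e # list_act (edge_res g e) es"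

primrec list_res :: "'g \<Rightarrow> 'x list \<Rightarrow> 'g" where
  "list_res g [] = g"
| "list_res g (e # es) = list_res (edge_res g e) es"

primcorec stream_act :: "'g \<Rightarrow> 'x stream \<Rightarrow> 'x stream" where
  "stream_act g w = edge_act g (shd w) ## stream_act (edge_res g (shd w)) (stl w)"


subsection \<open>The chain map of the correspondence \<open>X_reg\<close>\<close>

text \<open>
  The tuple \<open>(g\<^sub>1|\<^bsub>g\<^sub>2\<dots>g\<^sub>n(e)\<^esub>, \<dots>, g\<^sub>n|\<^sub>e)\<close>, where \<open>foldr edge_act gs e\<close> is \<open>g\<^sub>2(\<dots>(g\<^sub>n(e)))\<close>
  for \<open>gs = [g\<^sub>2, \<dots>, g\<^sub>n]\<close>.
\<close>

primrec tuple_res :: "'g list \<Rightarrow> 'x \<Rightarrow> 'g list" where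
  "tuple_res [] e = []"
| "tuple_res (g # gs) e = edge_res g (foldr edge_act gs e) # tuple_res gs e"

text \<open>In degree \<open>0\<close> the tuple is \<open>[v]\<close> for a vertex \<open>v\<close>, and \<open>src G v = v\<close>.\<close>

definition X_chain :: "nat \<Rightarrow> ('g list \<Rightarrow> 'a::ab_group_add) \<Rightarrow> 'g list \<Rightarrow> 'a" where
  "X_chain n h y =
     (\<Sum>gs | gs \<in> nerve G_reg n \<and> h gs \<noteq> 0.
        \<Sum>e | e \<in> E \<inter> X_reg \<and> ranc X e = src G (last gs) \<and>
               (if n = 0 then [sanc X e] else tuple_res gs e) = y. h gs)"

definition X_map ::
    "'a::ab_group_add itself \<Rightarrow> nat \<Rightarrow> ('g list \<Rightarrow> 'a) set \<Rightarrow> ('g list \<Rightarrow> 'a) set" where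
  "X_map A n = homology_map A G n (X_chain n)"

text \<open>
  Chains of \<open>G_reg\<close> vanish off its nerve, hence are already chains of \<open>G\<close>: the inclusion is
  the identity on chains.
\<close>

definition incl_map ::
    "'a::ab_group_add itself \<Rightarrow> nat \<Rightarrow> ('g list \<Rightarrow> 'a) set \<Rightarrow> ('g list \<Rightarrow> 'a) set" where
  "incl_map A n = homology_map A G n (\<lambda>h. h)"

definition id_minus_X ::
    "'a::ab_group_add itself \<Rightarrow> nat \<Rightarrow> ('g list \<Rightarrow> 'a) set \<Rightarrow> ('g list \<Rightarrow> 'a) set" where
  "id_minus_X A n Y =
     incl_map A n Y \<otimes>\<^bsub>homology A G n\<^esub> inv\<^bsub>homology A G n\<^esub> (X_map A n Y)"


subsection \<open>Finite paths and boundary paths\<close>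

definition path_rng :: "('g, 'x) fpath \<Rightarrow> 'g" where
  "path_rng p = fst p"

definition path_src :: "('g, 'x) fpath \<Rightarrow> 'g" where
  "path_src p = (if snd p = [] then fst p else sanc X (last (snd p)))"

definition fpaths :: "('g, 'x) fpath set" where
  "fpaths = {(v, es). v \<in> unit_space G \<and> set es \<subseteq> E \<and> (es \<noteq> [] \<longrightarrow> ranc X (hd es) = v) \<and>
     (\<forall>i. Suc i < length es \<longrightarrow> sanc X (es ! i) = ranc X (es ! Suc i))}"

definition path_conc :: "('g, 'x) fpath \<Rightarrow> ('g, 'x) fpath \<Rightarrow> ('g, 'x) fpath" where
  "path_conc p t = (fst p, snd p @ snd t)"

definition path_act :: "'g \<Rightarrow> ('g, 'x) fpath \<Rightarrow> ('g, 'x) fpath" where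
  "path_act g p = (rng G g, list_act g (snd p))"

definition path_res :: "'g \<Rightarrow> ('g, 'x) fpath \<Rightarrow> 'g" where
  "path_res g p = list_res g (snd p)"

definition bpaths :: "('g, 'x) bpath set" where
  "bpaths = {FinP p |p. p \<in> fpaths \<and> \<not> regular (path_src p)} \<union>
     {InfP w |w. \<forall>i. w !! i \<in> E \<and> sanc X (w !! i) = ranc X (w !! Suc i)}"

primrec bpath_rng :: "('g, 'x) bpath \<Rightarrow> 'g" where
  "bpath_rng (FinP p) = path_rng p"
| "bpath_rng (InfP w) = ranc X (shd w)"

primrec bpath_conc :: "('g, 'x) fpath \<Rightarrow> ('g, 'x) bpath \<Rightarrow> ('g, 'x) bpath" where
  "bpath_conc p (FinP t) = FinP (path_conc p t)"
| "bpath_conc p (InfP w) = InfP (snd p @- w)"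

primrec bpath_act :: "'g \<Rightarrow> ('g, 'x) bpath \<Rightarrow> ('g, 'x) bpath" where
  "bpath_act g (FinP p) = FinP (path_act g p)"
| "bpath_act g (InfP w) = InfP (stream_act g w)"

definition cylinder :: "('g, 'x) fpath \<Rightarrow> ('g, 'x) bpath set" where
  "cylinder p = bpath_conc p ` {w \<in> bpaths. bpath_rng w = path_src p}"

definition bpath_topology :: "('g, 'x) bpath topology" where
  "bpath_topology = topology_generated_by
     {cylinder p - (\<Union>e\<in>F. cylinder (path_conc p (ranc X e, [e]))) |p F.
        p \<in> fpaths \<and> finite F \<and> F \<subseteq> {e \<in> E. ranc X e = path_src p}}"


subsection \<open>The inverse semigroup and its action on boundary paths\<close>

definition semi_carrier :: "('g, 'x) semi set" where
  "semi_carrier = insert None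
     {Some (p, g, q) |p g q. p \<in> fpaths \<and> q \<in> fpaths \<and> g \<in> Arr G \<and>
        path_src p = rng G g \<and> path_src q = src G g}"

definition path_prefix :: "('g, 'x) fpath \<Rightarrow> ('g, 'x) fpath \<Rightarrow> bool" where
  "path_prefix q p \<longleftrightarrow> fst q = fst p \<and> (\<exists>ts. snd p = snd q @ ts)"

text \<open>The path \<open>t\<close> with \<open>p = qt\<close>, when \<open>q\<close> is a prefix of \<open>p\<close>.\<close>

definition path_rest :: "('g, 'x) fpath \<Rightarrow> ('g, 'x) fpath \<Rightarrow> ('g, 'x) fpath" where
  "path_rest q p = (path_src q, drop (length (snd q)) (snd p))"

fun semi_mul :: "('g, 'x) semi \<Rightarrow> ('g, 'x) semi \<Rightarrow> ('g, 'x) semi" where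
  "semi_mul (Some (p, g, q)) (Some (p', h, q')) =
     (if path_prefix q p' then
        let t = path_rest q p'
        in Some (path_conc p (path_act g t), mul G (path_res g t) h, q')
      else if path_prefix p' q then
        let t = path_rest p' q; t' = path_act (ginv G h) t
        in Some (p, mul G g (path_res h t'), path_conc q' t')
      else None)"
| "semi_mul _ _ = None"

definition idem :: "('g, 'x) fpath \<Rightarrow> ('g, 'x) semi" where
  "idem p = Some (p, path_src p, p)"

fun semi_dom :: "('g, 'x) semi \<Rightarrow> ('g, 'x) bpath set" where
  "semi_dom None = {}"
| "semi_dom (Some (p, g, q)) = cylinder q"

fun semi_act :: "('g, 'x) semi \<Rightarrow> ('g, 'x) bpath \<Rightarrow> ('g, 'x) bpath" where
  "semi_act None z = undefined"
| "semi_act (Some (p, g, q)) z = bpath_conc p (bpath_act g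
     (THE w. w \<in> bpaths \<and> bpath_rng w = path_src q \<and> z = bpath_conc q w))"


subsection \<open>The groupoid of germs\<close>

definition germ_pairs :: "(('g, 'x) semi \<times> ('g, 'x) bpath) set" where
  "germ_pairs = {(a, w). a \<in> semi_carrier \<and> w \<in> semi_dom a}"

text \<open>
  The germ \<open>[a, w]\<close> is the equivalence class of \<open>(a, w)\<close>.  The zero idempotent has empty
  domain, so only the idempotents \<open>idem e\<close> occur in the equivalence.
\<close>

definition germ :: "('g, 'x) semi \<Rightarrow> ('g, 'x) bpath \<Rightarrow> (('g, 'x) semi \<times> ('g, 'x) bpath) set" where
  "germ a w = {(b, w'). (b, w') \<in> germ_pairs \<and> w' = w \<and>
     (\<exists>e \<in> fpaths. w \<in> semi_dom (idem e) \<and> semi_mul a (idem e) = semi_mul b (idem e))}"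

definition unit_germ :: "('g, 'x) bpath \<Rightarrow> (('g, 'x) semi \<times> ('g, 'x) bpath) set" where
  "unit_germ w = germ (idem (bpath_rng w, [])) w"

fun semi_inv :: "('g, 'x) semi \<Rightarrow> ('g, 'x) semi" where
  "semi_inv None = None"
| "semi_inv (Some (p, g, q)) = Some (q, ginv G g, p)"

text \<open>
  The structure maps are given by formulas on representatives; the descriptions pick out their
  common value.
\<close>

definition germ_groupoid :: "(('g, 'x) semi \<times> ('g, 'x) bpath) set groupoid" where
  "germ_groupoid =
     \<lparr>Arr = {germ a w |a w. (a, w) \<in> germ_pairs},
      src = (\<lambda>\<gamma>. THE u. \<exists>a w. (a, w) \<in> germ_pairs \<and> \<gamma> = germ a w \<and> u = unit_germ w),
      rng = (\<lambda>\<gamma>. THE u. \<exists>a w. (a, w) \<in> germ_pairs \<and> \<gamma> = germ a w \<and>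
                            u = unit_germ (semi_act a w)),
      mul = (\<lambda>\<gamma> \<eta>. THE \<zeta>. \<exists>a b w. (b, w) \<in> germ_pairs \<and> (a, semi_act b w) \<in> germ_pairs \<and>
                            \<gamma> = germ a (semi_act b w) \<and> \<eta> = germ b w \<and> \<zeta> = germ (semi_mul a b) w),
      ginv = (\<lambda>\<gamma>. THE \<zeta>. \<exists>a w. (a, w) \<in> germ_pairs \<and> \<gamma> = germ a w \<and>
                            \<zeta> = germ (semi_inv a) (semi_act a w)),
      Top = topology_generated_by
              {{germ a w |w. w \<in> U} |a U. a \<in> semi_carrier \<and> openin bpath_topology U \<and>
                                          U \<subseteq> semi_dom a}\<rparr>"

end

end

theory Submission
  imports Defs "HOL-Library.Function_Algebras"
begin

text \<open>
  Pulling \<open>G\<close> back along the source map of the finite paths gives a discrete groupoid \<open>T\<close> with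
  arrows \<open>(p, g, q)\<close>, equivalent to \<open>G\<close>; likewise \<open>T_reg\<close> for \<open>G_reg\<close>.  A composable tuple of \<open>T\<close>
  whose last arrow has source \<open>q\<close> defines a compact open cell of composable tuples of germs, one for
  each boundary path in the cylinder of \<open>q\<close>.  Sending a tuple to the indicator of its cell maps the
  chains of \<open>T\<close> onto the chains of the groupoid of germs, and the only relations between cells come
  from subdividing a cell whose source is regular along the finitely many edges that extend \<open>q\<close>.
  Thus \<open>0 \<rightarrow> C(T_reg) \<rightarrow> C(T) \<rightarrow> C(germs) \<rightarrow> 0\<close> is exact, with first map the identity minus the
  subdivision.  Under the equivalences \<open>T \<rightarrow> G\<close> and \<open>T_reg \<rightarrow> G_reg\<close> the subdivision becomes the
  chain map of \<open>X_reg\<close>, and the long exact sequence of this short exact sequence is the one claimed.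
\<close>

section \<open>Complexes of abelian groups and their homology\<close>

text \<open>On the chains of \<open>G\<close> itself, \<open>id - X\<close> is in general not
  injective and its cokernel is not the complex of germs: an arrow of \<open>G\<close> does not
  remember the source path of a cell. With the paths recorded, injectivity holds because subdividing
  lengthens sources. The obstacle is exactness in the middle. The groupoid of germs may fail to be
  Hausdorff, so two cells can meet in a set that is not compact, and a relation between cells need
  not be settled by a common finite refinement. Instead a vanishing combination of cells is followed
  down the tree of finite paths. At a regular vertex a subdivision relation is split off and the
  finitely many edges remain. At a singular vertex the finite path ending there is itself a boundary
  path, and evaluation at it shows that there is nothing to subdivide. Along an infinite path
  nothing is left after finitely many steps. Since no infinite branch escapes, the descent ends. The
  same induction over the tree yields compactness of cylinders and the decomposition of compact open
  sets into cells.\<close>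

definition add_subgroup :: "'a::ab_group_add set \<Rightarrow> bool" where
  "add_subgroup S \<longleftrightarrow> 0 \<in> S \<and> (\<forall>x\<in>S. \<forall>y\<in>S. x - y \<in> S)"

lemma add_subgroup_zero: "add_subgroup S \<Longrightarrow> 0 \<in> S"
  and add_subgroup_diff: "add_subgroup S \<Longrightarrow> x \<in> S \<Longrightarrow> y \<in> S \<Longrightarrow> x - y \<in> S"
  by (auto simp: add_subgroup_def)

lemma add_subgroup_minus: "add_subgroup S \<Longrightarrow> x \<in> S \<Longrightarrow> - x \<in> S"
  using add_subgroup_diff[of S 0 x] add_subgroup_zero[of S] by simp

lemma add_subgroup_add: "add_subgroup S \<Longrightarrow> x \<in> S \<Longrightarrow> y \<in> S \<Longrightarrow> x + y \<in> S"
  using add_subgroup_diff[of S x "- y"] add_subgroup_minus[of S y] by simp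

lemma add_subgroup_sum: "add_subgroup S \<Longrightarrow> (\<And>i. i \<in> I \<Longrightarrow> f i \<in> S) \<Longrightarrow> sum f I \<in> S"
  by (induction I rule: infinite_finite_induct)
    (auto simp: add_subgroup_zero add_subgroup_add)

section \<open>Cosets, quotient groups and the maps induced by relations\<close>

definition residue_class :: "'a::ab_group_add set \<Rightarrow> 'a \<Rightarrow> 'a set" where
  "residue_class B c = (\<lambda>b. b + c) ` B"

text \<open>\<open>homology\<close> rewrites to this record
  (\<open>homology_eq_quotient_group\<close>), in which only cycles and boundaries occur and the
  ambient chain group has disappeared.\<close>

definition quotient_group :: "'a::ab_group_add set \<Rightarrow> 'a set \<Rightarrow> 'a set monoid" where
  "quotient_group Z B =
     \<lparr>carrier = residue_class B ` Z, monoid.mult = (\<lambda>X Y. {x + y |x y. x \<in> X \<and> y \<in> Y}), one = B\<rparr>"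

lemma residue_class_eq_iff:
  assumes "add_subgroup B"
  shows "residue_class B c = residue_class B c' \<longleftrightarrow> c - c' \<in> B"
proof
  assume "residue_class B c = residue_class B c'"
  moreover have "c \<in> residue_class B c"
    using add_subgroup_zero[OF assms] by (force simp: residue_class_def)
  ultimately show "c - c' \<in> B" by (auto simp: residue_class_def)
next
  assume *: "c - c' \<in> B"
  have "b + c \<in> residue_class B c'" if "b \<in> B" for b
    using add_subgroup_add[OF assms that *] by (force simp: residue_class_def)
  moreover have "b + c' \<in> residue_class B c" if "b \<in> B" for b
    using add_subgroup_diff[OF assms that *] by (force simp: residue_class_def)
  ultimately show "residue_class B c = residue_class B c'"
    by (auto simp: residue_class_def)
qed

lemma residue_class_zero: "residue_class B 0 = B"
  by (simp add: residue_class_def)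

lemma residue_class_add:
  assumes "add_subgroup B"
  shows "{x + y |x y. x \<in> residue_class B c \<and> y \<in> residue_class B c'} = residue_class B (c + c')"
proof -
  have "(b + c) + (b' + c') \<in> residue_class B (c + c')" if "b \<in> B" "b' \<in> B" for b b'
    using add_subgroup_add[OF assms that] by (force simp: residue_class_def algebra_simps)
  moreover have "\<exists>x y. b + (c + c') = x + y \<and> x \<in> residue_class B c \<and> y \<in> residue_class B c'"
    if "b \<in> B" for b
    using that add_subgroup_zero[OF assms]
    by (intro exI[of _ "b + c"] exI[of _ "0 + c'"]) (auto simp: residue_class_def algebra_simps)
  ultimately show ?thesis by (auto simp: residue_class_def)
qed

lemma quotient_group_simps:
  "carrier (quotient_group Z B) = residue_class B ` Z"
  "one (quotient_group Z B) = residue_class B 0"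
  "add_subgroup B \<Longrightarrow> residue_class B c \<otimes>\<^bsub>quotient_group Z B\<^esub> residue_class B c' = residue_class B (c + c')"
  using residue_class_add[of B c c'] by (simp_all add: quotient_group_def residue_class_zero)

lemma group_quotient_group:
  assumes Z: "add_subgroup Z" and B: "add_subgroup B"
  shows "group (quotient_group Z B)"
proof (rule groupI)
  fix X assume "X \<in> carrier (quotient_group Z B)"
  then obtain c where c: "c \<in> Z" "X = residue_class B c" by (auto simp: quotient_group_simps)
  then have "residue_class B (- c) \<otimes>\<^bsub>quotient_group Z B\<^esub> X = \<one>\<^bsub>quotient_group Z B\<^esub>"
    by (simp add: quotient_group_simps B)
  then show "\<exists>Y\<in>carrier (quotient_group Z B). Y \<otimes>\<^bsub>quotient_group Z B\<^esub> X = \<one>\<^bsub>quotient_group Z B\<^esub>"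
    using add_subgroup_minus[OF Z c(1)] by (auto simp: quotient_group_simps)
qed (auto simp: quotient_group_simps B add_subgroup_add[OF Z] add_subgroup_zero[OF Z] add.assoc)

lemma inv_quotient_group:
  assumes "add_subgroup Z" "add_subgroup B" "c \<in> Z"
  shows "inv\<^bsub>quotient_group Z B\<^esub> residue_class B c = residue_class B (- c)"
proof -
  interpret group "quotient_group Z B" by (rule group_quotient_group) fact+
  show ?thesis
    by (rule inv_equality) (use assms in \<open>auto simp: quotient_group_simps add_subgroup_minus\<close>)
qed

text \<open>The analogue of \<open>homology_map\<close> for a relation. Adding \<open>B\<close>
  fills up the coset even when \<open>R\<close> relates each representative to a single
  value.\<close>

definition induced_map :: "('a \<times> 'b) set \<Rightarrow> 'b::ab_group_add set \<Rightarrow> 'a set \<Rightarrow> 'b set" where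
  "induced_map R B Y = {b + z |b z c. b \<in> B \<and> c \<in> Y \<and> (c, z) \<in> R}"

text \<open>Relations instead of functions, because connecting homomorphisms are defined by zigzags.\<close>

locale homological_relation =
  fixes Z :: "'a::ab_group_add set" and B :: "'a set" and Z' :: "'b::ab_group_add set"
    and B' :: "'b set" and R :: "('a \<times> 'b) set"
  assumes Z: "add_subgroup Z" and B: "add_subgroup B" and BZ: "B \<subseteq> Z"
    and Z': "add_subgroup Z'" and B': "add_subgroup B'" and BZ': "B' \<subseteq> Z'"
    and R: "add_subgroup R" and R_sub: "R \<subseteq> Z \<times> Z'"
    and total: "c \<in> Z \<Longrightarrow> \<exists>z. (c, z) \<in> R"
    and bounds: "(b, z) \<in> R \<Longrightarrow> b \<in> B \<Longrightarrow> z \<in> B'"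
begin

text \<open>\<open>R\<close> is a subgroup, so two of its pairs whose first entries agree modulo
  \<open>B\<close> differ by a pair to which \<open>bounds\<close> applies. The choice of
  \<open>z\<close> is therefore immaterial modulo \<open>B'\<close>.\<close>

lemma induced_map_class:
  assumes "(c, z) \<in> R"
  shows "induced_map R B' (residue_class B c) = residue_class B' z"
proof -
  have 1: "b + z' \<in> residue_class B' z" if "b \<in> B'" "c' \<in> residue_class B c" "(c', z') \<in> R" for b z' c'
  proof -
    have "(c' - c, z' - z) \<in> R" using add_subgroup_diff[OF R that(3) assms] by simp
    moreover have "c' - c \<in> B" using that(2) by (auto simp: residue_class_def)
    ultimately have "b + (z' - z) \<in> B'" using bounds add_subgroup_add[OF B' that(1)] by blast
    then show ?thesis by (force simp: residue_class_def)
  qed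
  have 2: "c \<in> residue_class B c"
    using add_subgroup_zero[OF B] by (force simp: residue_class_def)
  show ?thesis
    using 1 2 assms unfolding induced_map_def residue_class_def[of B' z] by blast
qed

lemma group_hom_induced_map:
  "group_hom (quotient_group Z B) (quotient_group Z' B') (induced_map R B')"
proof -
  have "induced_map R B' \<in> hom (quotient_group Z B) (quotient_group Z' B')"
  proof (rule homI)
    fix X assume "X \<in> carrier (quotient_group Z B)"
    then obtain c where c: "c \<in> Z" "X = residue_class B c" by (auto simp: quotient_group_simps)
    obtain z where "(c, z) \<in> R" using total c by blast
    then show "induced_map R B' X \<in> carrier (quotient_group Z' B')"
      using R_sub c induced_map_class by (auto simp: quotient_group_simps)
  next
    fix X Y assume "X \<in> carrier (quotient_group Z B)" "Y \<in> carrier (quotient_group Z B)"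
    then obtain c c' where c: "c \<in> Z" "X = residue_class B c" "c' \<in> Z" "Y = residue_class B c'"
      by (auto simp: quotient_group_simps)
    obtain z z' where z: "(c, z) \<in> R" "(c', z') \<in> R" using total c by blast
    have "(c + c', z + z') \<in> R" using add_subgroup_add[OF R z] by simp
    then show "induced_map R B' (X \<otimes>\<^bsub>quotient_group Z B\<^esub> Y) =
        induced_map R B' X \<otimes>\<^bsub>quotient_group Z' B'\<^esub> induced_map R B' Y"
      using c z by (simp add: quotient_group_simps B B' induced_map_class)
  qed
  then show ?thesis
    by (intro group_hom.intro group_hom_axioms.intro group_quotient_group Z B Z' B')
qed

lemma kernel_induced_map:
  "kernel (quotient_group Z B) (quotient_group Z' B') (induced_map R B') =
     residue_class B ` {c. \<exists>z\<in>B'. (c, z) \<in> R}"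
proof -
  have "residue_class B c \<in> residue_class B ` {c. \<exists>z\<in>B'. (c, z) \<in> R}"
    if c: "c \<in> Z" "induced_map R B' (residue_class B c) = residue_class B' 0" for c
  proof -
    obtain z where z: "(c, z) \<in> R" using total[OF c(1)] by blast
    then have "z \<in> B'" using c induced_map_class residue_class_eq_iff[OF B', of z 0] by auto
    then show ?thesis using z by blast
  qed
  moreover have "induced_map R B' (residue_class B c) = residue_class B' 0" "c \<in> Z"
    if "z \<in> B'" "(c, z) \<in> R" for c z
    using that induced_map_class residue_class_eq_iff[OF B', of z 0] R_sub by auto
  ultimately show ?thesis unfolding kernel_def quotient_group_simps by blast
qed

lemma image_induced_map:
  "induced_map R B' ` carrier (quotient_group Z B) = residue_class B' ` Range R"
proof -
  have "residue_class B' z \<in> induced_map R B' ` residue_class B ` Z" if "(c, z) \<in> R" for c z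
    using that R_sub induced_map_class[OF that] by (intro image_eqI[of _ _ "residue_class B c"]) auto
  moreover have "induced_map R B' (residue_class B c) \<in> residue_class B' ` Range R" if "c \<in> Z" for c
    using total[OF that] induced_map_class by force
  ultimately show ?thesis unfolding quotient_group_simps by blast
qed

end

text \<open>Kernels and images of induced maps are sets of classes with known representatives;
  exactness is then a comparison of representatives modulo boundaries.\<close>

lemma residue_class_image_eqI:
  assumes "add_subgroup B" "\<And>x. x \<in> S \<Longrightarrow> \<exists>y\<in>T. x - y \<in> B" "\<And>x. x \<in> T \<Longrightarrow> \<exists>y\<in>S. x - y \<in> B"
  shows "residue_class B ` S = residue_class B ` T"
  using assms(2,3) residue_class_eq_iff[OF assms(1)] by (auto simp: image_iff)

section \<open>Chain complexes and the zigzags of a short exact sequence\<close>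

locale chain_complex =
  fixes C :: "nat \<Rightarrow> 'a::ab_group_add set" and d :: "nat \<Rightarrow> 'a \<Rightarrow> 'a"
  assumes subgroup: "add_subgroup (C n)"
    and d_closed: "x \<in> C (Suc n) \<Longrightarrow> d (Suc n) x \<in> C n"
    and d_diff: "x \<in> C n \<Longrightarrow> y \<in> C n \<Longrightarrow> d n (x - y) = d n x - d n y"
    and d_zero: "x \<in> C 0 \<Longrightarrow> d 0 x = 0"
    and d_d: "x \<in> C (Suc (Suc n)) \<Longrightarrow> d (Suc n) (d (Suc (Suc n)) x) = 0"
begin

definition cyc :: "nat \<Rightarrow> 'a set" where "cyc n = {c \<in> C n. d n c = 0}"
definition bd :: "nat \<Rightarrow> 'a set" where "bd n = d (Suc n) ` C (Suc n)"

abbreviation H :: "nat \<Rightarrow> 'a set monoid" where "H n \<equiv> quotient_group (cyc n) (bd n)"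

lemma d_0: "d n 0 = 0"
  using d_diff[of 0 n 0] add_subgroup_zero[OF subgroup] by simp

lemma cyc: "add_subgroup (cyc n)"
  using subgroup[of n] d_diff d_0 by (auto simp: add_subgroup_def cyc_def)

lemma bd: "add_subgroup (bd n)"
proof -
  have "d (Suc n) x - d (Suc n) y \<in> bd n" if "x \<in> C (Suc n)" "y \<in> C (Suc n)" for x y
    using that d_diff add_subgroup_diff[OF subgroup that] by (auto simp: bd_def intro: image_eqI[of _ _ "x - y"])
  moreover have "0 \<in> bd n"
    using d_0 add_subgroup_zero[OF subgroup] by (force simp: bd_def)
  ultimately show ?thesis by (auto simp: add_subgroup_def bd_def)
qed

lemma bd_cyc: "bd n \<subseteq> cyc n"
proof (cases n)
  case 0
  then show ?thesis using d_closed[of _ 0] by (auto simp: bd_def cyc_def d_zero)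
next
  case (Suc k)
  then show ?thesis using d_closed d_d by (auto simp: bd_def cyc_def)
qed

end

locale chain_map = C: chain_complex C d + D: chain_complex D e
  for C :: "nat \<Rightarrow> 'a::ab_group_add set" and d and D :: "nat \<Rightarrow> 'b::ab_group_add set" and e +
  fixes f :: "nat \<Rightarrow> 'a \<Rightarrow> 'b"
  assumes closed: "x \<in> C n \<Longrightarrow> f n x \<in> D n"
    and diff: "x \<in> C n \<Longrightarrow> y \<in> C n \<Longrightarrow> f n (x - y) = f n x - f n y"
    and comm: "x \<in> C (Suc n) \<Longrightarrow> e (Suc n) (f (Suc n) x) = f n (d (Suc n) x)"
begin

lemma zero: "f n 0 = 0"
  using diff[of 0 n 0] add_subgroup_zero[OF C.subgroup] by simp

lemma map_cyc: "x \<in> C.cyc n \<Longrightarrow> f n x \<in> D.cyc n"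
  by (cases n) (auto simp: C.cyc_def D.cyc_def closed comm zero D.d_zero)

lemma map_bd: "x \<in> C.bd n \<Longrightarrow> f n x \<in> D.bd n"
  by (auto simp: C.bd_def D.bd_def closed comm[symmetric])

end

text \<open>Such a map is an isomorphism on homology. Cycles lift exactly and not just up to a
  boundary, so the zigzags below can start from a given representative.\<close>

locale surj_quasi_iso = chain_map +
  assumes lift_cyc: "c \<in> D.cyc n \<Longrightarrow> \<exists>y\<in>C.cyc n. f n y = c"
    and reflect_bd: "y \<in> C.cyc n \<Longrightarrow> f n y \<in> D.bd n \<Longrightarrow> y \<in> C.bd n"

text \<open>A short exact sequence \<open>M \<rightarrow> N \<rightarrow> D\<close> whose first map is modelled, up to quasi-isomorphism,
  by a chain map \<open>f\<close> from \<open>K\<close> to \<open>C\<close>.\<close>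

locale modelled_short_exact =
  F: chain_map M dM N dN F + \<Theta>: chain_map N dN D dD \<Theta> +
  f: chain_map K dK C dC f + pM: surj_quasi_iso M dM K dK pM + pN: surj_quasi_iso N dN C dC pN
  for M :: "nat \<Rightarrow> 'm::ab_group_add set" and dM and N :: "nat \<Rightarrow> 'n::ab_group_add set" and dN
    and D :: "nat \<Rightarrow> 'd::ab_group_add set" and dD and K :: "nat \<Rightarrow> 'k::ab_group_add set" and dK
    and C :: "nat \<Rightarrow> 'c::ab_group_add set" and dC and F \<Theta> f pM pN +
  assumes inj: "m \<in> M n \<Longrightarrow> F n m = 0 \<Longrightarrow> m = 0"
    and exact: "y \<in> N n \<Longrightarrow> \<Theta> n y = 0 \<Longrightarrow> \<exists>m\<in>M n. y = F n m"
    and comp_zero: "m \<in> M n \<Longrightarrow> \<Theta> n (F n m) = 0"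
    and surj: "d \<in> D n \<Longrightarrow> \<exists>y\<in>N n. \<Theta> n y = d"
    and square: "m \<in> M n \<Longrightarrow> pN n (F n m) = f n (pM n m)"
begin

text \<open>The inverse of the isomorphism given by \<open>pN\<close>, followed by
  \<open>\<Theta>\<close>: a cycle of \<open>C\<close> is replaced by any cycle of \<open>N\<close>
  above it.\<close>

definition iota_rel :: "nat \<Rightarrow> ('c \<times> 'd) set" where
  "iota_rel n = {(pN n y, \<Theta> n y) |y. y \<in> F.D.cyc n}"

text \<open>The snake: lift through \<open>\<Theta>\<close>, take the boundary, pull it back along
  the injective \<open>F\<close>, project from \<open>M\<close> to \<open>K\<close>. That both ends
  are cycles follows in \<open>delta_cycle\<close>.\<close>

definition delta_rel :: "nat \<Rightarrow> ('d \<times> 'k) set" where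
  "delta_rel n = {(\<Theta> (Suc n) y, pM n m) |y m. y \<in> N (Suc n) \<and> m \<in> M n \<and> dN (Suc n) y = F n m}"

lemma cycle_of_F: "m \<in> M n \<Longrightarrow> F n m \<in> F.D.cyc n \<Longrightarrow> m \<in> F.C.cyc n"
proof (cases n)
  case (Suc k)
  assume "m \<in> M n" "F n m \<in> F.D.cyc n"
  then have "F k (dM n m) = 0" using F.comm[of m k] Suc by (simp add: F.D.cyc_def)
  then show ?thesis
    using inj[of "dM n m" k] F.C.d_closed[of m k] Suc \<open>m \<in> M n\<close> by (simp add: F.C.cyc_def)
qed (simp add: F.C.cyc_def F.C.d_zero)

lemma iota: "homological_relation (f.D.cyc n) (f.D.bd n) (\<Theta>.D.cyc n) (\<Theta>.D.bd n) (iota_rel n)"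
proof
  show "add_subgroup (iota_rel n)"
    unfolding add_subgroup_def
  proof (intro conjI ballI)
    show "0 \<in> iota_rel n"
      using add_subgroup_zero[OF F.D.cyc] pN.zero \<Theta>.zero by (force simp: iota_rel_def zero_prod_def)
  next
    fix u v assume "u \<in> iota_rel n" "v \<in> iota_rel n"
    then obtain y y' where y: "y \<in> F.D.cyc n" "y' \<in> F.D.cyc n"
      "u = (pN n y, \<Theta> n y)" "v = (pN n y', \<Theta> n y')" by (auto simp: iota_rel_def)
    then have "u - v = (pN n (y - y'), \<Theta> n (y - y'))"
      by (simp add: F.D.cyc_def pN.diff \<Theta>.diff)
    then show "u - v \<in> iota_rel n"
      using add_subgroup_diff[OF F.D.cyc y(1,2)] by (auto simp: iota_rel_def)
  qed
  show "iota_rel n \<subseteq> f.D.cyc n \<times> \<Theta>.D.cyc n"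
    using pN.map_cyc \<Theta>.map_cyc by (auto simp: iota_rel_def)
  show "\<exists>z. (c, z) \<in> iota_rel n" if "c \<in> f.D.cyc n" for c
    using pN.lift_cyc[OF that] by (auto simp: iota_rel_def)
  show "z \<in> \<Theta>.D.bd n" if "(b, z) \<in> iota_rel n" "b \<in> f.D.bd n" for b z
    using that pN.reflect_bd \<Theta>.map_bd by (auto simp: iota_rel_def)
qed (simp_all add: f.D.cyc f.D.bd f.D.bd_cyc \<Theta>.D.cyc \<Theta>.D.bd \<Theta>.D.bd_cyc)

lemma delta_total:
  assumes "d \<in> \<Theta>.D.cyc (Suc n)"
  obtains y m where "y \<in> N (Suc n)" "m \<in> F.C.cyc n" "dN (Suc n) y = F n m" "\<Theta> (Suc n) y = d"
proof -
  obtain y where y: "y \<in> N (Suc n)" "\<Theta> (Suc n) y = d"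
    using surj assms by (auto simp: \<Theta>.D.cyc_def)
  have "\<Theta> n (dN (Suc n) y) = 0"
    using \<Theta>.comm[OF y(1)] y assms by (simp add: \<Theta>.D.cyc_def)
  then obtain m where m: "m \<in> M n" "dN (Suc n) y = F n m"
    using exact[OF F.D.d_closed[OF y(1)]] by blast
  have "F n m \<in> F.D.cyc n" using m y F.D.bd_cyc[of n] by (auto simp: F.D.bd_def)
  then show ?thesis using that cycle_of_F m y by blast
qed

lemma delta_cycle:
  assumes "y \<in> N (Suc n)" "m \<in> M n" "dN (Suc n) y = F n m"
  shows "m \<in> F.C.cyc n" "\<Theta> (Suc n) y \<in> \<Theta>.D.cyc (Suc n)"
proof -
  have "F n m \<in> F.D.cyc n" using assms F.D.bd_cyc[of n] by (force simp: F.D.bd_def)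
  then show "m \<in> F.C.cyc n" using cycle_of_F assms by blast
  show "\<Theta> (Suc n) y \<in> \<Theta>.D.cyc (Suc n)"
    using assms \<Theta>.comm[of y n] comp_zero[of m n] \<Theta>.closed by (simp add: \<Theta>.D.cyc_def)
qed

lemma delta: "homological_relation (\<Theta>.D.cyc (Suc n)) (\<Theta>.D.bd (Suc n)) (f.C.cyc n) (f.C.bd n) (delta_rel n)"
proof
  show "add_subgroup (delta_rel n)"
    unfolding add_subgroup_def
  proof (intro conjI ballI)
    show "0 \<in> delta_rel n"
      using add_subgroup_zero[OF F.D.subgroup[of "Suc n"]] add_subgroup_zero[OF F.C.subgroup[of n]]
        pM.zero \<Theta>.zero F.D.d_0 F.zero
      unfolding delta_rel_def zero_prod_def by force
  next
    fix u v assume "u \<in> delta_rel n" "v \<in> delta_rel n"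
    then obtain y m y' m' where y: "y \<in> N (Suc n)" "m \<in> M n" "dN (Suc n) y = F n m"
        "y' \<in> N (Suc n)" "m' \<in> M n" "dN (Suc n) y' = F n m'"
      "u = (\<Theta> (Suc n) y, pM n m)" "v = (\<Theta> (Suc n) y', pM n m')" by (auto simp: delta_rel_def)
    then have "u - v = (\<Theta> (Suc n) (y - y'), pM n (m - m'))" "dN (Suc n) (y - y') = F n (m - m')"
      by (simp_all add: pM.diff \<Theta>.diff F.diff F.D.d_diff)
    then show "u - v \<in> delta_rel n"
      using add_subgroup_diff[OF F.D.subgroup y(1,4)] add_subgroup_diff[OF F.C.subgroup y(2,5)]
      by (auto simp: delta_rel_def)
  qed
  show "delta_rel n \<subseteq> \<Theta>.D.cyc (Suc n) \<times> f.C.cyc n"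
    using delta_cycle pM.map_cyc by (force simp: delta_rel_def)
  show "\<exists>z. (c, z) \<in> delta_rel n" if "c \<in> \<Theta>.D.cyc (Suc n)" for c
    using that by (rule delta_total) (auto simp: delta_rel_def F.C.cyc_def)
  show "z \<in> f.C.bd n" if bz: "(b, z) \<in> delta_rel n" "b \<in> \<Theta>.D.bd (Suc n)" for b z
  proof -
    obtain y m where y: "y \<in> N (Suc n)" "m \<in> M n" "dN (Suc n) y = F n m" "b = \<Theta> (Suc n) y" "z = pM n m"
      using bz(1) by (auto simp: delta_rel_def)
    obtain d' where d': "d' \<in> D (Suc (Suc n))" "b = dD (Suc (Suc n)) d'"
      using bz(2) by (auto simp: \<Theta>.D.bd_def)
    obtain y' where y': "y' \<in> N (Suc (Suc n))" "\<Theta> (Suc (Suc n)) y' = d'" using surj d' by blast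
    \<comment> \<open>Subtracting the boundary of a lift of \<open>d'\<close> moves \<open>y\<close>
      into the kernel of \<open>\<Theta>\<close> without changing its boundary; the preimage
      \<open>m'\<close> under \<open>F\<close> then bounds \<open>m\<close>.\<close>
    let ?w = "dN (Suc (Suc n)) y'"
    have w: "?w \<in> N (Suc n)" using y' F.D.d_closed by blast
    have "\<Theta> (Suc n) (y - ?w) = 0"
      using \<Theta>.diff[OF y(1) w] \<Theta>.comm[OF y'(1)] y y' d' by simp
    then obtain m' where m': "m' \<in> M (Suc n)" "y - ?w = F (Suc n) m'"
      using exact add_subgroup_diff[OF F.D.subgroup y(1) w] by blast
    have "F n (dM (Suc n) m') = dN (Suc n) (y - ?w)" using F.comm m' by simp
    also have "\<dots> = F n m" using F.D.d_diff[OF y(1) w] F.D.d_d[OF y'(1)] y by simp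
    finally have "F n (dM (Suc n) m' - m) = 0" using F.diff F.C.d_closed m' y by simp
    then have "dM (Suc n) m' = m"
      using inj[of "dM (Suc n) m' - m" n] add_subgroup_diff[OF F.C.subgroup] F.C.d_closed[OF m'(1)] y
      by auto
    then have "m \<in> F.C.bd n" using m' by (auto simp: F.C.bd_def)
    then show ?thesis using pM.map_bd y by simp
  qed
qed (simp_all add: f.C.cyc f.C.bd f.C.bd_cyc \<Theta>.D.cyc \<Theta>.D.bd \<Theta>.D.bd_cyc)

definition f_rel :: "nat \<Rightarrow> ('k \<times> 'c) set" where
  "f_rel n = {(k, f n k) |k. k \<in> f.C.cyc n}"

lemma f_hom: "homological_relation (f.C.cyc n) (f.C.bd n) (f.D.cyc n) (f.D.bd n) (f_rel n)"
proof
  show "add_subgroup (f_rel n)"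
    using f.C.cyc[of n] f.zero f.diff by (fastforce simp: add_subgroup_def f_rel_def zero_prod_def f.C.cyc_def)
  show "f_rel n \<subseteq> f.C.cyc n \<times> f.D.cyc n"
    using f.map_cyc by (auto simp: f_rel_def)
  show "\<exists>z. (c, z) \<in> f_rel n" if "c \<in> f.C.cyc n" for c
    using that by (auto simp: f_rel_def)
  show "z \<in> f.D.bd n" if "(b, z) \<in> f_rel n" "b \<in> f.C.bd n" for b z
    using that f.map_bd by (auto simp: f_rel_def)
qed (simp_all add: f.C.cyc f.C.bd f.C.bd_cyc f.D.cyc f.D.bd f.D.bd_cyc)

text \<open>A cycle of \<open>K\<close> that \<open>f\<close> sends to a boundary lifts to
  \<open>M\<close>. Since \<open>pN\<close> reflects boundaries, the image of the lift under
  \<open>F\<close> bounds some \<open>y\<close>, and \<open>y\<close> starts a zigzag ending at the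
  given cycle.\<close>

lemma exact_K:
  "residue_class (f.C.bd n) ` {c. \<exists>z\<in>f.D.bd n. (c, z) \<in> f_rel n} =
   residue_class (f.C.bd n) ` Range (delta_rel n)"
proof (rule residue_class_image_eqI[OF f.C.bd])
  fix c assume "c \<in> {c. \<exists>z\<in>f.D.bd n. (c, z) \<in> f_rel n}"
  then have c: "c \<in> f.C.cyc n" "f n c \<in> f.D.bd n" by (auto simp: f_rel_def)
  obtain m where m: "m \<in> F.C.cyc n" "pM n m = c" using pM.lift_cyc c by blast
  then have "pN n (F n m) \<in> f.D.bd n" using square c by (simp add: F.C.cyc_def)
  then have "F n m \<in> F.D.bd n" using pN.reflect_bd F.map_cyc m by blast
  then obtain y where "y \<in> N (Suc n)" "dN (Suc n) y = F n m" by (auto simp: F.D.bd_def)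
  then have "c \<in> Range (delta_rel n)" using m by (force simp: delta_rel_def F.C.cyc_def)
  then show "\<exists>y\<in>Range (delta_rel n). c - y \<in> f.C.bd n"
    using add_subgroup_zero[OF f.C.bd] by (intro bexI[of _ c]) auto
next
  fix k assume "k \<in> Range (delta_rel n)"
  then obtain y m where y: "y \<in> N (Suc n)" "m \<in> M n" "dN (Suc n) y = F n m" "k = pM n m"
    by (auto simp: delta_rel_def)
  have "f n k = pN n (F n m)" using square y by simp
  moreover have "F n m \<in> F.D.bd n" using y by (force simp: F.D.bd_def)
  ultimately have "f n k \<in> f.D.bd n" using pN.map_bd by simp
  moreover have "k \<in> f.C.cyc n" using delta_cycle y pM.map_cyc by blast
  ultimately show "\<exists>y\<in>{c. \<exists>z\<in>f.D.bd n. (c, z) \<in> f_rel n}. k - y \<in> f.C.bd n"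
    using add_subgroup_zero[OF f.C.bd] by (intro bexI[of _ k]) (auto simp: f_rel_def)
qed

text \<open>If \<open>\<Theta> y\<close> bounds, correcting \<open>y\<close> by the boundary of a
  lift leaves an element of the image of \<open>F\<close>. The correction projects to a boundary of
  \<open>C\<close>, which is why the two sets are compared modulo boundaries.\<close>

lemma exact_C:
  "residue_class (f.D.bd n) ` {c. \<exists>z\<in>\<Theta>.D.bd n. (c, z) \<in> iota_rel n} =
   residue_class (f.D.bd n) ` Range (f_rel n)"
proof (rule residue_class_image_eqI[OF f.D.bd])
  fix c assume "c \<in> {c. \<exists>z\<in>\<Theta>.D.bd n. (c, z) \<in> iota_rel n}"
  then obtain y d' where y: "y \<in> F.D.cyc n" "c = pN n y" "d' \<in> D (Suc n)" "\<Theta> n y = dD (Suc n) d'"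
    by (auto simp: iota_rel_def \<Theta>.D.bd_def)
  obtain y' where y': "y' \<in> N (Suc n)" "\<Theta> (Suc n) y' = d'" using surj y by blast
  let ?w = "dN (Suc n) y'"
  have w: "?w \<in> F.D.bd n" using y' by (auto simp: F.D.bd_def)
  then have wc: "?w \<in> F.D.cyc n" using F.D.bd_cyc by blast
  have yw: "y \<in> N n" "?w \<in> N n" using y wc by (auto simp: F.D.cyc_def)
  have "\<Theta> n (y - ?w) = 0"
    using \<Theta>.diff[OF yw] \<Theta>.comm[OF y'(1)] y y' by simp
  then obtain m where m: "m \<in> M n" "y - ?w = F n m"
    using exact add_subgroup_diff[OF F.D.subgroup yw] by blast
  have "m \<in> F.C.cyc n" using cycle_of_F m add_subgroup_diff[OF F.D.cyc y(1) wc] by simp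
  then have k: "pM n m \<in> f.C.cyc n" by (rule pM.map_cyc)
  have "c - f n (pM n m) = pN n ?w"
    using square[OF m(1)] m(2)[symmetric] pN.diff[OF yw] y(2) by (simp add: algebra_simps)
  then have "c - f n (pM n m) \<in> f.D.bd n" using pN.map_bd w by simp
  then show "\<exists>z\<in>Range (f_rel n). c - z \<in> f.D.bd n"
    using k by (auto simp: f_rel_def)
next
  fix c assume "c \<in> Range (f_rel n)"
  then obtain k where k: "k \<in> f.C.cyc n" "c = f n k" by (auto simp: f_rel_def)
  obtain m where m: "m \<in> F.C.cyc n" "pM n m = k" using pM.lift_cyc k by blast
  have "(c, 0) \<in> iota_rel n"
    using m k F.map_cyc[OF m(1)] square comp_zero unfolding iota_rel_def F.C.cyc_def by force
  then show "\<exists>y\<in>{c. \<exists>z\<in>\<Theta>.D.bd n. (c, z) \<in> iota_rel n}. c - y \<in> f.D.bd n"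
    using add_subgroup_zero[OF \<Theta>.D.bd] add_subgroup_zero[OF f.D.bd] by (intro bexI[of _ c]) auto
qed

text \<open>Since \<open>pM\<close> reflects boundaries, a zigzag that ends in a boundary of
  \<open>K\<close> already passes through a boundary \<open>dM m'\<close> of \<open>M\<close>.
  Subtracting \<open>F m'\<close> turns \<open>y\<close> into a cycle with the same image under
  \<open>\<Theta>\<close>.\<close>

lemma exact_D:
  "residue_class (\<Theta>.D.bd (Suc n)) ` {c. \<exists>z\<in>f.C.bd n. (c, z) \<in> delta_rel n} =
   residue_class (\<Theta>.D.bd (Suc n)) ` Range (iota_rel (Suc n))"
proof (rule residue_class_image_eqI[OF \<Theta>.D.bd])
  fix d assume "d \<in> {c. \<exists>z\<in>f.C.bd n. (c, z) \<in> delta_rel n}"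
  then obtain y m where y: "y \<in> N (Suc n)" "m \<in> M n" "dN (Suc n) y = F n m" "d = \<Theta> (Suc n) y"
      "pM n m \<in> f.C.bd n"
    by (auto simp: delta_rel_def)
  then have "m \<in> F.C.bd n" using delta_cycle pM.reflect_bd by blast
  then obtain m' where m': "m' \<in> M (Suc n)" "m = dM (Suc n) m'" by (auto simp: F.C.bd_def)
  let ?y = "y - F (Suc n) m'"
  have F': "F (Suc n) m' \<in> N (Suc n)" using F.closed m' by blast
  have "dN (Suc n) ?y = 0" using F.D.d_diff[OF y(1) F'] F.comm[OF m'(1)] y m' by simp
  then have "?y \<in> F.D.cyc (Suc n)"
    using add_subgroup_diff[OF F.D.subgroup y(1) F'] by (simp add: F.D.cyc_def)
  moreover have "\<Theta> (Suc n) ?y = d" using \<Theta>.diff[OF y(1) F'] comp_zero m' y by simp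
  ultimately have "d \<in> Range (iota_rel (Suc n))" unfolding iota_rel_def by force
  then show "\<exists>y\<in>Range (iota_rel (Suc n)). d - y \<in> \<Theta>.D.bd (Suc n)"
    using add_subgroup_zero[OF \<Theta>.D.bd] by (intro bexI[of _ d]) auto
next
  fix d assume "d \<in> Range (iota_rel (Suc n))"
  then obtain y where y: "y \<in> F.D.cyc (Suc n)" "d = \<Theta> (Suc n) y" by (auto simp: iota_rel_def)
  have "(d, 0) \<in> delta_rel n"
    unfolding delta_rel_def
    using y F.zero[of n] pM.zero[of n] add_subgroup_zero[OF F.C.subgroup[of n]]
    by (force simp: F.D.cyc_def)
  then show "\<exists>y\<in>{c. \<exists>z\<in>f.C.bd n. (c, z) \<in> delta_rel n}. d - y \<in> \<Theta>.D.bd (Suc n)"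
    using add_subgroup_zero[OF f.C.bd] add_subgroup_zero[OF \<Theta>.D.bd] by (intro bexI[of _ d]) auto
qed

lemma surj_0: "Range (iota_rel 0) = \<Theta>.D.cyc 0"
proof -
  have "d \<in> Range (iota_rel 0)" if d: "d \<in> \<Theta>.D.cyc 0" for d
  proof -
    obtain y where "y \<in> N 0" "\<Theta> 0 y = d" using d surj by (auto simp: \<Theta>.D.cyc_def)
    then show ?thesis unfolding iota_rel_def F.D.cyc_def using F.D.d_zero by force
  qed
  then show ?thesis using \<Theta>.map_cyc by (auto simp: iota_rel_def)
qed

text \<open>\<open>id_minus_X\<close> is not an \<open>induced_map\<close>; only its values on
  classes are known. This carries the exactness results over to any map with these values.\<close>

lemma f_rel_induced_unique:
  assumes "\<And>k. k \<in> f.C.cyc n \<Longrightarrow> \<phi> (residue_class (f.C.bd n) k) = residue_class (f.D.bd n) (f n k)"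
    and "Y \<in> carrier (f.C.H n)"
  shows "\<phi> Y = induced_map (f_rel n) (f.D.bd n) Y"
proof -
  interpret homological_relation "f.C.cyc n" "f.C.bd n" "f.D.cyc n" "f.D.bd n" "f_rel n"
    by (rule f_hom)
  obtain k where k: "k \<in> f.C.cyc n" "Y = residue_class (f.C.bd n) k"
    using assms(2) by (auto simp: quotient_group_simps)
  then have "(k, f n k) \<in> f_rel n" by (auto simp: f_rel_def)
  then show ?thesis using assms(1) k induced_map_class by metis
qed

theorem long_exact_sequence:
  assumes \<phi>: "\<And>n k. k \<in> f.C.cyc n \<Longrightarrow> \<phi> n (residue_class (f.C.bd n) k) = residue_class (f.D.bd n) (f n k)"
  shows "\<exists>\<iota> \<delta>.
     (\<forall>n. group_hom (f.C.H n) (f.D.H n) (\<phi> n) \<and> group_hom (f.D.H n) (\<Theta>.D.H n) (\<iota> n) \<and>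
          group_hom (\<Theta>.D.H (Suc n)) (f.C.H n) (\<delta> n)) \<and>
     (\<forall>n. kernel (f.C.H n) (f.D.H n) (\<phi> n) = \<delta> n ` carrier (\<Theta>.D.H (Suc n))) \<and>
     (\<forall>n. kernel (f.D.H n) (\<Theta>.D.H n) (\<iota> n) = \<phi> n ` carrier (f.C.H n)) \<and>
     (\<forall>n. kernel (\<Theta>.D.H (Suc n)) (f.C.H n) (\<delta> n) = \<iota> (Suc n) ` carrier (f.D.H (Suc n))) \<and>
     \<iota> 0 ` carrier (f.D.H 0) = carrier (\<Theta>.D.H 0)"
proof -
  define \<iota> where "\<iota> n = induced_map (iota_rel n) (\<Theta>.D.bd n)" for n
  define \<delta> where "\<delta> n = induced_map (delta_rel n) (f.C.bd n)" for n
  note eq = f_rel_induced_unique[of _ "\<phi> _", OF \<phi>]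
  have hom\<phi>: "group_hom (f.C.H n) (f.D.H n) (\<phi> n)" for n
  proof -
    interpret h: group_hom "f.C.H n" "f.D.H n" "induced_map (f_rel n) (f.D.bd n)"
      by (rule homological_relation.group_hom_induced_map[OF f_hom])
    show ?thesis
      by (intro group_hom.intro group_hom_axioms.intro h.is_group h.H.is_group homI)
        (simp_all add: eq h.hom_mult)
  qed
  have ker\<phi>: "kernel (f.C.H n) (f.D.H n) (\<phi> n) =
      kernel (f.C.H n) (f.D.H n) (induced_map (f_rel n) (f.D.bd n))" for n
    using eq by (auto simp: kernel_def)
  have im\<phi>: "\<phi> n ` carrier (f.C.H n) = residue_class (f.D.bd n) ` Range (f_rel n)" for n
    using homological_relation.image_induced_map[OF f_hom, of n] eq by (metis (no_types, lifting) image_cong)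
  show ?thesis
    unfolding ker\<phi> im\<phi> homological_relation.kernel_induced_map[OF f_hom]
    by (rule exI[of _ \<iota>], rule exI[of _ \<delta>])
      (simp only: \<iota>_def \<delta>_def hom\<phi> homological_relation.group_hom_induced_map[OF iota]
        homological_relation.group_hom_induced_map[OF delta]
        homological_relation.kernel_induced_map[OF iota] homological_relation.image_induced_map[OF iota]
        homological_relation.kernel_induced_map[OF delta] homological_relation.image_induced_map[OF delta]
        exact_K exact_C exact_D surj_0, simp add: quotient_group_simps(1))
qed

end

section \<open>Finitely supported chains\<close>

definition single :: "'x \<Rightarrow> 'a::ab_group_add \<Rightarrow> 'x \<Rightarrow> 'a" where
  "single x a = (\<lambda>y. if y = x then a else 0)"

definition fin_chains :: "'x set \<Rightarrow> ('x \<Rightarrow> 'a::ab_group_add) set" where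
  "fin_chains N = {h. finite {x. h x \<noteq> 0} \<and> {x. h x \<noteq> 0} \<subseteq> N}"

text \<open>The coefficient is an argument of \<open>\<phi>\<close> because \<open>A\<close> is a
  bare abelian group: the multiples of a basis element have to be supplied as a function of the
  coefficient.\<close>

definition lin_ext :: "('x \<Rightarrow> 'a::ab_group_add \<Rightarrow> 'b::ab_group_add) \<Rightarrow> ('x \<Rightarrow> 'a) \<Rightarrow> 'b" where
  "lin_ext \<phi> h = (\<Sum>x | h x \<noteq> 0. \<phi> x (h x))"

lemma sum_fun_apply: "(\<Sum>i\<in>I. f i) x = (\<Sum>i\<in>I. f i x)"
  by (induction I rule: infinite_finite_induct) auto

lemma single_simps [simp]: "single x 0 = 0" "single x a x = a" "single x (a + b) = single x a + single x b"
  "single x (- a) = - single x a"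
  by (auto simp: single_def fun_eq_iff)

lemma fin_chains_single [simp]: "x \<in> N \<Longrightarrow> single x a \<in> fin_chains N"
  by (auto simp: fin_chains_def single_def)

lemma fin_chains_subgroup: "add_subgroup (fin_chains (N :: 'x set) :: ('x \<Rightarrow> 'a::ab_group_add) set)"
proof -
  have "finite {x. f x - g x \<noteq> 0}" "{x. f x - g x \<noteq> 0} \<subseteq> N"
    if "finite {x. f x \<noteq> 0}" "{x. f x \<noteq> 0} \<subseteq> N" "finite {x. g x \<noteq> 0}" "{x. g x \<noteq> 0} \<subseteq> N" for f g :: "'x \<Rightarrow> 'a"
  proof -
    have *: "{x. f x - g x \<noteq> 0} \<subseteq> {x. f x \<noteq> 0} \<union> {x. g x \<noteq> 0}" by auto
    then show "finite {x. f x - g x \<noteq> 0}" using that(1,3) by (meson finite_UnI finite_subset)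
    show "{x. f x - g x \<noteq> 0} \<subseteq> N" using * that by blast
  qed
  then show ?thesis by (simp add: add_subgroup_def fin_chains_def)
qed

lemmas fin_chains_zero [simp] = add_subgroup_zero[OF fin_chains_subgroup]
  and fin_chains_add = add_subgroup_add[OF fin_chains_subgroup]
  and fin_chains_diff = add_subgroup_diff[OF fin_chains_subgroup]
  and fin_chains_minus = add_subgroup_minus[OF fin_chains_subgroup]
  and fin_chains_sum = add_subgroup_sum[OF fin_chains_subgroup]

lemma fin_chains_mono: "N \<subseteq> M \<Longrightarrow> h \<in> fin_chains N \<Longrightarrow> h \<in> fin_chains M"
  by (auto simp: fin_chains_def)

lemma fin_chains_finite: "h \<in> fin_chains N \<Longrightarrow> finite {x. h x \<noteq> 0}"
  by (simp add: fin_chains_def)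

lemma fin_chains_supp: "h \<in> fin_chains N \<Longrightarrow> h x \<noteq> 0 \<Longrightarrow> x \<in> N"
  by (auto simp: fin_chains_def)

lemma fin_chains_eq_sum:
  assumes "h \<in> fin_chains N"
  shows "h = (\<Sum>x | h x \<noteq> 0. single x (h x))"
proof
  fix y
  have "(\<Sum>x | h x \<noteq> 0. single x (h x)) y = (\<Sum>x | h x \<noteq> 0. if x = y then h x else 0)"
    by (auto simp: sum_fun_apply single_def intro!: sum.cong)
  then show "h y = (\<Sum>x | h x \<noteq> 0. single x (h x)) y"
    by (simp add: sum.delta[OF fin_chains_finite[OF assms]])
qed

lemma fin_chains_induct [consumes 1, case_names zero single add]:
  assumes h: "h \<in> fin_chains N" and 0: "P 0" and 1: "\<And>x a. x \<in> N \<Longrightarrow> P (single x a)"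
    and add: "\<And>f g. f \<in> fin_chains N \<Longrightarrow> g \<in> fin_chains N \<Longrightarrow> P f \<Longrightarrow> P g \<Longrightarrow> P (f + g)"
  shows "P h"
proof -
  have "P (\<Sum>x\<in>S. single x (h x)) \<and> (\<Sum>x\<in>S. single x (h x)) \<in> fin_chains N" if "finite S" "S \<subseteq> N" for S
    using that by (induction S) (auto intro!: 0 add 1 fin_chains_add)
  from this[of "{x. h x \<noteq> 0}"] show ?thesis
    using h fin_chains_eq_sum[OF h] fin_chains_finite[OF h] fin_chains_supp[OF h] by auto
qed

definition biadditive :: "('x \<Rightarrow> 'a::ab_group_add \<Rightarrow> 'b::ab_group_add) \<Rightarrow> bool" where
  "biadditive \<phi> \<longleftrightarrow> (\<forall>x a b. \<phi> x (a + b) = \<phi> x a + \<phi> x b)"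

lemma biadditive_zero: "biadditive \<phi> \<Longrightarrow> \<phi> x 0 = 0"
  unfolding biadditive_def by (metis add_cancel_right_right add_0)

lemma lin_ext_superset:
  assumes "biadditive \<phi>" "finite S" "{x. h x \<noteq> 0} \<subseteq> S"
  shows "lin_ext \<phi> h = (\<Sum>x\<in>S. \<phi> x (h x))"
  unfolding lin_ext_def using assms by (intro sum.mono_neutral_left) (auto simp: biadditive_zero)

lemma lin_ext_single:
  assumes "biadditive \<phi>"
  shows "lin_ext \<phi> (single x a) = \<phi> x a"
proof -
  have "{y. single x a y \<noteq> 0} \<subseteq> {x}" by (auto simp: single_def)
  from lin_ext_superset[OF assms _ this] show ?thesis by simp
qed

lemma lin_ext_zero [simp]: "lin_ext \<phi> 0 = 0"
  by (simp add: lin_ext_def)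

lemma lin_ext_add:
  assumes "biadditive \<phi>" "f \<in> fin_chains N" "g \<in> fin_chains N"
  shows "lin_ext \<phi> (f + g) = lin_ext \<phi> f + lin_ext \<phi> g"
proof -
  let ?S = "{x. f x \<noteq> 0} \<union> {x. g x \<noteq> 0}"
  have S: "finite ?S" using assms by (simp add: fin_chains_def)
  have "lin_ext \<phi> (f + g) = (\<Sum>x\<in>?S. \<phi> x (f x + g x))"
    using lin_ext_superset[OF assms(1) S, of "f + g"] by fastforce
  also have "\<dots> = (\<Sum>x\<in>?S. \<phi> x (f x)) + (\<Sum>x\<in>?S. \<phi> x (g x))"
    using assms(1) by (simp add: biadditive_def sum.distrib)
  also have "\<dots> = lin_ext \<phi> f + lin_ext \<phi> g"
    using lin_ext_superset[OF assms(1) S, of f] lin_ext_superset[OF assms(1) S, of g] by simp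
  finally show ?thesis .
qed

definition push :: "('x \<Rightarrow> 'y) \<Rightarrow> ('x \<Rightarrow> 'a::ab_group_add) \<Rightarrow> 'y \<Rightarrow> 'a" where
  "push f = lin_ext (\<lambda>x. single (f x))"

lemma biadditive_single [simp]: "biadditive (\<lambda>x. single (f x))"
  by (simp add: biadditive_def)

lemma push_simps [simp]: "push f 0 = 0" "push f (single x a) = single (f x) a"
  by (simp_all add: push_def lin_ext_single)

text \<open>Restricted to chains because sums over infinite supports are 0 by convention, so linear
  extensions are not additive on all functions.\<close>

definition additive_on :: "'x set \<Rightarrow> (('x \<Rightarrow> 'a::ab_group_add) \<Rightarrow> 'b::ab_group_add) \<Rightarrow> bool" where
  "additive_on N F \<longleftrightarrow> (\<forall>h\<in>fin_chains N. \<forall>k\<in>fin_chains N. F (h + k) = F h + F k)"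

lemma additive_onI: "(\<And>h k. h \<in> fin_chains N \<Longrightarrow> k \<in> fin_chains N \<Longrightarrow> F (h + k) = F h + F k) \<Longrightarrow> additive_on N F"
  by (simp add: additive_on_def)

lemma additive_onD: "additive_on N F \<Longrightarrow> h \<in> fin_chains N \<Longrightarrow> k \<in> fin_chains N \<Longrightarrow> F (h + k) = F h + F k"
  by (simp add: additive_on_def)

lemma additive_on_0:
  assumes "additive_on N F" shows "F 0 = 0"
proof -
  have "F (0 + 0) = F 0 + F 0" by (rule additive_onD[OF assms fin_chains_zero fin_chains_zero])
  then show ?thesis by simp
qed

lemma additive_on_diff:
  assumes "additive_on N F" "h \<in> fin_chains N" "k \<in> fin_chains N"
  shows "F (h - k) = F h - F k"
proof -
  have "F (h - k + k) = F (h - k) + F k"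
    by (rule additive_onD[OF assms(1) fin_chains_diff[OF assms(2,3)] assms(3)])
  also have "h - k + k = h" by (rule diff_add_cancel)
  finally show ?thesis by (metis add_diff_cancel_right')
qed

lemma add_subgroup_image:
  assumes "additive_on N F"
  shows "add_subgroup (F ` fin_chains N)"
proof -
  have "F h - F k \<in> F ` fin_chains N" if "h \<in> fin_chains N" "k \<in> fin_chains N" for h k
    using additive_on_diff[OF assms that] fin_chains_diff[OF that] by (metis image_eqI)
  moreover have "0 \<in> F ` fin_chains N" using additive_on_0[OF assms] fin_chains_zero by (metis image_eqI)
  ultimately show ?thesis by (auto simp: add_subgroup_def)
qed

lemma additive_on_minus_left:
  fixes F G :: "('x \<Rightarrow> 'a::ab_group_add) \<Rightarrow> 'b::ab_group_add"
  assumes "additive_on N F" "additive_on N G" shows "additive_on N (\<lambda>h. F h - G h)"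
proof (rule additive_onI)
  fix h k :: "'x \<Rightarrow> 'a" assume "h \<in> fin_chains N" "k \<in> fin_chains N"
  from additive_onD[OF assms(1) this] additive_onD[OF assms(2) this]
  show "F (h + k) - G (h + k) = F h - G h + (F k - G k)" by (simp only: add_diff_add)
qed

lemma additive_on_add_left:
  fixes F G :: "('x \<Rightarrow> 'a::ab_group_add) \<Rightarrow> 'b::ab_group_add"
  assumes "additive_on N F" "additive_on N G" shows "additive_on N (\<lambda>h. F h + G h)"
proof (rule additive_onI)
  fix h k :: "'x \<Rightarrow> 'a" assume "h \<in> fin_chains N" "k \<in> fin_chains N"
  from additive_onD[OF assms(1) this] additive_onD[OF assms(2) this]
  show "F (h + k) + G (h + k) = F h + G h + (F k + G k)" by (simp only: add_ac)
qed

lemma additive_on_sum_left: "(\<And>i. i \<in> I \<Longrightarrow> additive_on N (F i)) \<Longrightarrow> additive_on N (\<lambda>h. \<Sum>i\<in>I. F i h)"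
  by (simp add: additive_on_def sum.distrib)

lemma additive_on_id: "additive_on N (\<lambda>h. h)"
  by (simp add: additive_on_def)

lemma additive_on_comp:
  assumes "additive_on N F" "additive_on M G" "\<And>h. h \<in> fin_chains N \<Longrightarrow> F h \<in> fin_chains M"
  shows "additive_on N (\<lambda>h. G (F h))"
proof (rule additive_onI)
  fix h k :: "'a \<Rightarrow> 'b" assume hk: "h \<in> fin_chains N" "k \<in> fin_chains N"
  show "G (F (h + k)) = G (F h) + G (F k)"
    unfolding additive_onD[OF assms(1) hk]
    by (rule additive_onD[OF assms(2) assms(3)[OF hk(1)] assms(3)[OF hk(2)]])
qed

lemma additive_on_lin_ext: "biadditive \<phi> \<Longrightarrow> additive_on N (lin_ext \<phi>)"
  by (rule additive_onI) (rule lin_ext_add)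

text \<open>The chain identities below are reduced to single simplices through this rule.\<close>

lemma additive_on_eqI:
  assumes "additive_on N F" "additive_on N G" "h \<in> fin_chains N"
    "\<And>x a. x \<in> N \<Longrightarrow> F (single x a) = G (single x a)"
  shows "F h = G h"
  by (rule fin_chains_induct[where P = "\<lambda>h. F h = G h", OF assms(3)])
    (simp_all add: assms(4) additive_on_0[OF assms(1)] additive_on_0[OF assms(2)]
      additive_onD[OF assms(1)] additive_onD[OF assms(2)])

lemma additive_on_closed:
  assumes "additive_on N F" "add_subgroup S" "h \<in> fin_chains N" "\<And>x a. x \<in> N \<Longrightarrow> F (single x a) \<in> S"
  shows "F h \<in> S"
  by (rule fin_chains_induct[where P = "\<lambda>h. F h \<in> S", OF assms(3)])
    (simp_all add: assms(4) additive_on_0[OF assms(1)] additive_onD[OF assms(1)]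
      add_subgroup_zero[OF assms(2)] add_subgroup_add[OF assms(2)])

lemma additive_on_push: "additive_on N (push f)"
  unfolding push_def by (rule additive_on_lin_ext) simp

lemma push_closed: "h \<in> fin_chains N \<Longrightarrow> (\<And>x. x \<in> N \<Longrightarrow> f x \<in> M) \<Longrightarrow> push f h \<in> fin_chains M"
  by (rule additive_on_closed[OF additive_on_push fin_chains_subgroup]) auto

lemma push_push: "h \<in> fin_chains N \<Longrightarrow> push g (push f h) = push (\<lambda>x. g (f x)) h"
  by (rule additive_on_eqI[OF additive_on_comp[OF additive_on_push additive_on_push] additive_on_push])
    (auto intro: push_closed[of _ N _ UNIV])

lemma push_id: "h \<in> fin_chains N \<Longrightarrow> (\<And>x. x \<in> N \<Longrightarrow> f x = x) \<Longrightarrow> push f h = h"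
  by (rule additive_on_eqI[OF additive_on_push additive_on_id]) auto


section \<open>Chains of groupoids\<close>

lemma compactin_open_basis:
  assumes "compactin X S" "\<And>x. x \<in> S \<Longrightarrow> \<exists>B. B \<in> \<B> \<and> openin X B \<and> x \<in> B"
  obtains \<F> where "finite \<F>" "\<F> \<subseteq> \<B>" "S \<subseteq> \<Union>\<F>"
proof -
  have "\<exists>\<F>. finite \<F> \<and> \<F> \<subseteq> {B \<in> \<B>. openin X B} \<and> S \<subseteq> \<Union>\<F>"
    by (rule compactinD[OF assms(1)]) (use assms(2) in blast)+
  then show ?thesis using that by blast
qed

section \<open>Generators of the chain groups\<close>

definition indic :: "'x set \<Rightarrow> 'a::ab_group_add \<Rightarrow> 'x \<Rightarrow> 'a" where
  "indic U a = (\<lambda>x. if x \<in> U then a else 0)"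

definition chain_generators :: "'g groupoid \<Rightarrow> nat \<Rightarrow> ('g list \<Rightarrow> 'a::ab_group_add) set" where
  "chain_generators G n = {indic U a |a U. compactin (nerve_topology G n) U \<and>
     openin (nerve_topology G n) U \<and> Hausdorff_space (subtopology (nerve_topology G n) U)}"

lemma fun_group_simps: "carrier fun_group = UNIV" "f \<otimes>\<^bsub>fun_group\<^esub> g = f + g" "\<one>\<^bsub>fun_group\<^esub> = 0"
  by (simp_all add: fun_group_def plus_fun_def zero_fun_def)

lemma group_fun_group: "group (fun_group :: ('b \<Rightarrow> 'a::ab_group_add) monoid)"
proof (rule groupI)
  fix f :: "'b \<Rightarrow> 'a"
  show "\<exists>g\<in>carrier fun_group. g \<otimes>\<^bsub>fun_group\<^esub> f = \<one>\<^bsub>fun_group\<^esub>"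
    by (rule bexI[of _ "- f"]) (auto simp: fun_group_simps)
qed (auto simp: fun_group_simps add.assoc)

lemma inv_fun_group: "inv\<^bsub>fun_group\<^esub> (f :: 'b \<Rightarrow> 'a::ab_group_add) = - f"
  using group.inv_equality[OF group_fun_group, of "- f" f] by (simp add: fun_group_simps)

lemma chain_group_carrier:
  "carrier (chain_group A G n) = generate fun_group (chain_generators G n)"
  by (simp add: chain_group_def carrier_subgroup_generated fun_group_simps chain_generators_def indic_def)

lemma chain_group_subgroup:
  "add_subgroup (carrier (chain_group (A :: 'a::ab_group_add itself) G n))"
proof -
  let ?S = "chain_generators G n :: ('b list \<Rightarrow> 'a) set"
  interpret subgroup "generate fun_group ?S" "fun_group"
    by (rule group.generate_is_subgroup[OF group_fun_group]) (simp add: fun_group_simps)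
  have "f - g \<in> generate fun_group ?S" if "f \<in> generate fun_group ?S" "g \<in> generate fun_group ?S" for f g
    using m_closed[OF that(1) m_inv_closed[OF that(2)]] by (simp add: fun_group_simps inv_fun_group)
  then show ?thesis
    using one_closed by (simp add: add_subgroup_def chain_group_carrier fun_group_simps)
qed

lemma chain_group_generators: "chain_generators G n \<subseteq> carrier (chain_group A G n)"
  by (auto simp: chain_group_carrier intro: generate.incl)

lemma chain_group_minimal:
  assumes "add_subgroup S" "chain_generators G n \<subseteq> S"
  shows "carrier (chain_group A G n) \<subseteq> S"
proof
  fix h assume "h \<in> carrier (chain_group A G n)"
  then have "h \<in> generate fun_group (chain_generators G n)" by (simp add: chain_group_carrier)
  then show "h \<in> S"
    using assms
    by (induction rule: generate.induct)
      (auto simp: fun_group_simps inv_fun_group intro: add_subgroup_zero add_subgroup_minus add_subgroup_add)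
qed

lemma homology_eq_quotient_group:
  "homology A G n = quotient_group (cycles A G n) (boundaries A G n)"
proof -
  have *: "f \<otimes>\<^bsub>chain_group A G n\<^esub> g = f + g" for f g
    by (simp add: chain_group_def subgroup_generated_def fun_group_simps)
  have "rcosets\<^bsub>(chain_group A G n)\<lparr>carrier := cycles A G n\<rparr>\<^esub> boundaries A G n =
      residue_class (boundaries A G n) ` cycles A G n"
    by (simp add: RCOSETS_def r_coset_def residue_class_def * UNION_singleton_eq_range)
  moreover have "(<#>\<^bsub>(chain_group A G n)\<lparr>carrier := cycles A G n\<rparr>\<^esub>) = (\<lambda>X Y. {x + y |x y. x \<in> X \<and> y \<in> Y})"
  proof (intro ext)
    fix X Y
    have **: "f \<otimes>\<^bsub>(chain_group A G n)\<lparr>carrier := cycles A G n\<rparr>\<^esub> g = f + g" for f g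
      by (simp add: *)
    show "X <#>\<^bsub>(chain_group A G n)\<lparr>carrier := cycles A G n\<rparr>\<^esub> Y = {x + y |x y. x \<in> X \<and> y \<in> Y}"
      unfolding set_mult_def ** by blast
  qed
  ultimately show ?thesis
    unfolding homology_def FactGroup_def quotient_group_def by (simp only:)
qed

section \<open>The topology of the nerve\<close>

lemma openin_nerve_topology:
  "openin (nerve_topology G n) S \<longleftrightarrow>
     (\<exists>U. openin (product_topology (\<lambda>_. Top G) {..<max 1 n}) U \<and>
          S = {gs \<in> nerve G n. (\<lambda>i\<in>{..<max 1 n}. gs ! i) \<in> U})"
  unfolding nerve_topology_def openin_pullback_topology by (rule ex_cong) auto

lemma nerve_length: "gs \<in> nerve G n \<Longrightarrow> length gs = max 1 n"
  by (auto simp: nerve_def split: if_splits)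

lemma openin_nerve_topology_box:
  assumes "\<And>i. i < max 1 n \<Longrightarrow> openin (Top G) (V i)"
  shows "openin (nerve_topology G n) {gs \<in> nerve G n. \<forall>i<max 1 n. gs ! i \<in> V i}"
  unfolding openin_nerve_topology
proof (intro exI conjI)
  show "openin (product_topology (\<lambda>_. Top G) {..<max 1 n}) (\<Pi>\<^sub>E i\<in>{..<max 1 n}. V i)"
    using assms by (simp add: openin_PiE_gen)
  show "{gs \<in> nerve G n. \<forall>i<max 1 n. gs ! i \<in> V i} =
    {gs \<in> nerve G n. (\<lambda>i\<in>{..<max 1 n}. gs ! i) \<in> (\<Pi>\<^sub>E i\<in>{..<max 1 n}. V i)}"
    by (auto simp: PiE_iff)
qed

lemma openin_nerve_topologyE:
  assumes "openin (nerve_topology G n) S" "gs \<in> S"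
  obtains V where "\<And>i. i < max 1 n \<Longrightarrow> openin (Top G) (V i) \<and> gs ! i \<in> V i"
    "{gs \<in> nerve G n. \<forall>i<max 1 n. gs ! i \<in> V i} \<subseteq> S" "gs \<in> nerve G n"
proof -
  obtain U where U: "openin (product_topology (\<lambda>_. Top G) {..<max 1 n}) U"
    "S = {gs \<in> nerve G n. (\<lambda>i\<in>{..<max 1 n}. gs ! i) \<in> U}"
    using assms(1) unfolding openin_nerve_topology by blast
  have "(\<lambda>i\<in>{..<max 1 n}. gs ! i) \<in> U" using assms(2) U(2) by blast
  from U(1)[unfolded openin_product_topology_alt, rule_format, OF this]
  obtain V where V: "\<forall>i\<in>{..<max 1 n}. openin (Top G) (V i)"
    "(\<lambda>i\<in>{..<max 1 n}. gs ! i) \<in> Pi\<^sub>E {..<max 1 n} V" "Pi\<^sub>E {..<max 1 n} V \<subseteq> U"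
    by blast
  have 1: "gs ! i \<in> V i" if "i < max 1 n" for i
    using PiE_mem[OF V(2), of i] that by simp
  have 2: "{gs \<in> nerve G n. \<forall>i<max 1 n. gs ! i \<in> V i} \<subseteq> S"
  proof
    fix hs assume hs: "hs \<in> {gs \<in> nerve G n. \<forall>i<max 1 n. gs ! i \<in> V i}"
    then have "(\<lambda>i\<in>{..<max 1 n}. hs ! i) \<in> Pi\<^sub>E {..<max 1 n} V" by (intro restrict_PiE_iff[THEN iffD2]) simp
    then show "hs \<in> S" using V(3) U(2) hs by blast
  qed
  have 3: "gs \<in> nerve G n" using U(2) assms(2) by blast
  show ?thesis by (rule that[of V]) (use V(1) 1 2 3 in simp_all)
qed

context discrete_groupoid
begin

lemma openin_nerve: "openin (nerve_topology G n) S \<longleftrightarrow> S \<subseteq> nerve G n"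
proof
  assume "S \<subseteq> nerve G n"
  have unit: "unit_space G \<subseteq> Arr G" using src_unit by (auto simp: unit_space_def)
  have arr: "gs ! i \<in> Arr G" if "gs \<in> nerve G n" "i < max 1 n" for gs i
  proof -
    have "set gs \<subseteq> Arr G" using that(1) unit by (auto simp: nerve_def split: if_splits)
    then show ?thesis using nerve_length[OF that(1)] that(2) by (metis nth_mem subsetD)
  qed
  have "openin (nerve_topology G n) {gs}" if "gs \<in> nerve G n" for gs
  proof -
    have "{hs \<in> nerve G n. \<forall>i<max 1 n. hs ! i \<in> {gs ! i}} = {gs}"
      using that nerve_length by (auto intro!: nth_equalityI simp: nerve_length)
    then show ?thesis
      using openin_nerve_topology_box[of n G "\<lambda>i. {gs ! i}"] arr[OF that] by (simp add: discrete)
  qed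
  then have "openin (nerve_topology G n) (\<Union>gs\<in>S. {gs})"
    using \<open>S \<subseteq> nerve G n\<close> by (intro openin_Union) auto
  then show "openin (nerve_topology G n) S" by simp
qed (auto simp: openin_nerve_topology)

lemma nerve_topology_discrete: "nerve_topology G n = discrete_topology (nerve G n)"
  by (simp add: topology_eq openin_nerve)

lemma chain_group_eq_fin_chains: "carrier (chain_group (A :: 'c::ab_group_add itself) G n) = fin_chains (nerve G n)"
proof
  have "indic U a \<in> fin_chains (nerve G n)"
    if "compactin (nerve_topology G n) U" "openin (nerve_topology G n) U" for U and a :: 'c
    using that by (auto simp: nerve_topology_discrete compactin_discrete_topology fin_chains_def indic_def)
  then show "carrier (chain_group A G n) \<subseteq> fin_chains (nerve G n)"
    by (intro chain_group_minimal fin_chains_subgroup) (auto simp: chain_generators_def)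
  have *: "single x a \<in> chain_generators G n" if "x \<in> nerve G n" for x and a :: 'c
  proof -
    have "single x a = indic {x} a" by (auto simp: single_def indic_def)
    then show ?thesis
      using that by (auto simp: chain_generators_def nerve_topology_discrete compactin_discrete_topology
          Hausdorff_space_discrete_topology)
  qed
  show "fin_chains (nerve G n) \<subseteq> carrier (chain_group A G n)"
    by (rule subsetI, rule additive_on_closed[OF additive_on_id chain_group_subgroup])
      (use * chain_group_generators in blast)+
qed

end

section \<open>Signed sums, pushforward and boundary\<close>

definition alt :: "nat \<Rightarrow> 'a::ab_group_add \<Rightarrow> 'a" where
  "alt i a = (if even i then a else - a)"

lemma alt_simps [simp]: "alt i 0 = 0" "alt i (a + b) = alt i a + alt i b" "alt i (- a) = - alt i a"
  "alt i (alt j a) = alt (i + j) a" "alt 0 a = a" "alt (Suc i) a = - alt i a"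
  by (auto simp: alt_def)

lemma alt_sum: "alt i (sum f S) = (\<Sum>x\<in>S. alt i (f x))"
  by (simp add: alt_def sum_negf)

text \<open>The hypotheses bound fibres and not supports: the indicator of a cell of germs has
  infinite support in general, but face maps are injective on the cell.\<close>

lemma pushforward_add:
  assumes "\<And>y. finite {x \<in> B. f x = y \<and> h x \<noteq> 0}" "\<And>y. finite {x \<in> B. f x = y \<and> k x \<noteq> 0}"
  shows "pushforward B f (h + k) = pushforward B f h + pushforward B f k"
proof
  fix y
  let ?S = "{x \<in> B. f x = y \<and> h x \<noteq> 0} \<union> {x \<in> B. f x = y \<and> k x \<noteq> 0}"
  have S: "finite ?S" using assms by simp
  have "pushforward B f l y = (\<Sum>x\<in>?S. l x)" if "{x \<in> B. f x = y \<and> l x \<noteq> 0} \<subseteq> ?S" for l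
    unfolding pushforward_def using that by (intro sum.mono_neutral_left[OF S]) auto
  from this[of h] this[of k] this[of "h + k"]
  show "pushforward B f (h + k) y = (pushforward B f h + pushforward B f k) y"
    by (fastforce simp: sum.distrib)
qed

lemma boundary_eq:
  "n > 0 \<Longrightarrow> boundary G n h = (\<Sum>i\<le>n. alt i (pushforward (nerve G n) (face G n i) h))"
  by (auto simp: boundary_def fun_eq_iff sum_fun_apply alt_def intro!: sum.cong)

lemma boundary_0: "boundary G 0 h = 0"
  by (auto simp: boundary_def)

lemma boundary_add_general:
  assumes "\<And>i y. n > 0 \<Longrightarrow> i \<le> n \<Longrightarrow> finite {x \<in> nerve G n. face G n i x = y \<and> h x \<noteq> 0}"
    "\<And>i y. n > 0 \<Longrightarrow> i \<le> n \<Longrightarrow> finite {x \<in> nerve G n. face G n i x = y \<and> k x \<noteq> 0}"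
  shows "boundary G n (h + k) = boundary G n h + boundary G n k"
proof (cases "n > 0")
  case True
  have "boundary G n (h + k) = (\<Sum>i\<le>n. alt i (pushforward (nerve G n) (face G n i) h) +
      alt i (pushforward (nerve G n) (face G n i) k))"
    unfolding boundary_eq[OF True]
    by (rule sum.cong[OF refl]) (simp add: pushforward_add assms True)
  then show ?thesis by (simp add: boundary_eq[OF True] sum.distrib)
qed (simp add: boundary_0)

lemma boundary_add:
  assumes "h \<in> fin_chains N" "k \<in> fin_chains N"
  shows "boundary G n (h + k) = boundary G n h + boundary G n k"
  using assms by (intro boundary_add_general) (auto intro: finite_subset[OF _ fin_chains_finite])

lemma additive_on_boundary: "additive_on N (boundary G n)"
  by (rule additive_onI) (rule boundary_add)

text \<open>Injectivity leaves at most one term in each fibre sum. Singletons and cells of germs are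
  the two instances.\<close>

lemma pushforward_indic:
  assumes "U \<subseteq> B" "inj_on f U"
  shows "pushforward B f (indic U a) = indic (f ` U) a"
proof
  fix y
  show "pushforward B f (indic U a) y = indic (f ` U) a y"
  proof (cases "y \<in> f ` U \<and> a \<noteq> 0")
    case True
    then obtain x where x: "x \<in> U" "y = f x" by blast
    then have "{x \<in> B. f x = y \<and> indic U a x \<noteq> 0} = {x}"
      using assms True by (auto simp: indic_def inj_on_def split: if_splits)
    then show ?thesis using x by (simp add: pushforward_def indic_def)
  next
    case False
    then have "{x \<in> B. f x = y \<and> indic U a x \<noteq> 0} = {}" by (auto simp: indic_def)
    then have "pushforward B f (indic U a) y = 0" by (simp only: pushforward_def sum.empty)
    then show ?thesis using False by (auto simp: indic_def)
  qed
qed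

lemma single_eq_indic: "single x a = indic {x} a"
  by (auto simp: single_def indic_def)

lemma boundary_single:
  assumes "x \<in> nerve G n" "n > 0"
  shows "boundary G n (single x a) = (\<Sum>i\<le>n. alt i (single (face G n i x) a))"
  unfolding boundary_eq[OF assms(2)]
  by (rule sum.cong[OF refl]) (use assms in \<open>simp add: single_eq_indic pushforward_indic\<close>)

text \<open>Replacing \<open>(j, i)\<close> by \<open>(i, j - 1)\<close> matches the pairs with
  \<open>i < j\<close> to those with \<open>j \<le> i\<close> and shifts the index sum by one, so
  the terms cancel.\<close>

lemma alt_sum_simplicial_zero:
  fixes T :: "nat \<Rightarrow> nat \<Rightarrow> 'b::ab_group_add"
  assumes "\<And>i j. i < j \<Longrightarrow> j \<le> Suc n \<Longrightarrow> T i j = T (j - 1) i"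
  shows "(\<Sum>j\<le>Suc n. \<Sum>i\<le>n. alt (i + j) (T i j)) = 0"
proof -
  let ?f = "\<lambda>(j, i). alt (i + j) (T i j)"
  let ?P = "{(j, i). j \<le> Suc n \<and> i \<le> n \<and> i < j}" and ?Q = "{(j, i). j \<le> Suc n \<and> i \<le> n \<and> j \<le> i}"
  have fin: "finite ?P" "finite ?Q"
    by (rule finite_subset[of _ "{..Suc n} \<times> {..n}"]; auto)+
  have "(\<Sum>j\<le>Suc n. \<Sum>i\<le>n. alt (i + j) (T i j)) = sum ?f ({..Suc n} \<times> {..n})"
    by (simp add: sum.cartesian_product)
  also have "{..Suc n} \<times> {..n} = ?P \<union> ?Q" by auto
  also have "sum ?f (?P \<union> ?Q) = sum ?f ?P + sum ?f ?Q"
    by (rule sum.union_disjoint) (use fin in auto)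
  also have "sum ?f ?P = sum (\<lambda>p. - ?f p) ?Q"
  proof (rule sum.reindex_bij_witness[of _ "\<lambda>(j, i). (Suc i, j)" "\<lambda>(j, i). (i, j - 1)"])
    fix p assume "p \<in> ?P"
    then obtain j i where p: "p = (j, i)" "j \<le> Suc n" "i < j" by auto
    then obtain m where "j = Suc m" by (cases j) auto
    then show "- ?f (case p of (j, i) \<Rightarrow> (i, j - 1)) = ?f p"
      using p assms[of i j] by (simp add: add.commute)
  qed auto
  finally show ?thesis by (simp add: sum_negf)
qed

text \<open>\<open>T j i\<close> stands for face \<open>j\<close> of prism \<open>i\<close>, and
  \<open>S j i\<close> for prism \<open>i\<close> of face \<open>j\<close>. Terms off the two
  diagonals cancel against \<open>S\<close>; those with \<open>j = i\<close> and
  \<open>j = i + 1\<close> telescope to the two ends.\<close>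

lemma alt_sum_simplicial_homotopy:
  fixes T S :: "nat \<Rightarrow> nat \<Rightarrow> 'b::ab_group_add"
  assumes lower: "\<And>i j. j < i \<Longrightarrow> i \<le> Suc n \<Longrightarrow> T j i = S j (i - 1)"
    and upper: "\<And>i j. i + 1 < j \<Longrightarrow> j \<le> Suc (Suc n) \<Longrightarrow> T j i = S (j - 1) i"
    and diag: "\<And>i. i < Suc n \<Longrightarrow> T (Suc i) i = T (Suc i) (Suc i)"
  shows "(\<Sum>j\<le>Suc (Suc n). \<Sum>i\<le>Suc n. alt (i + j) (T j i)) + (\<Sum>j\<le>Suc n. \<Sum>i\<le>n. alt (i + j) (S j i)) =
    T 0 0 - T (Suc (Suc n)) (Suc n)"
proof -
  let ?f = "\<lambda>(j, i). alt (i + j) (T j i)" and ?g = "\<lambda>(j, i). alt (i + j) (S j i)"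
  let ?L = "{(j, i). i \<le> Suc n \<and> j < i}" and ?U = "{(j, i). i \<le> Suc n \<and> j \<le> Suc (Suc n) \<and> i + 1 < j}"
  let ?D = "{(j, i). i \<le> Suc n \<and> j = i}" and ?D' = "{(j, i). i \<le> Suc n \<and> j = Suc i}"
  let ?A = "{..Suc (Suc n)} \<times> {..Suc n}"
  have sub: "?L \<subseteq> ?A" "?U \<subseteq> ?A" "?D \<subseteq> ?A" "?D' \<subseteq> ?A" by auto
  have fin: "finite ?L" "finite ?U" "finite ?D" "finite ?D'"
    by (rule finite_subset[OF sub(1)] finite_subset[OF sub(2)] finite_subset[OF sub(3)]
        finite_subset[OF sub(4)]; simp)+
  have "(\<Sum>j\<le>Suc (Suc n). \<Sum>i\<le>Suc n. alt (i + j) (T j i)) = sum ?f ?A"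
    by (simp only: sum.cartesian_product)
  also have "?A = ?L \<union> (?U \<union> (?D \<union> ?D'))" by auto
  also have "sum ?f \<dots> = sum ?f ?L + (sum ?f ?U + (sum ?f ?D + sum ?f ?D'))"
    using fin by (simp add: sum.union_disjoint disjoint_iff)
  also have "sum ?f ?L = sum (\<lambda>p. - ?g p) {(j, i). i \<le> n \<and> j \<le> i}"
  proof (rule sum.reindex_bij_witness[of _ "\<lambda>(j, i). (j, Suc i)" "\<lambda>(j, i). (j, i - 1)"])
    fix p assume "p \<in> ?L"
    then obtain j m where p: "p = (j, Suc m)" "m \<le> n" "j < Suc m" by (auto simp: less_eq_Suc_le) (metis Suc_le_D Suc_le_mono)
    then show "- ?g (case p of (j, i) \<Rightarrow> (j, i - 1)) = ?f p"
      using lower[of j "Suc m"] by simp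
  qed auto
  also have "sum ?f ?U = sum (\<lambda>p. - ?g p) {(j, i). j \<le> Suc n \<and> i < j}"
  proof (rule sum.reindex_bij_witness[of _ "\<lambda>(j, i). (Suc j, i)" "\<lambda>(j, i). (j - 1, i)"])
    fix p assume "p \<in> ?U"
    then obtain m i where p: "p = (Suc m, i)" "m \<le> Suc n" "i < m" by (auto simp: less_eq_Suc_le) (metis Suc_le_D Suc_le_mono)
    then show "- ?g (case p of (j, i) \<Rightarrow> (j - 1, i)) = ?f p"
      using upper[of i "Suc m"] by simp
  qed auto
  also have "sum ?f ?D = (\<Sum>i\<le>Suc n. T i i)"
    by (rule sum.reindex_bij_witness[of _ "\<lambda>i. (i, i)" fst]) (auto simp: alt_def)
  also have "sum ?f ?D' = (\<Sum>i\<le>Suc n. - T (Suc i) i)"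
    by (rule sum.reindex_bij_witness[of _ "\<lambda>i. (Suc i, i)" snd]) (auto simp: alt_def)
  also have "(\<Sum>i\<le>Suc n. - T (Suc i) i) = - T (Suc (Suc n)) (Suc n) - (\<Sum>i\<le>n. T (Suc i) (Suc i))"
    using diag by (simp add: sum_negf)
  also have "(\<Sum>i\<le>Suc n. T i i) = T 0 0 + (\<Sum>i\<le>n. T (Suc i) (Suc i))"
    by (simp only: sum.atMost_Suc_shift)
  finally have *: "(\<Sum>j\<le>Suc (Suc n). \<Sum>i\<le>Suc n. alt (i + j) (T j i)) =
      - (sum ?g {(j, i). i \<le> n \<and> j \<le> i} + sum ?g {(j, i). j \<le> Suc n \<and> i < j}) +
      (T 0 0 - T (Suc (Suc n)) (Suc n))"
    by (simp add: sum_negf)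
  have finL: "finite {(j, i). i \<le> n \<and> j \<le> i}" and finU: "finite {(j, i). j \<le> Suc n \<and> i < j \<and> i \<le> n}"
    by (rule finite_subset[of _ "{..Suc n} \<times> {..n}"]; auto)+
  have "sum ?g {(j, i). i \<le> n \<and> j \<le> i} + sum ?g {(j, i). j \<le> Suc n \<and> i < j} + 0 =
      sum ?g {(j, i). i \<le> n \<and> j \<le> i} + sum ?g {(j, i). j \<le> Suc n \<and> i < j \<and> i \<le> n}"
    by (auto intro!: arg_cong[where f = "sum ?g"])
  also have "\<dots> = sum ?g ({..Suc n} \<times> {..n})"
    by (subst sum.union_disjoint[symmetric]) (rule finL, rule finU, auto intro!: arg_cong[where f = "sum ?g"])
  finally show ?thesis using * by (simp add: sum.cartesian_product)
qed

lemma additive_on_sum: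
  assumes "additive_on N F" "\<And>i. i \<in> I \<Longrightarrow> f i \<in> fin_chains N"
  shows "F (\<Sum>i\<in>I. f i) = (\<Sum>i\<in>I. F (f i))"
  using assms(2)
proof (induction I rule: infinite_finite_induct)
  case (insert i I)
  have 1: "F (f i + sum f I) = F (f i) + F (sum f I)"
    by (rule additive_onD[OF assms(1)]) (use insert in \<open>auto intro: fin_chains_sum\<close>)
  have 2: "F (sum f I) = (\<Sum>i\<in>I. F (f i))" using insert by blast
  show ?case by (simp only: sum.insert[OF insert(1,2)] 1 2)
qed (simp_all add: additive_on_0[OF assms(1)])

lemma additive_on_alt:
  assumes "additive_on N F" "h \<in> fin_chains N"
  shows "F (alt i h) = alt i (F h)"
  using additive_on_diff[OF assms(1) fin_chains_zero assms(2)] additive_on_0[OF assms(1)] by (simp add: alt_def)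

lemma fin_chains_alt: "h \<in> fin_chains N \<Longrightarrow> alt i h \<in> fin_chains N"
  by (simp add: alt_def fin_chains_minus)

lemma additive_on_alt_left:
  fixes F :: "('x \<Rightarrow> 'a::ab_group_add) \<Rightarrow> 'b::ab_group_add"
  assumes "additive_on N F" shows "additive_on N (\<lambda>h. alt i (F h))"
proof (rule additive_onI)
  fix h k :: "'x \<Rightarrow> 'a" assume "h \<in> fin_chains N" "k \<in> fin_chains N"
  from additive_onD[OF assms(1) this]
  show "alt i (F (h + k)) = alt i (F h) + alt i (F k)" by simp
qed

section \<open>Simplicial identities of the nerve\<close>

context groupoid
begin

text \<open>One formula serves the outer faces too: for \<open>i = 0\<close> every entry is shifted,
  for \<open>i = n\<close> the first \<open>n - 1\<close> entries stay. Degree 1 is excluded because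
  units are stored as one-element lists.\<close>

lemma face_nth:
  assumes "length gs = n" "2 \<le> n" "i \<le> n"
  shows "face G n i gs = map (\<lambda>k. if Suc k < i then gs ! k
     else if Suc k = i then mul G (gs ! k) (gs ! Suc k) else gs ! Suc k) [0..<n - 1]"
proof (rule nth_equalityI)
  show "length (face G n i gs) = length (map (\<lambda>k. if Suc k < i then gs ! k
     else if Suc k = i then mul G (gs ! k) (gs ! Suc k) else gs ! Suc k) [0..<n - 1])"
    using assms by (auto simp: face_def)
  fix k assume "k < length (face G n i gs)"
  then have k: "Suc k < n" using assms by (auto simp: face_def split: if_splits)
  consider "i = 0" | "i = n" | i' where "i = Suc i'" "Suc i' < n"
    using assms(3) by (cases i) (auto simp: le_less)
  then show "face G n i gs ! k = map (\<lambda>k. if Suc k < i then gs ! k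
     else if Suc k = i then mul G (gs ! k) (gs ! Suc k) else gs ! Suc k) [0..<n - 1] ! k"
  proof cases
    case (3 i')
    consider "k < i'" | "k = i'" | d where "k = Suc (i' + d)"
      by (metis less_imp_Suc_add nat_neq_iff)
    then show ?thesis using 3 k assms by cases (auto simp: face_def nth_append min_def)
  qed (use k assms in \<open>auto simp: face_def nth_tl nth_butlast\<close>)
qed

lemma nerve_Suc: "gs \<in> nerve G (Suc n) \<longleftrightarrow> length gs = Suc n \<and> (\<forall>i\<le>n. gs ! i \<in> Arr G) \<and>
    (\<forall>i<n. src G (gs ! i) = rng G (gs ! Suc i))"
  by (auto simp: nerve_def subset_code(1) all_set_conv_all_nth less_Suc_eq_le)

lemma nerve_0: "gs \<in> nerve G 0 \<longleftrightarrow> (\<exists>u\<in>unit_space G. gs = [u])"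
  by (auto simp: nerve_def)

lemma unit_src: "u \<in> unit_space G \<Longrightarrow> src G u = u"
  and unit_rng: "u \<in> unit_space G \<Longrightarrow> rng G u = u"
  and unit_arr: "u \<in> unit_space G \<Longrightarrow> u \<in> Arr G"
  and src_in_unit: "g \<in> Arr G \<Longrightarrow> src G g \<in> unit_space G"
  and rng_in_unit: "g \<in> Arr G \<Longrightarrow> rng G g \<in> unit_space G"
  using src_unit rng_unit by (auto simp: unit_space_def) (metis image_eqI)

lemma face_1: "face G (Suc 0) i [g] = (if i = 0 then [src G g] else [rng G g])"
  by (simp add: face_def)

lemma nerve_nth_closed:
  assumes "gs \<in> nerve G (Suc n)" "k < n"
  shows "mul G (gs ! k) (gs ! Suc k) \<in> Arr G" "src G (mul G (gs ! k) (gs ! Suc k)) = src G (gs ! Suc k)"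
    "rng G (mul G (gs ! k) (gs ! Suc k)) = rng G (gs ! k)"
  using assms mul_closed[of "gs ! k" "gs ! Suc k"] by (auto simp: nerve_Suc)

lemma nerve_nth_assoc:
  assumes "gs \<in> nerve G (Suc n)" "Suc k < n"
  shows "mul G (mul G (gs ! k) (gs ! Suc k)) (gs ! Suc (Suc k)) = mul G (gs ! k) (mul G (gs ! Suc k) (gs ! Suc (Suc k)))"
  using assms mul_assoc[of "gs ! k" "gs ! Suc k" "gs ! Suc (Suc k)"] by (auto simp: nerve_Suc)

lemma face_closed:
  assumes gs: "gs \<in> nerve G (Suc n)" and i: "i \<le> Suc n"
  shows "face G (Suc n) i gs \<in> nerve G n"
proof (cases n)
  case 0
  then obtain g where "gs = [g]" "g \<in> Arr G" using gs by (auto simp: nerve_Suc length_Suc_conv)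
  then show ?thesis using 0 src_in_unit rng_in_unit by (auto simp: face_1 nerve_0)
next
  case (Suc m)
  have gs': "length gs = Suc (Suc m)" "\<And>k. k \<le> Suc m \<Longrightarrow> gs ! k \<in> Arr G"
    "\<And>k. k \<le> m \<Longrightarrow> src G (gs ! k) = rng G (gs ! Suc k)"
    using gs Suc by (auto simp: nerve_Suc)
  show ?thesis
    using gs' nerve_nth_closed[OF gs] i
    by (auto simp: Suc face_nth nerve_Suc simp del: upt_Suc)
qed

lemma face_face:
  assumes gs: "gs \<in> nerve G (Suc (Suc n))" and ij: "i < j" "j \<le> Suc (Suc n)"
  shows "face G (Suc n) i (face G (Suc (Suc n)) j gs) = face G (Suc n) (j - 1) (face G (Suc (Suc n)) i gs)"
proof (cases n)
  \<comment> \<open>Only here, going from pairs down to units, do the exceptional faces of degree 1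
    occur.\<close>
  case 0
  then obtain g h where "gs = [g, h]" "g \<in> Arr G" "h \<in> Arr G" "src G g = rng G h"
  proof -
    obtain g h where gh: "gs = [g, h]" using gs 0 by (auto simp: nerve_Suc length_Suc_conv)
    have "\<forall>k\<le>1. gs ! k \<in> Arr G" "src G (gs ! 0) = rng G (gs ! 1)"
      using gs 0 by (auto simp: nerve_Suc)
    then have "gs ! 0 \<in> Arr G" "gs ! 1 \<in> Arr G" "src G (gs ! 0) = rng G (gs ! 1)" by blast+
    then show ?thesis using that gh by simp
  qed
  moreover have "(i = 0 \<and> j = 1) \<or> (i = 0 \<and> j = 2) \<or> (i = 1 \<and> j = 2)" using ij 0 by auto
  ultimately show ?thesis
    using 0 mul_closed by (auto simp: face_def)
next
  case (Suc m)
  have len: "length gs = Suc (Suc n)" using gs by (simp add: nerve_Suc)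
  have *: "length (face G (Suc (Suc n)) i gs) = Suc n" if "i \<le> Suc (Suc n)" for i
    using face_closed[OF gs that] by (simp add: nerve_Suc)
  have A: "face G (Suc n) i (face G (Suc (Suc n)) j gs) = map (\<lambda>k. if Suc k < i then face G (Suc (Suc n)) j gs ! k
     else if Suc k = i then mul G (face G (Suc (Suc n)) j gs ! k) (face G (Suc (Suc n)) j gs ! Suc k)
     else face G (Suc (Suc n)) j gs ! Suc k) [0..<n]" if "i \<le> Suc n" "j \<le> Suc (Suc n)" for i j
    using face_nth[OF *[OF that(2)], of i] that Suc by simp
  have B: "face G (Suc (Suc n)) i gs ! k = (if Suc k < i then gs ! k
     else if Suc k = i then mul G (gs ! k) (gs ! Suc k) else gs ! Suc k)" if "i \<le> Suc (Suc n)" "k < Suc n" for i k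
    using face_nth[OF len, of i] that by (simp del: upt_Suc)
  obtain j' where "j = Suc j'" using ij by (cases j) auto
  then show ?thesis
    using ij by (simp add: A) (auto simp: B nerve_nth_assoc[OF gs])
qed

end

context discrete_groupoid
begin

lemma boundary_closed:
  assumes "h \<in> fin_chains (nerve G (Suc n))"
  shows "boundary G (Suc n) h \<in> fin_chains (nerve G n)"
proof (rule additive_on_closed[OF additive_on_boundary fin_chains_subgroup assms])
  fix x :: "'a list" and a :: 'b assume "x \<in> nerve G (Suc n)"
  then show "boundary G (Suc n) (single x a) \<in> fin_chains (nerve G n)"
    unfolding boundary_single[OF \<open>x \<in> nerve G (Suc n)\<close> zero_less_Suc]
    by (intro fin_chains_sum fin_chains_alt fin_chains_single face_closed) auto
qed

lemma boundary_boundary: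
  fixes h :: "'a list \<Rightarrow> 'b::ab_group_add"
  assumes "h \<in> fin_chains (nerve G (Suc (Suc n)))"
  shows "boundary G (Suc n) (boundary G (Suc (Suc n)) h) = 0"
proof (rule additive_on_eqI[where F = "\<lambda>h. boundary G (Suc n) (boundary G (Suc (Suc n)) h)" and G = "\<lambda>_. 0", OF _ _ assms])
  show "additive_on (nerve G (Suc (Suc n))) (\<lambda>h. boundary G (Suc n) (boundary G (Suc (Suc n)) h))"
    by (rule additive_on_comp[OF additive_on_boundary additive_on_boundary boundary_closed])
  show "additive_on (nerve G (Suc (Suc n))) (\<lambda>_. 0)" by (simp add: additive_on_def)
  fix x and a :: 'b assume x: "x \<in> nerve G (Suc (Suc n))"
  let ?N = "nerve G (Suc n)"
  have c: "single (face G (Suc (Suc n)) j x) a \<in> fin_chains ?N" if "j \<le> Suc (Suc n)" for j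
    using face_closed[OF x that] by simp
  have "boundary G (Suc n) (boundary G (Suc (Suc n)) (single x a)) =
      boundary G (Suc n) (\<Sum>j\<le>Suc (Suc n). alt j (single (face G (Suc (Suc n)) j x) a))"
    using x by (simp only: boundary_single zero_less_Suc)
  also have "\<dots> = (\<Sum>j\<le>Suc (Suc n). boundary G (Suc n) (alt j (single (face G (Suc (Suc n)) j x) a)))"
    by (rule additive_on_sum[OF additive_on_boundary]) (use c in \<open>auto intro: fin_chains_alt\<close>)
  also have "\<dots> = (\<Sum>j\<le>Suc (Suc n). \<Sum>i\<le>Suc n. alt (i + j) (single (face G (Suc n) i (face G (Suc (Suc n)) j x)) a))"
  proof (rule sum.cong[OF refl])
    fix j assume "j \<in> {..Suc (Suc n)}"
    then have j: "j \<le> Suc (Suc n)" by simp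
    show "boundary G (Suc n) (alt j (single (face G (Suc (Suc n)) j x) a)) =
        (\<Sum>i\<le>Suc n. alt (i + j) (single (face G (Suc n) i (face G (Suc (Suc n)) j x)) a))"
      unfolding additive_on_alt[OF additive_on_boundary c[OF j]]
      by (simp only: boundary_single[OF face_closed[OF x j] zero_less_Suc] alt_sum alt_simps add.commute)
  qed
  also have "\<dots> = 0"
    by (rule alt_sum_simplicial_zero) (simp only: face_face[OF x])
  finally show "boundary G (Suc n) (boundary G (Suc (Suc n)) (single x a)) = 0" .
qed

lemma chain_complex_fin: "chain_complex (\<lambda>n. fin_chains (nerve G n) :: ('a list \<Rightarrow> 'b::ab_group_add) set) (boundary G)"
  by standard (simp_all add: fin_chains_subgroup boundary_closed boundary_boundary boundary_0
      additive_on_diff[OF additive_on_boundary])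

end


section \<open>Equivalences of discrete groupoids\<close>

locale groupoid_functor = A: groupoid A + B: groupoid B for A :: "'a groupoid" and B :: "'b groupoid" +
  fixes \<phi> :: "'a \<Rightarrow> 'b"
  assumes arr: "g \<in> Arr A \<Longrightarrow> \<phi> g \<in> Arr B"
    and src: "g \<in> Arr A \<Longrightarrow> src B (\<phi> g) = \<phi> (src A g)"
    and rng: "g \<in> Arr A \<Longrightarrow> rng B (\<phi> g) = \<phi> (rng A g)"
    and mul: "g \<in> Arr A \<Longrightarrow> h \<in> Arr A \<Longrightarrow> src A g = rng A h \<Longrightarrow> \<phi> (mul A g h) = mul B (\<phi> g) (\<phi> h)"
begin

lemma unit: "u \<in> unit_space A \<Longrightarrow> \<phi> u \<in> unit_space B"
  using B.src_in_unit[OF arr] src by (auto simp: unit_space_def)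

lemma nerve: "gs \<in> nerve A n \<Longrightarrow> map \<phi> gs \<in> nerve B n"
proof (cases n)
  case (Suc m)
  assume "gs \<in> nerve A n"
  then show ?thesis unfolding Suc B.nerve_Suc A.nerve_Suc using arr src rng
    by (auto simp: nth_map)
qed (auto simp: A.nerve_0 B.nerve_0 unit)

lemma face:
  assumes "gs \<in> nerve A (Suc n)" "i \<le> Suc n"
  shows "face B (Suc n) i (map \<phi> gs) = map \<phi> (face A (Suc n) i gs)"
proof (cases n)
  case 0
  then show ?thesis using assms by (auto simp: A.nerve_Suc length_Suc_conv A.face_1 B.face_1 src rng)
next
  case (Suc m)
  have "length gs = Suc n" using assms by (simp add: A.nerve_Suc)
  then show ?thesis
    using assms Suc by (auto simp: A.face_nth B.face_nth A.nerve_Suc mul simp del: upt_Suc)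
qed

end

locale discrete_groupoid_functor = groupoid_functor A B \<phi> + A: discrete_groupoid A + B: discrete_groupoid B
  for A :: "'a groupoid" and B :: "'b groupoid" and \<phi>
begin

lemma push_chain_map:
  "chain_map (\<lambda>n. fin_chains (nerve A n) :: ('a list \<Rightarrow> 'c::ab_group_add) set) (boundary A)
     (\<lambda>n. fin_chains (nerve B n)) (boundary B) (\<lambda>_. push (map \<phi>))"
proof (intro chain_map.intro chain_map_axioms.intro A.chain_complex_fin B.chain_complex_fin)
  fix n and x y :: "'a list \<Rightarrow> 'c"
  show "push (map \<phi>) x \<in> fin_chains (nerve B n)" if "x \<in> fin_chains (nerve A n)"
    using that nerve by (rule push_closed)
  show "push (map \<phi>) (x - y) = push (map \<phi>) x - push (map \<phi>) y"
    if "x \<in> fin_chains (nerve A n)" "y \<in> fin_chains (nerve A n)"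
    using that by (rule additive_on_diff[OF additive_on_push])
  show "boundary B (Suc n) (push (map \<phi>) x) = push (map \<phi>) (boundary A (Suc n) x)"
    if x: "x \<in> fin_chains (nerve A (Suc n))"
  proof (rule additive_on_eqI[where F = "\<lambda>x. boundary B (Suc n) (push (map \<phi>) x)" and
        G = "\<lambda>x. push (map \<phi>) (boundary A (Suc n) x)", OF _ _ x])
    show "additive_on (nerve A (Suc n)) (\<lambda>x. boundary B (Suc n) (push (map \<phi>) x))"
      by (rule additive_on_comp[OF additive_on_push additive_on_boundary[of UNIV]]) (auto intro: push_closed)
    show "additive_on (nerve A (Suc n)) (\<lambda>x. push (map \<phi>) (boundary A (Suc n) x))"
      by (rule additive_on_comp[OF additive_on_boundary additive_on_push A.boundary_closed])
    fix gs and a :: 'c assume gs: "gs \<in> nerve A (Suc n)"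
    have "push (map \<phi>) (boundary A (Suc n) (single gs a)) =
        (\<Sum>i\<le>Suc n. push (map \<phi>) (alt i (single (face A (Suc n) i gs) a)))"
      unfolding boundary_single[OF gs zero_less_Suc]
      by (rule additive_on_sum[OF additive_on_push[of UNIV]]) (auto intro: fin_chains_alt)
    also have "\<dots> = (\<Sum>i\<le>Suc n. alt i (single (face B (Suc n) i (map \<phi> gs)) a))"
      by (rule sum.cong[OF refl]) (simp add: additive_on_alt[OF additive_on_push[of UNIV]] face[OF gs])
    finally show "boundary B (Suc n) (push (map \<phi>) (single gs a)) = push (map \<phi>) (boundary A (Suc n) (single gs a))"
      by (simp only: push_simps boundary_single[OF nerve[OF gs] zero_less_Suc])
  qed
qed

end

text \<open>\<open>\<eta> u\<close> is an arrow from \<open>\<phi> u\<close> to \<open>u\<close>.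
  Naturality makes the endomorphism of the chains induced by \<open>\<phi>\<close> homotopic to the
  identity.\<close>

locale natural_to_identity = discrete_groupoid A + groupoid_functor A A \<phi> for A :: "'a groupoid" and \<phi> +
  fixes \<eta> :: "'a \<Rightarrow> 'a"
  assumes \<eta>: "u \<in> unit_space A \<Longrightarrow> \<eta> u \<in> Arr A \<and> rng A (\<eta> u) = u \<and> src A (\<eta> u) = \<phi> u"
    and natural: "g \<in> Arr A \<Longrightarrow> mul A g (\<eta> (src A g)) = mul A (\<eta> (rng A g)) (\<phi> g)"
begin

text \<open>The simplices that triangulate the prism over a tuple: follow the given arrows for
  \<open>i\<close> steps, cross over by \<open>\<eta>\<close>, continue with images under
  \<open>\<phi>\<close>. In degree 0 the list \<open>[u]\<close> carries no arrow and only the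
  crossing remains.\<close>

definition prism :: "nat \<Rightarrow> nat \<Rightarrow> 'a list \<Rightarrow> 'a list" where
  "prism n i gs = (if n = 0 then [\<eta> (hd gs)]
     else map (\<lambda>k. if k < i then gs ! k
       else if k = i then \<eta> (if i = 0 then rng A (gs ! 0) else src A (gs ! (i - 1)))
       else \<phi> (gs ! (k - 1))) [0..<Suc n])"

text \<open>The vertex of the crossing is both the source of one arrow and the range of the next.
  The range is preferred here wherever there is a next arrow, which makes the comparison with faces
  uniform.\<close>

lemma prism_nth:
  assumes "gs \<in> nerve A (Suc m)" "i \<le> Suc m" "k \<le> Suc m"
  shows "prism (Suc m) i gs ! k = (if k < i then gs ! k
       else if k = i then \<eta> (if i = Suc m then src A (gs ! m) else rng A (gs ! i)) else \<phi> (gs ! (k - 1)))"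
  using assms by (auto simp: prism_def nerve_Suc less_Suc_eq_le simp del: upt_Suc)

lemma prism_length: "length (prism n i gs) = Suc n"
  by (simp add: prism_def)

lemma prism_closed:
  assumes gs: "gs \<in> nerve A n" and i: "i \<le> n"
  shows "prism n i gs \<in> nerve A (Suc n)"
proof (cases n)
  case 0
  then show ?thesis using gs \<eta> by (auto simp: nerve_0 nerve_Suc prism_def)
next
  case (Suc m)
  have gs': "gs \<in> nerve A (Suc m)" using gs Suc by simp
  have a: "\<And>k. k \<le> m \<Longrightarrow> gs ! k \<in> Arr A" "\<And>k. k < m \<Longrightarrow> src A (gs ! k) = rng A (gs ! Suc k)"
    using gs' by (auto simp: nerve_Suc)
  have \<eta>': "\<eta> (src A (gs ! k)) \<in> Arr A" "rng A (\<eta> (src A (gs ! k))) = src A (gs ! k)"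
    "src A (\<eta> (src A (gs ! k))) = src A (\<phi> (gs ! k))"
    "\<eta> (rng A (gs ! k)) \<in> Arr A" "rng A (\<eta> (rng A (gs ! k))) = rng A (gs ! k)"
    "src A (\<eta> (rng A (gs ! k))) = rng A (\<phi> (gs ! k))" if "k \<le> m" for k
    using \<eta> a(1)[OF that] src_in_unit rng_in_unit src rng by auto
  have 1: "prism n i gs ! k \<in> Arr A" if "k \<le> n" for k
    using that i Suc prism_nth[OF gs', of i k] a(1) \<eta>' arr by auto
  have 2: "src A (prism n i gs ! k) = rng A (prism n i gs ! Suc k)" if "k < n" for k
  proof -
    consider "Suc k < i" | "Suc k = i" | "k = i" | "i < k" by linarith
    then show ?thesis
    proof cases
      case 1
      then show ?thesis using that i Suc prism_nth[OF gs', of i k] prism_nth[OF gs', of i "Suc k"] a(2)[of k] by simp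
    next
      case 2
      then show ?thesis
        using that i Suc prism_nth[OF gs', of i k] prism_nth[OF gs', of i "Suc k"] a(2)[of k] \<eta>' by auto
    next
      case 3
      then show ?thesis using that i Suc prism_nth[OF gs', of i k] prism_nth[OF gs', of i "Suc k"] \<eta>' by auto
    next
      case 4
      then obtain l where "k = Suc l" by (cases k) auto
      then show ?thesis
        using 4 that i Suc prism_nth[OF gs', of i k] prism_nth[OF gs', of i "Suc k"] a[of l] a(1)[of k] src rng by auto
    qed
  qed
  show ?thesis using 1 2 by (simp add: nerve_Suc prism_length)
qed

lemma prism_face_nth:
  assumes gs: "gs \<in> nerve A (Suc m)" and i: "i \<le> Suc m" and j: "j \<le> Suc (Suc m)" and k: "k \<le> m"
  shows "face A (Suc (Suc m)) j (prism (Suc m) i gs) ! k =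
    (if Suc k < j then prism (Suc m) i gs ! k
     else if Suc k = j then mul A (prism (Suc m) i gs ! k) (prism (Suc m) i gs ! Suc k)
     else prism (Suc m) i gs ! Suc k)"
  using face_nth[OF prism_length, of "Suc m" j i gs] j k by (simp del: upt_Suc)

lemma face_prism_length:
  assumes "gs \<in> nerve A (Suc m)" "i \<le> Suc m" "j \<le> Suc (Suc m)"
  shows "length (face A (Suc (Suc m)) j (prism (Suc m) i gs)) = Suc m"
  using face_closed[OF prism_closed[OF assms(1,2)] assms(3)] by (simp add: nerve_Suc)

lemma prism_first: "gs \<in> nerve A (Suc m) \<Longrightarrow> face A (Suc (Suc m)) 0 (prism (Suc m) 0 gs) = map \<phi> gs"
  by (rule nth_equalityI) (auto simp: face_prism_length prism_face_nth prism_nth nerve_Suc[of gs] less_Suc_eq_le)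

lemma prism_last: "gs \<in> nerve A (Suc m) \<Longrightarrow> face A (Suc (Suc m)) (Suc (Suc m)) (prism (Suc m) (Suc m) gs) = gs"
  by (rule nth_equalityI) (auto simp: face_prism_length prism_face_nth prism_nth nerve_Suc[of gs] less_Suc_eq_le)

text \<open>Neighbouring prisms share a face: merging \<open>\<eta>\<close> with the arrow next to
  it gives the two sides of the naturality square.\<close>

lemma prism_diag:
  assumes gs: "gs \<in> nerve A (Suc m)" and i: "i < Suc m"
  shows "face A (Suc (Suc m)) (Suc i) (prism (Suc m) i gs) = face A (Suc (Suc m)) (Suc i) (prism (Suc m) (Suc i) gs)"
proof (rule nth_equalityI)
  show "length (face A (Suc (Suc m)) (Suc i) (prism (Suc m) i gs)) =
      length (face A (Suc (Suc m)) (Suc i) (prism (Suc m) (Suc i) gs))"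
    using assms by (simp add: face_prism_length)
  fix k assume "k < length (face A (Suc (Suc m)) (Suc i) (prism (Suc m) i gs))"
  then have k: "k \<le> m" using assms by (simp add: face_prism_length)
  have v: "(if Suc i = Suc m then src A (gs ! m) else rng A (gs ! Suc i)) = src A (gs ! i)"
    using gs i by (auto simp: nerve_Suc)
  have "mul A (gs ! i) (\<eta> (src A (gs ! i))) = mul A (\<eta> (rng A (gs ! i))) (\<phi> (gs ! i))"
    using natural gs i by (simp add: nerve_Suc)
  then show "face A (Suc (Suc m)) (Suc i) (prism (Suc m) i gs) ! k =
      face A (Suc (Suc m)) (Suc i) (prism (Suc m) (Suc i) gs) ! k"
    using gs i k v by (auto simp: prism_face_nth prism_nth)
qed

lemma prism_lower:
  assumes gs: "gs \<in> nerve A (Suc m)" and ij: "j < i" "i \<le> Suc m"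
  shows "face A (Suc (Suc m)) j (prism (Suc m) i gs) = prism m (i - 1) (face A (Suc m) j gs)"
proof (cases m)
  case 0
  then have [simp]: "j = 0" "i = Suc 0" using ij by auto
  obtain g where "gs = [g]" using gs 0 by (auto simp: nerve_Suc length_Suc_conv)
  then show ?thesis using 0 by (simp add: prism_def face_def)
next
  case (Suc l)
  have len: "length gs = Suc m" using gs by (simp add: nerve_Suc)
  have f: "face A (Suc m) j gs \<in> nerve A (Suc l)" using face_closed[OF gs, of j] ij Suc by simp
  have nth: "face A (Suc (Suc l)) j gs ! k = (if Suc k < j then gs ! k
     else if Suc k = j then mul A (gs ! k) (gs ! Suc k) else gs ! Suc k)" if "k \<le> l" for k
    using face_nth[OF len, of j] that ij Suc by (simp del: upt_Suc)
  obtain i' where i': "i = Suc i'" using ij by (cases i) auto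
  show ?thesis
  proof (rule nth_equalityI)
    show "length (face A (Suc (Suc m)) j (prism (Suc m) i gs)) = length (prism m (i - 1) (face A (Suc m) j gs))"
      using gs ij by (simp add: face_prism_length prism_length)
    fix k assume "k < length (face A (Suc (Suc m)) j (prism (Suc m) i gs))"
    then have k: "k \<le> m" using gs ij by (simp add: face_prism_length)
    have "src A (mul A (gs ! l) (gs ! Suc l)) = src A (gs ! Suc l)"
      "\<And>k. k < m \<Longrightarrow> rng A (mul A (gs ! k) (gs ! Suc k)) = rng A (gs ! k)"
      using nerve_nth_closed[OF gs] Suc by auto
    then show "face A (Suc (Suc m)) j (prism (Suc m) i gs) ! k = prism m (i - 1) (face A (Suc m) j gs) ! k"
      using gs ij k f Suc i' by (auto simp: prism_face_nth prism_nth nth)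
  qed
qed

lemma prism_upper:
  assumes gs: "gs \<in> nerve A (Suc m)" and ij: "i + 1 < j" "j \<le> Suc (Suc m)"
  shows "face A (Suc (Suc m)) j (prism (Suc m) i gs) = prism m i (face A (Suc m) (j - 1) gs)"
proof (cases m)
  case 0
  then have [simp]: "j = 2" "i = 0" using ij by auto
  obtain g where "gs = [g]" using gs 0 by (auto simp: nerve_Suc length_Suc_conv)
  then show ?thesis using 0 by (simp add: prism_def face_def)
next
  case (Suc l)
  obtain j' where j': "j = Suc j'" using ij by (cases j) auto
  have len: "length gs = Suc m" using gs by (simp add: nerve_Suc)
  have f: "face A (Suc m) j' gs \<in> nerve A (Suc l)" using face_closed[OF gs, of j'] ij Suc j' by simp
  have nth: "face A (Suc (Suc l)) j' gs ! k = (if Suc k < j' then gs ! k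
     else if Suc k = j' then mul A (gs ! k) (gs ! Suc k) else gs ! Suc k)" if "k \<le> l" for k
    using face_nth[OF len, of j'] that ij Suc j' by (simp del: upt_Suc)
  show ?thesis
  proof (rule nth_equalityI)
    show "length (face A (Suc (Suc m)) j (prism (Suc m) i gs)) = length (prism m i (face A (Suc m) (j - 1) gs))"
      using gs ij by (simp add: face_prism_length prism_length)
    fix k assume "k < length (face A (Suc (Suc m)) j (prism (Suc m) i gs))"
    then have k: "k \<le> m" using gs ij by (simp add: face_prism_length)
    have r: "rng A (mul A (gs ! k) (gs ! Suc k)) = rng A (gs ! k)" "src A (gs ! k) = rng A (gs ! Suc k)" if "k < m" for k
      using nerve_nth_closed[OF gs that] gs that by (auto simp: nerve_Suc)
    have p: "\<phi> (mul A (gs ! k) (gs ! Suc k)) = mul A (\<phi> (gs ! k)) (\<phi> (gs ! Suc k))" if "k < m" for k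
      using mul[of "gs ! k" "gs ! Suc k"] gs that by (auto simp: nerve_Suc)
    have "k = 0 \<or> (\<exists>k'. k = Suc k')" by (cases k) auto
    then show "face A (Suc (Suc m)) j (prism (Suc m) i gs) ! k = prism m i (face A (Suc m) (j - 1) gs) ! k"
      using gs ij k f Suc j' r p by (auto simp: prism_face_nth prism_nth nth)
  qed
qed

definition prism_op :: "nat \<Rightarrow> ('a list \<Rightarrow> 'c::ab_group_add) \<Rightarrow> 'a list \<Rightarrow> 'c" where
  "prism_op n h = (\<Sum>i\<le>n. alt i (push (prism n i) h))"

lemma additive_on_prism_op: "additive_on N (prism_op n)"
proof -
  have "additive_on N (\<lambda>h. \<Sum>i\<le>n. alt i (push (prism n i) h))"
    by (intro additive_on_sum_left additive_on_alt_left additive_on_push)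
  then show ?thesis by (simp add: prism_op_def[abs_def])
qed

lemma prism_op_single: "prism_op n (single x a) = (\<Sum>i\<le>n. alt i (single (prism n i x) a))"
  by (simp add: prism_op_def)

lemma prism_op_closed: "h \<in> fin_chains (nerve A n) \<Longrightarrow> prism_op n h \<in> fin_chains (nerve A (Suc n))"
  unfolding prism_op_def by (intro fin_chains_sum fin_chains_alt push_closed prism_closed) auto

lemma prism_homotopy:
  fixes h :: "'a list \<Rightarrow> 'c::ab_group_add"
  assumes h: "h \<in> fin_chains (nerve A (Suc m))"
  shows "boundary A (Suc (Suc m)) (prism_op (Suc m) h) + prism_op m (boundary A (Suc m) h) = push (map \<phi>) h - h"
proof (rule additive_on_eqI[where F = "\<lambda>h. boundary A (Suc (Suc m)) (prism_op (Suc m) h) + prism_op m (boundary A (Suc m) h)"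
      and G = "\<lambda>h. push (map \<phi>) h - h", OF _ _ h])
  show "additive_on (nerve A (Suc m)) (\<lambda>h. boundary A (Suc (Suc m)) (prism_op (Suc m) h) + prism_op m (boundary A (Suc m) h))"
    by (intro additive_on_add_left additive_on_comp[OF additive_on_prism_op additive_on_boundary prism_op_closed]
        additive_on_comp[OF additive_on_boundary additive_on_prism_op boundary_closed])
  show "additive_on (nerve A (Suc m)) (\<lambda>h. push (map \<phi>) h - h)"
    by (intro additive_on_minus_left additive_on_push additive_on_id)
  fix x and a :: 'c assume x: "x \<in> nerve A (Suc m)"
  have "boundary A (Suc (Suc m)) (prism_op (Suc m) (single x a)) =
      (\<Sum>i\<le>Suc m. boundary A (Suc (Suc m)) (alt i (single (prism (Suc m) i x) a)))"
    unfolding prism_op_single by (rule additive_on_sum[OF additive_on_boundary[of UNIV]]) (auto intro: fin_chains_alt)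
  also have "\<dots> = (\<Sum>i\<le>Suc m. \<Sum>j\<le>Suc (Suc m). alt (i + j) (single (face A (Suc (Suc m)) j (prism (Suc m) i x)) a))"
  proof (rule sum.cong[OF refl])
    fix i assume "i \<in> {..Suc m}"
    then have i: "i \<le> Suc m" by simp
    show "boundary A (Suc (Suc m)) (alt i (single (prism (Suc m) i x) a)) =
        (\<Sum>j\<le>Suc (Suc m). alt (i + j) (single (face A (Suc (Suc m)) j (prism (Suc m) i x)) a))"
      unfolding additive_on_alt[OF additive_on_boundary fin_chains_single[OF prism_closed[OF x i]]]
      by (simp only: boundary_single[OF prism_closed[OF x i] zero_less_Suc] alt_sum alt_simps)
  qed
  also have "\<dots> = (\<Sum>j\<le>Suc (Suc m). \<Sum>i\<le>Suc m. alt (i + j) (single (face A (Suc (Suc m)) j (prism (Suc m) i x)) a))"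
    by (rule sum.swap)
  finally have 1: "boundary A (Suc (Suc m)) (prism_op (Suc m) (single x a)) = \<dots>" .
  have "prism_op m (boundary A (Suc m) (single x a)) =
      (\<Sum>j\<le>Suc m. prism_op m (alt j (single (face A (Suc m) j x) a)))"
    unfolding boundary_single[OF x zero_less_Suc]
    by (rule additive_on_sum[OF additive_on_prism_op[of UNIV]]) (auto intro: fin_chains_alt)
  also have "\<dots> = (\<Sum>j\<le>Suc m. \<Sum>i\<le>m. alt (i + j) (single (prism m i (face A (Suc m) j x)) a))"
    by (rule sum.cong[OF refl])
      (simp add: additive_on_alt[OF additive_on_prism_op[of UNIV]] prism_op_single alt_sum add.commute)
  finally have 2: "prism_op m (boundary A (Suc m) (single x a)) = \<dots>" .
  show "boundary A (Suc (Suc m)) (prism_op (Suc m) (single x a)) + prism_op m (boundary A (Suc m) (single x a)) =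
      push (map \<phi>) (single x a) - single x a"
    unfolding 1 2
    by (subst alt_sum_simplicial_homotopy)
      (simp_all only: prism_lower[OF x] prism_upper[OF x] prism_diag[OF x] prism_first[OF x] prism_last[OF x] push_simps)
qed

lemma prism_homotopy_0:
  fixes h :: "'a list \<Rightarrow> 'c::ab_group_add"
  assumes h: "h \<in> fin_chains (nerve A 0)"
  shows "boundary A (Suc 0) (prism_op 0 h) = push (map \<phi>) h - h"
proof (rule additive_on_eqI[where F = "\<lambda>h. boundary A (Suc 0) (prism_op 0 h)" and G = "\<lambda>h. push (map \<phi>) h - h", OF _ _ h])
  show "additive_on (nerve A 0) (\<lambda>h. boundary A (Suc 0) (prism_op 0 h))"
    by (rule additive_on_comp[OF additive_on_prism_op additive_on_boundary prism_op_closed])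
  show "additive_on (nerve A 0) (\<lambda>h. push (map \<phi>) h - h)"
    by (intro additive_on_minus_left additive_on_push additive_on_id)
  fix x and a :: 'c assume x: "x \<in> nerve A 0"
  then obtain u where u: "u \<in> unit_space A" "x = [u]" by (auto simp: nerve_0)
  have "prism_op 0 (single x a) = single [\<eta> u] a" using u by (simp add: prism_op_single prism_def)
  moreover have "[\<eta> u] \<in> nerve A (Suc 0)" using \<eta> u by (simp add: nerve_Suc)
  ultimately show "boundary A (Suc 0) (prism_op 0 (single x a)) = push (map \<phi>) (single x a) - single x a"
    using u \<eta>[OF u(1)] by (simp add: boundary_single face_1)
qed

text \<open>On a cycle the homotopy formula loses its second term, and in degree 0 it has
  none.\<close>

lemma cycle_homologous:
  fixes c :: "'a list \<Rightarrow> 'c::ab_group_add"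
  assumes c: "c \<in> fin_chains (nerve A n)" "boundary A n c = 0"
  shows "\<exists>b\<in>fin_chains (nerve A (Suc n)). boundary A (Suc n) b = push (map \<phi>) c - c"
proof (intro bexI[OF _ prism_op_closed[OF c(1)]])
  show "boundary A (Suc n) (prism_op n c) = push (map \<phi>) c - c"
  proof (cases n)
    case (Suc m)
    have "prism_op m (boundary A (Suc m) c) = 0"
      using c Suc by (simp add: additive_on_0[OF additive_on_prism_op[of UNIV]])
    then show ?thesis
      using prism_homotopy[of c m] c Suc by (simp only: add_0_right)
  qed (use prism_homotopy_0 c in simp)
qed

end

section \<open>The pullback of a groupoid along a map into its units\<close>

definition pullback_groupoid :: "'g groupoid \<Rightarrow> 'p set \<Rightarrow> ('p \<Rightarrow> 'g) \<Rightarrow> ('p \<times> 'g \<times> 'p) groupoid" where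
  "pullback_groupoid G P s =
     \<lparr>Arr = {(p, g, q). p \<in> P \<and> q \<in> P \<and> g \<in> Arr G \<and> s p = rng G g \<and> s q = src G g},
      src = (\<lambda>(p, g, q). (q, src G g, q)),
      rng = (\<lambda>(p, g, q). (p, rng G g, p)),
      mul = (\<lambda>(p, g, q) (p', h, q'). (p, mul G g h, q')),
      ginv = (\<lambda>(p, g, q). (q, ginv G g, p)),
      Top = discrete_topology {(p, g, q). p \<in> P \<and> q \<in> P \<and> g \<in> Arr G \<and> s p = rng G g \<and> s q = src G g}\<rparr>"

lemma pullback_groupoid_simps:
  "(p, g, q) \<in> Arr (pullback_groupoid G P s) \<longleftrightarrow> p \<in> P \<and> q \<in> P \<and> g \<in> Arr G \<and> s p = rng G g \<and> s q = src G g"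
  "src (pullback_groupoid G P s) (p, g, q) = (q, src G g, q)"
  "rng (pullback_groupoid G P s) (p, g, q) = (p, rng G g, p)"
  "mul (pullback_groupoid G P s) (p, g, q) (p', h, q') = (p, mul G g h, q')"
  "ginv (pullback_groupoid G P s) (p, g, q) = (q, ginv G g, p)"
  by (simp_all add: pullback_groupoid_def)

lemma (in groupoid) pullback_unit:
  "x \<in> unit_space (pullback_groupoid G P s) \<longleftrightarrow> (\<exists>p\<in>P. s p \<in> unit_space G \<and> x = (p, s p, p))"
proof
  assume "x \<in> unit_space (pullback_groupoid G P s)"
  then obtain p g q where "x = src (pullback_groupoid G P s) (p, g, q)" "(p, g, q) \<in> Arr (pullback_groupoid G P s)"
    by (auto simp: unit_space_def)
  then show "\<exists>p\<in>P. s p \<in> unit_space G \<and> x = (p, s p, p)"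
    using src_in_unit by (auto simp: pullback_groupoid_simps)
next
  assume "\<exists>p\<in>P. s p \<in> unit_space G \<and> x = (p, s p, p)"
  then obtain p where p: "p \<in> P" "s p \<in> unit_space G" "x = (p, s p, p)" by blast
  then have "x \<in> Arr (pullback_groupoid G P s)" "src (pullback_groupoid G P s) x = x"
    using unit_src unit_rng unit_arr by (auto simp: pullback_groupoid_simps)
  then show "x \<in> unit_space (pullback_groupoid G P s)" unfolding unit_space_def by (metis imageI)
qed

lemma (in groupoid) discrete_groupoid_pullback: "discrete_groupoid (pullback_groupoid G P s)"
proof
  show "Top (pullback_groupoid G P s) = discrete_topology (Arr (pullback_groupoid G P s))"
    by (simp add: pullback_groupoid_def)
qed (use src_unit rng_unit mul_closed mul_assoc mul_unit ginv_closed mul_ginv in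
  \<open>auto simp: pullback_groupoid_simps\<close>)

locale pullback_equivalence = discrete_groupoid G for G :: "'g groupoid" +
  fixes P :: "'p set" and s :: "'p \<Rightarrow> 'g" and j :: "'g \<Rightarrow> 'p"
  assumes sect: "u \<in> unit_space G \<Longrightarrow> j u \<in> P \<and> s (j u) = u"
begin

abbreviation T where "T \<equiv> pullback_groupoid G P s"

definition proj :: "'p \<times> 'g \<times> 'p \<Rightarrow> 'g" where "proj = (\<lambda>(p, g, q). g)"
definition incl :: "'g \<Rightarrow> 'p \<times> 'g \<times> 'p" where "incl g = (j (rng G g), g, j (src G g))"
text \<open>Intended for units \<open>(p, s p, p)\<close>, where it is the arrow over
  \<open>s p\<close> from the chosen point \<open>j (s p)\<close> to \<open>p\<close>.\<close>

definition comparison :: "'p \<times> 'g \<times> 'p \<Rightarrow> 'p \<times> 'g \<times> 'p" where "comparison = (\<lambda>(p, g, q). (p, g, j g))"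

sublocale T: discrete_groupoid T by (rule discrete_groupoid_pullback)

sublocale proj: discrete_groupoid_functor T G proj
  by standard (auto simp: proj_def pullback_groupoid_simps)

lemma incl_functor: "groupoid_functor G T incl"
proof
  fix g h assume gh: "g \<in> Arr G" "h \<in> Arr G" "src G g = rng G h"
  show "incl (mul G g h) = mul T (incl g) (incl h)"
    using mul_closed[OF gh] by (simp add: incl_def pullback_groupoid_simps)
qed (use sect src_in_unit rng_in_unit src_unit rng_unit in \<open>auto simp: incl_def pullback_groupoid_simps\<close>)

sublocale incl: discrete_groupoid_functor G T incl
  using incl_functor by (simp add: discrete_groupoid_functor_def T.discrete_groupoid_axioms discrete_groupoid_axioms)

sublocale nat: natural_to_identity T "\<lambda>x. incl (proj x)" comparison
proof
  fix u assume "u \<in> unit_space T"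
  then obtain p where p: "p \<in> P" "s p \<in> unit_space G" "u = (p, s p, p)" by (auto simp: pullback_unit)
  then show "comparison u \<in> Arr T \<and> rng T (comparison u) = u \<and> src T (comparison u) = incl (proj u)"
    using sect unit_src unit_rng unit_arr
    by (auto simp: comparison_def incl_def proj_def pullback_groupoid_simps)
next
  fix x assume "x \<in> Arr T"
  then obtain p g q where x: "x = (p, g, q)" "(p, g, q) \<in> Arr T" by (cases x) auto
  then show "mul T x (comparison (src T x)) = mul T (comparison (rng T x)) (incl (proj x))"
    using mul_unit[of g] by (simp add: comparison_def incl_def proj_def pullback_groupoid_simps)
next
  fix x y assume "x \<in> Arr T" "y \<in> Arr T" "src T x = rng T y"
  then show "incl (proj (mul T x y)) = mul T (incl (proj x)) (incl (proj y))"
    using incl.mul[of "proj x" "proj y"] proj.mul proj.arr proj.src[of x] proj.rng[of y] by simp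
qed (use proj.arr proj.src proj.rng incl.arr incl.src incl.rng in auto)

lemma proj_incl: "proj (incl g) = g"
  by (simp add: proj_def incl_def)

text \<open>\<open>proj\<close> after \<open>incl\<close> is the identity, so cycles lift by
  \<open>incl\<close>. \<open>incl\<close> after \<open>proj\<close> is homotopic to the identity,
  so a cycle of \<open>T\<close> is homologous to one determined by its projection.\<close>

lemma proj_quasi_iso:
  "surj_quasi_iso (\<lambda>n. fin_chains (nerve T n) :: (('p \<times> 'g \<times> 'p) list \<Rightarrow> 'c::ab_group_add) set) (boundary T)
     (\<lambda>n. fin_chains (nerve G n)) (boundary G) (\<lambda>_. push (map proj))"
proof -
  interpret p: chain_map "\<lambda>n. fin_chains (nerve T n) :: (('p \<times> 'g \<times> 'p) list \<Rightarrow> 'c) set" "boundary T"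
    "\<lambda>n. fin_chains (nerve G n)" "boundary G" "\<lambda>_. push (map proj)"
    by (rule proj.push_chain_map)
  interpret i: chain_map "\<lambda>n. fin_chains (nerve G n) :: ('g list \<Rightarrow> 'c) set" "boundary G"
    "\<lambda>n. fin_chains (nerve T n)" "boundary T" "\<lambda>_. push (map incl)"
    by (rule incl.push_chain_map)
  show ?thesis
  proof
    fix c n assume c: "c \<in> p.D.cyc n"
    have "push (map proj) (push (map incl) c) = push (\<lambda>x. map proj (map incl x)) c"
      by (rule push_push[of _ "nerve G n"]) (use c in \<open>simp add: p.D.cyc_def\<close>)
    also have "\<dots> = c"
      by (rule push_id[of _ "nerve G n"]) (use c in \<open>auto simp: p.D.cyc_def proj_incl comp_def\<close>)
    finally show "\<exists>y\<in>p.C.cyc n. push (map proj) y = c" using i.map_cyc[OF c] by blast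
  next
    fix y n assume y: "y \<in> p.C.cyc n" and b: "push (map proj) y \<in> p.D.bd n"
    have y': "y \<in> fin_chains (nerve T n)" "boundary T n y = 0" using y by (auto simp: p.C.cyc_def)
    obtain b where b: "b \<in> fin_chains (nerve T (Suc n))"
      "boundary T (Suc n) b = push (map (\<lambda>x. incl (proj x))) y - y"
      using nat.cycle_homologous[OF y'] by blast
    have "push (map incl) (push (map proj) y) = push (\<lambda>x. map incl (map proj x)) y"
      by (rule push_push[OF y'(1)])
    then have "push (map (\<lambda>x. incl (proj x))) y \<in> p.C.bd n"
      using i.map_bd[OF \<open>push (map proj) y \<in> p.D.bd n\<close>] by (simp add: comp_def)
    moreover have "push (map (\<lambda>x. incl (proj x))) y - y \<in> p.C.bd n"
      using b by (force simp: p.C.bd_def)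
    ultimately have "push (map (\<lambda>x. incl (proj x))) y - (push (map (\<lambda>x. incl (proj x))) y - y) \<in> p.C.bd n"
      by (rule add_subgroup_diff[OF p.C.bd])
    then show "y \<in> p.C.bd n" by (simp only: diff_diff_eq2 add_diff_cancel_left')
  qed
qed

end

lemma (in discrete_groupoid) discrete_groupoid_restriction: "discrete_groupoid (restriction G V)"
proof
  let ?B = "{g \<in> Arr G. src G g \<in> V \<and> rng G g \<in> V}"
  have "Arr G \<inter> ?B = ?B" by blast
  then show "Top (restriction G V) = discrete_topology (Arr (restriction G V))"
    using discrete by (simp add: restriction_def Let_def)
qed (use src_unit rng_unit mul_closed mul_assoc mul_unit ginv_closed mul_ginv in \<open>auto simp: restriction_def Let_def\<close>)

section \<open>Edges and paths of a self-similar action\<close>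

lemma (in groupoid) ginv_ginv: "g \<in> Arr G \<Longrightarrow> ginv G (ginv G g) = g"
proof -
  assume g: "g \<in> Arr G"
  let ?i = "ginv G g" and ?j = "ginv G (ginv G g)"
  have i: "?i \<in> Arr G" "src G ?i = rng G g" "rng G ?i = src G g" using ginv_closed[OF g] by auto
  have j: "?j \<in> Arr G" "src G ?j = src G g" "rng G ?j = rng G g" using ginv_closed[OF i(1)] i by auto
  have "?j = mul G ?j (mul G ?i g)" using mul_ginv[OF g] mul_unit[OF j(1)] j by simp
  also have "\<dots> = mul G (mul G ?j ?i) g" using mul_assoc[OF j(1) i(1) g] i j by simp
  also have "\<dots> = g" using mul_ginv[OF i(1)] mul_unit[OF g] i by simp
  finally show ?thesis .
qed

context graph_picture
begin

lemma right_orbit_self: "x \<in> Pts X \<Longrightarrow> x \<in> right_orbit x"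
  unfolding right_orbit_def using anchors[of x] ract_unit[of x]
  by (intro CollectI exI[of _ "sanc X x"]) (simp add: unit_arr unit_rng)

lemma right_orbitE:
  assumes "y \<in> right_orbit x" "x \<in> Pts X"
  obtains g where "g \<in> Arr G" "sanc X x = rng G g" "y = ract X x g" "y \<in> Pts X"
    "sanc X y = src G g" "ranc X y = ranc X x" "x = ract X y (ginv G g)"
proof -
  obtain g where g: "g \<in> Arr G" "sanc X x = rng G g" "y = ract X x g"
    using assms(1) by (auto simp: right_orbit_def)
  have "ract X y (ginv G g) = ract X x (mul G g (ginv G g))"
    using g assms(2) ginv_closed[of g] ract_mul[of x g "ginv G g"] by simp
  also have "\<dots> = x" using g mul_ginv[of g] ract_unit[OF assms(2)] by simp
  finally have "x = ract X y (ginv G g)" by (rule sym)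
  moreover have "y \<in> Pts X" "sanc X y = src G g" "ranc X y = ranc X x"
    using ract_closed[OF assms(2) g(1,2)] g(3) by auto
  ultimately show ?thesis using that g by blast
qed

lemma right_orbit_mono:
  assumes "y \<in> right_orbit x" "x \<in> Pts X"
  shows "right_orbit y \<subseteq> right_orbit x"
proof
  fix z assume z: "z \<in> right_orbit y"
  obtain g where g: "g \<in> Arr G" "sanc X x = rng G g" "y = ract X x g" "y \<in> Pts X" "sanc X y = src G g"
    using assms by (rule right_orbitE)
  obtain h where h: "h \<in> Arr G" "sanc X y = rng G h" "z = ract X y h"
    using z by (auto simp: right_orbit_def)
  have "z = ract X x (mul G g h)" "mul G g h \<in> Arr G" "rng G (mul G g h) = sanc X x"
    using ract_mul[OF assms(2) g(1) h(1) g(2)] mul_closed[OF g(1) h(1)] g h by auto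
  then show "z \<in> right_orbit x" by (auto simp: right_orbit_def)
qed

lemma right_orbit_sym:
  assumes "y \<in> right_orbit x" "x \<in> Pts X"
  shows "x \<in> right_orbit y"
proof -
  obtain g where "g \<in> Arr G" "sanc X y = src G g" "x = ract X y (ginv G g)"
    using assms by (rule right_orbitE)
  then show ?thesis using ginv_closed[of g] by (auto simp: right_orbit_def)
qed

lemma right_orbit_eq: "y \<in> right_orbit x \<Longrightarrow> x \<in> Pts X \<Longrightarrow> right_orbit y = right_orbit x"
proof (rule subset_antisym)
  assume y: "y \<in> right_orbit x" "x \<in> Pts X"
  then show "right_orbit y \<subseteq> right_orbit x" by (rule right_orbit_mono)
  obtain g where "y \<in> Pts X" using y by (rule right_orbitE)
  then show "right_orbit x \<subseteq> right_orbit y" using right_orbit_mono right_orbit_sym[OF y] by blast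
qed

lemma E_Pts: "e \<in> E \<Longrightarrow> e \<in> Pts X"
  using transversal_E by (auto simp: transversal_def)

lemma edge_unique: "x \<in> Pts X \<Longrightarrow> \<exists>!e. e \<in> E \<and> e \<in> right_orbit x"
  using transversal_E by (auto simp: transversal_def)

lemma edge: "x \<in> Pts X \<Longrightarrow> edge x \<in> E \<and> edge x \<in> right_orbit x"
  unfolding edge_def by (rule theI') (rule edge_unique)

lemma edge_eq: "x \<in> Pts X \<Longrightarrow> e \<in> E \<Longrightarrow> e \<in> right_orbit x \<Longrightarrow> edge x = e"
  using edge edge_unique by blast

text \<open>If xg = xh, then g times the inverse of h fixes x and is a unit by freeness.\<close>

lemma ract_inj:
  assumes x: "x \<in> Pts X" and g: "g \<in> Arr G" "sanc X x = rng G g" and h: "h \<in> Arr G" "sanc X x = rng G h"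
    and eq: "ract X x g = ract X x h"
  shows "g = h"
proof -
  have s: "src G g = src G h" using ract_closed[OF x g] ract_closed[OF x h] eq by simp
  let ?k = "mul G g (ginv G h)"
  have k: "?k \<in> Arr G" "rng G ?k = rng G g" "src G ?k = rng G h"
    using mul_closed[of g "ginv G h"] g h s ginv_closed[of h] by auto
  have "ract X x ?k = ract X (ract X x h) (ginv G h)"
    using ract_mul[OF x g(1) _ g(2), of "ginv G h"] s ginv_closed[OF h(1)] eq by simp
  also have "\<dots> = ract X x (mul G h (ginv G h))"
    using ract_mul[OF x h(1) _ h(2), of "ginv G h"] ginv_closed[OF h(1)] by simp
  also have "\<dots> = x" using mul_ginv[OF h(1)] h ract_unit[OF x] by simp
  finally have "?k \<in> unit_space G" using ract_free[OF x k(1)] k g by simp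
  then have "?k = rng G h" using unit_src k by metis
  then have "h = mul G ?k h" using mul_unit[OF h(1)] by simp
  also have "\<dots> = mul G g (mul G (ginv G h) h)"
    using mul_assoc[OF g(1) _ h(1), of "ginv G h"] ginv_closed[OF h(1)] s by simp
  also have "\<dots> = g" using mul_ginv[OF h(1)] s mul_unit[OF g(1)] by simp
  finally show ?thesis by simp
qed

lemma arrow:
  assumes x: "x \<in> Pts X"
  shows "arrow x \<in> Arr G \<and> sanc X (edge x) = rng G (arrow x) \<and> ract X (edge x) (arrow x) = x"
  unfolding arrow_def
proof (rule theI')
  obtain g where g: "g \<in> Arr G" "sanc X x = rng G g" "edge x = ract X x g" "edge x \<in> Pts X"
    "sanc X (edge x) = src G g" "x = ract X (edge x) (ginv G g)"
    using conjunct2[OF edge[OF x]] x by (rule right_orbitE)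
  show "\<exists>!h. h \<in> Arr G \<and> sanc X (edge x) = rng G h \<and> ract X (edge x) h = x"
  proof (rule ex1I[of _ "ginv G g"])
    show "ginv G g \<in> Arr G \<and> sanc X (edge x) = rng G (ginv G g) \<and> ract X (edge x) (ginv G g) = x"
      using g ginv_closed[OF g(1)] by simp
    fix h assume "h \<in> Arr G \<and> sanc X (edge x) = rng G h \<and> ract X (edge x) h = x"
    then show "h = ginv G g"
      using ract_inj[of "edge x" h "ginv G g"] g ginv_closed[OF g(1)] by auto
  qed
qed

lemma edge_arrow_ract:
  assumes e: "e \<in> E" and h: "h \<in> Arr G" "sanc X e = rng G h"
  shows "edge (ract X e h) = e" "arrow (ract X e h) = h"
proof -
  have x: "ract X e h \<in> Pts X" using ract_closed[OF E_Pts[OF e] h] by blast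
  have "ract X e h \<in> right_orbit e" using h by (auto simp: right_orbit_def)
  then show 1: "edge (ract X e h) = e"
    using edge_eq[OF x e] right_orbit_sym E_Pts[OF e] by blast
  show "arrow (ract X e h) = h"
    using ract_inj[OF E_Pts[OF e], of "arrow (ract X e h)" h] arrow[OF x] h by (simp add: 1)
qed

lemma edge_act:
  assumes g: "g \<in> Arr G" and e: "e \<in> E" "ranc X e = src G g"
  shows "edge_act g e \<in> E" "ranc X (edge_act g e) = rng G g" "edge_res g e \<in> Arr G"
    "sanc X (edge_act g e) = rng G (edge_res g e)" "src G (edge_res g e) = sanc X e"
    "lact X g e = ract X (edge_act g e) (edge_res g e)"
proof -
  have l: "lact X g e \<in> Pts X" "ranc X (lact X g e) = rng G g" "sanc X (lact X g e) = sanc X e"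
    using lact_closed[OF g E_Pts[OF e(1)]] e by auto
  show 1: "edge_act g e \<in> E" using edge[OF l(1)] by (simp add: edge_act_def)
  show 2: "edge_res g e \<in> Arr G" "sanc X (edge_act g e) = rng G (edge_res g e)"
    and 3: "lact X g e = ract X (edge_act g e) (edge_res g e)"
    using arrow[OF l(1)] by (simp_all add: edge_act_def edge_res_def)
  show "ranc X (edge_act g e) = rng G g" "src G (edge_res g e) = sanc X e"
    using ract_closed[OF E_Pts[OF 1] 2] l 3 by auto
qed

text \<open>Uniqueness of the decomposition x = eh reduces identities for \<open>edge_act\<close>
  and \<open>edge_res\<close> to identities in \<open>X\<close>.\<close>

lemma edge_act_eqI:
  assumes "e' \<in> E" "h \<in> Arr G" "sanc X e' = rng G h" "lact X g e = ract X e' h"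
  shows "edge_act g e = e'" "edge_res g e = h"
  using edge_arrow_ract[OF assms(1-3)] assms(4) by (simp_all add: edge_act_def edge_res_def)

lemma edge_act_unit:
  assumes "e \<in> E" "ranc X e = u"
  shows "edge_act u e = e" "edge_res u e = sanc X e"
proof -
  have "lact X u e = e" "ract X e (sanc X e) = e" "sanc X e \<in> unit_space G"
    using lact_unit[OF E_Pts[OF assms(1)]] ract_unit[OF E_Pts[OF assms(1)]] anchors[OF E_Pts[OF assms(1)]] assms(2)
    by auto
  then show "edge_act u e = e" "edge_res u e = sanc X e"
    using edge_act_eqI[OF assms(1), of "sanc X e" u e] unit_arr unit_rng by auto
qed

lemma edge_act_mul:
  assumes g: "g \<in> Arr G" and h: "h \<in> Arr G" "src G g = rng G h" and e: "e \<in> E" "ranc X e = src G h"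
  shows "edge_act (mul G g h) e = edge_act g (edge_act h e)"
    "edge_res (mul G g h) e = mul G (edge_res g (edge_act h e)) (edge_res h e)"
proof -
  note h' = edge_act[OF h(1) e]
  note g' = edge_act[OF g h'(1)]
  have s: "ranc X (edge_act h e) = src G g" using h' h by simp
  have "lact X (mul G g h) e = lact X g (ract X (edge_act h e) (edge_res h e))"
    using lact_mul[OF g h(1) E_Pts[OF e(1)] h(2)] e h'(6) by simp
  also have "\<dots> = ract X (lact X g (edge_act h e)) (edge_res h e)"
    using lact_ract[OF g E_Pts[OF h'(1)] h'(3) s[symmetric] h'(4)] by simp
  also have "\<dots> = ract X (edge_act g (edge_act h e)) (mul G (edge_res g (edge_act h e)) (edge_res h e))"
    using ract_mul[OF E_Pts[OF g'(1)] g'(3) h'(3) g'(4)] s g' h' by simp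
  finally have l: "lact X (mul G g h) e = \<dots>" .
  note m = mul_closed[of "edge_res g (edge_act h e)" "edge_res h e"]
  show "edge_act (mul G g h) e = edge_act g (edge_act h e)"
    "edge_res (mul G g h) e = mul G (edge_res g (edge_act h e)) (edge_res h e)"
    using edge_act_eqI[OF g'(1)[OF s] _ _ l] m s g' h' by auto
qed

definition edges_at :: "'g \<Rightarrow> 'x set" where
  "edges_at v = {e \<in> E. ranc X e = v}"

lemma edge_act_ginv:
  assumes g: "g \<in> Arr G" and e: "e \<in> E" "ranc X e = src G g"
  shows "edge_act (ginv G g) (edge_act g e) = e"
  using edge_act_mul(1)[OF _ g _ e, of "ginv G g"] ginv_closed[OF g] mul_ginv[OF g] edge_act_unit[OF e] by simp

lemma edge_act_bij:
  assumes g: "g \<in> Arr G"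
  shows "bij_betw (edge_act g) (edges_at (src G g)) (edges_at (rng G g))"
proof (rule bij_betw_byWitness[where f' = "edge_act (ginv G g)"])
  note gg = ginv_ginv[OF g]
  show "\<forall>e\<in>edges_at (src G g). edge_act (ginv G g) (edge_act g e) = e"
    using edge_act_ginv[OF g] by (auto simp: edges_at_def)
  show "\<forall>e\<in>edges_at (rng G g). edge_act g (edge_act (ginv G g) e) = e"
    using edge_act_ginv[of "ginv G g"] ginv_closed[OF g] gg by (auto simp: edges_at_def)
  show "edge_act g ` edges_at (src G g) \<subseteq> edges_at (rng G g)"
    using edge_act[OF g] by (auto simp: edges_at_def)
  show "edge_act (ginv G g) ` edges_at (rng G g) \<subseteq> edges_at (src G g)"
    using edge_act[of "ginv G g"] ginv_closed[OF g] by (auto simp: edges_at_def)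
qed

text \<open>A transversal meets each right orbit once, and the range is constant on an orbit, so the
  edges at \<open>v\<close> represent the orbits over \<open>v\<close>.\<close>

lemma regular_iff: "regular v \<longleftrightarrow> v \<in> unit_space G \<and> finite (edges_at v) \<and> edges_at v \<noteq> {}"
proof -
  have "bij_betw right_orbit (edges_at v) (right_orbit ` {x \<in> Pts X. ranc X x = v})"
    unfolding bij_betw_def
  proof
    show "inj_on right_orbit (edges_at v)"
    proof (rule inj_onI)
      fix e f assume "e \<in> edges_at v" "f \<in> edges_at v" "right_orbit e = right_orbit f"
      then have "e \<in> E" "f \<in> E" "e \<in> right_orbit f"
        using right_orbit_self[of e] E_Pts by (auto simp: edges_at_def)
      then show "e = f" using edge_eq[of f] right_orbit_self[of f] E_Pts by metis
    qed
    have "right_orbit x \<in> right_orbit ` edges_at v" if "x \<in> Pts X" "ranc X x = v" for x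
    proof (rule image_eqI)
      show "right_orbit x = right_orbit (edge x)" using right_orbit_eq edge[OF that(1)] that by blast
      have "ranc X (edge x) = ranc X x"
        using conjunct2[OF edge[OF that(1)]] that(1) by (rule right_orbitE)
      then show "edge x \<in> edges_at v" using edge[OF that(1)] that by (simp add: edges_at_def)
    qed
    then show "right_orbit ` edges_at v = right_orbit ` {x \<in> Pts X. ranc X x = v}"
      using E_Pts by (auto simp: edges_at_def)
  qed
  then have "finite (right_orbit ` {x \<in> Pts X. ranc X x = v}) \<longleftrightarrow> finite (edges_at v)"
    "right_orbit ` {x \<in> Pts X. ranc X x = v} = {} \<longleftrightarrow> edges_at v = {}"
    by (auto simp: bij_betw_finite bij_betw_def)
  then show ?thesis by (simp add: regular_def)
qed

lemma regular_invariant: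
  assumes g: "g \<in> Arr G"
  shows "regular (src G g) \<longleftrightarrow> regular (rng G g)"
  using bij_betw_finite[OF edge_act_bij[OF g]] edge_act_bij[OF g] src_in_unit[OF g] rng_in_unit[OF g]
  unfolding regular_iff bij_betw_def by auto

subsection \<open>Lists of edges\<close>

text \<open>A recursive counterpart of \<open>fpaths\<close>, as \<open>psrc\<close> is of
  \<open>path_src\<close>. The base vertex is an argument because an induction along the edges
  continues at the source of the first one.\<close>

primrec epath :: "'g \<Rightarrow> 'x list \<Rightarrow> bool" where
  "epath v [] \<longleftrightarrow> v \<in> unit_space G"
| "epath v (e # es) \<longleftrightarrow> e \<in> E \<and> ranc X e = v \<and> epath (sanc X e) es"

primrec psrc :: "'g \<Rightarrow> 'x list \<Rightarrow> 'g" where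
  "psrc v [] = v"
| "psrc v (e # es) = psrc (sanc X e) es"

lemma epath_unit: "epath v es \<Longrightarrow> v \<in> unit_space G"
  by (cases es) (auto dest!: E_Pts dest: anchors)

lemma psrc_unit: "epath v es \<Longrightarrow> psrc v es \<in> unit_space G"
  by (induction es arbitrary: v) auto

lemma epath_append: "epath v (es @ fs) \<longleftrightarrow> epath v es \<and> epath (psrc v es) fs"
  by (induction es arbitrary: v) (auto dest: epath_unit)

lemma psrc_append: "psrc v (es @ fs) = psrc (psrc v es) fs"
  by (induction es arbitrary: v) auto

lemma path_src_eq: "path_src p = psrc (fst p) (snd p)"
proof -
  have "psrc v es = (if es = [] then v else sanc X (last es))" for v es
    by (induction es arbitrary: v) auto
  then show ?thesis by (simp add: path_src_def)
qed

lemma fpaths_iff: "p \<in> fpaths \<longleftrightarrow> epath (fst p) (snd p)"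
proof -
  have *: "epath v es \<longleftrightarrow> v \<in> unit_space G \<and> set es \<subseteq> E \<and> (es \<noteq> [] \<longrightarrow> ranc X (hd es) = v) \<and>
     (\<forall>i. Suc i < length es \<longrightarrow> sanc X (es ! i) = ranc X (es ! Suc i))" for v es
  proof (induction es arbitrary: v)
    case (Cons e es)
    have "(\<forall>i. Suc i < length (e # es) \<longrightarrow> sanc X ((e # es) ! i) = ranc X ((e # es) ! Suc i)) \<longleftrightarrow>
      (es \<noteq> [] \<longrightarrow> sanc X e = ranc X (hd es)) \<and>
      (\<forall>i. Suc i < length es \<longrightarrow> sanc X (es ! i) = ranc X (es ! Suc i))"
      by (cases es) (auto simp: nth_Cons split: nat.splits)
    moreover have "e \<in> E \<Longrightarrow> ranc X e \<in> unit_space G \<and> sanc X e \<in> unit_space G"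
      using E_Pts anchors by blast
    ultimately show ?case by (auto simp: Cons)
  qed simp
  show ?thesis by (cases p) (simp add: fpaths_def *)
qed

lemma list_act:
  assumes "g \<in> Arr G" "epath (src G g) es"
  shows "epath (rng G g) (list_act g es)" "list_res g es \<in> Arr G"
    "psrc (rng G g) (list_act g es) = rng G (list_res g es)" "src G (list_res g es) = psrc (src G g) es"
  using assms
proof (induction es arbitrary: g)
  case (Cons e es)
  { case 1 then show ?case using Cons(1)[of "edge_res g e"] edge_act[of g e] by simp }
  { case 2 then show ?case using Cons(2)[of "edge_res g e"] edge_act[of g e] by simp }
  { case 3 then show ?case using Cons(3)[of "edge_res g e"] edge_act[of g e] by simp }
  { case 4 then show ?case using Cons(4)[of "edge_res g e"] edge_act[of g e] by simp }
qed (auto simp: rng_in_unit)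

lemma length_list_act [simp]: "length (list_act g es) = length es"
  by (induction es arbitrary: g) auto

lemma list_act_append: "list_act g (es @ fs) = list_act g es @ list_act (list_res g es) fs"
  and list_res_append: "list_res g (es @ fs) = list_res (list_res g es) fs"
  by (induction es arbitrary: g) auto

lemma list_act_mul:
  assumes "g \<in> Arr G" "h \<in> Arr G" "src G g = rng G h" "epath (src G h) es"
  shows "list_act (mul G g h) es = list_act g (list_act h es)"
    "list_res (mul G g h) es = mul G (list_res g (list_act h es)) (list_res h es)"
proof -
  have "list_act (mul G g h) es = list_act g (list_act h es) \<and>
      list_res (mul G g h) es = mul G (list_res g (list_act h es)) (list_res h es)"
    using assms
  proof (induction es arbitrary: g h)
    case (Cons e es)
    let ?g = "edge_res g (edge_act h e)" and ?h = "edge_res h e"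
    have e: "e \<in> E" "ranc X e = src G h" "epath (sanc X e) es" using Cons.prems by auto
    note a = edge_act[OF Cons.prems(2) e(1,2)]
    have s: "ranc X (edge_act h e) = src G g" using a Cons.prems by simp
    note b = edge_act[OF Cons.prems(1) a(1) s]
    have "src G ?g = rng G ?h" "epath (src G ?h) es" using a b e by simp_all
    from Cons.IH[OF b(3) a(3) this] show ?case
      using edge_act_mul[OF Cons.prems(1-3) e(1,2)] by simp
  qed simp
  then show "list_act (mul G g h) es = list_act g (list_act h es)"
    "list_res (mul G g h) es = mul G (list_res g (list_act h es)) (list_res h es)" by auto
qed

lemma list_act_unit:
  assumes "epath u es" shows "list_act u es = es" "list_res u es = psrc u es"
  using assms by (induction es arbitrary: u) (auto simp: edge_act_unit)

lemma list_act_ginv: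
  assumes "g \<in> Arr G" "epath (src G g) es"
  shows "list_act (ginv G g) (list_act g es) = es"
  using list_act_mul(1)[of "ginv G g" g es] assms ginv_closed[of g] mul_ginv[of g] list_act_unit by simp

lemma list_act_surj:
  assumes "g \<in> Arr G" "epath (rng G g) fs"
  obtains es where "epath (src G g) es" "list_act g es = fs" "es = list_act (ginv G g) fs"
  using that[of "list_act (ginv G g) fs"] list_act[of "ginv G g" fs] list_act_ginv[of "ginv G g" fs]
    ginv_closed[of g] ginv_ginv[of g] assms by simp

end

section \<open>Boundary paths\<close>

context graph_picture
begin

definition spath :: "'x stream \<Rightarrow> bool" where
  "spath w \<longleftrightarrow> (\<forall>i. w !! i \<in> E \<and> sanc X (w !! i) = ranc X (w !! Suc i))"

definition bpaths_at :: "'g \<Rightarrow> ('g, 'x) bpath set" where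
  "bpaths_at v = {w \<in> bpaths. bpath_rng w = v}"

text \<open>\<open>path_conc\<close> discards the base point of its second argument, so a bare list
  of edges describes an extension, and describes it uniquely.\<close>

definition ext :: "('g, 'x) fpath \<Rightarrow> 'x list \<Rightarrow> ('g, 'x) fpath" where
  "ext p ts = (fst p, snd p @ ts)"

lemma spath_SCons: "spath (e ## w) \<longleftrightarrow> e \<in> E \<and> sanc X e = ranc X (shd w) \<and> spath w"
proof -
  have "(\<forall>i. Q i) \<longleftrightarrow> Q 0 \<and> (\<forall>i. Q (Suc i))" for Q :: "nat \<Rightarrow> bool"
    by (metis nat.exhaust)
  from this[of "\<lambda>i. (e ## w) !! i \<in> E \<and> sanc X ((e ## w) !! i) = ranc X ((e ## w) !! Suc i)"]
  show ?thesis by (simp add: spath_def)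
qed

lemma spath_unit: "spath w \<Longrightarrow> ranc X (shd w) \<in> unit_space G"
proof -
  assume "spath w"
  then have "w !! 0 \<in> E" unfolding spath_def by blast
  then show ?thesis using anchors[OF E_Pts] by simp
qed

lemma spath_shift:
  "spath (es @- w) \<and> ranc X (shd (es @- w)) = v \<longleftrightarrow> epath v es \<and> psrc v es = ranc X (shd w) \<and> spath w"
proof (induction es arbitrary: v)
  case Nil
  then show ?case using spath_unit[of w] by auto
next
  case (Cons e es)
  have "spath ((e # es) @- w) \<and> ranc X (shd ((e # es) @- w)) = v \<longleftrightarrow>
      e \<in> E \<and> ranc X e = v \<and> spath (es @- w) \<and> ranc X (shd (es @- w)) = sanc X e"
    by (auto simp: spath_SCons)
  then show ?case unfolding Cons.IH by simp
qed

lemma bpaths_at_iff: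
  "FinP p \<in> bpaths_at v \<longleftrightarrow> fst p = v \<and> p \<in> fpaths \<and> \<not> regular (path_src p)"
  "InfP w \<in> bpaths_at v \<longleftrightarrow> spath w \<and> ranc X (shd w) = v"
  by (cases p; auto simp: bpaths_at_def bpaths_def spath_def path_rng_def)+

lemma path_conc_eq: "path_conc p t = ext p (snd t)"
  by (simp add: path_conc_def ext_def)

lemma ext_simps [simp]:
  "path_src (ext p ts) = psrc (path_src p) ts" "ext (ext p ts) us = ext p (ts @ us)" "ext p [] = p"
  "ext p ts = ext p us \<longleftrightarrow> ts = us" "fst (ext p ts) = fst p" "snd (ext p ts) = snd p @ ts"
  by (simp_all add: ext_def path_src_eq psrc_append)

lemma ext_neq [simp]: "ext p ts = p \<longleftrightarrow> ts = []" "p = ext p ts \<longleftrightarrow> ts = []"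
  by (cases p; simp add: ext_def)+

lemma ext_fpaths [simp]: "ext p ts \<in> fpaths \<longleftrightarrow> p \<in> fpaths \<and> epath (path_src p) ts"
  by (simp add: fpaths_iff path_src_eq epath_append)

lemma path_src_unit: "p \<in> fpaths \<Longrightarrow> path_src p \<in> unit_space G"
  by (simp add: fpaths_iff path_src_eq psrc_unit)

lemma cylinder_eq: "cylinder p = bpath_conc p ` bpaths_at (path_src p)"
  by (simp add: cylinder_def bpaths_at_def)

lemma in_cylinderI: "w = bpath_conc p u \<Longrightarrow> u \<in> bpaths_at (path_src p) \<Longrightarrow> w \<in> cylinder p"
  by (simp add: cylinder_eq)

lemma in_cylinderE:
  assumes "w \<in> cylinder p" obtains u where "u \<in> bpaths_at (path_src p)" "w = bpath_conc p u"
  using assms by (auto simp: cylinder_eq)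

lemma conc_eq_iff:
  "FinP t = bpath_conc p u \<longleftrightarrow> (\<exists>r. u = FinP r \<and> t = ext p (snd r))"
  "InfP s = bpath_conc p u \<longleftrightarrow> (\<exists>r. u = InfP r \<and> s = snd p @- r)"
  by (cases u; auto simp: path_conc_eq)+

lemma bpath_conc_ext: "bpath_conc (ext p ts) w = bpath_conc p (bpath_conc (path_src p, ts) w)"
  by (cases w) (simp_all add: path_conc_def ext_def)

lemma path_src_pair [simp]: "path_src (v, ts) = psrc v ts"
  by (simp add: path_src_eq)

lemma bpath_conc_at:
  assumes "p \<in> fpaths" "w \<in> bpaths_at (path_src p)"
  shows "bpath_conc p w \<in> bpaths_at (fst p)"
proof (cases w)
  case (FinP t)
  then show ?thesis
    using assms
    by (cases t) (auto simp: bpaths_at_iff path_conc_eq fpaths_iff path_src_eq epath_append psrc_append)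
next
  case (InfP s)
  then show ?thesis
    using assms spath_shift[of "snd p" s "fst p"] by (simp add: bpaths_at_iff fpaths_iff path_src_eq)
qed

lemma shift_left_inj: "xs @- u = xs @- w \<Longrightarrow> u = w"
  by (induction xs) auto

lemma bpath_conc_inj:
  assumes "u \<in> bpaths_at (path_src p)" "w \<in> bpaths_at (path_src p)" "bpath_conc p u = bpath_conc p w"
  shows "u = w"
  using assms by (cases u; cases w) (auto simp: bpaths_at_iff path_conc_def prod_eq_iff dest: shift_left_inj)

lemma cylinder_root: "v \<in> unit_space G \<Longrightarrow> cylinder (v, []) = bpaths_at v"
proof -
  assume "v \<in> unit_space G"
  have "bpath_conc (v, []) w = w" if "w \<in> bpaths_at v" for w
    using that by (cases w) (auto simp: bpaths_at_iff path_conc_def prod_eq_iff)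
  then show ?thesis by (force simp: cylinder_eq)
qed

lemma cylinder_ext_iff:
  assumes "w \<in> bpaths_at (path_src p)" "epath (path_src p) ts"
  shows "bpath_conc p w \<in> cylinder (ext p ts) \<longleftrightarrow> w \<in> cylinder (path_src p, ts)"
proof
  assume "bpath_conc p w \<in> cylinder (ext p ts)"
  then obtain u where u: "u \<in> bpaths_at (psrc (path_src p) ts)" "bpath_conc p w = bpath_conc (ext p ts) u"
    by (auto simp: cylinder_eq)
  have "bpath_conc (path_src p, ts) u \<in> bpaths_at (path_src p)"
    using bpath_conc_at[of "(path_src p, ts)" u] u assms(2) by (simp add: fpaths_iff)
  then have "w = bpath_conc (path_src p, ts) u"
    using bpath_conc_inj[OF assms(1)] u(2) by (simp add: bpath_conc_ext)
  then show "w \<in> cylinder (path_src p, ts)" using u(1) by (auto simp: cylinder_eq)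
next
  assume "w \<in> cylinder (path_src p, ts)"
  then show "bpath_conc p w \<in> cylinder (ext p ts)"
    by (auto simp: cylinder_eq bpath_conc_ext[symmetric])
qed

lemma cylinder_bpaths: "p \<in> fpaths \<Longrightarrow> w \<in> cylinder p \<Longrightarrow> w \<in> bpaths_at (fst p)"
  by (erule in_cylinderE) (simp add: bpath_conc_at)

lemma cylinder_ext_subset:
  assumes "epath (path_src p) ts"
  shows "cylinder (ext p ts) \<subseteq> cylinder p"
proof
  fix z assume "z \<in> cylinder (ext p ts)"
  then obtain w where w: "w \<in> bpaths_at (psrc (path_src p) ts)" "z = bpath_conc p (bpath_conc (path_src p, ts) w)"
    by (auto simp: cylinder_eq bpath_conc_ext)
  have "bpath_conc (path_src p, ts) w \<in> bpaths_at (path_src p)"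
    using bpath_conc_at[of "(path_src p, ts)" w] w assms by (simp add: fpaths_iff)
  then show "z \<in> cylinder p" using w by (auto simp: cylinder_eq)
qed

text \<open>A boundary path without a first edge is a vertex, which must then be singular. Every
  descent in the tree of paths rests on this dichotomy.\<close>

lemma bpaths_at_step:
  assumes w: "w \<in> bpaths_at v"
  shows "(w = FinP (v, []) \<and> \<not> regular v) \<or> (\<exists>e\<in>edges_at v. w \<in> cylinder (v, [e]))"
proof (cases w)
  case (FinP p)
  then have p: "fst p = v" "epath v (snd p)" "\<not> regular (psrc v (snd p))"
    using w by (auto simp: bpaths_at_iff fpaths_iff path_src_eq)
  show ?thesis
  proof (cases "snd p")
    case Nil
    then show ?thesis using p FinP by (auto simp: prod_eq_iff)
  next
    case (Cons e es)
    then have "FinP (sanc X e, es) \<in> bpaths_at (sanc X e)" "e \<in> edges_at v"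
      using p by (auto simp: bpaths_at_iff fpaths_iff edges_at_def)
    moreover have "w = bpath_conc (v, [e]) (FinP (sanc X e, es))"
      using p Cons FinP by (simp add: path_conc_def prod_eq_iff)
    ultimately have "w \<in> cylinder (v, [e])" by (intro in_cylinderI) auto
    then show ?thesis using \<open>e \<in> edges_at v\<close> by blast
  qed
next
  case (InfP s)
  then have s: "spath s" "ranc X (shd s) = v" using w by (auto simp: bpaths_at_iff)
  then have "InfP (stl s) \<in> bpaths_at (sanc X (shd s))" "shd s \<in> edges_at v"
    using spath_SCons[of "shd s" "stl s"] by (auto simp: bpaths_at_iff edges_at_def)
  moreover have "w = bpath_conc (v, [shd s]) (InfP (stl s))" using InfP by simp
  ultimately have "w \<in> cylinder (v, [shd s])" by (intro in_cylinderI) auto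
  then show ?thesis using \<open>shd s \<in> edges_at v\<close> by blast
qed

lemma epath_edge: "e \<in> edges_at v \<Longrightarrow> epath v [e]"
  using E_Pts anchors by (auto simp: edges_at_def)

lemma FinP_in_cylinder:
  assumes "p \<in> fpaths" "\<not> regular (path_src p)"
  shows "FinP p \<in> cylinder p"
proof -
  have "FinP (path_src p, []) \<in> bpaths_at (path_src p)"
    using assms path_src_unit by (simp add: bpaths_at_iff fpaths_iff)
  moreover have "FinP p = bpath_conc p (FinP (path_src p, []))"
    by (simp add: path_conc_def)
  ultimately show ?thesis by (metis in_cylinderI)
qed

lemma cylinder_step:
  assumes w: "w \<in> cylinder p"
  shows "(w = FinP p \<and> \<not> regular (path_src p)) \<or> (\<exists>e\<in>edges_at (path_src p). w \<in> cylinder (ext p [e]))"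
proof -
  obtain u where u: "u \<in> bpaths_at (path_src p)" "w = bpath_conc p u" using w by (auto simp: cylinder_eq)
  from bpaths_at_step[OF u(1)] show ?thesis
  proof
    assume "u = FinP (path_src p, []) \<and> \<not> regular (path_src p)"
    then show ?thesis using u by (simp add: path_conc_def)
  next
    assume "\<exists>e\<in>edges_at (path_src p). u \<in> cylinder (path_src p, [e])"
    then show ?thesis using cylinder_ext_iff[OF u(1)] u(2) epath_edge by blast
  qed
qed

lemma shift_compare: "xs @- u = ys @- w \<Longrightarrow> (\<exists>ts. ys = xs @ ts) \<or> (\<exists>ts. xs = ys @ ts)"
proof (induction xs arbitrary: ys)
  case (Cons x xs)
  then show ?case by (cases ys) auto
qed auto

text \<open>Of two prefixes of one boundary path the longer extends the shorter. Cylinders are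
  therefore nested or disjoint.\<close>

lemma cylinder_compare:
  assumes "p \<in> fpaths" "q \<in> fpaths" "w \<in> cylinder p" "w \<in> cylinder q"
  obtains ts where "epath (path_src p) ts" "q = ext p ts" | ts where "epath (path_src q) ts" "p = ext q ts"
proof -
  have f: "fst p = fst q"
    using cylinder_bpaths[OF assms(1,3)] cylinder_bpaths[OF assms(2,4)] by (simp add: bpaths_at_def)
  have "(\<exists>ts. snd q = snd p @ ts) \<or> (\<exists>ts. snd p = snd q @ ts)"
  proof (cases w)
    case (FinP t)
    from assms(3) obtain u where "FinP t = bpath_conc p u" unfolding FinP by (rule in_cylinderE)
    moreover from assms(4) obtain u' where "FinP t = bpath_conc q u'" unfolding FinP by (rule in_cylinderE)
    ultimately obtain a b where "t = ext p a" "t = ext q b" unfolding conc_eq_iff by metis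
    then have "snd p @ a = snd q @ b" by (metis ext_simps(6))
    then show ?thesis by (metis append_eq_append_conv2)
  next
    case (InfP s)
    from assms(3) obtain u where "InfP s = bpath_conc p u" unfolding InfP by (rule in_cylinderE)
    moreover from assms(4) obtain u' where "InfP s = bpath_conc q u'" unfolding InfP by (rule in_cylinderE)
    ultimately obtain a b where "s = snd p @- a" "s = snd q @- b" unfolding conc_eq_iff by blast
    then show ?thesis using shift_compare by metis
  qed
  then show ?thesis
  proof
    assume "\<exists>ts. snd q = snd p @ ts"
    then obtain ts where "q = ext p ts" using f by (auto simp: ext_def prod_eq_iff)
    then show ?thesis using that(1) assms(2) by auto
  next
    assume "\<exists>ts. snd p = snd q @ ts"
    then obtain ts where "p = ext q ts" using f by (auto simp: ext_def prod_eq_iff)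
    then show ?thesis using that(2) assms(1) by auto
  qed
qed

lemma FinP_cylinderD:
  assumes "p \<in> fpaths" "FinP q \<in> cylinder p"
  obtains ts where "epath (path_src p) ts" "q = ext p ts"
proof -
  have "FinP q \<in> bpaths_at (fst p)" using cylinder_bpaths[OF assms] .
  then have q: "q \<in> fpaths" "\<not> regular (path_src q)" by (auto simp: bpaths_at_iff)
  obtain u where u: "u \<in> bpaths_at (path_src p)" "FinP q = bpath_conc p u" using assms(2) by (auto simp: cylinder_eq)
  then obtain t where "u = FinP t" by (cases u) auto
  then have "q = ext p (snd t)" using u by (simp add: path_conc_eq)
  then show ?thesis using that q by auto
qed

lemma FinP_not_in_ext:
  assumes "p \<in> fpaths" "e \<in> edges_at (path_src p)"
  shows "FinP p \<notin> cylinder (ext p [e])"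
proof
  assume "FinP p \<in> cylinder (ext p [e])"
  then obtain ts where "p = ext (ext p [e]) ts"
    using FinP_cylinderD[of "ext p [e]" p] assms epath_edge by auto
  then show False by simp
qed

lemma cylinder_edge_unique:
  assumes "p \<in> fpaths" "e \<in> edges_at (path_src p)" "f \<in> edges_at (path_src p)"
    "w \<in> cylinder (ext p [e])" "w \<in> cylinder (ext p [f])"
  shows "e = f"
  using cylinder_compare[OF _ _ assms(4,5)] assms(1-3) epath_edge by auto

lemma InfP_long:
  assumes "InfP s \<in> bpaths_at v"
  obtains p where "p \<in> fpaths" "InfP s \<in> cylinder p" "length (snd p) = n"
proof -
  have s: "spath s" "ranc X (shd s) = v" using assms by (auto simp: bpaths_at_iff)
  have "epath v (stake n s)" "psrc v (stake n s) = ranc X (shd (sdrop n s))" "spath (sdrop n s)"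
    using spath_shift[of "stake n s" "sdrop n s" v] s by (auto simp: stake_sdrop)
  then have "(v, stake n s) \<in> fpaths" "InfP (sdrop n s) \<in> bpaths_at (path_src (v, stake n s))"
    by (auto simp: fpaths_iff bpaths_at_iff)
  moreover have "InfP s = bpath_conc (v, stake n s) (InfP (sdrop n s))" by (simp add: stake_sdrop)
  ultimately have "InfP s \<in> cylinder (v, stake n s)" by (intro in_cylinderI) auto
  then show ?thesis using that[of "(v, stake n s)"] \<open>(v, stake n s) \<in> fpaths\<close> by simp
qed

subsection \<open>The action on boundary paths\<close>

lemma stream_act_shift: "stream_act g (es @- w) = list_act g es @- stream_act (list_res g es) w"
  by (induction es arbitrary: g) (simp_all add: stream_act.code[of _ "_ ## _"])

lemma snth_shift: "(xs @- w) !! (length xs + k) = w !! k"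
  by (induction xs) auto

lemma spath_stream_act:
  assumes g: "g \<in> Arr G" and w: "spath w" "ranc X (shd w) = src G g"
  shows "spath (stream_act g w)" "ranc X (shd (stream_act g w)) = rng G g"
proof -
  have *: "stream_act g w !! n \<in> E" "sanc X (stream_act g w !! n) = ranc X (stream_act g w !! Suc n)" for n
  proof -
    \<comment> \<open>Entry \<open>n\<close> is reached by splitting off the first \<open>n\<close>
      edges; what acts on the rest is the restriction \<open>?h\<close>.\<close>
    let ?es = "stake n w" and ?w = "sdrop n w"
    let ?h = "list_res g ?es"
    have e: "epath (src G g) ?es" "psrc (src G g) ?es = ranc X (shd ?w)" "spath ?w"
      using spath_shift[of ?es ?w "src G g"] w by (auto simp: stake_sdrop)
    have h: "?h \<in> Arr G" "src G ?h = ranc X (w !! n)" using list_act[OF g e(1)] e(2) by simp_all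
    have eq: "stream_act g w = list_act g ?es @- stream_act ?h ?w"
      using stream_act_shift[of g ?es ?w] by (simp add: stake_sdrop)
    have "stream_act g w !! (length (list_act g ?es) + k) = stream_act ?h ?w !! k" for k
      unfolding eq by (rule snth_shift)
    from this[of 0] this[of 1]
    have 1: "stream_act g w !! n = edge_act ?h (w !! n)"
      "stream_act g w !! Suc n = edge_act (edge_res ?h (w !! n)) (w !! Suc n)"
      by simp_all
    have wn: "w !! n \<in> E" "w !! Suc n \<in> E" "sanc X (w !! n) = ranc X (w !! Suc n)"
      using w unfolding spath_def by blast+
    note a = edge_act[OF h(1) wn(1) h(2)[symmetric]]
    note b = edge_act[OF a(3) wn(2)]
    show "stream_act g w !! n \<in> E" "sanc X (stream_act g w !! n) = ranc X (stream_act g w !! Suc n)"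
      using a b wn 1 by auto
  qed
  then show "spath (stream_act g w)" by (auto simp: spath_def)
  have "shd w \<in> E" using w unfolding spath_def by (metis snth.simps(1))
  then show "ranc X (shd (stream_act g w)) = rng G g" using edge_act[OF g] w by simp
qed

lemma stream_act_mul:
  assumes "g \<in> Arr G" "h \<in> Arr G" "src G g = rng G h" "spath w" "ranc X (shd w) = src G h"
  shows "stream_act (mul G g h) w = stream_act g (stream_act h w)"
  using assms
proof (coinduction arbitrary: g h w)
  case (Eq_stream g h w)
  have w: "shd w \<in> E" "sanc X (shd w) = ranc X (shd (stl w))" "spath (stl w)"
    using spath_SCons[of "shd w" "stl w"] Eq_stream by auto
  note a = edge_act[OF Eq_stream(2) w(1) Eq_stream(5)]
  have s: "ranc X (edge_act h (shd w)) = src G g" using a Eq_stream by simp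
  note b = edge_act[OF Eq_stream(1) a(1) s]
  note m = edge_act_mul[OF Eq_stream(1-3) w(1) Eq_stream(5)]
  show ?case
  proof (intro conjI)
    show "\<exists>g' h' w'. stl (stream_act (mul G g h) w) = stream_act (mul G g' h') w' \<and>
        stl (stream_act g (stream_act h w)) = stream_act g' (stream_act h' w') \<and> g' \<in> Arr G \<and> h' \<in> Arr G \<and>
        src G g' = rng G h' \<and> spath w' \<and> ranc X (shd w') = src G h'"
      by (rule exI[of _ "edge_res g (edge_act h (shd w))"], rule exI[of _ "edge_res h (shd w)"],
          rule exI[of _ "stl w"]) (use m a b w s in auto)
  qed (use m in simp)
qed

lemma stream_act_unit:
  assumes "spath w" "ranc X (shd w) = u"
  shows "stream_act u w = w"
  using assms
proof (coinduction arbitrary: u w)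
  case (Eq_stream u w)
  have w: "shd w \<in> E" "sanc X (shd w) = ranc X (shd (stl w))" "spath (stl w)"
    using spath_SCons[of "shd w" "stl w"] Eq_stream by auto
  then show ?case using edge_act_unit[OF w(1) Eq_stream(2)] by auto
qed

lemma bpath_act_closed:
  assumes g: "g \<in> Arr G" and w: "w \<in> bpaths_at (src G g)"
  shows "bpath_act g w \<in> bpaths_at (rng G g)"
proof (cases w)
  case (FinP p)
  then have p: "fst p = src G g" "epath (src G g) (snd p)" "\<not> regular (psrc (src G g) (snd p))"
    using w by (auto simp: bpaths_at_iff fpaths_iff path_src_eq)
  note l = list_act[OF g p(2)]
  show ?thesis using FinP p l regular_invariant[OF l(2)] by (simp add: bpaths_at_iff fpaths_iff path_act_def)
next
  case (InfP s)
  then show ?thesis using spath_stream_act[OF g] w by (simp add: bpaths_at_iff)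
qed

lemma bpath_act_conc:
  "bpath_act g (bpath_conc (v, ts) w) = bpath_conc (rng G g, list_act g ts) (bpath_act (list_res g ts) w)"
  by (cases w) (simp_all add: path_conc_def path_act_def list_act_append stream_act_shift)

lemma bpath_act_mul:
  assumes "g \<in> Arr G" "h \<in> Arr G" "src G g = rng G h" "w \<in> bpaths_at (src G h)"
  shows "bpath_act (mul G g h) w = bpath_act g (bpath_act h w)"
proof (cases w)
  case (FinP p)
  then show ?thesis using assms list_act_mul(1)[OF assms(1-3), of "snd p"] mul_closed[OF assms(1-3)]
    by (cases p) (auto simp: bpaths_at_iff fpaths_iff path_act_def)
next
  case (InfP s)
  then show ?thesis using assms stream_act_mul by (simp add: bpaths_at_iff)
qed

lemma bpath_act_unit:
  assumes "w \<in> bpaths_at u"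
  shows "bpath_act u w = w"
proof (cases w)
  case (FinP p)
  then have "fst p = u" "epath u (snd p)" using assms by (auto simp: bpaths_at_iff fpaths_iff)
  then show ?thesis using FinP list_act_unit[of u "snd p"] unit_rng epath_unit by (simp add: path_act_def prod_eq_iff)
next
  case (InfP s)
  then show ?thesis using assms stream_act_unit by (simp add: bpaths_at_iff)
qed

subsection \<open>Prefixes and neighbourhoods of a boundary path\<close>

text \<open>Eventually along the prefixes of \<open>w\<close>. For a boundary path
  \<open>w = FinP p\<close> this amounts to evaluation at \<open>p\<close>, the longest
  prefix.\<close>

definition ev_prefix :: "('g, 'x) bpath \<Rightarrow> (('g, 'x) fpath \<Rightarrow> bool) \<Rightarrow> bool" where
  "ev_prefix w Q \<longleftrightarrow> (\<exists>p\<in>fpaths. w \<in> cylinder p \<and>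
     (\<forall>ts. epath (path_src p) ts \<longrightarrow> w \<in> cylinder (ext p ts) \<longrightarrow> Q (ext p ts)))"

definition nbhd :: "('g, 'x) fpath \<Rightarrow> 'x set \<Rightarrow> ('g, 'x) bpath set" where
  "nbhd p F = cylinder p - (\<Union>e\<in>F. cylinder (ext p [e]))"

text \<open>The neighbourhood filter of \<open>w\<close> in terms of basic sets;
  \<open>openin_bpath_iff\<close> links it to the topology. Arguments about open sets become
  pointwise, which suits maps that are defined only on a cylinder.\<close>

definition near :: "('g, 'x) bpath \<Rightarrow> ('g, 'x) bpath set \<Rightarrow> bool" where
  "near w W \<longleftrightarrow> (\<exists>p F. p \<in> fpaths \<and> finite F \<and> F \<subseteq> edges_at (path_src p) \<and> w \<in> nbhd p F \<and> nbhd p F \<subseteq> W)"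

lemma ev_prefix_mono: "ev_prefix w P \<Longrightarrow> (\<And>p. p \<in> fpaths \<Longrightarrow> w \<in> cylinder p \<Longrightarrow> P p \<Longrightarrow> Q p) \<Longrightarrow> ev_prefix w Q"
  unfolding ev_prefix_def by (metis ext_fpaths)

lemma ev_prefix_ex:
  assumes "ev_prefix w P"
  obtains p where "p \<in> fpaths" "w \<in> cylinder p" "P p"
proof -
  obtain p where p: "p \<in> fpaths" "w \<in> cylinder p"
    "\<And>ts. epath (path_src p) ts \<Longrightarrow> w \<in> cylinder (ext p ts) \<Longrightarrow> P (ext p ts)"
    using assms unfolding ev_prefix_def by blast
  then show ?thesis using that p(3)[of "[]"] path_src_unit by simp
qed

lemma ev_prefix_ext:
  assumes "p \<in> fpaths" "w \<in> cylinder p"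
  shows "ev_prefix w (\<lambda>q. \<exists>ts. epath (path_src p) ts \<and> q = ext p ts)"
  using assms unfolding ev_prefix_def by blast

text \<open>The two witnessing prefixes are comparable, and the longer one witnesses both
  properties.\<close>

lemma ev_prefix_conj:
  assumes "ev_prefix w P" "ev_prefix w Q"
  shows "ev_prefix w (\<lambda>p. P p \<and> Q p)"
proof -
  have step: "ev_prefix w (\<lambda>p. P p \<and> Q p)"
    if p: "p \<in> fpaths" "w \<in> cylinder p" "\<forall>ts. epath (path_src p) ts \<longrightarrow> w \<in> cylinder (ext p ts) \<longrightarrow> P (ext p ts)"
      and q: "q \<in> fpaths" "w \<in> cylinder q" "\<forall>ts. epath (path_src q) ts \<longrightarrow> w \<in> cylinder (ext q ts) \<longrightarrow> Q (ext q ts)"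
      and us: "epath (path_src p) us" "q = ext p us" for P Q p q us
    unfolding ev_prefix_def
  proof (intro bexI[OF _ q(1)] conjI allI impI q(2))
    fix ts assume "epath (path_src q) ts" "w \<in> cylinder (ext q ts)"
    then show "P (ext q ts)" "Q (ext q ts)"
      using p(3) q(3) us by (auto simp: epath_append)
  qed
  obtain p where p: "p \<in> fpaths" "w \<in> cylinder p"
    "\<forall>ts. epath (path_src p) ts \<longrightarrow> w \<in> cylinder (ext p ts) \<longrightarrow> P (ext p ts)"
    using assms(1) unfolding ev_prefix_def by blast
  obtain q where q: "q \<in> fpaths" "w \<in> cylinder q"
    "\<forall>ts. epath (path_src q) ts \<longrightarrow> w \<in> cylinder (ext q ts) \<longrightarrow> Q (ext q ts)"
    using assms(2) unfolding ev_prefix_def by blast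
  show ?thesis
  proof (rule cylinder_compare[OF p(1) q(1) p(2) q(2)])
    fix ts assume "epath (path_src p) ts" "q = ext p ts"
    then show ?thesis by (rule step[OF p q])
  next
    fix ts assume "epath (path_src q) ts" "p = ext q ts"
    then have "ev_prefix w (\<lambda>p. Q p \<and> P p)" by (rule step[OF q p])
    then show ?thesis by (simp add: conj_commute)
  qed
qed

text \<open>A proper extension that contains \<open>w\<close> leaves \<open>p\<close> through an
  edge outside \<open>F\<close>, so its whole cylinder already lies in \<open>nbhd p F\<close> and
  no further edge has to be removed.\<close>

lemma nbhd_refine:
  assumes p: "p \<in> fpaths" "finite F" "F \<subseteq> edges_at (path_src p)" and w: "w \<in> nbhd p F"
    and ts: "epath (path_src p) ts" "w \<in> cylinder (ext p ts)"
  obtains F' where "finite F'" "F' \<subseteq> edges_at (path_src (ext p ts))" "w \<in> nbhd (ext p ts) F'"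
    "nbhd (ext p ts) F' \<subseteq> nbhd p F"
proof (cases ts)
  case Nil
  then show ?thesis using that[of F] p w by simp
next
  case (Cons e us)
  have e: "e \<in> edges_at (path_src p)" "epath (sanc X e) us" using ts Cons by (auto simp: edges_at_def)
  have sub: "cylinder (ext p ts) \<subseteq> cylinder (ext p [e])"
    using cylinder_ext_subset[of "ext p [e]" us] e Cons by simp
  then have "e \<notin> F" using w ts by (auto simp: nbhd_def)
  then have "cylinder (ext p [e]) \<inter> cylinder (ext p [f]) = {}" if "f \<in> F" for f
    using cylinder_edge_unique[OF p(1) e(1), of f] p(3) that by blast
  then have "nbhd (ext p ts) {} \<subseteq> nbhd p F"
    using sub cylinder_ext_subset[OF epath_edge[OF e(1)]] by (fastforce simp: nbhd_def)
  then show ?thesis using that[of "{}"] ts by (simp add: nbhd_def)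
qed

lemma near_mono: "near w U \<Longrightarrow> U \<subseteq> W \<Longrightarrow> near w W"
  unfolding near_def by blast

lemma near_cylinder: "p \<in> fpaths \<Longrightarrow> w \<in> cylinder p \<Longrightarrow> near w (cylinder p)"
  unfolding near_def by (intro exI[of _ p] exI[of _ "{}"]) (auto simp: nbhd_def)

lemma near_extE:
  assumes "near w W" "p \<in> fpaths" "w \<in> cylinder p"
  obtains ts F where "epath (path_src p) ts" "finite F" "F \<subseteq> edges_at (path_src (ext p ts))"
    "w \<in> nbhd (ext p ts) F" "nbhd (ext p ts) F \<subseteq> W"
proof -
  obtain q F where q: "q \<in> fpaths" "finite F" "F \<subseteq> edges_at (path_src q)" "w \<in> nbhd q F" "nbhd q F \<subseteq> W"
    using assms(1) unfolding near_def by blast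
  then have wq: "w \<in> cylinder q" by (simp add: nbhd_def)
  show ?thesis
  proof (rule cylinder_compare[OF assms(2) q(1) assms(3) wq])
    fix ts assume "epath (path_src p) ts" "q = ext p ts"
    then show ?thesis using that q by blast
  next
    fix ts assume ts: "epath (path_src q) ts" "p = ext q ts"
    obtain F' where "finite F'" "F' \<subseteq> edges_at (path_src p)" "w \<in> nbhd p F'" "nbhd p F' \<subseteq> nbhd q F"
      using nbhd_refine[OF q(1-4) ts(1)] assms(3) ts(2) by blast
    then show ?thesis using that[of "[]" F'] q(5) path_src_unit[OF assms(2)] by auto
  qed
qed

lemma near_Int:
  assumes "near w U" "near w W" shows "near w (U \<inter> W)"
proof -
  obtain p F where p: "p \<in> fpaths" "finite F" "F \<subseteq> edges_at (path_src p)" "w \<in> nbhd p F" "nbhd p F \<subseteq> U"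
    using assms(1) unfolding near_def by blast
  then have "w \<in> cylinder p" by (simp add: nbhd_def)
  then obtain ts F' where ts: "epath (path_src p) ts" "finite F'" "F' \<subseteq> edges_at (path_src (ext p ts))"
    "w \<in> nbhd (ext p ts) F'" "nbhd (ext p ts) F' \<subseteq> W"
    using near_extE[OF assms(2) p(1)] by blast
  then have "w \<in> cylinder (ext p ts)" by (simp add: nbhd_def)
  then obtain F'' where F'': "finite F''" "F'' \<subseteq> edges_at (path_src (ext p ts))" "w \<in> nbhd (ext p ts) F''"
    "nbhd (ext p ts) F'' \<subseteq> nbhd p F"
    using nbhd_refine[OF p(1-4) ts(1)] by blast
  have "nbhd (ext p ts) (F' \<union> F'') = nbhd (ext p ts) F' \<inter> nbhd (ext p ts) F''"
    by (auto simp: nbhd_def)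
  then show ?thesis
    unfolding near_def using p ts F''
    by (intro exI[of _ "ext p ts"] exI[of _ "F' \<union> F''"]) auto
qed

text \<open>The factor \<open>bpaths\<close> gives the empty intersection its proper value.\<close>

lemma near_Inter: "finite I \<Longrightarrow> w \<in> bpaths_at v \<Longrightarrow> (\<And>i. i \<in> I \<Longrightarrow> near w (W i)) \<Longrightarrow> near w (bpaths \<inter> (\<Inter>i\<in>I. W i))"
proof (induction I rule: finite_induct)
  case empty
  have v: "v \<in> unit_space G"
  proof (cases w)
    case (FinP p)
    then show ?thesis using empty by (auto simp: bpaths_at_iff fpaths_iff dest: epath_unit)
  next
    case (InfP s)
    then show ?thesis using empty spath_unit by (auto simp: bpaths_at_iff)
  qed
  then have "near w (cylinder (v, []))"
    using empty cylinder_root[OF v] by (intro near_cylinder) (auto simp: fpaths_iff)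
  then show ?case using cylinder_root[OF v] by (auto elim!: near_mono simp: bpaths_at_def)
next
  case (insert i I)
  then have "near w (W i)" "near w (bpaths \<inter> (\<Inter>i\<in>I. W i))" by auto
  from near_Int[OF this] show ?case by (rule near_mono) auto
qed

lemma openin_nbhd:
  assumes "p \<in> fpaths" "finite F" "F \<subseteq> edges_at (path_src p)"
  shows "openin bpath_topology (nbhd p F)"
proof -
  have "nbhd p F = cylinder p - (\<Union>e\<in>F. cylinder (path_conc p (ranc X e, [e])))"
    by (simp add: nbhd_def path_conc_eq)
  then show ?thesis
    unfolding bpath_topology_def using assms
    by (intro topology_generated_by_Basis CollectI exI[of _ p] exI[of _ F]) (auto simp: edges_at_def)
qed

lemma openin_cylinder: "p \<in> fpaths \<Longrightarrow> openin bpath_topology (cylinder p)"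
  using openin_nbhd[of p "{}"] by (simp add: nbhd_def)

lemma openin_bpath_iff: "openin bpath_topology U \<longleftrightarrow> (\<forall>w\<in>U. near w U)"
proof
  assume "openin bpath_topology U"
  then have "generate_topology_on {cylinder p - (\<Union>e\<in>F. cylinder (path_conc p (ranc X e, [e]))) |p F.
        p \<in> fpaths \<and> finite F \<and> F \<subseteq> {e \<in> E. ranc X e = path_src p}} U"
    unfolding bpath_topology_def by (simp add: openin_topology_generated_by_iff)
  then show "\<forall>w\<in>U. near w U"
  proof induction
    case (Int a b)
    then show ?case using near_Int by blast
  next
    case (UN K)
    then show ?case using near_mono by (metis Union_iff Union_upper)
  next
    case (Basis s)
    then obtain p F where "s = nbhd p F" "p \<in> fpaths" "finite F" "F \<subseteq> edges_at (path_src p)"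
      by (auto simp: nbhd_def path_conc_eq edges_at_def)
    then show ?case unfolding near_def by blast
  qed auto
next
  assume *: "\<forall>w\<in>U. near w U"
  have "\<exists>B. openin bpath_topology B \<and> w \<in> B \<and> B \<subseteq> U" if "w \<in> U" for w
    using * that openin_nbhd unfolding near_def by meson
  then show "openin bpath_topology U" by (metis openin_subopen)
qed

text \<open>The tree of finite paths has no infinite branch avoiding \<open>P\<close>; this replaces compactness
  arguments on the boundary path space.\<close>

lemma path_tree_induct:
  assumes step: "\<And>p. p \<in> fpaths \<Longrightarrow> \<exists>F. finite F \<and> F \<subseteq> edges_at (path_src p) \<and> ((\<forall>e\<in>F. P (ext p [e])) \<longrightarrow> P p)"
    and branch: "\<And>s v. InfP s \<in> bpaths_at v \<Longrightarrow> ev_prefix (InfP s) P"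
    and p0: "p0 \<in> fpaths"
  shows "P p0"
proof (rule ccontr)
  assume "\<not> P p0"
  have "\<exists>e\<in>edges_at (path_src p). \<not> P (ext p [e])" if "p \<in> fpaths" "\<not> P p" for p
    using step[OF that(1)] that(2) by blast
  then obtain f where f: "\<And>p. p \<in> fpaths \<Longrightarrow> \<not> P p \<Longrightarrow> f p \<in> edges_at (path_src p) \<and> \<not> P (ext p [f p])"
    by metis
  define pp where "pp n = ((\<lambda>p. ext p [f p]) ^^ n) p0" for n
  \<comment> \<open>The edges chosen by \<open>f\<close> at failing paths form an infinite branch
    below \<open>p0\<close>, along which \<open>P\<close> fails throughout; this will contradict
    \<open>branch\<close>.\<close>
  define s where "s = smap f (siterate (\<lambda>p. ext p [f p]) p0)"
  have pp: "pp n \<in> fpaths \<and> \<not> P (pp n)" for n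
  proof (induction n)
    case (Suc n)
    then show ?case
      using f[of "pp n"] epath_edge[of "f (pp n)" "path_src (pp n)"] by (simp add: pp_def)
  qed (use p0 \<open>\<not> P p0\<close> in \<open>simp add: pp_def\<close>)
  have s_nth: "s !! n = f (pp n)" for n by (simp add: s_def pp_def)
  have pp_ext: "pp n = ext p0 (stake n s)" for n
  proof (induction n)
    case (Suc n)
    have "pp (Suc n) = ext (pp n) [f (pp n)]" by (simp add: pp_def)
    also have "\<dots> = ext p0 (stake n s @ [s !! n])" using Suc s_nth by simp
    finally show ?case by (simp only: stake_Suc)
  qed (simp add: pp_def)
  have edge: "s !! n \<in> E" "ranc X (s !! n) = path_src (pp n)" for n
    using f[of "pp n"] pp[of n] by (auto simp: s_nth edges_at_def)
  have "path_src (pp (Suc n)) = sanc X (s !! n)" for n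
    by (simp add: pp_def s_nth)
  then have s: "spath s" unfolding spath_def using edge by (simp del: snth.simps)
  have cyl: "InfP (snd p0 @- s) \<in> cylinder (pp n)" for n
  proof -
    have "InfP (sdrop n s) \<in> bpaths_at (path_src (pp n))"
      using s edge[of n] spath_shift[of "stake n s" "sdrop n s" "ranc X (shd s)"]
      by (auto simp: bpaths_at_iff stake_sdrop)
    moreover have "InfP (snd p0 @- s) = bpath_conc (pp n) (InfP (sdrop n s))"
      by (simp add: pp_ext shift_append stake_sdrop)
    ultimately show ?thesis by (metis in_cylinderI)
  qed
  have "InfP (snd p0 @- s) \<in> bpaths_at (fst p0)"
    using cylinder_bpaths[OF p0] cyl[of 0] by (simp add: pp_def)
  from branch[OF this] obtain q where q: "q \<in> fpaths" "InfP (snd p0 @- s) \<in> cylinder q"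
    "\<And>ts. epath (path_src q) ts \<Longrightarrow> InfP (snd p0 @- s) \<in> cylinder (ext q ts) \<Longrightarrow> P (ext q ts)"
    unfolding ev_prefix_def by blast
  \<comment> \<open>The path \<open>pp ?n\<close> has at least as many edges as \<open>q\<close>, so
    of the two comparable prefixes it is the one that extends the other.\<close>
  let ?n = "length (snd q)"
  have len: "length (snd (pp ?n)) \<ge> ?n" by (simp add: pp_ext)
  obtain ts where "epath (path_src q) ts" "pp ?n = ext q ts"
  proof (rule cylinder_compare[OF q(1) _ q(2) cyl[of ?n]])
    show "pp ?n \<in> fpaths" using pp by blast
    fix ts assume ts: "epath (path_src (pp ?n)) ts" "q = ext (pp ?n) ts"
    have "length (snd q) = length (snd (pp ?n)) + length ts"
      using arg_cong[OF ts(2), of "\<lambda>p. length (snd p)"] by (simp only: ext_simps length_append)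
    then have "length ts = 0" using len by linarith
    then have "ts = []" by simp
    then have "pp ?n = ext q []" using ts(2) by (metis ext_simps(3))
    moreover have "epath (path_src q) []" using path_src_unit[OF q(1)] by simp
    ultimately show thesis using that by blast
  qed (rule that)
  then show False using q(3)[of ts] cyl[of ?n] pp by metis
qed

end

section \<open>Germs\<close>

context graph_picture
begin

section \<open>Triples as arrows of a pullback groupoid: restriction and action\<close>

abbreviation T :: "(('g, 'x) fpath \<times> 'g \<times> ('g, 'x) fpath) groupoid" where
  "T \<equiv> pullback_groupoid G fpaths path_src"

sublocale T: discrete_groupoid T by (rule discrete_groupoid_pullback)

abbreviation pr :: "('g, 'x) fpath \<times> 'g \<times> ('g, 'x) fpath \<Rightarrow> ('g, 'x) fpath" where "pr x \<equiv> fst x"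
abbreviation ar :: "('g, 'x) fpath \<times> 'g \<times> ('g, 'x) fpath \<Rightarrow> 'g" where "ar x \<equiv> fst (snd x)"
abbreviation pd :: "('g, 'x) fpath \<times> 'g \<times> ('g, 'x) fpath \<Rightarrow> ('g, 'x) fpath" where "pd x \<equiv> snd (snd x)"

definition act :: "('g, 'x) fpath \<times> 'g \<times> ('g, 'x) fpath \<Rightarrow> ('g, 'x) bpath \<Rightarrow> ('g, 'x) bpath" where
  "act x z = semi_act (Some x) z"

text \<open>In the semigroup this is the product of \<open>x\<close> with the idempotent of
  \<open>ext (pd x) ts\<close>. Over the smaller cylinder it has the same germs as \<open>x\<close>
  (\<open>gm_ares\<close>).\<close>

definition ares :: "('g, 'x) fpath \<times> 'g \<times> ('g, 'x) fpath \<Rightarrow> 'x list \<Rightarrow> ('g, 'x) fpath \<times> 'g \<times> ('g, 'x) fpath" where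
  "ares x ts = (ext (pr x) (list_act (ar x) ts), list_res (ar x) ts, ext (pd x) ts)"

text \<open>\<open>tail q v\<close> is the list \<open>ts\<close> with \<open>v = ext q ts\<close>, when \<open>q\<close> is a prefix of \<open>v\<close>.\<close>

definition tail :: "('g, 'x) fpath \<Rightarrow> ('g, 'x) fpath \<Rightarrow> 'x list" where
  "tail q v = drop (length (snd q)) (snd v)"

text \<open>Meaningful when \<open>v\<close> extends \<open>pd x\<close>. All long prefixes of a
  point of the cylinder do, so equalities of restrictions are stated under
  \<open>ev_prefix\<close>.\<close>

definition restr :: "('g, 'x) fpath \<times> 'g \<times> ('g, 'x) fpath \<Rightarrow> ('g, 'x) fpath \<Rightarrow> ('g, 'x) fpath \<times> 'g \<times> ('g, 'x) fpath" where
  "restr x v = ares x (tail (pd x) v)"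

lemma tail_ext [simp]: "tail q (ext q ts) = ts"
  by (simp add: tail_def)

lemma T_arr: "x \<in> Arr T \<longleftrightarrow> pr x \<in> fpaths \<and> pd x \<in> fpaths \<and> ar x \<in> Arr G \<and>
    path_src (pr x) = rng G (ar x) \<and> path_src (pd x) = src G (ar x)"
  by (cases x) (simp add: pullback_groupoid_simps)

lemma T_simps: "src T x = (pd x, src G (ar x), pd x)" "rng T x = (pr x, rng G (ar x), pr x)"
  "mul T x y = (pr x, mul G (ar x) (ar y), pd y)" "ginv T x = (pd x, ginv G (ar x), pr x)"
  by (cases x; cases y; simp add: pullback_groupoid_simps)+

lemma T_comp: "x \<in> Arr T \<Longrightarrow> y \<in> Arr T \<Longrightarrow> src T x = rng T y \<longleftrightarrow> pd x = pr y"
  by (auto simp: T_simps T_arr)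

lemma T_comp_ar: "x \<in> Arr T \<Longrightarrow> y \<in> Arr T \<Longrightarrow> pd x = pr y \<Longrightarrow> src G (ar x) = rng G (ar y)"
  by (auto simp: T_arr)

lemma T_unit: "p \<in> fpaths \<Longrightarrow> (p, path_src p, p) \<in> Arr T"
  using path_src_unit[of p] unit_arr unit_src unit_rng by (auto simp: T_arr)

lemma ares_simps [simp]: "pr (ares x ts) = ext (pr x) (list_act (ar x) ts)" "ar (ares x ts) = list_res (ar x) ts"
  "pd (ares x ts) = ext (pd x) ts"
  by (simp_all add: ares_def)

lemma ares_Nil [simp]: "ares x [] = x"
  by (cases x) (simp add: ares_def)

lemma ares_ares: "ares (ares x ts) us = ares x (ts @ us)"
  by (simp add: ares_def list_act_append list_res_append)

lemma ares_arr: "x \<in> Arr T \<Longrightarrow> epath (path_src (pd x)) ts \<Longrightarrow> ares x ts \<in> Arr T"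
  using list_act[of "ar x" ts] by (auto simp: T_arr)

lemma ares_mul:
  assumes "x \<in> Arr T" "y \<in> Arr T" "pd x = pr y" "epath (path_src (pd y)) ts"
  shows "ares (mul T x y) ts = mul T (ares x (list_act (ar y) ts)) (ares y ts)"
  using assms list_act_mul[of "ar x" "ar y" ts] by (auto simp: T_arr T_simps ares_def)

lemma ares_unit: "p \<in> fpaths \<Longrightarrow> epath (path_src p) ts \<Longrightarrow> ares (p, path_src p, p) ts = (ext p ts, path_src (ext p ts), ext p ts)"
  by (simp add: ares_def list_act_unit)

lemma restr_ext [simp]: "restr x (ext (pd x) ts) = ares x ts"
  by (simp add: restr_def)

lemma act_conc:
  assumes "w \<in> bpaths_at (path_src (pd x))"
  shows "act x (bpath_conc (pd x) w) = bpath_conc (pr x) (bpath_act (ar x) w)"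
proof -
  have "(THE u. u \<in> bpaths \<and> bpath_rng u = path_src (pd x) \<and> bpath_conc (pd x) w = bpath_conc (pd x) u) = w"
    using assms bpath_conc_inj by (intro the_equality) (auto simp: bpaths_at_def)
  then show ?thesis by (cases x) (simp add: act_def)
qed

lemma act_cylinder:
  assumes "x \<in> Arr T" "z \<in> cylinder (pd x)"
  shows "act x z \<in> cylinder (pr x)"
proof -
  obtain w where w: "w \<in> bpaths_at (path_src (pd x))" "z = bpath_conc (pd x) w"
    using assms(2) by (rule in_cylinderE)
  show ?thesis
    unfolding w(2) act_conc[OF w(1)]
    by (rule in_cylinderI[OF refl]) (use bpath_act_closed[of "ar x" w] w assms in \<open>auto simp: T_arr\<close>)
qed

lemma act_ares:
  assumes "x \<in> Arr T" "epath (path_src (pd x)) ts" "z \<in> cylinder (ext (pd x) ts)"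
  shows "act (ares x ts) z = act x z"
proof -
  obtain w where w: "w \<in> bpaths_at (psrc (path_src (pd x)) ts)" "z = bpath_conc (ext (pd x) ts) w"
    using assms(3) by (auto elim!: in_cylinderE)
  let ?u = "bpath_conc (path_src (pd x), ts) w"
  have u: "?u \<in> bpaths_at (path_src (pd x))"
    using bpath_conc_at[of "(path_src (pd x), ts)" w] w assms(2) by (simp add: fpaths_iff)
  have "act (ares x ts) z = bpath_conc (ext (pr x) (list_act (ar x) ts)) (bpath_act (list_res (ar x) ts) w)"
    using act_conc[of w "ares x ts"] w by simp
  also have "\<dots> = bpath_conc (pr x) (bpath_act (ar x) ?u)"
    using assms(1) by (simp add: bpath_act_conc bpath_conc_ext T_arr)
  also have "\<dots> = act x z" unfolding w(2) bpath_conc_ext act_conc[OF u] ..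
  finally show ?thesis .
qed

lemma act_ext:
  assumes "x \<in> Arr T" "epath (path_src (pd x)) ts" "z \<in> cylinder (ext (pd x) ts)"
  shows "act x z \<in> cylinder (ext (pr x) (list_act (ar x) ts))"
  using act_cylinder[OF ares_arr[OF assms(1,2)], of z] act_ares[OF assms] assms(3) by simp

lemma act_mul:
  assumes "x \<in> Arr T" "y \<in> Arr T" "pd x = pr y" "z \<in> cylinder (pd y)"
  shows "act (mul T x y) z = act x (act y z)"
proof -
  obtain w where w: "w \<in> bpaths_at (path_src (pd y))" "z = bpath_conc (pd y) w"
    using assms(4) by (rule in_cylinderE)
  have "bpath_act (ar y) w \<in> bpaths_at (path_src (pd x))"
    using bpath_act_closed[of "ar y" w] assms w by (auto simp: T_arr)
  then show ?thesis
    using act_conc[of w y] act_conc[of w "mul T x y"] act_conc[of "bpath_act (ar y) w" x] assms w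
      bpath_act_mul[of "ar x" "ar y" w]
    by (simp add: T_simps T_arr)
qed

lemma act_unit:
  assumes "z \<in> cylinder p"
  shows "act (p, path_src p, p) z = z"
proof -
  obtain w where w: "w \<in> bpaths_at (path_src p)" "z = bpath_conc p w"
    using assms by (rule in_cylinderE)
  then show ?thesis using act_conc[of w "(p, path_src p, p)"] bpath_act_unit by simp
qed

lemma act_ginv:
  assumes x: "x \<in> Arr T" and z: "z \<in> cylinder (pd x)"
  shows "act (ginv T x) (act x z) = z"
proof -
  have i: "ginv T x \<in> Arr T" "pd (ginv T x) = pr x"
    using T.ginv_closed[OF x] by (simp_all only: T_simps fst_conv snd_conv)
  have u: "src T x = (pd x, path_src (pd x), pd x)" using x by (simp only: T_arr T_simps)
  have "act (ginv T x) (act x z) = act (src T x) z"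
    using act_mul[OF i(1) x i(2) z] conjunct1[OF T.mul_ginv[OF x]] by argo
  then show ?thesis unfolding u act_unit[OF z] .
qed

lemma act_inj:
  assumes "x \<in> Arr T" "z \<in> cylinder (pd x)" "z' \<in> cylinder (pd x)" "act x z = act x z'"
  shows "z = z'"
  using act_ginv[OF assms(1,2)] act_ginv[OF assms(1,3)] assms(4) by metis

lemma act_surj:
  assumes x: "x \<in> Arr T" and z: "z \<in> cylinder (pr x)"
  obtains z' where "z' \<in> cylinder (pd x)" "act x z' = z"
proof -
  have i: "ginv T x \<in> Arr T" "pd (ginv T x) = pr x" "pr (ginv T x) = pd x"
    using T.ginv_closed[OF x] by (auto simp: T_simps)
  have "ginv T (ginv T x) = x" by (rule T.ginv_ginv[OF x])
  then show ?thesis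
    using that[of "act (ginv T x) z"] act_ginv[OF i(1), of z] act_cylinder[OF i(1), of z] z i by simp
qed

lemma act_ext_iff:
  assumes x: "x \<in> Arr T" and ts: "epath (path_src (pd x)) ts" and z: "z \<in> cylinder (pd x)"
  shows "act x z \<in> cylinder (ext (pr x) (list_act (ar x) ts)) \<longleftrightarrow> z \<in> cylinder (ext (pd x) ts)"
proof
  assume "act x z \<in> cylinder (ext (pr x) (list_act (ar x) ts))"
  then obtain z' where z': "z' \<in> cylinder (ext (pd x) ts)" "act (ares x ts) z' = act x z"
    using act_surj[OF ares_arr[OF x ts], of "act x z"] by auto
  then have "act x z' = act x z" using act_ares[OF x ts] by simp
  then have "z' = z" using act_inj[OF x _ z] cylinder_ext_subset[OF ts] z' by blast
  then show "z \<in> cylinder (ext (pd x) ts)" using z' by simp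
qed (rule act_ext[OF x ts])

text \<open>A prefix of \<open>act x z\<close> that extends \<open>pr x\<close> is the image of a
  prefix of \<open>z\<close>, and longer prefixes of \<open>z\<close> go to its extensions.\<close>

lemma ev_prefix_act:
  assumes x: "x \<in> Arr T" and z: "z \<in> cylinder (pd x)" and ev: "ev_prefix (act x z) P"
  shows "ev_prefix z (\<lambda>v. P (pr (restr x v)))"
proof -
  note pz = act_cylinder[OF x z]
  have px: "pr x \<in> fpaths" "pd x \<in> fpaths" using x by (auto simp: T_arr)
  obtain u where u: "ev_prefix (act x z) (\<lambda>v. P v \<and> (\<exists>ts. epath (path_src (pr x)) ts \<and> v = ext (pr x) ts))"
    using ev_prefix_conj[OF ev ev_prefix_ext[OF px(1) pz]] by blast
  then obtain v where v: "v \<in> fpaths" "act x z \<in> cylinder v"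
    "\<And>ts. epath (path_src v) ts \<Longrightarrow> act x z \<in> cylinder (ext v ts) \<Longrightarrow>
      P (ext v ts) \<and> (\<exists>us. epath (path_src (pr x)) us \<and> ext v ts = ext (pr x) us)"
    unfolding ev_prefix_def by blast
  obtain us where us: "epath (path_src (pr x)) us" "v = ext (pr x) us"
    using v(3)[of "[]"] v path_src_unit by auto
  obtain ts where ts: "epath (src G (ar x)) ts" "list_act (ar x) ts = us"
    using list_act_surj[of "ar x" us] x us by (auto simp: T_arr)
  have ts': "epath (path_src (pd x)) ts" using ts x by (simp add: T_arr)
  have "z \<in> cylinder (ext (pd x) ts)" using act_ext_iff[OF x ts' z] v us ts by simp
  show ?thesis
    unfolding ev_prefix_def
  proof (intro bexI[of _ "ext (pd x) ts"] conjI allI impI \<open>z \<in> cylinder (ext (pd x) ts)\<close>)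
    show "ext (pd x) ts \<in> fpaths" using px ts' by simp
    fix rs assume rs: "epath (path_src (ext (pd x) ts)) rs" "z \<in> cylinder (ext (ext (pd x) ts) rs)"
    then have e: "epath (path_src (pd x)) (ts @ rs)" using ts' by (simp add: epath_append)
    have "act x z \<in> cylinder (ext (pr x) (list_act (ar x) (ts @ rs)))"
      using act_ext[OF x e] rs by simp
    moreover have "ext (pr x) (list_act (ar x) (ts @ rs)) = ext v (list_act (list_res (ar x) ts) rs)"
      using us ts by (simp add: list_act_append)
    moreover have "epath (path_src v) (list_act (list_res (ar x) ts) rs)"
      using list_act[of "ar x" "ts @ rs"] e x us ts by (auto simp: T_arr list_act_append epath_append)
    ultimately have "P (ext (pr x) (list_act (ar x) (ts @ rs)))" using v(3) by metis
    then show "P (pr (restr x (ext (ext (pd x) ts) rs)))" by simp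
  qed
qed

lemma near_act:
  assumes x: "x \<in> Arr T" and z: "z \<in> cylinder (pd x)" and near: "near (act x z) W"
  shows "near z {z' \<in> cylinder (pd x). act x z' \<in> W}"
proof -
  have px: "pr x \<in> fpaths" "pd x \<in> fpaths" using x by (auto simp: T_arr)
  obtain us F where us: "epath (path_src (pr x)) us" "finite F" "F \<subseteq> edges_at (path_src (ext (pr x) us))"
    "act x z \<in> nbhd (ext (pr x) us) F" "nbhd (ext (pr x) us) F \<subseteq> W"
    using near_extE[OF near px(1) act_cylinder[OF x z]] by blast
  obtain ts where ts: "epath (src G (ar x)) ts" "list_act (ar x) ts = us"
    using list_act_surj[of "ar x" us] x us by (auto simp: T_arr)
  have ts': "epath (path_src (pd x)) ts" using ts x by (simp add: T_arr)
  let ?y = "ares x ts"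
  have y: "?y \<in> Arr T" by (rule ares_arr[OF x ts'])
  have ar: "ar ?y \<in> Arr G" "path_src (pd ?y) = src G (ar ?y)" "path_src (pr ?y) = rng G (ar ?y)"
    using y by (auto simp: T_arr)
  \<comment> \<open>The edges to be removed at the source are the preimages of \<open>F\<close>
    under the bijection \<open>edge_act (ar ?y)\<close>, hence finitely many.\<close>
  define F' where "F' = {e \<in> edges_at (path_src (pd ?y)). edge_act (ar ?y) e \<in> F}"
  have bij: "bij_betw (edge_act (ar ?y)) (edges_at (path_src (pd ?y))) (edges_at (path_src (pr ?y)))"
    using edge_act_bij[OF ar(1)] ar by simp
  have finF': "finite F'"
    by (rule finite_imageD[of "edge_act (ar ?y)"])
      (use bij us(2) in \<open>auto simp: F'_def bij_betw_def intro: finite_subset[of _ F] inj_on_subset\<close>)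
  have zy: "z \<in> cylinder (pd ?y)"
    using act_ext_iff[OF x ts' z] us(4) ts(2) by (simp add: nbhd_def)
  have *: "act x z' \<in> nbhd (ext (pr x) us) F \<longleftrightarrow> z' \<in> nbhd (pd ?y) F'" if z': "z' \<in> cylinder (pd ?y)" for z'
  proof -
    have a: "act x z' = act ?y z'" using act_ares[OF x ts'] z' by simp
    have "act ?y z' \<in> cylinder (ext (pr ?y) [edge_act (ar ?y) e]) \<longleftrightarrow> z' \<in> cylinder (ext (pd ?y) [e])"
      if "e \<in> edges_at (path_src (pd ?y))" for e
      using act_ext_iff[OF y epath_edge[OF that] z'] by simp
    moreover have "\<exists>e\<in>edges_at (path_src (pd ?y)). f = edge_act (ar ?y) e" if "f \<in> F" for f
      using bij us(3) that ts(2) by (auto simp: bij_betw_def)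
    ultimately have "(\<exists>f\<in>F. act ?y z' \<in> cylinder (ext (pr ?y) [f])) \<longleftrightarrow> (\<exists>e\<in>F'. z' \<in> cylinder (ext (pd ?y) [e]))"
      unfolding F'_def by (smt (verit, ccfv_threshold) mem_Collect_eq)
    then show ?thesis
      unfolding nbhd_def a using act_cylinder[OF y z'] z' ts(2) by auto
  qed
  show ?thesis
    unfolding near_def
  proof (intro exI[of _ "pd ?y"] exI[of _ F'] conjI finF')
    show "pd ?y \<in> fpaths" using y by (simp add: T_arr)
    show "F' \<subseteq> edges_at (path_src (pd ?y))" by (auto simp: F'_def)
    show "z \<in> nbhd (pd ?y) F'" using *[OF zy] us(4) by simp
    show "nbhd (pd ?y) F' \<subseteq> {z' \<in> cylinder (pd x). act x z' \<in> W}"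
    proof
      fix z' assume z': "z' \<in> nbhd (pd ?y) F'"
      then have "z' \<in> cylinder (pd ?y)" by (simp add: nbhd_def)
      moreover from *[OF this] have "act x z' \<in> W" using z' us(5) by blast
      ultimately show "z' \<in> {z' \<in> cylinder (pd x). act x z' \<in> W}"
        using cylinder_ext_subset[OF ts'] by auto
    qed
  qed
qed

subsection \<open>Equality of germs\<close>

lemma semi_carrier_iff: "a \<in> semi_carrier \<longleftrightarrow> a = None \<or> (\<exists>x\<in>Arr T. a = Some x)"
  by (auto simp: semi_carrier_def T_arr)

lemma germ_pairs_iff: "(a, w) \<in> germ_pairs \<longleftrightarrow> (\<exists>x\<in>Arr T. a = Some x \<and> w \<in> cylinder (pd x))"
  by (cases a) (auto simp: germ_pairs_def semi_carrier_iff)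

lemma path_prefix_iff: "path_prefix q p \<longleftrightarrow> (\<exists>ts. p = ext q ts)"
  by (auto simp: path_prefix_def ext_def prod_eq_iff)

lemma path_rest_ext [simp]: "path_rest q (ext q ts) = (path_src q, ts)"
  by (simp add: path_rest_def)

lemma semi_mul_left:
  assumes "pr y = ext (pd x) ts"
  shows "semi_mul (Some x) (Some y) = Some (mul T (ares x ts) y)"
proof -
  obtain p g q where x: "x = (p, g, q)" by (cases x)
  obtain p' h q' where y: "y = (p', h, q')" by (cases y)
  have "path_prefix q p'" "path_rest q p' = (path_src q, ts)" using assms x y by (auto simp: path_prefix_iff)
  then show ?thesis
    by (simp add: x y T_simps ares_def path_conc_eq path_act_def path_res_def Let_def)
qed

lemma semi_mul_right:
  assumes y: "y \<in> Arr T" and pd: "pd x = ext (pr y) ts" and ts: "epath (path_src (pr y)) ts"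
  shows "semi_mul (Some x) (Some y) = Some (mul T x (ares y (list_act (ginv G (ar y)) ts)))"
proof (cases "ts = []")
  case True
  then show ?thesis using semi_mul_left[of y x "[]"] pd by simp
next
  case False
  obtain p g q where x: "x = (p, g, q)" by (cases x)
  obtain p' h q' where yy: "y = (p', h, q')" by (cases y)
  have q: "q = ext p' ts" using pd x yy by simp
  have "\<not> path_prefix q p'" using False q by (auto simp: path_prefix_iff)
  moreover have "path_prefix p' q" "path_rest p' q = (path_src p', ts)"
    using q by (auto simp: path_prefix_iff)
  ultimately show ?thesis
    by (simp add: x yy T_simps ares_def path_conc_eq path_act_def path_res_def Let_def)
qed

text \<open>Multiplication by an idempotent around \<open>w\<close> cuts \<open>x\<close> down to a
  smaller cylinder or leaves it alone. Either way the restrictions to long prefixes of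
  \<open>w\<close> stay the same.\<close>

lemma idem_restr:
  assumes x: "x \<in> Arr T" and e: "e \<in> fpaths" and w: "w \<in> cylinder (pd x)" "w \<in> cylinder e"
  shows "\<exists>y. semi_mul (Some x) (idem e) = Some y \<and> ev_prefix w (\<lambda>v. restr y v = restr x v)"
proof -
  have px: "pd x \<in> fpaths" using x by (simp add: T_arr)
  show ?thesis
  proof (rule cylinder_compare[OF px e w])
    fix ts assume ts: "epath (path_src (pd x)) ts" "e = ext (pd x) ts"
    have "semi_mul (Some x) (idem e) = Some (mul T (ares x ts) (e, path_src e, e))"
      using semi_mul_left[of "(e, path_src e, e)" x ts] ts by (simp add: idem_def)
    also have "mul T (ares x ts) (e, path_src e, e) = ares x ts"
      using T.mul_unit[OF ares_arr[OF x ts(1)]] ares_arr[OF x ts(1)] ts by (simp add: T_simps T_arr)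
    finally have "semi_mul (Some x) (idem e) = Some (ares x ts)" .
    moreover have "ev_prefix w (\<lambda>v. restr (ares x ts) v = restr x v)"
      by (rule ev_prefix_mono[OF ev_prefix_ext[OF e w(2)]])
        (auto simp: ts(2) ares_ares restr_def tail_def ext_def)
    ultimately show ?thesis by blast
  next
    fix ts assume ts: "epath (path_src e) ts" "pd x = ext e ts"
    let ?u = "(e, path_src e, e)"
    have u: "?u \<in> Arr T" by (rule T_unit[OF e])
    have eu: "path_src e \<in> unit_space G" by (rule path_src_unit[OF e])
    have "list_act (ginv G (path_src e)) ts = ts"
      using list_act_ginv[of "path_src e" ts] list_act_unit(1)[OF ts(1)] eu unit_arr unit_src ts(1) by simp
    then have "semi_mul (Some x) (idem e) = Some (mul T x (ares ?u ts))"
      using semi_mul_right[OF u, of x ts] ts by (simp add: idem_def)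
    also have "mul T x (ares ?u ts) = x"
      using ares_unit[OF e ts(1)] T.mul_unit[OF x] x ts by (simp add: T_simps T_arr)
    finally have "semi_mul (Some x) (idem e) = Some x" .
    moreover have "ev_prefix w (\<lambda>v. restr x v = restr x v)"
      by (rule ev_prefix_mono[OF ev_prefix_ext[OF e w(2)]]) simp
    ultimately show ?thesis by blast
  qed
qed

text \<open>The idempotent in the definition of germs turns into eventual equality of restrictions,
  which is stable under conjunction and under the action. Conversely, the idempotent of a common
  prefix \<open>v\<close> serves as witness.\<close>

lemma germ_mem_iff:
  assumes x: "x \<in> Arr T" and w: "w \<in> cylinder (pd x)"
  shows "(b, w') \<in> germ (Some x) w \<longleftrightarrow>
    w' = w \<and> (\<exists>y\<in>Arr T. b = Some y \<and> w \<in> cylinder (pd y) \<and> ev_prefix w (\<lambda>v. restr x v = restr y v))"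
proof
  assume "(b, w') \<in> germ (Some x) w"
  then obtain y e where y: "y \<in> Arr T" "b = Some y" "w \<in> cylinder (pd y)" "w' = w" "e \<in> fpaths"
    "w \<in> cylinder e" "semi_mul (Some x) (idem e) = semi_mul (Some y) (idem e)"
    by (auto simp: germ_def germ_pairs_iff idem_def)
  obtain x' where x': "semi_mul (Some x) (idem e) = Some x'" "ev_prefix w (\<lambda>v. restr x' v = restr x v)"
    using idem_restr[OF x y(5) w y(6)] by blast
  obtain y' where y': "semi_mul (Some y) (idem e) = Some y'" "ev_prefix w (\<lambda>v. restr y' v = restr y v)"
    using idem_restr[OF y(1,5,3,6)] by blast
  have "x' = y'" using x'(1) y'(1) y(7) by simp
  then have "ev_prefix w (\<lambda>v. restr x v = restr y v)"
    using ev_prefix_conj[OF x'(2) y'(2)] by (auto elim: ev_prefix_mono)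
  then show "w' = w \<and> (\<exists>y\<in>Arr T. b = Some y \<and> w \<in> cylinder (pd y) \<and> ev_prefix w (\<lambda>v. restr x v = restr y v))"
    using y by blast
next
  assume "w' = w \<and> (\<exists>y\<in>Arr T. b = Some y \<and> w \<in> cylinder (pd y) \<and> ev_prefix w (\<lambda>v. restr x v = restr y v))"
  then obtain y where y: "w' = w" "y \<in> Arr T" "b = Some y" "w \<in> cylinder (pd y)"
    "ev_prefix w (\<lambda>v. restr x v = restr y v)" by blast
  have f: "pd x \<in> fpaths" "pd y \<in> fpaths" using x y by (auto simp: T_arr)
  obtain v ts us where v: "v \<in> fpaths" "w \<in> cylinder v" "restr x v = restr y v"
    "epath (path_src (pd x)) ts" "v = ext (pd x) ts" "epath (path_src (pd y)) us" "v = ext (pd y) us"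
    using ev_prefix_ex[OF ev_prefix_conj[OF y(5) ev_prefix_conj[OF ev_prefix_ext[OF f(1) w] ev_prefix_ext[OF f(2) y(4)]]]]
    by metis
  have s: "semi_mul (Some z) (idem v) = Some (ares z rs)"
    if z: "z \<in> Arr T" "epath (path_src (pd z)) rs" "v = ext (pd z) rs" for z rs
  proof -
    have "semi_mul (Some z) (idem v) = Some (mul T (ares z rs) (v, path_src v, v))"
      using semi_mul_left[of "(v, path_src v, v)" z rs] z by (simp add: idem_def)
    also have "mul T (ares z rs) (v, path_src v, v) = ares z rs"
      using T.mul_unit[OF ares_arr[OF z(1,2)]] ares_arr[OF z(1,2)] z by (simp add: T_simps T_arr)
    finally show ?thesis .
  qed
  have "restr x v = ares x ts" "restr y v = ares y us" using v(5,7) restr_ext by metis+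
  then have "semi_mul (Some x) (idem v) = semi_mul (Some y) (idem v)"
    using s[OF x v(4,5)] s[OF y(2) v(6,7)] v(3) by simp
  then show "(b, w') \<in> germ (Some x) w"
    using y v by (auto simp: germ_def germ_pairs_iff idem_def intro!: bexI[of _ v])
qed

abbreviation gm :: "('g, 'x) fpath \<times> 'g \<times> ('g, 'x) fpath \<Rightarrow> ('g, 'x) bpath \<Rightarrow> (('g, 'x) semi \<times> ('g, 'x) bpath) set" where
  "gm x w \<equiv> germ (Some x) w"

lemma ev_prefix_True: "p \<in> fpaths \<Longrightarrow> w \<in> cylinder p \<Longrightarrow> (\<And>v. P v) \<Longrightarrow> ev_prefix w P"
  by (rule ev_prefix_mono[OF ev_prefix_ext])

lemma germ_eq_iff:
  assumes x: "x \<in> Arr T" "w \<in> cylinder (pd x)" and y: "y \<in> Arr T" "w' \<in> cylinder (pd y)"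
  shows "gm x w = gm y w' \<longleftrightarrow> w = w' \<and> ev_prefix w (\<lambda>v. restr x v = restr y v)"
proof
  have "pd y \<in> fpaths" using y by (simp add: T_arr)
  then have "(Some y, w') \<in> gm y w'"
    using y by (auto simp: germ_mem_iff intro: ev_prefix_True)
  moreover assume "gm x w = gm y w'"
  ultimately have "(Some y, w') \<in> gm x w" by simp
  then show "w = w' \<and> ev_prefix w (\<lambda>v. restr x v = restr y v)"
    unfolding germ_mem_iff[OF x] by (metis option.inject)
next
  assume *: "w = w' \<and> ev_prefix w (\<lambda>v. restr x v = restr y v)"
  have "ev_prefix w (\<lambda>v. restr x v = restr z v) \<longleftrightarrow> ev_prefix w (\<lambda>v. restr y v = restr z v)" for z
  proof
    assume "ev_prefix w (\<lambda>v. restr x v = restr z v)"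
    from ev_prefix_conj[OF conjunct2[OF *] this] show "ev_prefix w (\<lambda>v. restr y v = restr z v)"
      by (rule ev_prefix_mono) metis
  next
    assume "ev_prefix w (\<lambda>v. restr y v = restr z v)"
    from ev_prefix_conj[OF conjunct2[OF *] this] show "ev_prefix w (\<lambda>v. restr x v = restr z v)"
      by (rule ev_prefix_mono) metis
  qed
  then have "(b, u) \<in> gm x w \<longleftrightarrow> (b, u) \<in> gm y w'" for b u
    using germ_mem_iff[OF x] germ_mem_iff[OF y] * by simp
  then show "gm x w = gm y w'" by auto
qed

lemma gm_ares:
  assumes "x \<in> Arr T" "epath (path_src (pd x)) ts" "w \<in> cylinder (ext (pd x) ts)"
  shows "gm (ares x ts) w = gm x w"
proof -
  have f: "ext (pd x) ts \<in> fpaths" using assms by (simp add: T_arr)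
  have "ev_prefix w (\<lambda>v. restr (ares x ts) v = restr x v)"
    by (rule ev_prefix_mono[OF ev_prefix_ext[OF f assms(3)]])
      (auto simp: ares_ares restr_def tail_def ext_def)
  moreover have "w \<in> cylinder (pd x)" using cylinder_ext_subset[OF assms(2)] assms(3) by blast
  ultimately show ?thesis using germ_eq_iff[OF ares_arr[OF assms(1,2)] _ assms(1)] assms(3) by simp
qed

lemma germ_act_eq:
  assumes x: "x \<in> Arr T" "w \<in> cylinder (pd x)" and y: "y \<in> Arr T" "w \<in> cylinder (pd y)" and eq: "gm x w = gm y w"
  shows "act x w = act y w"
proof -
  have f: "pd x \<in> fpaths" "pd y \<in> fpaths" using x y by (auto simp: T_arr)
  have ev: "ev_prefix w (\<lambda>v. restr x v = restr y v)" using eq germ_eq_iff[OF x y] by simp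
  obtain v ts us where v: "v \<in> fpaths" "w \<in> cylinder v" "restr x v = restr y v"
    "epath (path_src (pd x)) ts" "v = ext (pd x) ts" "epath (path_src (pd y)) us" "v = ext (pd y) us"
    using ev_prefix_ex[OF ev_prefix_conj[OF ev ev_prefix_conj[OF ev_prefix_ext[OF f(1) x(2)] ev_prefix_ext[OF f(2) y(2)]]]]
    by metis
  have "restr x v = ares x ts" "restr y v = ares y us" using v(5,7) restr_ext by metis+
  then show ?thesis
    using act_ares[OF x(1) v(4), of w] act_ares[OF y(1) v(6), of w] v by simp
qed

lemma unit_germ_eq:
  assumes "p \<in> fpaths" "w \<in> cylinder p"
  shows "unit_germ w = gm (p, path_src p, p) w"
proof -
  have w: "w \<in> bpaths_at (fst p)" using cylinder_bpaths[OF assms] .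
  have v: "fst p \<in> unit_space G" using assms(1) by (auto simp: fpaths_iff dest: epath_unit)
  let ?r = "(fst p, [])"
  have r: "?r \<in> fpaths" "w \<in> cylinder ?r" "path_src ?r = fst p" "p = ext ?r (snd p)"
    using v w cylinder_root by (auto simp: fpaths_iff ext_def)
  have "epath (path_src ?r) (snd p)" using assms(1) by (simp add: fpaths_iff)
  then have "ares (?r, path_src ?r, ?r) (snd p) = (p, path_src p, p)"
    using ares_unit[OF r(1), of "snd p"] r(4) by simp
  moreover have "unit_germ w = gm (?r, path_src ?r, ?r) w"
    using w by (simp add: unit_germ_def idem_def bpaths_at_def)
  ultimately show ?thesis
    using gm_ares[OF T_unit[OF r(1)], of "snd p" w] \<open>epath (path_src ?r) (snd p)\<close> r(4) assms(2) by simp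
qed

lemma unit_germ_inj:
  assumes "p \<in> fpaths" "w \<in> cylinder p" "p' \<in> fpaths" "w' \<in> cylinder p'" "unit_germ w = unit_germ w'"
  shows "w = w'"
  using germ_eq_iff[OF T_unit[OF assms(1)] _ T_unit[OF assms(3)], of w w'] assms
    unit_germ_eq[OF assms(1,2)] unit_germ_eq[OF assms(3,4)] by simp

subsection \<open>The structure maps of the groupoid of germs\<close>

abbreviation GG where "GG \<equiv> germ_groupoid"

lemma GG_arr: "\<gamma> \<in> Arr GG \<longleftrightarrow> (\<exists>x\<in>Arr T. \<exists>w\<in>cylinder (pd x). \<gamma> = gm x w)"
  by (auto simp: germ_groupoid_def germ_pairs_iff)

lemma GG_src:
  assumes x: "x \<in> Arr T" "w \<in> cylinder (pd x)"
  shows "src GG (gm x w) = unit_germ w"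
  unfolding germ_groupoid_def groupoid.simps
proof (rule the_equality)
  show "\<exists>a w'. (a, w') \<in> germ_pairs \<and> gm x w = germ a w' \<and> unit_germ w = unit_germ w'"
    using x by (auto simp: germ_pairs_iff)
  fix u assume "\<exists>a w'. (a, w') \<in> germ_pairs \<and> gm x w = germ a w' \<and> u = unit_germ w'"
  then obtain y w' where y: "y \<in> Arr T" "w' \<in> cylinder (pd y)" "gm x w = gm y w'" "u = unit_germ w'"
    unfolding germ_pairs_iff by metis
  then show "u = unit_germ w" using germ_eq_iff[OF x y(1,2)] by simp
qed

lemma GG_rng:
  assumes x: "x \<in> Arr T" "w \<in> cylinder (pd x)"
  shows "rng GG (gm x w) = unit_germ (act x w)"
  unfolding germ_groupoid_def groupoid.simps
proof (rule the_equality)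
  show "\<exists>a w'. (a, w') \<in> germ_pairs \<and> gm x w = germ a w' \<and> unit_germ (act x w) = unit_germ (semi_act a w')"
    using x by (auto simp: germ_pairs_iff act_def intro!: exI[of _ "Some x"] exI[of _ w])
  fix u assume "\<exists>a w'. (a, w') \<in> germ_pairs \<and> gm x w = germ a w' \<and> u = unit_germ (semi_act a w')"
  then obtain y w' where y: "y \<in> Arr T" "w' \<in> cylinder (pd y)" "gm x w = gm y w'" "u = unit_germ (act y w')"
    by (auto simp: germ_pairs_iff act_def)
  have w: "w = w'" using germ_eq_iff[OF x y(1,2)] y(3) by blast
  show "u = unit_germ (act x w)"
    using germ_act_eq[OF x y(1) y(2)[folded w] y(3)[folded w]] y(4) w by simp
qed

text \<open>The two branches of \<open>semi_mul\<close> merge under restriction: along long prefixes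
  of \<open>w\<close> the inner paths coincide and the product is taken in \<open>T\<close>.\<close>

lemma semi_mul_restr:
  assumes x: "x \<in> Arr T" and y: "y \<in> Arr T" "w \<in> cylinder (pd y)" "act y w \<in> cylinder (pd x)"
  shows "\<exists>z\<in>Arr T. semi_mul (Some x) (Some y) = Some z \<and> w \<in> cylinder (pd z) \<and>
    ev_prefix w (\<lambda>v. restr z v = mul T (restr x (pr (restr y v))) (restr y v))"
proof -
  have f: "pd x \<in> fpaths" "pr y \<in> fpaths" "pd y \<in> fpaths" using x y by (auto simp: T_arr)
  show ?thesis
  proof (rule cylinder_compare[OF f(1,2) y(3) act_cylinder[OF y(1,2)]])
    fix ts assume ts: "epath (path_src (pd x)) ts" "pr y = ext (pd x) ts"
    let ?x = "ares x ts"
    have x': "?x \<in> Arr T" "pd ?x = pr y" using ares_arr[OF x ts(1)] ts by auto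
    have z: "mul T ?x y \<in> Arr T" using T.mul_closed[OF x'(1) y(1)] T_comp[OF x'(1) y(1)] x'(2) by blast
    have pdz: "pd (mul T ?x y) = pd y" by (simp add: T_simps)
    have "ev_prefix w (\<lambda>v. restr (mul T ?x y) v = mul T (restr x (pr (restr y v))) (restr y v))"
    proof (rule ev_prefix_mono[OF ev_prefix_ext[OF f(3) y(2)]])
      fix v assume "\<exists>us. epath (path_src (pd y)) us \<and> v = ext (pd y) us"
      then obtain us where us: "epath (path_src (pd y)) us" "v = ext (pd y) us" by blast
      have "restr (mul T ?x y) v = ares (mul T ?x y) us"
        using us pdz restr_ext[of "mul T ?x y" us] by simp
      also have "\<dots> = mul T (ares x (ts @ list_act (ar y) us)) (ares y us)"
        using ares_mul[OF x'(1) y(1) x'(2) us(1)] by (simp add: ares_ares)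
      also have "ares x (ts @ list_act (ar y) us) = restr x (pr (ares y us))"
        using ts(2) restr_ext[of x "ts @ list_act (ar y) us"] by simp
      finally show "restr (mul T ?x y) v = mul T (restr x (pr (restr y v))) (restr y v)"
        using us(2) by simp
    qed
    then show ?thesis using semi_mul_left[OF ts(2)] z pdz y(2) by auto
  next
    fix ts assume ts: "epath (path_src (pr y)) ts" "pd x = ext (pr y) ts"
    obtain rs where rs: "epath (src G (ar y)) rs" "list_act (ar y) rs = ts" "rs = list_act (ginv G (ar y)) ts"
      using list_act_surj[of "ar y" ts] ts y by (auto simp: T_arr)
    have rs': "epath (path_src (pd y)) rs" using rs y by (simp add: T_arr)
    let ?y = "ares y rs"
    have y': "?y \<in> Arr T" "pd x = pr ?y" using ares_arr[OF y(1) rs'] ts rs by auto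
    have wy: "w \<in> cylinder (pd ?y)" using act_ext_iff[OF y(1) rs' y(2)] y(3) ts rs by simp
    have z: "mul T x ?y \<in> Arr T" using T.mul_closed[OF x y'(1)] T_comp[OF x y'(1)] y'(2) by blast
    have pdz: "pd (mul T x ?y) = pd ?y" by (simp add: T_simps)
    have fy: "pd ?y \<in> fpaths" using y' by (simp add: T_arr)
    have "ev_prefix w (\<lambda>v. restr (mul T x ?y) v = mul T (restr x (pr (restr y v))) (restr y v))"
    proof (rule ev_prefix_mono[OF ev_prefix_ext[OF fy wy]])
      fix v assume "\<exists>us. epath (path_src (pd ?y)) us \<and> v = ext (pd ?y) us"
      then obtain us where us: "epath (path_src (pd ?y)) us" "v = ext (pd ?y) us" by blast
      have v: "v = ext (pd y) (rs @ us)" using us by simp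
      have "restr (mul T x ?y) v = ares (mul T x ?y) us"
        using us pdz restr_ext[of "mul T x ?y" us] by simp
      also have "\<dots> = mul T (ares x (list_act (ar ?y) us)) (ares ?y us)"
        using ares_mul[OF x y'(1) y'(2) us(1)] by simp
      also have "ares x (list_act (ar ?y) us) = restr x (pr (ares y (rs @ us)))"
        using restr_ext[of x "list_act (ar ?y) us"] ts rs by (simp add: list_act_append)
      finally show "restr (mul T x ?y) v = mul T (restr x (pr (restr y v))) (restr y v)"
        unfolding v restr_ext by (simp only: ares_ares)
    qed
    then show ?thesis using semi_mul_right[OF y(1) ts(2,1)] rs z pdz wy by auto
  qed
qed

text \<open>Independence of representatives. The second factors agree along prefixes of
  \<open>w\<close>, the first factors along prefixes of \<open>act y w\<close>, and
  \<open>ev_prefix_act\<close> pulls the latter back to \<open>w\<close>.\<close>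

lemma GG_mul_aux:
  assumes x: "x \<in> Arr T" and y: "y \<in> Arr T" "w \<in> cylinder (pd y)" "act y w \<in> cylinder (pd x)"
    and x': "x' \<in> Arr T" and y': "y' \<in> Arr T" "w' \<in> cylinder (pd y')" "act y' w' \<in> cylinder (pd x')"
    and eq: "gm x (act y w) = gm x' (act y' w')" "gm y w = gm y' w'"
  shows "germ (semi_mul (Some x) (Some y)) w = germ (semi_mul (Some x') (Some y')) w'"
proof -
  obtain z where z: "z \<in> Arr T" "semi_mul (Some x) (Some y) = Some z" "w \<in> cylinder (pd z)"
    "ev_prefix w (\<lambda>v. restr z v = mul T (restr x (pr (restr y v))) (restr y v))"
    using semi_mul_restr[OF x y] by blast
  obtain z' where z': "z' \<in> Arr T" "semi_mul (Some x') (Some y') = Some z'" "w' \<in> cylinder (pd z')"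
    "ev_prefix w' (\<lambda>v. restr z' v = mul T (restr x' (pr (restr y' v))) (restr y' v))"
    using semi_mul_restr[OF x' y'] by blast
  have w: "w = w'" and 1: "ev_prefix w (\<lambda>v. restr y v = restr y' v)"
    using eq(2) germ_eq_iff[OF y(1,2) y'(1,2)] by auto
  have "ev_prefix (act y w) (\<lambda>v. restr x v = restr x' v)"
    using eq(1) germ_eq_iff[OF x y(3) x' y'(3)] by auto
  from ev_prefix_act[OF y(1,2) this]
  have 2: "ev_prefix w (\<lambda>v. restr x (pr (restr y v)) = restr x' (pr (restr y v)))" .
  have "ev_prefix w (\<lambda>v. restr z v = restr z' v)"
    by (rule ev_prefix_mono[OF ev_prefix_conj[OF ev_prefix_conj[OF 1 2] ev_prefix_conj[OF z(4) z'(4)[folded w]]]]) auto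
  then show ?thesis using germ_eq_iff[OF z(1,3) z'(1,3)] z z' w by simp
qed

text \<open>The case of matching representatives suffices, because every composable tuple of germs
  is \<open>zpt\<close> of a composable tuple of \<open>T\<close>
  (\<open>nerve_GG_zpt\<close>).\<close>

lemma GG_mul:
  assumes x: "x \<in> Arr T" and y: "y \<in> Arr T" "w \<in> cylinder (pd y)" and c: "pd x = pr y"
  shows "mul GG (gm x (act y w)) (gm y w) = gm (mul T x y) w"
  unfolding germ_groupoid_def groupoid.simps
proof (rule the_equality)
  have a: "act y w \<in> cylinder (pd x)" using act_cylinder[OF y] c by simp
  have s: "semi_mul (Some x) (Some y) = Some (mul T x y)" using semi_mul_left[of y x "[]"] c by simp
  show "\<exists>a b w'. (b, w') \<in> germ_pairs \<and> (a, semi_act b w') \<in> germ_pairs \<and>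
      gm x (act y w) = germ a (semi_act b w') \<and> gm y w = germ b w' \<and> gm (mul T x y) w = germ (semi_mul a b) w'"
    using x y a by (intro exI[of _ "Some x"] exI[of _ "Some y"] exI[of _ w]) (simp add: s germ_pairs_iff flip: act_def)
  fix u assume "\<exists>a b w'. (b, w') \<in> germ_pairs \<and> (a, semi_act b w') \<in> germ_pairs \<and>
      gm x (act y w) = germ a (semi_act b w') \<and> gm y w = germ b w' \<and> u = germ (semi_mul a b) w'"
  then obtain x' y' w' where *: "y' \<in> Arr T" "w' \<in> cylinder (pd y')" "x' \<in> Arr T" "act y' w' \<in> cylinder (pd x')"
    "gm x (act y w) = gm x' (act y' w')" "gm y w = gm y' w'" "u = germ (semi_mul (Some x') (Some y')) w'"
    by (auto simp: germ_pairs_iff act_def)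
  then show "u = gm (mul T x y) w"
    using GG_mul_aux[OF x y a *(3) *(1,2,4) *(5,6)] s by simp
qed

end

section \<open>Tuples of germs\<close>

lemma nerve_one: "gs \<in> nerve G (Suc 0) \<longleftrightarrow> (\<exists>x\<in>Arr G. gs = [x])"
  by (auto simp: nerve_def length_Suc_conv)

lemma nerve_Cons: "x # gs \<in> nerve G (Suc (Suc n)) \<longleftrightarrow> x \<in> Arr G \<and> gs \<in> nerve G (Suc n) \<and> src G x = rng G (hd gs)"
proof -
  have "(\<forall>i. Suc i < Suc (Suc n) \<longrightarrow> src G ((x # gs) ! i) = rng G ((x # gs) ! Suc i)) \<longleftrightarrow>
    src G x = rng G (hd gs) \<and> (\<forall>i. Suc i < Suc n \<longrightarrow> src G (gs ! i) = rng G (gs ! Suc i))"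
    if "length gs = Suc n"
  proof -
    have "hd gs = gs ! 0" using that by (cases gs) auto
    then show ?thesis by (auto simp: nth_Cons split: nat.splits)
  qed
  then show ?thesis by (auto simp: nerve_def)
qed

lemma face_first: "xs \<noteq> [] \<Longrightarrow> face G (Suc (length xs)) 0 (x # xs) = xs"
  by (simp add: face_def)

lemma face_last: "xs \<noteq> [] \<Longrightarrow> face G (Suc (length xs)) (Suc (length xs)) (xs @ [x]) = xs"
  by (simp add: face_def)

lemma face_mid: "face G (Suc (Suc (length as + length bs))) (Suc (length as)) (as @ x # y # bs) = as @ mul G x y # bs"
  by (simp add: face_def nth_append)

lemma face_one: "face G (Suc 0) 0 [x] = [src G x]" "face G (Suc 0) (Suc 0) [x] = [rng G x]"
  by (simp_all add: face_def)

text \<open>Each case splits \<open>gs\<close> as a concatenation, so that functions defined by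
  recursion on tuples compute on the face.\<close>

lemma face_cases:
  assumes "length gs = Suc n" "i \<le> Suc n"
  obtains (src) x where "n = 0" "i = 0" "gs = [x]" | (rng) x where "n = 0" "i = 1" "gs = [x]"
  | (first) x xs where "xs \<noteq> []" "gs = x # xs" "i = 0" "n = length xs"
  | (last) x xs where "xs \<noteq> []" "gs = xs @ [x]" "i = Suc n" "n = length xs"
  | (mid) as x y bs where "gs = as @ x # y # bs" "i = Suc (length as)" "n = Suc (length as + length bs)"
proof (cases n)
  case 0
  then show ?thesis using assms src rng by (auto simp: length_Suc_conv le_Suc_eq)
next
  case (Suc m)
  consider "i = 0" | "i = Suc n" | k where "i = Suc k" "k < n"
    using assms(2) by (cases i) (auto simp: le_less)
  then show ?thesis
  proof cases
    case 1
    obtain x xs where "gs = x # xs" using assms(1) by (cases gs) auto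
    then show ?thesis using first[of xs x] assms(1) Suc 1 by (metis Suc_inject length_Cons length_0_conv nat.distinct(1))
  next
    case 2
    obtain xs x where "gs = xs @ [x]" using assms(1) by (cases gs rule: rev_cases) auto
    then show ?thesis using last[of xs x] assms(1) Suc 2 by (metis Suc_inject length_append_singleton length_0_conv nat.distinct(1))
  next
    case 3
    then have "Suc k < length gs" using assms(1) by simp
    then have "gs = take k gs @ gs ! k # gs ! Suc k # drop (Suc (Suc k)) gs"
      by (metis Cons_nth_drop_Suc Suc_lessD append_take_drop_id)
    then show ?thesis
      using 3 assms(1) by (intro mid[of "take k gs" "gs ! k" "gs ! Suc k" "drop (Suc (Suc k)) gs"]) auto
  qed
qed

section \<open>Composable tuples of triples and their germs\<close>

context graph_picture
begin

text \<open>The empty tuple is excluded because degree 0 is represented by one-element lists of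
  units.\<close>

primrec tchain :: "(('g, 'x) fpath \<times> 'g \<times> ('g, 'x) fpath) list \<Rightarrow> bool" where
  "tchain [] \<longleftrightarrow> False"
| "tchain (x # xs) \<longleftrightarrow> x \<in> Arr T \<and> (xs \<noteq> [] \<longrightarrow> tchain xs \<and> pd x = pr (hd xs))"

definition tsrc :: "(('g, 'x) fpath \<times> 'g \<times> ('g, 'x) fpath) list \<Rightarrow> ('g, 'x) fpath" where
  "tsrc xs = pd (last xs)"

primrec tact :: "(('g, 'x) fpath \<times> 'g \<times> ('g, 'x) fpath) list \<Rightarrow> ('g, 'x) bpath \<Rightarrow> ('g, 'x) bpath" where
  "tact [] w = w"
| "tact (x # xs) w = act x (tact xs w)"

primrec tlact :: "(('g, 'x) fpath \<times> 'g \<times> ('g, 'x) fpath) list \<Rightarrow> 'x list \<Rightarrow> 'x list" where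
  "tlact [] ts = ts"
| "tlact (x # xs) ts = list_act (ar x) (tlact xs ts)"

primrec tres :: "(('g, 'x) fpath \<times> 'g \<times> ('g, 'x) fpath) list \<Rightarrow> 'x list \<Rightarrow> (('g, 'x) fpath \<times> 'g \<times> ('g, 'x) fpath) list" where
  "tres [] ts = []"
| "tres (x # xs) ts = ares x (tlact xs ts) # tres xs ts"

text \<open>Each germ sits over the image of \<open>w\<close> under the arrows to its right, which
  makes neighbouring germs composable.\<close>

primrec zpt :: "(('g, 'x) fpath \<times> 'g \<times> ('g, 'x) fpath) list \<Rightarrow> ('g, 'x) bpath \<Rightarrow> (('g, 'x) semi \<times> ('g, 'x) bpath) set list" where
  "zpt [] w = []"
| "zpt (x # xs) w = gm x (tact xs w) # zpt xs w"

definition trestr :: "(('g, 'x) fpath \<times> 'g \<times> ('g, 'x) fpath) list \<Rightarrow> ('g, 'x) fpath \<Rightarrow> (('g, 'x) fpath \<times> 'g \<times> ('g, 'x) fpath) list" where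
  "trestr xs v = tres xs (tail (tsrc xs) v)"

lemma trestr_ext [simp]: "trestr xs (ext (tsrc xs) ts) = tres xs ts"
  by (simp add: trestr_def)

lemma trestr_single: "trestr [x] v = [restr x v]"
  by (simp add: trestr_def restr_def tsrc_def)

lemma tsrc_Cons: "tsrc (x # xs) = (if xs = [] then pd x else tsrc xs)"
  by (simp add: tsrc_def)

lemma length_tres [simp]: "length (tres xs ts) = length xs"
  and length_zpt [simp]: "length (zpt xs w) = length xs"
  by (induction xs) auto

lemma tres_eq_Nil [simp]: "tres xs ts = [] \<longleftrightarrow> xs = []"
  using length_tres[of xs ts] by (metis length_0_conv)

lemma tlact_Nil [simp]: "tlact xs [] = []"
  by (induction xs) auto

lemma tres_Nil [simp]: "tres xs [] = xs"
  by (induction xs) auto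

lemma tlact_append_list: "tlact xs (ts @ us) = tlact xs ts @ tlact (tres xs ts) us"
  by (induction xs) (auto simp: list_act_append)

lemma tres_tres: "tres (tres xs ts) us = tres xs (ts @ us)"
  by (induction xs) (auto simp: ares_ares tlact_append_list)

lemma tact_append: "tact (xs @ ys) w = tact xs (tact ys w)"
  and tlact_append: "tlact (xs @ ys) ts = tlact xs (tlact ys ts)"
  and tres_append: "tres (xs @ ys) ts = tres xs (tlact ys ts) @ tres ys ts"
  and zpt_append: "zpt (xs @ ys) w = zpt xs (tact ys w) @ zpt ys w"
  by (induction xs) (auto simp: tlact_def)

lemma tchain_append:
  "xs \<noteq> [] \<Longrightarrow> ys \<noteq> [] \<Longrightarrow> tchain (xs @ ys) \<longleftrightarrow> tchain xs \<and> tchain ys \<and> tsrc xs = pr (hd ys)"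
proof (induction xs)
  case (Cons x xs)
  then show ?case by (cases xs) (auto simp: tsrc_Cons)
qed simp

lemma tsrc_append: "ys \<noteq> [] \<Longrightarrow> tsrc (xs @ ys) = tsrc ys"
  by (simp add: tsrc_def)

lemma tchain_arr: "tchain xs \<Longrightarrow> x \<in> set xs \<Longrightarrow> x \<in> Arr T"
  by (induction xs) (auto split: if_splits)

lemma tchain_tsrc: "tchain xs \<Longrightarrow> tsrc xs \<in> fpaths"
  using tchain_arr[of xs "last xs"] by (cases xs) (auto simp: tsrc_def T_arr)

lemma tchain_hd: "tchain xs \<Longrightarrow> pr (hd xs) \<in> fpaths"
  using tchain_arr[of xs "hd xs"] by (cases xs) (auto simp: T_arr)

lemma tchain_tres:
  assumes "tchain xs" "epath (path_src (tsrc xs)) ts"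
  shows "tchain (tres xs ts) \<and> tsrc (tres xs ts) = ext (tsrc xs) ts \<and>
    pr (hd (tres xs ts)) = ext (pr (hd xs)) (tlact xs ts) \<and> epath (path_src (pr (hd xs))) (tlact xs ts)"
  using assms
proof (induction xs)
  case (Cons x xs)
  have x: "x \<in> Arr T" using Cons.prems by simp
  have l: "epath (path_src (pr x)) (list_act (ar x) us)" if "epath (path_src (pd x)) us" for us
    using list_act(1)[of "ar x" us] x that by (simp add: T_arr)
  show ?case
  proof (cases "xs = []")
    case True
    then show ?thesis using Cons.prems x l ares_arr[OF x] by (simp add: tsrc_def)
  next
    case False
    then have c: "tchain xs" "pd x = pr (hd xs)" "epath (path_src (tsrc xs)) ts"
      using Cons.prems by (auto simp: tsrc_Cons)
    note IH = Cons.IH[OF c(1,3)]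
    show ?thesis
      using False IH c l ares_arr[OF x, of "tlact xs ts"] by (simp add: tsrc_Cons)
  qed
qed simp

lemma tact_ext:
  assumes "tchain xs" "epath (path_src (tsrc xs)) ts" "w \<in> cylinder (ext (tsrc xs) ts)"
  shows "tact xs w \<in> cylinder (ext (pr (hd xs)) (tlact xs ts))"
  using assms
proof (induction xs)
  case (Cons x xs)
  have x: "x \<in> Arr T" using Cons.prems by simp
  show ?case
  proof (cases "xs = []")
    case True
    then show ?thesis using Cons.prems act_ext[OF x] by (simp add: tsrc_def)
  next
    case False
    then have c: "tchain xs" "pd x = pr (hd xs)" "epath (path_src (tsrc xs)) ts"
      "w \<in> cylinder (ext (tsrc xs) ts)" using Cons.prems by (auto simp: tsrc_Cons)
    then show ?thesis
      using Cons.IH[OF c(1,3,4)] act_ext[OF x] tchain_tres[OF c(1,3)] by simp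
  qed
qed simp

lemma tact_cylinder:
  assumes "tchain xs" "w \<in> cylinder (tsrc xs)"
  shows "tact xs w \<in> cylinder (pr (hd xs))"
  using tact_ext[OF assms(1), of "[]" w] assms(2) path_src_unit[OF tchain_tsrc[OF assms(1)]] by simp

lemma tact_tres:
  assumes "tchain xs" "epath (path_src (tsrc xs)) ts" "w \<in> cylinder (ext (tsrc xs) ts)"
  shows "tact (tres xs ts) w = tact xs w" "zpt (tres xs ts) w = zpt xs w"
proof -
  have "tact (tres xs ts) w = tact xs w \<and> zpt (tres xs ts) w = zpt xs w"
    using assms
  proof (induction xs)
    case (Cons x xs)
    have x: "x \<in> Arr T" using Cons.prems by simp
    show ?case
    proof (cases "xs = []")
      case True
      then show ?thesis using Cons.prems act_ares[OF x] gm_ares[OF x] by (simp add: tsrc_def)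
    next
      case False
      then have c: "tchain xs" "pd x = pr (hd xs)" "epath (path_src (tsrc xs)) ts"
        "w \<in> cylinder (ext (tsrc xs) ts)" using Cons.prems by (auto simp: tsrc_Cons)
      have e: "epath (path_src (pd x)) (tlact xs ts)" "tact xs w \<in> cylinder (ext (pd x) (tlact xs ts))"
        using tchain_tres[OF c(1,3)] tact_ext[OF c(1,3,4)] c(2) by auto
      then show ?thesis
        using Cons.IH[OF c(1,3,4)] act_ares[OF x e] gm_ares[OF x e] by simp
    qed
  qed simp
  then show "tact (tres xs ts) w = tact xs w" "zpt (tres xs ts) w = zpt xs w" by auto
qed

lemma trestr_Cons:
  assumes "tchain (x # xs)" "xs \<noteq> []" "epath (path_src (tsrc xs)) ts" "v = ext (tsrc xs) ts"
  shows "trestr (x # xs) v = restr x (pr (hd (trestr xs v))) # trestr xs v"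
proof -
  have c: "tchain xs" "pd x = pr (hd xs)" "tsrc (x # xs) = tsrc xs" using assms by (auto simp: tsrc_Cons)
  have h: "pr (hd (tres xs ts)) = ext (pd x) (tlact xs ts)" using tchain_tres[OF c(1) assms(3)] c by simp
  have "trestr (x # xs) v = tres (x # xs) ts" using assms(4) c(3) by (simp add: trestr_def)
  then show ?thesis using assms(4) h by simp
qed

lemma ev_prefix_tact:
  assumes "tchain xs" "w \<in> cylinder (tsrc xs)" "ev_prefix (tact xs w) P"
  shows "ev_prefix w (\<lambda>v. P (pr (hd (trestr xs v))))"
  using assms
proof (induction xs arbitrary: P)
  case (Cons x xs)
  have x: "x \<in> Arr T" using Cons.prems by simp
  show ?case
  proof (cases "xs = []")
    case True
    then show ?thesis
      using Cons.prems ev_prefix_act[OF x, of w P] by (simp add: tsrc_def trestr_def restr_def)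
  next
    case False
    then have c: "tchain xs" "pd x = pr (hd xs)" "w \<in> cylinder (tsrc xs)" "tchain (x # xs)"
      using Cons.prems by (auto simp: tsrc_Cons)
    have "tact xs w \<in> cylinder (pd x)" using tact_cylinder[OF c(1,3)] c(2) by simp
    from ev_prefix_act[OF x this] Cons.prems(3)
    have "ev_prefix (tact xs w) (\<lambda>v. P (pr (restr x v)))" by simp
    from ev_prefix_conj[OF Cons.IH[OF c(1,3) this] ev_prefix_ext[OF tchain_tsrc[OF c(1)] c(3)]]
    show ?thesis
    proof (rule ev_prefix_mono)
      fix v assume "P (pr (restr x (pr (hd (trestr xs v))))) \<and> (\<exists>ts. epath (path_src (tsrc xs)) ts \<and> v = ext (tsrc xs) ts)"
      then obtain ts where "epath (path_src (tsrc xs)) ts" "v = ext (tsrc xs) ts"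
        "P (pr (restr x (pr (hd (trestr xs v)))))" by blast
      then show "P (pr (hd (trestr (x # xs) v)))" using trestr_Cons[OF c(4) False, of ts v] by simp
    qed
  qed
qed simp

lemma ev_prefix_tsrc:
  assumes "tchain xs" "w \<in> cylinder (tsrc xs)"
  shows "ev_prefix w (\<lambda>v. \<exists>ts. epath (path_src (tsrc xs)) ts \<and> v = ext (tsrc xs) ts)"
  using ev_prefix_ext[OF tchain_tsrc[OF assms(1)] assms(2)] .

text \<open>Equality of germs gives a condition along the prefixes of a different base point in each
  position; \<open>ev_prefix_tact\<close> brings all of them back to prefixes of
  \<open>w\<close>.\<close>

lemma zpt_eqD:
  assumes "tchain xs" "w \<in> cylinder (tsrc xs)" "tchain ys" "w' \<in> cylinder (tsrc ys)" "zpt xs w = zpt ys w'"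
  shows "w = w' \<and> ev_prefix w (\<lambda>v. trestr xs v = trestr ys v)"
  using assms
proof (induction xs arbitrary: ys)
  case (Cons x xs)
  obtain y ys' where ys: "ys = y # ys'" using Cons.prems by (cases ys) auto
  have x: "x \<in> Arr T" and y: "y \<in> Arr T" using Cons.prems ys by auto
  have len: "length xs = length ys'" using arg_cong[OF Cons.prems(5), of length] ys by simp
  show ?case
  proof (cases "xs = []")
    case True
    then have "ys' = []" using len by simp
    then have "gm x w = gm y w'" "w \<in> cylinder (pd x)" "w' \<in> cylinder (pd y)"
      using Cons.prems ys True by (auto simp: tsrc_def)
    then have "w = w'" "ev_prefix w (\<lambda>v. restr x v = restr y v)" using germ_eq_iff[OF x _ y] by blast+
    moreover have "trestr (x # xs) v = trestr ys v \<longleftrightarrow> restr x v = restr y v" for v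
      by (simp add: ys True \<open>ys' = []\<close> trestr_single)
    ultimately show ?thesis by simp
  next
    case False
    then have ys': "ys' \<noteq> []" using len by auto
    have c: "tchain xs" "pd x = pr (hd xs)" "w \<in> cylinder (tsrc xs)"
      "tchain ys'" "pd y = pr (hd ys')" "w' \<in> cylinder (tsrc ys')"
      using Cons.prems ys ys' False by (auto simp: tsrc_Cons)
    have z: "gm x (tact xs w) = gm y (tact ys' w')" "zpt xs w = zpt ys' w'" using Cons.prems(5) ys by auto
    have IH: "w = w'" "ev_prefix w (\<lambda>v. trestr xs v = trestr ys' v)"
      using Cons.IH[OF c(1,3,4,6) z(2)] by auto
    have t: "tact xs w \<in> cylinder (pd x)" "tact ys' w' \<in> cylinder (pd y)"
      using tact_cylinder c by auto
    have "ev_prefix (tact xs w) (\<lambda>v. restr x v = restr y v)"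
      using z(1) germ_eq_iff[OF x t(1) y t(2)] by blast
    from ev_prefix_tact[OF c(1,3) this]
    have "ev_prefix w (\<lambda>v. restr x (pr (hd (trestr xs v))) = restr y (pr (hd (trestr xs v))))" .
    from ev_prefix_conj[OF ev_prefix_conj[OF this IH(2)] ev_prefix_conj[OF ev_prefix_tsrc[OF c(1,3)] ev_prefix_tsrc[OF c(4) c(6)[folded IH(1)]]]]
    have "ev_prefix w (\<lambda>v. trestr (x # xs) v = trestr ys v)"
    proof (rule ev_prefix_mono)
      fix v assume v: "(restr x (pr (hd (trestr xs v))) = restr y (pr (hd (trestr xs v))) \<and> trestr xs v = trestr ys' v) \<and>
        (\<exists>ts. epath (path_src (tsrc xs)) ts \<and> v = ext (tsrc xs) ts) \<and>
        (\<exists>ts. epath (path_src (tsrc ys')) ts \<and> v = ext (tsrc ys') ts)"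
      obtain ts us where "epath (path_src (tsrc xs)) ts" "v = ext (tsrc xs) ts"
        "epath (path_src (tsrc ys')) us" "v = ext (tsrc ys') us" using v by blast
      then have "trestr (x # xs) v = restr x (pr (hd (trestr xs v))) # trestr xs v"
        "trestr (y # ys') v = restr y (pr (hd (trestr ys' v))) # trestr ys' v"
        using trestr_Cons[OF Cons.prems(1) False] trestr_Cons[of y ys'] Cons.prems(3) ys ys' by metis+
      then show "trestr (x # xs) v = trestr ys v" using v ys by metis
    qed
    then show ?thesis using IH(1) by blast
  qed
qed simp

lemma zpt_inj: "tchain xs \<Longrightarrow> w \<in> cylinder (tsrc xs) \<Longrightarrow> w' \<in> cylinder (tsrc xs) \<Longrightarrow> zpt xs w = zpt xs w' \<Longrightarrow> w = w'"
  using zpt_eqD by blast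

subsection \<open>Simplices of the groupoid of germs\<close>

lemma nerve_T_Suc: "xs \<in> nerve T (Suc n) \<longleftrightarrow> tchain xs \<and> length xs = Suc n"
proof (induction n arbitrary: xs)
  case 0
  then show ?case by (auto simp: nerve_one length_Suc_conv)
next
  case (Suc n)
  show ?case
  proof (cases xs)
    case Nil
    then show ?thesis by (auto simp: nerve_def)
  next
    case (Cons x ys)
    have "src T x = rng T (hd ys) \<longleftrightarrow> pd x = pr (hd ys)" if "x \<in> Arr T" "tchain ys"
      using T_comp[OF that(1), of "hd ys"] tchain_arr[OF that(2), of "hd ys"] that by (cases ys) auto
    then show ?thesis unfolding Cons nerve_Cons Suc.IH by auto
  qed
qed

lemma nerve_T_0: "xs \<in> nerve T 0 \<longleftrightarrow> (\<exists>p\<in>fpaths. xs = [(p, path_src p, p)])"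
  unfolding T.nerve_0 Bex_def pullback_unit using path_src_unit by blast

lemma nerve_tchain: "xs \<in> nerve T n \<Longrightarrow> tchain xs"
  using T_unit by (cases n) (auto simp: nerve_T_Suc nerve_T_0 simp del: path_src_pair)

lemma tres_nerve:
  assumes "xs \<in> nerve T n" "epath (path_src (tsrc xs)) ts"
  shows "tres xs ts \<in> nerve T n"
proof (cases n)
  case 0
  then obtain p where "p \<in> fpaths" "xs = [(p, path_src p, p)]" using assms by (auto simp: nerve_T_0)
  then show ?thesis using assms 0 by (auto simp: nerve_T_0 ares_unit tsrc_def)
next
  case (Suc m)
  then show ?thesis using assms tchain_tres[of xs ts] by (simp add: nerve_T_Suc)
qed

lemma unit_germ_unit:
  assumes "p \<in> fpaths" "w \<in> cylinder p"
  shows "unit_germ w \<in> unit_space GG"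
proof -
  have "gm (p, path_src p, p) w \<in> Arr GG" using T_unit[OF assms(1)] assms(2) unfolding GG_arr by force
  then show ?thesis
    using GG_src[OF T_unit[OF assms(1)], of w] assms(2) unfolding unit_space_def by (metis imageI snd_conv)
qed

lemma hd_zpt:
  assumes "tchain xs" "w \<in> cylinder (tsrc xs)"
  shows "hd (zpt xs w) \<in> Arr GG" "rng GG (hd (zpt xs w)) = unit_germ (tact xs w)"
proof -
  obtain x ys where xs: "xs = x # ys" using assms by (cases xs) auto
  then have x: "x \<in> Arr T" using assms by simp
  have "tact ys w \<in> cylinder (pd x)"
    using tact_cylinder[of ys w] assms xs by (cases "ys = []") (auto simp: tsrc_Cons)
  then show "hd (zpt xs w) \<in> Arr GG" "rng GG (hd (zpt xs w)) = unit_germ (tact xs w)"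
    using GG_rng[OF x] x xs GG_arr by auto
qed

lemma zpt_nerve:
  assumes "xs \<in> nerve T n" "w \<in> cylinder (tsrc xs)"
  shows "zpt xs w \<in> nerve GG n"
proof -
  have S: "zpt xs w \<in> nerve GG (Suc m)" if "tchain xs" "length xs = Suc m" "w \<in> cylinder (tsrc xs)" for m
    using that
  proof (induction m arbitrary: xs)
    case 0
    then show ?case using hd_zpt(1)[of xs w] by (auto simp: nerve_one length_Suc_conv)
  next
    case (Suc m)
    then obtain x ys where xs: "xs = x # ys" "ys \<noteq> []" "length ys = Suc m" by (auto simp: length_Suc_conv)
    then have c: "tchain ys" "pd x = pr (hd ys)" "w \<in> cylinder (tsrc ys)" "x \<in> Arr T"
      using Suc.prems by (auto simp: tsrc_Cons)
    have t: "tact ys w \<in> cylinder (pd x)" using tact_cylinder[OF c(1,3)] c(2) by simp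
    have "gm x (tact ys w) \<in> Arr GG" using c(4) t GG_arr by auto
    moreover have "src GG (gm x (tact ys w)) = rng GG (hd (zpt ys w))"
      using GG_src[OF c(4) t] hd_zpt(2)[OF c(1,3)] by simp
    ultimately show ?case using Suc.IH[OF c(1) xs(3) c(3)] xs(1) by (simp add: nerve_Cons)
  qed
  show ?thesis
  proof (cases n)
    case 0
    then obtain p where p: "p \<in> fpaths" "xs = [(p, path_src p, p)]" using assms by (auto simp: nerve_T_0)
    then show ?thesis
      using 0 unit_germ_eq[OF p(1), of w] unit_germ_unit[OF p(1), of w] assms(2)
      by (auto simp: nerve_def tsrc_def)
  next
    case (Suc m)
    then show ?thesis using S[of m] assms by (simp add: nerve_T_Suc)
  qed
qed

lemma nerve_GG_zpt:
  assumes "gs \<in> nerve GG n"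
  obtains xs w where "xs \<in> nerve T n" "w \<in> cylinder (tsrc xs)" "gs = zpt xs w"
proof -
  have S: "\<exists>xs w. xs \<in> nerve T (Suc m) \<and> w \<in> cylinder (tsrc xs) \<and> gs = zpt xs w" if "gs \<in> nerve GG (Suc m)" for m gs
    using that
  proof (induction m arbitrary: gs)
    case 0
    then obtain x w where "x \<in> Arr T" "w \<in> cylinder (pd x)" "gs = [gm x w]" by (auto simp: nerve_one GG_arr)
    then show ?case by (intro exI[of _ "[x]"] exI[of _ w]) (auto simp: nerve_one tsrc_def)
  next
    case (Suc m)
    then obtain \<gamma> hs where gs: "gs = \<gamma> # hs" by (cases gs) (auto simp: nerve_def)
    then have h: "\<gamma> \<in> Arr GG" "hs \<in> nerve GG (Suc m)" "src GG \<gamma> = rng GG (hd hs)"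
      using Suc.prems by (auto simp: nerve_Cons)
    obtain xs w where xs: "xs \<in> nerve T (Suc m)" "w \<in> cylinder (tsrc xs)" "hs = zpt xs w"
      using Suc.IH[OF h(2)] by blast
    have c: "tchain xs" "length xs = Suc m" using xs(1) by (auto simp: nerve_T_Suc)
    obtain x u where x: "x \<in> Arr T" "u \<in> cylinder (pd x)" "\<gamma> = gm x u" using h(1) by (auto simp: GG_arr)
    have fx: "pd x \<in> fpaths" using x by (simp add: T_arr)
    have "unit_germ u = unit_germ (tact xs w)"
      using h(3) GG_src[OF x(1,2)] hd_zpt(2)[OF c(1) xs(2)] x(3) xs(3) by simp
    then have u: "u = tact xs w"
      using unit_germ_inj[OF fx x(2) tchain_hd[OF c(1)] tact_cylinder[OF c(1) xs(2)]] by simp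
    have "ev_prefix (tact xs w) (\<lambda>v. \<exists>us. epath (path_src (pd x)) us \<and> v = ext (pd x) us)"
      using ev_prefix_ext[OF fx x(2)] u by simp
    \<comment> \<open>The prefix \<open>v\<close> of \<open>w\<close> is long enough for the range
      path of the restricted tuple to extend \<open>pd x\<close>; restricting \<open>x\<close> by
      the difference makes it composable with that tuple.\<close>
    from ev_prefix_ex[OF ev_prefix_conj[OF ev_prefix_tact[OF c(1) xs(2) this] ev_prefix_tsrc[OF c(1) xs(2)]]]
    obtain v us ts where v: "w \<in> cylinder v" "epath (path_src (pd x)) us" "pr (hd (trestr xs v)) = ext (pd x) us"
      "epath (path_src (tsrc xs)) ts" "v = ext (tsrc xs) ts" by metis
    let ?ys = "tres xs ts"
    have y: "tchain ?ys" "tsrc ?ys = v" "pr (hd ?ys) = ext (pd x) us" "?ys \<noteq> []"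
      using tchain_tres[OF c(1) v(4)] v(3,5) c by auto
    have zy: "zpt ?ys w = hs" "tact ?ys w = u"
      using tact_tres[OF c(1) v(4)] v(1,5) xs(3) u by auto
    have "u \<in> cylinder (ext (pd x) us)" using tact_cylinder[OF y(1), of w] y(2,3) v(1) zy(2) by simp
    then have "gm (ares x us) u = \<gamma>" using gm_ares[OF x(1) v(2)] x(3) by simp
    then have "gs = zpt (ares x us # ?ys) w" using gs zy by simp
    moreover have "ares x us # ?ys \<in> nerve T (Suc (Suc m))"
      using ares_arr[OF x(1) v(2)] y c(2) by (simp add: nerve_T_Suc)
    moreover have "w \<in> cylinder (tsrc (ares x us # ?ys))" using y v(1) by (simp add: tsrc_Cons)
    ultimately show ?case by blast
  qed
  show ?thesis
  proof (cases n)
    case 0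
    then obtain \<gamma> where \<gamma>: "\<gamma> \<in> Arr GG" "gs = [src GG \<gamma>]" using assms by (auto simp: nerve_def unit_space_def)
    then obtain x w where x: "x \<in> Arr T" "w \<in> cylinder (pd x)" "\<gamma> = gm x w" by (auto simp: GG_arr)
    let ?p = "pd x"
    have p: "?p \<in> fpaths" using x by (simp add: T_arr)
    have "gs = zpt [(?p, path_src ?p, ?p)] w"
      using \<gamma> GG_src[OF x(1,2)] x(3) unit_germ_eq[OF p x(2)] by simp
    moreover have "[(?p, path_src ?p, ?p)] \<in> nerve T n" using p 0 nerve_T_0 by blast
    ultimately show ?thesis using that x(2) by (simp add: tsrc_def)
  next
    case (Suc m)
    then show ?thesis using assms S that by blast
  qed
qed

text \<open>The last face changes the source from \<open>w\<close> to its image under the last arrow.\<close>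

definition face_pt :: "nat \<Rightarrow> nat \<Rightarrow> (('g, 'x) fpath \<times> 'g \<times> ('g, 'x) fpath) list \<Rightarrow> ('g, 'x) bpath \<Rightarrow> ('g, 'x) bpath" where
  "face_pt n i xs w = (if i = n then act (last xs) w else w)"

definition face_ls :: "nat \<Rightarrow> nat \<Rightarrow> (('g, 'x) fpath \<times> 'g \<times> ('g, 'x) fpath) list \<Rightarrow> 'x list \<Rightarrow> 'x list" where
  "face_ls n i xs ts = (if i = n then list_act (ar (last xs)) ts else ts)"

lemma face_zpt:
  assumes xs: "xs \<in> nerve T (Suc n)" and i: "i \<le> Suc n" and w: "w \<in> cylinder (tsrc xs)"
  shows "face GG (Suc n) i (zpt xs w) = zpt (face T (Suc n) i xs) (face_pt (Suc n) i xs w)"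
proof -
  have c: "tchain xs" "length xs = Suc n" using xs by (auto simp: nerve_T_Suc)
  from c(2) i show ?thesis
  proof (cases rule: face_cases)
    case (src x)
    then have x: "x \<in> Arr T" "w \<in> cylinder (pd x)" "pd x \<in> fpaths" using c w by (auto simp: tsrc_def T_arr)
    have "src T x = (pd x, path_src (pd x), pd x)" using x(1) by (simp add: T_simps T_arr)
    then show ?thesis
      using src GG_src[OF x(1,2)] unit_germ_eq[OF x(3,2)] by (simp add: face_one face_pt_def)
  next
    case (rng x)
    then have x: "x \<in> Arr T" "w \<in> cylinder (pd x)" "pr x \<in> fpaths" using c w by (auto simp: tsrc_def T_arr)
    have "rng T x = (pr x, path_src (pr x), pr x)" using x(1) by (simp add: T_simps T_arr)
    then show ?thesis
      using rng GG_rng[OF x(1,2)] unit_germ_eq[OF x(3) act_cylinder[OF x(1,2)]] by (simp add: face_one face_pt_def)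
  next
    case (first x ys)
    then show ?thesis
      using face_first[of ys T x] face_first[of "zpt ys w" GG "gm x (tact ys w)"]
      by (cases ys) (simp_all add: face_pt_def)
  next
    case (last x ys)
    then show ?thesis
      using face_last[of ys T x] face_last[of "zpt ys (act x w)" GG "gm x w"]
      by (cases ys) (simp_all add: face_pt_def zpt_append tact_append)
  next
    case (mid as x y bs)
    let ?u = "tact bs w"
    have cc: "tchain (x # y # bs)" "w \<in> cylinder (tsrc (x # y # bs))"
      using c w mid tchain_append[of as "x # y # bs"] tsrc_append[of "x # y # bs" as] by (cases as; simp)+
    then have x: "x \<in> Arr T" "y \<in> Arr T" "pd x = pr y" by auto
    have u: "?u \<in> cylinder (pd y)"
      using cc tact_cylinder[of bs w] by (cases bs) (auto simp: tsrc_Cons)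
    have z: "zpt xs w = zpt as (act x (act y ?u)) @ gm x (act y ?u) # gm y ?u # zpt bs w"
      using mid by (simp add: zpt_append)
    have f: "face T (Suc n) i xs = as @ mul T x y # bs" using face_mid[of T as bs x y] mid by simp
    have "face GG (Suc n) i (zpt xs w) = zpt as (act x (act y ?u)) @ mul GG (gm x (act y ?u)) (gm y ?u) # zpt bs w"
      using face_mid[of GG "zpt as (act x (act y ?u))" "zpt bs w" "gm x (act y ?u)" "gm y ?u"] z mid by simp
    also have "\<dots> = zpt (as @ mul T x y # bs) w"
      using GG_mul[OF x(1,2) u x(3)] act_mul[OF x u] by (simp add: zpt_append)
    finally show ?thesis using f mid by (simp add: face_pt_def)
  qed
qed

lemma tsrc_face:
  assumes xs: "xs \<in> nerve T (Suc n)" and i: "i \<le> Suc n"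
  shows "tsrc (face T (Suc n) i xs) = (if i = Suc n then pr (last xs) else tsrc xs)"
proof -
  have c: "tchain xs" "length xs = Suc n" using xs by (auto simp: nerve_T_Suc)
  from c(2) i show ?thesis
  proof (cases rule: face_cases)
    case (last x ys)
    then have "tsrc ys = pr x" using c(1) tchain_append[of ys "[x]"] by simp
    then show ?thesis using last face_last[of ys T x] by simp
  next
    case (mid as x y bs)
    then show ?thesis using face_mid[of T as bs x y] by (simp add: tsrc_def T_simps)
  qed (auto simp: face_one face_first T_simps tsrc_def)
qed

lemma face_tres:
  assumes xs: "xs \<in> nerve T (Suc n)" and i: "i \<le> Suc n" and ts: "epath (path_src (tsrc xs)) ts"
  shows "face T (Suc n) i (tres xs ts) = tres (face T (Suc n) i xs) (face_ls (Suc n) i xs ts)"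
proof -
  have c: "tchain xs" "length xs = Suc n" using xs by (auto simp: nerve_T_Suc)
  from c(2) i show ?thesis
  proof (cases rule: face_cases)
    case (src x)
    then have x: "x \<in> Arr T" "epath (path_src (pd x)) ts" "pd x \<in> fpaths" using c ts by (auto simp: tsrc_def T_arr)
    have "src T x = (pd x, path_src (pd x), pd x)" "src T (ares x ts) = (ext (pd x) ts, path_src (ext (pd x) ts), ext (pd x) ts)"
      using x(1) ares_arr[OF x(1,2)] by (auto simp: T_simps T_arr)
    then show ?thesis
      using src ares_unit[OF x(3,2)] by (simp add: face_one face_ls_def)
  next
    case (rng x)
    then have x: "x \<in> Arr T" "epath (path_src (pd x)) ts" "pr x \<in> fpaths" using c ts by (auto simp: tsrc_def T_arr)
    have a: "ares x ts \<in> Arr T" using ares_arr[OF x(1,2)] .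
    have "rng T x = (pr x, path_src (pr x), pr x)"
      "rng T (ares x ts) = (ext (pr x) (list_act (ar x) ts), path_src (ext (pr x) (list_act (ar x) ts)), ext (pr x) (list_act (ar x) ts))"
      using x(1) a by (auto simp: T_simps T_arr)
    moreover have "epath (path_src (pr x)) (list_act (ar x) ts)" using a by (simp add: T_arr)
    ultimately show ?thesis
      using rng ares_unit[OF x(3)] by (simp add: face_one face_ls_def)
  next
    case (first x ys)
    then show ?thesis
      using face_first[of ys T x] face_first[of "tres ys ts" T "ares x (tlact ys ts)"] by (simp add: face_ls_def)
  next
    case (last x ys)
    then show ?thesis
      using face_last[of ys T x] face_last[of "tres ys (list_act (ar x) ts)" T "ares x ts"]
      by (simp add: face_ls_def tres_append)
  next
    case (mid as x y bs)
    let ?u = "tlact bs ts"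
    have cc: "tchain (x # y # bs)" "epath (path_src (tsrc (x # y # bs))) ts"
      using c ts mid tchain_append[of as "x # y # bs"] tsrc_append[of "x # y # bs" as] by (cases as; simp)+
    then have x: "x \<in> Arr T" "y \<in> Arr T" "pd x = pr y" by auto
    have u: "epath (path_src (pd y)) ?u"
      using cc tchain_tres[of bs ts] by (cases bs) (auto simp: tsrc_Cons)
    have l: "list_act (ar (mul T x y)) ?u = list_act (ar x) (list_act (ar y) ?u)"
      using list_act_mul(1)[of "ar x" "ar y" ?u] x u T_comp_ar[OF x] by (simp add: T_simps T_arr)
    have z: "tres xs ts = tres as (list_act (ar x) (list_act (ar y) ?u)) @ ares x (list_act (ar y) ?u) # ares y ?u # tres bs ts"
      using mid by (simp add: tres_append)
    have f: "face T (Suc n) i xs = as @ mul T x y # bs" using face_mid[of T as bs x y] mid by simp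
    have "face T (Suc n) i (tres xs ts) =
        tres as (list_act (ar x) (list_act (ar y) ?u)) @ mul T (ares x (list_act (ar y) ?u)) (ares y ?u) # tres bs ts"
      using face_mid[of T "tres as (list_act (ar x) (list_act (ar y) ?u))" "tres bs ts" "ares x (list_act (ar y) ?u)" "ares y ?u"] z mid
      by simp
    also have "\<dots> = tres (as @ mul T x y # bs) ts"
      using ares_mul[OF x u] l by (simp add: tres_append)
    finally show ?thesis using f mid by (simp add: face_ls_def)
  qed
qed

end

section \<open>Cells and chains of the groupoid of germs\<close>

lemma indic_simps: "indic {} a = 0" "A \<inter> B = {} \<Longrightarrow> indic (A \<union> B) a = indic A a + indic B a"
  "A \<subseteq> B \<Longrightarrow> indic (B - A) a = indic B a - indic A a" "indic A (a + b) = indic A a + indic A b"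
  "indic A 0 = 0"
  by (auto simp: indic_def fun_eq_iff)

lemma indic_UN_disjoint:
  assumes "finite I" "disjoint_family_on A I"
  shows "indic (\<Union>i\<in>I. A i) a = (\<Sum>i\<in>I. indic (A i) a)"
  using assms
proof (induction I rule: finite_induct)
  case (insert i I)
  have "A i \<inter> (\<Union>j\<in>I. A j) = {}" using insert by (auto simp: disjoint_family_on_def)
  moreover have "disjoint_family_on A I" using insert by (auto simp: disjoint_family_on_def)
  ultimately have 1: "indic (A i \<union> (\<Union>j\<in>I. A j)) a = indic (A i) a + (\<Sum>i\<in>I. indic (A i) a)"
    using indic_simps(2)[of "A i" "\<Union>j\<in>I. A j" a] insert.IH by simp
  show ?case by (simp only: UN_insert 1 sum.insert[OF insert.hyps])
qed (simp add: indic_simps)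

context graph_picture
begin

section \<open>Open sets of tuples of germs\<close>

lemma GG_open_basis:
  assumes "x \<in> Arr T" "openin bpath_topology U" "U \<subseteq> cylinder (pd x)"
  shows "openin (Top GG) (gm x ` U)"
proof -
  have "gm x ` U = {germ (Some x) w |w. w \<in> U}" by blast
  moreover have "Some x \<in> semi_carrier" "U \<subseteq> semi_dom (Some x)"
    using assms by (auto simp: semi_carrier_iff) (cases x; auto)
  ultimately have "gm x ` U \<in> {{germ a w |w. w \<in> U} |a U. a \<in> semi_carrier \<and> openin bpath_topology U \<and> U \<subseteq> semi_dom a}"
    using assms(2) by blast
  then show ?thesis
    unfolding germ_groupoid_def groupoid.simps by (rule topology_generated_by_Basis)
qed

text \<open>For a basic open set the germ has a second representative \<open>y\<close>. Both
  restrict to the same triple over a common prefix of \<open>w\<close>, and on that cylinder their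
  germs agree.\<close>

lemma near_GG:
  assumes "openin (Top GG) W" "x \<in> Arr T" "w \<in> cylinder (pd x)" "gm x w \<in> W"
  shows "near w {w' \<in> cylinder (pd x). gm x w' \<in> W}"
proof -
  have fx: "pd x \<in> fpaths" using assms(2) by (simp add: T_arr)
  have "generate_topology_on {{germ a w |w. w \<in> U} |a U. a \<in> semi_carrier \<and> openin bpath_topology U \<and> U \<subseteq> semi_dom a} W"
    using assms(1) unfolding germ_groupoid_def groupoid.simps openin_topology_generated_by_iff .
  then show ?thesis
    using assms(4)
  proof (induction)
    case Empty
    then show ?case by simp
  next
    case (Int a b)
    then have "near w {w' \<in> cylinder (pd x). gm x w' \<in> a}" "near w {w' \<in> cylinder (pd x). gm x w' \<in> b}" by auto
    from near_Int[OF this] show ?case by (rule near_mono) auto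
  next
    case (UN K)
    then obtain k where "k \<in> K" "near w {w' \<in> cylinder (pd x). gm x w' \<in> k}" by auto
    then show ?case by (elim near_mono) auto
  next
    case (Basis W)
    then obtain a U where a: "W = {germ a w |w. w \<in> U}" "a \<in> semi_carrier" "openin bpath_topology U" "U \<subseteq> semi_dom a"
      by blast
    obtain w0 where w0: "w0 \<in> U" "gm x w = germ a w0" using Basis.prems a(1) by blast
    then obtain y where y: "y \<in> Arr T" "a = Some y" using a(2,4) by (cases a) (auto simp: semi_carrier_iff)
    have dom: "semi_dom a = cylinder (pd y)" using y(2) by (cases y) auto
    have w0y: "w0 \<in> cylinder (pd y)" using w0(1) a(4) dom by blast
    have fy: "pd y \<in> fpaths" using y by (simp add: T_arr)
    have "w = w0" and ev: "ev_prefix w (\<lambda>v. restr x v = restr y v)"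
      using germ_eq_iff[OF assms(2,3) y(1) w0y] w0(2) y(2) by blast+
    then have wy: "w \<in> cylinder (pd y)" "w \<in> U" using w0y w0 by auto
    obtain v ts us where v: "v \<in> fpaths" "w \<in> cylinder v" "restr x v = restr y v"
      "epath (path_src (pd x)) ts" "v = ext (pd x) ts" "epath (path_src (pd y)) us" "v = ext (pd y) us"
      using ev_prefix_ex[OF ev_prefix_conj[OF ev ev_prefix_conj[OF ev_prefix_ext[OF fx assms(3)] ev_prefix_ext[OF fy wy(1)]]]]
      by metis
    have eq: "ares x ts = ares y us" using v(3,5,7) restr_ext by metis
    have "near w (U \<inter> cylinder v)"
      using near_Int near_cylinder[OF v(1,2)] a(3) wy(2) openin_bpath_iff by blast
    then show ?case
    proof (rule near_mono)
      show "U \<inter> cylinder v \<subseteq> {w' \<in> cylinder (pd x). gm x w' \<in> W}"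
      proof
        fix w' assume w': "w' \<in> U \<inter> cylinder v"
        have "gm x w' = gm (ares x ts) w'" using gm_ares[OF assms(2) v(4)] w' v(5) by simp
        also have "\<dots> = gm y w'" using gm_ares[OF y(1) v(6)] w' v(7) eq by simp
        finally have "gm x w' \<in> W" using a(1) y(2) w' by auto
        moreover have "w' \<in> cylinder (pd x)" using cylinder_ext_subset[OF v(4)] v(5) w' by blast
        ultimately show "w' \<in> {w' \<in> cylinder (pd x). gm x w' \<in> W}" by simp
      qed
    qed
  qed
qed

lemma zpt_nth: "i < length xs \<Longrightarrow> zpt xs w ! i = gm (xs ! i) (tact (drop (Suc i) xs) w)"
  by (induction xs arbitrary: i) (auto simp: nth_Cons split: nat.splits)

lemma tchain_drop:
  assumes "tchain xs" "Suc i < length xs"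
  shows "tchain (drop (Suc i) xs)" "tsrc (drop (Suc i) xs) = tsrc xs" "pr (hd (drop (Suc i) xs)) = pd (xs ! i)"
proof -
  have ne: "take (Suc i) xs \<noteq> []" "drop (Suc i) xs \<noteq> []" using assms(2) by auto
  have "tchain (take (Suc i) xs @ drop (Suc i) xs)" using assms(1) by simp
  then show "tchain (drop (Suc i) xs)" "tsrc (drop (Suc i) xs) = tsrc xs" "pr (hd (drop (Suc i) xs)) = pd (xs ! i)"
    using tchain_append[OF ne] ne assms(2) take_Suc_conv_app_nth[of i xs] by (simp_all add: tsrc_def)
qed

lemma tact_drop_cylinder:
  assumes "tchain xs" "i < length xs" "w \<in> cylinder (tsrc xs)"
  shows "tact (drop (Suc i) xs) w \<in> cylinder (pd (xs ! i))"
proof (cases "Suc i < length xs")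
  case True
  then show ?thesis using tchain_drop[OF assms(1) True] tact_cylinder[of "drop (Suc i) xs" w] assms(3) by simp
next
  case False
  then have "length xs = Suc i" using assms(2) by simp
  then have "drop (Suc i) xs = []" "last xs = xs ! i" using last_conv_nth[of xs] by force+
  then show ?thesis using assms(3) by (simp add: tsrc_def)
qed

text \<open>Only the last germ chooses a base point. Composability fixes the base points of the
  others, since a unit germ determines its boundary path.\<close>

lemma zpt_of_members:
  assumes "tchain xs" "gs \<in> nerve GG (length xs)"
    "\<And>i. i < length xs \<Longrightarrow> gs ! i \<in> gm (xs ! i) ` (if Suc i = length xs then U else cylinder (pd (xs ! i)))"
    "U \<subseteq> cylinder (tsrc xs)"
  shows "gs \<in> zpt xs ` U"
  using assms
proof (induction xs arbitrary: gs)
  case (Cons x xs)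
  have x: "x \<in> Arr T" using Cons.prems by simp
  obtain \<gamma> hs where gs: "gs = \<gamma> # hs" "length hs = length xs"
    using nerve_length[OF Cons.prems(2)] by (cases gs) auto
  show ?case
  proof (cases "xs = []")
    case True
    then show ?thesis using gs Cons.prems(3)[of 0] by auto
  next
    case False
    then obtain m where m: "length xs = Suc m" by (cases xs) auto
    have c: "tchain xs" "pd x = pr (hd xs)" "U \<subseteq> cylinder (tsrc xs)" using Cons.prems False by (auto simp: tsrc_Cons)
    have g: "\<gamma> \<in> Arr GG" "hs \<in> nerve GG (length xs)" "src GG \<gamma> = rng GG (hd hs)"
      using Cons.prems(2) gs m by (auto simp: nerve_Cons)
    have "hs ! i \<in> gm (xs ! i) ` (if Suc i = length xs then U else cylinder (pd (xs ! i)))" if "i < length xs" for i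
      using Cons.prems(3)[of "Suc i"] gs that by (auto split: if_splits)
    then have "hs \<in> zpt xs ` U" using Cons.IH[OF c(1) g(2) _ c(3)] by blast
    then obtain w where w: "w \<in> U" "hs = zpt xs w" by blast
    have wx: "w \<in> cylinder (tsrc xs)" using w c by blast
    have "\<gamma> \<in> gm x ` cylinder (pd x)" using Cons.prems(3)[of 0] gs m by simp
    then obtain u where u: "u \<in> cylinder (pd x)" "\<gamma> = gm x u" by blast
    have "unit_germ u = unit_germ (tact xs w)"
      using g(3) GG_src[OF x u(1)] hd_zpt(2)[OF c(1) wx] u w by simp
    moreover have "pd x \<in> fpaths" using x by (simp add: T_arr)
    ultimately have "u = tact xs w"
      using unit_germ_inj[OF _ u(1) tchain_hd[OF c(1)] tact_cylinder[OF c(1) wx]] by simp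
    then show ?thesis using gs u w by force
  qed
qed simp

text \<open>A unit \<open>[u]\<close> is also a tuple of length 1, so degree 0 can be handled by the
  length of the list, as in the recursions over tuples.\<close>

lemma nerve_GG_mem_Suc:
  assumes "xs \<in> nerve T n" "gs \<in> nerve GG n" "gs ! 0 \<in> Arr GG"
  shows "gs \<in> nerve GG (length xs)"
proof (cases n)
  case 0
  then obtain u where "gs = [u]" using assms(2) by (auto simp: nerve_def)
  then show ?thesis using 0 assms nerve_length[OF assms(1)] by (simp add: nerve_one)
next
  case (Suc m)
  then show ?thesis using assms nerve_length[OF assms(1)] by simp
qed

text \<open>The image is a box in the nerve: the last factor is cut down to \<open>U\<close>, the
  others are full.\<close>

lemma openin_zpt_image:
  assumes xs: "xs \<in> nerve T n" and U: "openin bpath_topology U" "U \<subseteq> cylinder (tsrc xs)"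
  shows "openin (nerve_topology GG n) (zpt xs ` U)"
proof -
  have c: "tchain xs" using nerve_tchain[OF xs] .
  have len: "length xs = max 1 n" using nerve_length[OF xs] .
  let ?V = "\<lambda>i. gm (xs ! i) ` (if Suc i = length xs then U else cylinder (pd (xs ! i)))"
  have arr: "xs ! i \<in> Arr T" if "i < length xs" for i using tchain_arr[OF c] that by simp
  have lastU: "U \<subseteq> cylinder (pd (xs ! i))" if "Suc i = length xs" for i
  proof -
    have "last xs = xs ! i" using that by (cases xs rule: rev_cases) (auto simp: nth_append)
    then show ?thesis using U(2) by (simp add: tsrc_def)
  qed
  have "openin (Top GG) (?V i)" if "i < max 1 n" for i
    using GG_open_basis[OF arr[of i]] that len U(1) lastU[of i] arr[of i] openin_cylinder by (auto simp: T_arr)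
  then have "openin (nerve_topology GG n) {gs \<in> nerve GG n. \<forall>i<max 1 n. gs ! i \<in> ?V i}"
    by (rule openin_nerve_topology_box)
  also have "{gs \<in> nerve GG n. \<forall>i<max 1 n. gs ! i \<in> ?V i} = zpt xs ` U"
  proof (rule subset_antisym; rule subsetI)
    fix gs assume gs: "gs \<in> {gs \<in> nerve GG n. \<forall>i<max 1 n. gs ! i \<in> ?V i}"
    have "gs ! 0 \<in> ?V 0" using gs by auto
    then have "gs ! 0 \<in> Arr GG" using arr[of 0] len lastU[of 0] unfolding GG_arr by (fastforce split: if_splits)
    then have "gs \<in> nerve GG (length xs)" using nerve_GG_mem_Suc[OF xs] gs by blast
    then show "gs \<in> zpt xs ` U" by (rule zpt_of_members[OF c _ _ U(2)]) (use gs len in auto)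
  next
    fix gs assume "gs \<in> zpt xs ` U"
    then obtain w where w: "w \<in> U" "gs = zpt xs w" by blast
    have "gs ! i \<in> ?V i" if "i < length xs" for i
      using zpt_nth[OF that] tact_drop_cylinder[OF c that] w U(2) that by auto
    then show "gs \<in> {gs \<in> nerve GG n. \<forall>i<max 1 n. gs ! i \<in> ?V i}"
      using zpt_nerve[OF xs] w U(2) len by auto
  qed
  finally show ?thesis .
qed

lemma near_tact:
  assumes "tchain xs" "w \<in> cylinder (tsrc xs)" "near (tact xs w) W"
  shows "near w {w' \<in> cylinder (tsrc xs). tact xs w' \<in> W}"
  using assms
proof (induction xs arbitrary: W)
  case (Cons x xs)
  have x: "x \<in> Arr T" using Cons.prems by simp
  show ?case
  proof (cases "xs = []")
    case True
    then show ?thesis using Cons.prems near_act[OF x] by (simp add: tsrc_def)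
  next
    case False
    then have c: "tchain xs" "pd x = pr (hd xs)" "w \<in> cylinder (tsrc xs)" "tsrc (x # xs) = tsrc xs"
      using Cons.prems by (auto simp: tsrc_Cons)
    have "near (tact xs w) {w' \<in> cylinder (pd x). act x w' \<in> W}"
      using near_act[OF x, of "tact xs w" W] tact_cylinder[OF c(1,3)] c(2) Cons.prems(3) by simp
    from Cons.IH[OF c(1,3) this] show ?thesis unfolding c(4) by (rule near_mono) auto
  qed
qed simp

lemma near_zpt:
  assumes W: "openin (nerve_topology GG n) W" and xs: "xs \<in> nerve T n" and w: "w \<in> cylinder (tsrc xs)" "zpt xs w \<in> W"
  shows "near w {w' \<in> cylinder (tsrc xs). zpt xs w' \<in> W}"
proof -
  have c: "tchain xs" using nerve_tchain[OF xs] .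
  have len: "length xs = max 1 n" using nerve_length[OF xs] .
  obtain V where V: "\<And>i. i < max 1 n \<Longrightarrow> openin (Top GG) (V i) \<and> zpt xs w ! i \<in> V i"
    "{gs \<in> nerve GG n. \<forall>i<max 1 n. gs ! i \<in> V i} \<subseteq> W" "zpt xs w \<in> nerve GG n"
    using openin_nerve_topologyE[OF W w(2)] by blast
  have near_i: "near w {w' \<in> cylinder (tsrc xs). zpt xs w' ! i \<in> V i}" if i: "i < length xs" for i
  proof -
    let ?d = "drop (Suc i) xs"
    have x: "xs ! i \<in> Arr T" using tchain_arr[OF c] i by simp
    have "gm (xs ! i) (tact ?d w) \<in> V i" "openin (Top GG) (V i)" using V(1)[of i] i len zpt_nth[OF i] by auto
    then have n: "near (tact ?d w) {w' \<in> cylinder (pd (xs ! i)). gm (xs ! i) w' \<in> V i}"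
      using near_GG[OF _ x tact_drop_cylinder[OF c i w(1)]] by blast
    show ?thesis
    proof (cases "Suc i < length xs")
      case True
      then have d: "tchain ?d" "tsrc ?d = tsrc xs" using tchain_drop[OF c True] by auto
      have "near w {w' \<in> cylinder (tsrc ?d). tact ?d w' \<in> {w' \<in> cylinder (pd (xs ! i)). gm (xs ! i) w' \<in> V i}}"
        by (rule near_tact[OF d(1) _ n]) (use d w in simp)
      then show ?thesis by (rule near_mono) (use d zpt_nth[OF i] in auto)
    next
      case False
      then have "?d = []" "last xs = xs ! i" using i by (cases xs rule: rev_cases; auto simp: nth_append)+
      then show ?thesis using n zpt_nth[OF i] by (simp add: tsrc_def)
    qed
  qed
  have wb: "w \<in> bpaths_at (fst (tsrc xs))" using cylinder_bpaths[OF tchain_tsrc[OF c] w(1)] .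
  have "near w (bpaths \<inter> (\<Inter>i\<in>{..<length xs}. {w' \<in> cylinder (tsrc xs). zpt xs w' ! i \<in> V i}))"
    by (rule near_Inter[OF _ wb]) (use near_i in auto)
  then show ?thesis
  proof (rule near_mono)
    show "bpaths \<inter> (\<Inter>i\<in>{..<length xs}. {w' \<in> cylinder (tsrc xs). zpt xs w' ! i \<in> V i}) \<subseteq>
        {w' \<in> cylinder (tsrc xs). zpt xs w' \<in> W}"
    proof
      fix w' assume w': "w' \<in> bpaths \<inter> (\<Inter>i\<in>{..<length xs}. {w' \<in> cylinder (tsrc xs). zpt xs w' ! i \<in> V i})"
      have "0 < length xs" using len by simp
      then have "w' \<in> cylinder (tsrc xs)" using w' by blast
      then show "w' \<in> {w' \<in> cylinder (tsrc xs). zpt xs w' \<in> W}"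
        using V(2) zpt_nerve[OF xs] w' len by auto
    qed
  qed
qed

lemma openin_zpt_preimage:
  assumes "openin (nerve_topology GG n) W" "xs \<in> nerve T n"
  shows "openin bpath_topology {w \<in> cylinder (tsrc xs). zpt xs w \<in> W}"
  unfolding openin_bpath_iff using near_zpt[OF assms] by blast

text \<open>An infinite path leaves \<open>p\<close> through some edge, which is not among the
  removed ones; the cylinder beyond that edge lies inside the neighbourhood.\<close>

lemma near_InfP:
  assumes "near (InfP s) U"
  shows "ev_prefix (InfP s) (\<lambda>p. cylinder p \<subseteq> U)"
proof -
  obtain p F where p: "p \<in> fpaths" "F \<subseteq> edges_at (path_src p)" "InfP s \<in> nbhd p F" "nbhd p F \<subseteq> U"
    using assms unfolding near_def by blast
  then have "InfP s \<in> cylinder p" by (simp add: nbhd_def)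
  then obtain e where e: "e \<in> edges_at (path_src p)" "InfP s \<in> cylinder (ext p [e])"
    using cylinder_step by blast
  have "cylinder (ext p [e]) \<inter> cylinder (ext p [f]) = {}" if "f \<in> F" for f
    using cylinder_edge_unique[OF p(1) e(1), of f] p(2,3) e(2) that by (auto simp: nbhd_def)
  then have "cylinder (ext p [e]) \<subseteq> nbhd p F"
    using cylinder_ext_subset[OF epath_edge[OF e(1)]] by (fastforce simp: nbhd_def)
  then have "cylinder (ext p [e]) \<subseteq> U" using p(4) by blast
  moreover have f: "ext p [e] \<in> fpaths" using p(1) epath_edge[OF e(1)] by simp
  ultimately show ?thesis
    using cylinder_ext_subset by (intro ev_prefix_mono[OF ev_prefix_ext[OF f e(2)]]) blast
qed

text \<open>A basic neighbourhood of \<open>FinP p\<close> can be taken at \<open>p\<close> itself,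
  since no cylinder of a proper extension contains this point.\<close>

lemma near_FinP:
  assumes "near (FinP p) U" "p \<in> fpaths" "\<not> regular (path_src p)"
  obtains F where "finite F" "F \<subseteq> edges_at (path_src p)" "cylinder p \<subseteq> U \<union> (\<Union>e\<in>F. cylinder (ext p [e]))"
    "nbhd p F \<subseteq> U"
proof -
  obtain ts F where ts: "epath (path_src p) ts" "finite F" "F \<subseteq> edges_at (path_src (ext p ts))"
    "FinP p \<in> nbhd (ext p ts) F" "nbhd (ext p ts) F \<subseteq> U"
    using near_extE[OF assms(1,2) FinP_in_cylinder[OF assms(2,3)]] by blast
  have "FinP p \<in> cylinder (ext p ts)" "ext p ts \<in> fpaths" using ts assms(2) by (auto simp: nbhd_def)
  then obtain us where "p = ext (ext p ts) us" using FinP_cylinderD by blast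
  then have "ts = []" by simp
  then show ?thesis using that[of F] ts by (auto simp: nbhd_def)
qed

section \<open>Cylinders are compact and separated\<close>

lemma cylinder_regular:
  assumes "regular (path_src p)"
  shows "cylinder p = (\<Union>e\<in>edges_at (path_src p). cylinder (ext p [e]))"
  using cylinder_step[of _ p] assms cylinder_ext_subset[OF epath_edge] by blast

text \<open>Finite subcovers are assembled along the tree of paths. At a singular \<open>p\<close>
  the member of the cover around \<open>FinP p\<close> swallows all but finitely many edges, so even
  infinitely many edges give a finite step.\<close>

lemma compactin_cylinder:
  assumes "q \<in> fpaths"
  shows "compactin bpath_topology (cylinder q)"
  unfolding compactin_def
proof (intro conjI allI impI)
  show "cylinder q \<subseteq> topspace bpath_topology" using openin_subset[OF openin_cylinder[OF assms]] .
  fix \<U> assume \<U>: "Ball \<U> (openin bpath_topology) \<and> cylinder q \<subseteq> \<Union>\<U>"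
  \<comment> \<open>The implication makes \<open>P\<close> true at paths whose cylinder is not
    covered, because the induction ranges over all finite paths.\<close>
  define P where "P p \<longleftrightarrow> (cylinder p \<subseteq> \<Union>\<U> \<longrightarrow> (\<exists>\<F>. finite \<F> \<and> \<F> \<subseteq> \<U> \<and> cylinder p \<subseteq> \<Union>\<F>))" for p
  have near: "near w U" if "U \<in> \<U>" "w \<in> U" for U w using \<U> that openin_bpath_iff by blast
  have union: "\<exists>\<F>. finite \<F> \<and> \<F> \<subseteq> \<U> \<and> (\<Union>e\<in>F. cylinder (ext p [e])) \<subseteq> \<Union>\<F>"
    if F: "finite F" "F \<subseteq> edges_at (path_src p)" "\<forall>e\<in>F. P (ext p [e])" "cylinder p \<subseteq> \<Union>\<U>" for p F
  proof -
    have "\<exists>\<F>. finite \<F> \<and> \<F> \<subseteq> \<U> \<and> cylinder (ext p [e]) \<subseteq> \<Union>\<F>" if "e \<in> F" for e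
    proof -
      have "cylinder (ext p [e]) \<subseteq> cylinder p" using F(2) that by (intro cylinder_ext_subset epath_edge) blast
      then have "cylinder (ext p [e]) \<subseteq> \<Union>\<U>" using F(4) by (rule subset_trans)
      moreover have "P (ext p [e])" using F(3) that by blast
      ultimately show ?thesis unfolding P_def by (rule rev_mp)
    qed
    then obtain \<F> where \<F>: "\<And>e. e \<in> F \<Longrightarrow> finite (\<F> e) \<and> \<F> e \<subseteq> \<U> \<and> cylinder (ext p [e]) \<subseteq> \<Union>(\<F> e)" by metis
    show ?thesis by (rule exI[of _ "\<Union>e\<in>F. \<F> e"]) (use \<F> F(1) in fastforce)
  qed
  have "P q"
  proof (rule path_tree_induct[OF _ _ assms])
    fix p assume p: "p \<in> fpaths"
    show "\<exists>F. finite F \<and> F \<subseteq> edges_at (path_src p) \<and> ((\<forall>e\<in>F. P (ext p [e])) \<longrightarrow> P p)"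
    proof (cases "regular (path_src p)")
      case True
      have fin: "finite (edges_at (path_src p))" using True by (simp add: regular_iff)
      have "P p" if "\<forall>e\<in>edges_at (path_src p). P (ext p [e])"
        unfolding P_def[of p] using union[OF fin subset_refl that] cylinder_regular[OF True] by simp
      then show ?thesis using fin by blast
    next
      case sing: False
      show ?thesis
      proof (cases "cylinder p \<subseteq> \<Union>\<U>")
        case True
        then obtain U where U: "U \<in> \<U>" "FinP p \<in> U" using FinP_in_cylinder[OF p sing] by blast
        obtain F where F: "finite F" "F \<subseteq> edges_at (path_src p)"
          "cylinder p \<subseteq> U \<union> (\<Union>e\<in>F. cylinder (ext p [e]))" "nbhd p F \<subseteq> U"
          by (rule near_FinP[OF near[OF U] p sing])
        have "P p" if e: "\<forall>e\<in>F. P (ext p [e])"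
        proof -
          obtain \<F> where \<F>: "finite \<F>" "\<F> \<subseteq> \<U>" "(\<Union>e\<in>F. cylinder (ext p [e])) \<subseteq> \<Union>\<F>"
            using union[OF F(1,2) e True] by blast
          have "cylinder p \<subseteq> \<Union>(insert U \<F>)" using F(3) \<F>(3) unfolding Union_insert by blast
          then have "finite (insert U \<F>) \<and> insert U \<F> \<subseteq> \<U> \<and> cylinder p \<subseteq> \<Union>(insert U \<F>)" using \<F>(1,2) U(1) by simp
          then show ?thesis unfolding P_def by blast
        qed
        then show ?thesis using F by blast
      next
        case False
        then show ?thesis unfolding P_def by (intro exI[of _ "{}"]) auto
      qed
    qed
  next
    fix s v assume s: "InfP s \<in> bpaths_at v"
    obtain p where p: "p \<in> fpaths" "InfP s \<in> cylinder p" using InfP_long[OF s, of 0] by blast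
    show "ev_prefix (InfP s) P"
    proof (cases "InfP s \<in> \<Union>\<U>")
      case True
      then obtain U where U: "U \<in> \<U>" "InfP s \<in> U" by blast
      have "P p" if "cylinder p \<subseteq> U" for p
        unfolding P_def using that U by (intro impI exI[of _ "{U}"]) auto
      then show ?thesis using ev_prefix_mono[OF near_InfP[OF near[OF U]]] by blast
    next
      case False
      then show ?thesis
        unfolding P_def by (intro ev_prefix_mono[OF ev_prefix_ext[OF p]]) blast
    qed
  qed
  then show "\<exists>\<F>. finite \<F> \<and> \<F> \<subseteq> \<U> \<and> cylinder q \<subseteq> \<Union>\<F>" using \<U> by (simp add: P_def)
qed

text \<open>If \<open>w\<close> continues \<open>p\<close>, removing its next edge from the cylinder
  of \<open>p\<close> separates the two points. If \<open>p\<close> continues a finite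
  \<open>w\<close>, the roles are swapped. Otherwise there are disjoint cylinders.\<close>

lemma separate_FinP:
  assumes q: "q \<in> fpaths" "FinP p \<in> cylinder q" "w \<in> cylinder q" "w \<noteq> FinP p"
  shows "\<exists>U V. openin bpath_topology U \<and> openin bpath_topology V \<and> U \<inter> V = {} \<and> FinP p \<in> U \<and> w \<in> V"
proof -
  have step: "\<exists>U V. openin bpath_topology U \<and> openin bpath_topology V \<and> U \<inter> V = {} \<and> FinP p \<in> U \<and> w \<in> V"
    if p: "p \<in> fpaths" "\<not> regular (path_src p)" and w: "w \<in> cylinder p" "w \<noteq> FinP p" for p w
  proof -
    obtain e where e: "e \<in> edges_at (path_src p)" "w \<in> cylinder (ext p [e])" using cylinder_step[OF w(1)] w(2) by blast
    have "FinP p \<in> nbhd p {e}" using FinP_in_cylinder[OF p] FinP_not_in_ext[OF p(1) e(1)] by (simp add: nbhd_def)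
    moreover have "nbhd p {e} \<inter> cylinder (ext p [e]) = {}" by (auto simp: nbhd_def)
    moreover have "ext p [e] \<in> fpaths" using p(1) epath_edge[OF e(1)] by simp
    ultimately show ?thesis
      using openin_nbhd[OF p(1), of "{e}"] openin_cylinder[of "ext p [e]"] e by blast
  qed
  have p: "p \<in> fpaths" "\<not> regular (path_src p)" using cylinder_bpaths[OF q(1,2)] by (auto simp: bpaths_at_iff)
  have sep: ?thesis if p': "p' \<in> fpaths" "w \<in> cylinder p'" "cylinder p \<inter> cylinder p' = {}" for p'
    using openin_cylinder[OF p(1)] openin_cylinder[OF p'(1)] p'(2,3) FinP_in_cylinder[OF p] by blast
  show ?thesis
  proof (cases "w \<in> cylinder p")
    case True
    then show ?thesis using step[OF p] q(4) by blast
  next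
    case False
    show ?thesis
    proof (cases w)
      case (FinP p')
      have p': "p' \<in> fpaths" "\<not> regular (path_src p')" using cylinder_bpaths[OF q(1,3)] FinP by (auto simp: bpaths_at_iff)
      show ?thesis
      proof (cases "FinP p \<in> cylinder p'")
        case True
        then show ?thesis using step[OF p' True] FinP q(4) by (metis inf_commute)
      next
        case F': False
        have "cylinder p \<inter> cylinder p' = {}"
        proof (rule ccontr)
          assume "cylinder p \<inter> cylinder p' \<noteq> {}"
          then obtain u where u: "u \<in> cylinder p" "u \<in> cylinder p'" by blast
          show False
          proof (rule cylinder_compare[OF p(1) p'(1) u])
            fix ts assume "epath (path_src p) ts" "p' = ext p ts"
            then show False using False FinP FinP_in_cylinder[OF p'] cylinder_ext_subset by blast
          next
            fix ts assume "epath (path_src p') ts" "p = ext p' ts"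
            then show False using F' FinP_in_cylinder[OF p] cylinder_ext_subset by blast
          qed
        qed
        then show ?thesis using sep[OF p'(1)] FinP FinP_in_cylinder[OF p'] by blast
      qed
    next
      case (InfP s)
      \<comment> \<open>A prefix of the same length as \<open>p\<close>. It differs from
        \<open>p\<close> because \<open>w\<close> lies outside that cylinder, so the two cylinders
        are disjoint.\<close>
      obtain p' where p': "p' \<in> fpaths" "w \<in> cylinder p'" "length (snd p') = length (snd p)"
        using InfP_long[of s "fst q"] cylinder_bpaths[OF q(1,3)] InfP by metis
      have "cylinder p \<inter> cylinder p' = {}"
      proof (rule ccontr)
        assume "cylinder p \<inter> cylinder p' \<noteq> {}"
        then obtain u where u: "u \<in> cylinder p" "u \<in> cylinder p'" by blast
        have "p = p'"
        proof (rule cylinder_compare[OF p(1) p'(1) u])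
          fix ts assume "p' = ext p ts"
          then show "p = p'" using p'(3) by simp
        next
          fix ts assume "p = ext p' ts"
          then show "p = p'" using p'(3) by simp
        qed
        then show False using False p'(2) by blast
      qed
      then show ?thesis using sep[OF p'(1,2)] by blast
    qed
  qed
qed

lemma separate_bpaths:
  assumes q: "q \<in> fpaths" "w \<in> cylinder q" "w' \<in> cylinder q" "w \<noteq> w'"
  shows "\<exists>U V. openin bpath_topology U \<and> openin bpath_topology V \<and> U \<inter> V = {} \<and> w \<in> U \<and> w' \<in> V"
proof (cases w)
  case (FinP p)
  then show ?thesis using separate_FinP[of q p w'] q by blast
next
  case (InfP s)
  show ?thesis
  proof (cases w')
    case (FinP p)
    then show ?thesis using separate_FinP[of q p w] q by (metis inf_commute)
  next
    case InfP': (InfP s')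
    have "\<exists>i. s !! i \<noteq> s' !! i"
    proof (rule ccontr)
      assume "\<nexists>i. s !! i \<noteq> s' !! i"
      then have "smap id s = s'" unfolding smap_alt by simp
      then show False using q(4) InfP InfP' by (simp add: stream.map_id)
    qed
    then obtain i where "s !! i \<noteq> s' !! i" by blast
    then have "stake (Suc i) s \<noteq> stake (Suc i) s'" using stake_nth[of i "Suc i"] by (metis lessI)
    then obtain n where n: "stake n s \<noteq> stake n s'" by blast
    have *: "\<exists>p. p \<in> fpaths \<and> InfP t \<in> cylinder p \<and> snd p = stake n t" if t: "InfP t \<in> cylinder q" for t
    proof -
      obtain p where p: "p \<in> fpaths" "InfP t \<in> cylinder p" "length (snd p) = n"
        using InfP_long[OF cylinder_bpaths[OF q(1) t]] by blast
      obtain u where "InfP t = bpath_conc p u" using p(2) by (rule in_cylinderE)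
      then obtain r where "t = snd p @- r" unfolding conc_eq_iff by blast
      then have "snd p = stake n t" using p(3) by (simp add: stake_shift)
      then show ?thesis using p by blast
    qed
    obtain p where p: "p \<in> fpaths" "w \<in> cylinder p" "snd p = stake n s" using *[of s] q InfP by blast
    obtain p' where p': "p' \<in> fpaths" "w' \<in> cylinder p'" "snd p' = stake n s'" using *[of s'] q InfP' by blast
    have "cylinder p \<inter> cylinder p' = {}"
    proof (rule ccontr)
      assume "cylinder p \<inter> cylinder p' \<noteq> {}"
      then obtain u where u: "u \<in> cylinder p" "u \<in> cylinder p'" by blast
      have len: "length (snd p) = length (snd p')" using p(3) p'(3) by simp
      have "p = p'"
      proof (rule cylinder_compare[OF p(1) p'(1) u])
        fix ts assume "p' = ext p ts"
        then show "p = p'" using len by simp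
      next
        fix ts assume "p = ext p' ts"
        then show "p = p'" using len by simp
      qed
      then show False using n p(3) p'(3) by simp
    qed
    then show ?thesis using openin_cylinder[OF p(1)] openin_cylinder[OF p'(1)] p(2) p'(2) by blast
  qed
qed

section \<open>Cells and the chains they span\<close>

definition cell :: "(('g, 'x) fpath \<times> 'g \<times> ('g, 'x) fpath) list \<Rightarrow> (('g, 'x) semi \<times> ('g, 'x) bpath) set list set" where
  "cell xs = zpt xs ` cylinder (tsrc xs)"

lemma cell_nerve: "xs \<in> nerve T n \<Longrightarrow> cell xs \<subseteq> nerve GG n"
  using zpt_nerve by (auto simp: cell_def)

lemma openin_cell: "xs \<in> nerve T n \<Longrightarrow> openin (nerve_topology GG n) (cell xs)"
  unfolding cell_def by (rule openin_zpt_image) (auto intro: openin_cylinder tchain_tsrc nerve_tchain)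

lemma compactin_cell:
  assumes xs: "xs \<in> nerve T n"
  shows "compactin (nerve_topology GG n) (cell xs)"
proof -
  have f: "tsrc xs \<in> fpaths" using tchain_tsrc[OF nerve_tchain[OF xs]] .
  let ?C = "subtopology bpath_topology (cylinder (tsrc xs))"
  have top: "topspace ?C = cylinder (tsrc xs)"
    using openin_subset[OF openin_cylinder[OF f]] by (auto simp: topspace_subtopology)
  have "continuous_map ?C (nerve_topology GG n) (zpt xs)"
    unfolding continuous_map_def top
  proof (intro conjI allI impI)
    show "zpt xs \<in> cylinder (tsrc xs) \<rightarrow> topspace (nerve_topology GG n)"
      using openin_subset[OF openin_cell[OF xs]] by (auto simp: cell_def)
    fix W assume "openin (nerve_topology GG n) W"
    then show "openin ?C {w \<in> cylinder (tsrc xs). zpt xs w \<in> W}"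
      using openin_zpt_preimage[OF _ xs] by (auto simp: openin_subtopology)
  qed
  moreover have "compactin ?C (cylinder (tsrc xs))" using compactin_cylinder[OF f] by (simp add: compactin_subtopology)
  ultimately show ?thesis unfolding cell_def by (rule image_compactin[rotated])
qed

text \<open>\<open>zpt xs\<close> is injective and open on the cylinder, so the separation of
  boundary paths is inherited, although the nerve as a whole need not be Hausdorff.\<close>

lemma Hausdorff_cell:
  assumes xs: "xs \<in> nerve T n"
  shows "Hausdorff_space (subtopology (nerve_topology GG n) (cell xs))"
  unfolding Hausdorff_space_def
proof (intro allI impI)
  have c: "tchain xs" using nerve_tchain[OF xs] .
  fix x y assume "x \<in> topspace (subtopology (nerve_topology GG n) (cell xs)) \<and>
    y \<in> topspace (subtopology (nerve_topology GG n) (cell xs)) \<and> x \<noteq> y"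
  then obtain w w' where w: "w \<in> cylinder (tsrc xs)" "w' \<in> cylinder (tsrc xs)" "x = zpt xs w" "y = zpt xs w'" "w \<noteq> w'"
    by (auto simp: topspace_subtopology cell_def)
  obtain U V where U: "openin bpath_topology U" "openin bpath_topology V" "U \<inter> V = {}" "w \<in> U" "w' \<in> V"
    using separate_bpaths[OF tchain_tsrc[OF c] w(1,2,5)] by blast
  let ?U = "U \<inter> cylinder (tsrc xs)" and ?V = "V \<inter> cylinder (tsrc xs)"
  have "openin (nerve_topology GG n) (zpt xs ` ?U)" "openin (nerve_topology GG n) (zpt xs ` ?V)"
    using openin_zpt_image[OF xs] U openin_cylinder[OF tchain_tsrc[OF c]] by (auto intro: openin_Int)
  then have "openin (subtopology (nerve_topology GG n) (cell xs)) (zpt xs ` ?U)"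
    "openin (subtopology (nerve_topology GG n) (cell xs)) (zpt xs ` ?V)"
    by (auto simp: openin_subtopology cell_def)
  moreover have "zpt xs ` ?U \<inter> zpt xs ` ?V = {}" using zpt_inj[OF c] U(3) by blast
  ultimately show "\<exists>U V. openin (subtopology (nerve_topology GG n) (cell xs)) U \<and>
      openin (subtopology (nerve_topology GG n) (cell xs)) V \<and> x \<in> U \<and> y \<in> V \<and> disjnt U V"
    using w U by (intro exI[of _ "zpt xs ` ?U"] exI[of _ "zpt xs ` ?V"]) (auto simp: disjnt_def)
qed

lemma cell_tres:
  assumes "tchain xs" "epath (path_src (tsrc xs)) ts"
  shows "cell (tres xs ts) = zpt xs ` cylinder (ext (tsrc xs) ts)"
  using tact_tres(2)[OF assms] tchain_tres[OF assms] by (auto simp: cell_def)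

definition cell_sum :: "((('g, 'x) fpath \<times> 'g \<times> ('g, 'x) fpath) list \<Rightarrow> 'a::ab_group_add) \<Rightarrow>
    (('g, 'x) semi \<times> ('g, 'x) bpath) set list \<Rightarrow> 'a" where
  "cell_sum = lin_ext (\<lambda>xs. indic (cell xs))"

lemma biadditive_cell: "biadditive (\<lambda>xs. indic (cell xs))"
  by (simp add: biadditive_def indic_simps)

lemma additive_on_cell_sum: "additive_on N cell_sum"
  unfolding cell_sum_def by (rule additive_on_lin_ext[OF biadditive_cell])

lemma cell_sum_single: "cell_sum (single xs a) = indic (cell xs) a"
  unfolding cell_sum_def by (rule lin_ext_single[OF biadditive_cell])

lemma cell_sum_image_subgroup: "add_subgroup (cell_sum ` fin_chains N)"
  by (rule add_subgroup_image[OF additive_on_cell_sum])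

lemma indic_cell_in_image: "xs \<in> nerve T n \<Longrightarrow> indic (cell xs) a \<in> cell_sum ` fin_chains (nerve T n)"
  by (metis cell_sum_single fin_chains_single image_eqI)

lemma cell_sum_closed:
  fixes A :: "'a::ab_group_add itself"
  assumes "h \<in> fin_chains (nerve T n)"
  shows "cell_sum h \<in> carrier (chain_group A GG n)"
proof (rule additive_on_closed[OF additive_on_cell_sum chain_group_subgroup assms])
  fix xs and a :: 'a assume "xs \<in> nerve T n"
  then have "indic (cell xs) a \<in> chain_generators GG n"
    using compactin_cell openin_cell Hausdorff_cell unfolding chain_generators_def by blast
  then show "cell_sum (single xs a) \<in> carrier (chain_group A GG n)"
    using chain_group_generators unfolding cell_sum_single by blast
qed

lemma cylinder_edges_disjoint:
  assumes "p \<in> fpaths" "F \<subseteq> edges_at (path_src p)"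
  shows "disjoint_family_on (\<lambda>e. cylinder (ext p [e])) F"
  unfolding disjoint_family_on_def using cylinder_edge_unique[OF assms(1)] assms(2) by blast

text \<open>A relatively clopen part \<open>W\<close> of the cylinder is resolved into cells along
  the tree. On an infinite path the cylinders eventually lie inside or outside \<open>W\<close>; at
  a singular vertex the path ending there decides all but finitely many edges.\<close>

lemma indic_clopen:
  assumes xs: "xs \<in> nerve T n" and W: "openin bpath_topology W" "openin bpath_topology (cylinder (tsrc xs) - W)"
  shows "indic (zpt xs ` (W \<inter> cylinder (tsrc xs))) a \<in> cell_sum ` fin_chains (nerve T n)"
proof -
  let ?S = "cell_sum ` fin_chains (nerve T n)"
  have c: "tchain xs" using nerve_tchain[OF xs] .
  let ?q = "tsrc xs"
  have q: "?q \<in> fpaths" using tchain_tsrc[OF c] .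
  note S = cell_sum_image_subgroup[of "nerve T n"]
  have cyl: "indic (zpt xs ` cylinder p) a \<in> ?S" if "p \<in> fpaths" "p = ext ?q ts" for p ts
  proof -
    have ts: "epath (path_src ?q) ts" using that by simp
    show ?thesis using indic_cell_in_image[OF tres_nerve[OF xs ts]] unfolding cell_tres[OF c ts] that(2) .
  qed
  have un: "indic (zpt xs ` (\<Union>e\<in>F. B e)) a = (\<Sum>e\<in>F. indic (zpt xs ` B e) a)"
    if "finite F" "p \<in> fpaths" "p = ext ?q ts" "F \<subseteq> edges_at (path_src p)" "\<And>e. e \<in> F \<Longrightarrow> B e \<subseteq> cylinder (ext p [e])" for F p ts B
  proof -
    have "disjoint_family_on (\<lambda>e. zpt xs ` B e) F"
      unfolding disjoint_family_on_def
    proof (intro ballI impI)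
      fix e f assume ef: "e \<in> F" "f \<in> F" "e \<noteq> f"
      have "B e \<inter> B f = {}"
        using cylinder_edges_disjoint[OF that(2,4)] that(5) ef by (fastforce simp: disjoint_family_on_def)
      moreover have "B g \<subseteq> cylinder ?q" if "g \<in> F" for g
      proof -
        have "ext p [g] = ext ?q (ts @ [g])" "epath (path_src ?q) (ts @ [g])"
          using \<open>p = ext ?q ts\<close> \<open>p \<in> fpaths\<close> epath_edge[of g "path_src p"] that \<open>F \<subseteq> edges_at (path_src p)\<close>
          by (auto simp: epath_append)
        then show ?thesis
          using \<open>\<And>e. e \<in> F \<Longrightarrow> B e \<subseteq> cylinder (ext p [e])\<close>[OF that] cylinder_ext_subset[of ?q "ts @ [g]"] by auto
      qed
      ultimately show "zpt xs ` B e \<inter> zpt xs ` B f = {}" using zpt_inj[OF c] ef by blast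
    qed
    then show ?thesis unfolding image_UN by (rule indic_UN_disjoint[OF that(1)])
  qed
  \<comment> \<open>Vacuous at paths that do not extend \<open>?q\<close>, to which
    \<open>xs\<close> cannot be restricted.\<close>
  define P where "P p \<longleftrightarrow> (\<forall>ts. p = ext ?q ts \<longrightarrow> indic (zpt xs ` (W \<inter> cylinder p)) a \<in> ?S)" for p
  have "P ?q"
  proof (rule path_tree_induct[OF _ _ q])
    fix p assume p: "p \<in> fpaths"
    show "\<exists>F. finite F \<and> F \<subseteq> edges_at (path_src p) \<and> ((\<forall>e\<in>F. P (ext p [e])) \<longrightarrow> P p)"
    proof (cases "\<exists>ts. p = ext ?q ts")
      case False
      then show ?thesis unfolding P_def by (intro exI[of _ "{}"]) auto
    next
      case True
      then obtain ts where ts: "p = ext ?q ts" by blast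
      have Pe: "indic (zpt xs ` (W \<inter> cylinder (ext p [e]))) a \<in> ?S" if "P (ext p [e])" for e
        using that ts unfolding P_def by simp
      have PF: "indic (zpt xs ` (\<Union>e\<in>F. W \<inter> cylinder (ext p [e]))) a \<in> ?S"
        if F: "finite F" "F \<subseteq> edges_at (path_src p)" "\<forall>e\<in>F. P (ext p [e])" for F
        unfolding un[OF F(1) p ts F(2), of "\<lambda>e. W \<inter> cylinder (ext p [e])", OF Int_lower2]
        using Pe F(3) by (intro add_subgroup_sum[OF S]) blast
      have PI: "P p" if "indic (zpt xs ` (W \<inter> cylinder p)) a \<in> ?S" using that unfolding P_def by blast
      have pq: "cylinder p \<subseteq> cylinder ?q" using cylinder_ext_subset[of ?q ts] ts p by auto
      show ?thesis
      proof (cases "regular (path_src p)")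
        case True
        have eq: "W \<inter> cylinder p = (\<Union>e\<in>edges_at (path_src p). W \<inter> cylinder (ext p [e]))"
          using cylinder_regular[OF True] by blast
        have fin: "finite (edges_at (path_src p))" using True by (simp add: regular_iff)
        show ?thesis
          using PF[OF fin subset_refl] PI fin unfolding eq by blast
      next
        case sing: False
        have fp: "FinP p \<in> cylinder p" using FinP_in_cylinder[OF p sing] .
        show ?thesis
        proof (cases "FinP p \<in> W")
          case True
          have "near (FinP p) W" using W(1) True openin_bpath_iff by blast
          then obtain F where F: "finite F" "F \<subseteq> edges_at (path_src p)"
            "cylinder p \<subseteq> W \<union> (\<Union>e\<in>F. cylinder (ext p [e]))" "nbhd p F \<subseteq> W"
            by (rule near_FinP[OF _ p sing])
          have sub: "(\<Union>e\<in>F. cylinder (ext p [e])) \<subseteq> cylinder p"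
            using F(2) cylinder_ext_subset[OF epath_edge] by blast
          \<comment> \<open>Outside the edges in \<open>F\<close> the whole cylinder of
            \<open>p\<close> lies in \<open>W\<close>. The indicator of this part is that of a cell
            minus those of finitely many smaller cells.\<close>
          have eq: "W \<inter> cylinder p = (cylinder p - (\<Union>e\<in>F. cylinder (ext p [e]))) \<union> (\<Union>e\<in>F. W \<inter> cylinder (ext p [e]))"
            using F(4) sub unfolding nbhd_def by blast
          have inj: "inj_on (zpt xs) (cylinder p)" using zpt_inj[OF c] pq by (meson inj_onI subsetD)
          have "zpt xs ` (W \<inter> cylinder p) = (zpt xs ` cylinder p - zpt xs ` (\<Union>e\<in>F. cylinder (ext p [e]))) \<union>
              zpt xs ` (\<Union>e\<in>F. W \<inter> cylinder (ext p [e]))"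
            unfolding eq image_Un using inj_on_image_set_diff[OF inj, of "cylinder p"] sub by (simp add: Diff_subset)
          moreover have "(zpt xs ` cylinder p - zpt xs ` (\<Union>e\<in>F. cylinder (ext p [e]))) \<inter>
              zpt xs ` (\<Union>e\<in>F. W \<inter> cylinder (ext p [e])) = {}" by blast
          ultimately have "indic (zpt xs ` (W \<inter> cylinder p)) a =
              indic (zpt xs ` cylinder p - zpt xs ` (\<Union>e\<in>F. cylinder (ext p [e]))) a +
              indic (zpt xs ` (\<Union>e\<in>F. W \<inter> cylinder (ext p [e]))) a"
            using indic_simps(2) by metis
          also have "indic (zpt xs ` cylinder p - zpt xs ` (\<Union>e\<in>F. cylinder (ext p [e]))) a =
              indic (zpt xs ` cylinder p) a - indic (zpt xs ` (\<Union>e\<in>F. cylinder (ext p [e]))) a"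
            by (rule indic_simps(3)) (use sub in blast)
          also have "indic (zpt xs ` (\<Union>e\<in>F. cylinder (ext p [e]))) a = (\<Sum>e\<in>F. indic (zpt xs ` cylinder (ext p [e])) a)"
            by (rule un[OF F(1) p ts F(2)]) simp
          finally have 1: "indic (zpt xs ` (W \<inter> cylinder p)) a = indic (zpt xs ` cylinder p) a -
              (\<Sum>e\<in>F. indic (zpt xs ` cylinder (ext p [e])) a) + indic (zpt xs ` (\<Union>e\<in>F. W \<inter> cylinder (ext p [e]))) a" .
          have "indic (zpt xs ` cylinder (ext p [e])) a \<in> ?S" if "e \<in> F" for e
          proof -
            have "epath (path_src p) [e]" using F(2) that by (intro epath_edge) blast
            then have "ext p [e] \<in> fpaths" using p unfolding ext_fpaths by blast
            moreover have "ext p [e] = ext ?q (ts @ [e])" using ts by simp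
            ultimately show ?thesis by (rule cyl)
          qed
          then have "indic (zpt xs ` cylinder p) a - (\<Sum>e\<in>F. indic (zpt xs ` cylinder (ext p [e])) a) \<in> ?S"
            by (intro add_subgroup_diff[OF S cyl[OF p ts]] add_subgroup_sum[OF S])
          then have "P p" if "\<forall>e\<in>F. P (ext p [e])"
            using PI unfolding 1 using add_subgroup_add[OF S _ PF[OF F(1,2) that]] by blast
          then show ?thesis using F by blast
        next
          case False
          then have "near (FinP p) (cylinder ?q - W)" using W(2) fp pq openin_bpath_iff by blast
          then obtain F where F: "finite F" "F \<subseteq> edges_at (path_src p)"
            "cylinder p \<subseteq> (cylinder ?q - W) \<union> (\<Union>e\<in>F. cylinder (ext p [e]))" "nbhd p F \<subseteq> cylinder ?q - W"
            by (rule near_FinP[OF _ p sing])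
          have "cylinder (ext p [e]) \<subseteq> cylinder p" if "e \<in> F" for e
            using F(2) that by (intro cylinder_ext_subset epath_edge) blast
          then have eq: "W \<inter> cylinder p = (\<Union>e\<in>F. W \<inter> cylinder (ext p [e]))" using F(3) by blast
          show ?thesis using PF[OF F(1,2)] PI F unfolding eq by blast
        qed
      qed
    qed
  next
    fix s v assume s: "InfP s \<in> bpaths_at v"
    obtain p where p: "p \<in> fpaths" "InfP s \<in> cylinder p" using InfP_long[OF s, of 0] by blast
    show "ev_prefix (InfP s) P"
    proof (cases "InfP s \<in> W")
      case True
      then have "near (InfP s) W" using W(1) openin_bpath_iff by blast
      then show ?thesis
      proof (rule ev_prefix_mono[OF near_InfP])
        fix p assume "p \<in> fpaths" "cylinder p \<subseteq> W"
        then show "P p" unfolding P_def using cyl by (metis Int_absorb1)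
      qed
    next
      case out: False
      show ?thesis
      proof (cases "InfP s \<in> cylinder ?q")
        case True
        then have "near (InfP s) (cylinder ?q - W)" using W(2) out openin_bpath_iff by blast
        then show ?thesis
        proof (rule ev_prefix_mono[OF near_InfP])
          fix p assume "cylinder p \<subseteq> cylinder ?q - W"
          then have "W \<inter> cylinder p = {}" by blast
          then have "indic (zpt xs ` (W \<inter> cylinder p)) a = 0" by (simp only: image_empty indic_simps(1))
          then show "P p" unfolding P_def using add_subgroup_zero[OF S] by metis
        qed
      next
        case False
        show ?thesis
        proof (rule ev_prefix_mono[OF ev_prefix_ext[OF p]])
          fix r assume r: "r \<in> fpaths" "InfP s \<in> cylinder r"
          then show "P r" unfolding P_def using False cylinder_ext_subset by (metis ext_fpaths subsetD)
        qed
      qed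
    qed
  qed
  then show ?thesis unfolding P_def by (metis ext_simps(3))
qed

text \<open>The complement inside the compact cell is the image of an open set, so the image of
  \<open>W\<close> is closed there.\<close>

lemma compactin_zpt_image:
  assumes xs: "xs \<in> nerve T n" and W: "openin bpath_topology W" "openin bpath_topology (cylinder (tsrc xs) - W)"
    "W \<subseteq> cylinder (tsrc xs)"
  shows "compactin (nerve_topology GG n) (zpt xs ` W)"
proof -
  let ?X = "nerve_topology GG n"
  have c: "tchain xs" using nerve_tchain[OF xs] .
  have "zpt xs ` W = cell xs - zpt xs ` (cylinder (tsrc xs) - W)"
    using zpt_inj[OF c] W(3) unfolding cell_def by blast
  moreover have "openin (subtopology ?X (cell xs)) (zpt xs ` (cylinder (tsrc xs) - W))"
    using openin_zpt_image[OF xs W(2)] by (auto simp: openin_subtopology cell_def)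
  moreover have top: "topspace (subtopology ?X (cell xs)) = cell xs"
    using openin_subset[OF openin_cell[OF xs]] by (auto simp: topspace_subtopology)
  ultimately have "closedin (subtopology ?X (cell xs)) (zpt xs ` W)"
    unfolding closedin_def using W(3) by (simp add: cell_def image_mono double_diff)
  moreover have "compactin (subtopology ?X (cell xs)) (cell xs)"
    using compactin_cell[OF xs] by (simp add: compactin_subtopology)
  moreover have "zpt xs ` W \<subseteq> cell xs" using W(3) by (auto simp: cell_def)
  ultimately have "compactin (subtopology ?X (cell xs)) (zpt xs ` W)" using closed_compactin by blast
  then show ?thesis by (simp add: compactin_subtopology)
qed

lemma nbhd_clopen:
  assumes "p \<in> fpaths" "finite F" "F \<subseteq> edges_at (path_src p)"
  shows "openin bpath_topology (cylinder p - nbhd p F)" "nbhd p F \<subseteq> cylinder p"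
proof -
  have "cylinder p - nbhd p F = (\<Union>e\<in>F. cylinder (ext p [e]))"
    using assms(3) cylinder_ext_subset[OF epath_edge] unfolding nbhd_def by blast
  moreover have "openin bpath_topology (cylinder (ext p [e]))" if "e \<in> F" for e
    using openin_cylinder[of "ext p [e]"] epath_edge assms that by auto
  ultimately show "openin bpath_topology (cylinder p - nbhd p F)" by (simp only:) (auto intro!: openin_Union)
  show "nbhd p F \<subseteq> cylinder p" by (auto simp: nbhd_def)
qed

text \<open>A compact open Hausdorff set \<open>U\<close> is covered by finitely many clopen pieces
  of cells, which are made disjoint one at a time. The union of the earlier pieces is compact, hence
  closed in the Hausdorff set \<open>U\<close>, so a new piece minus this union is again clopen in
  its cell.\<close>

lemma chain_group_GG_subset: "carrier (chain_group (A :: 'a::ab_group_add itself) GG n) \<subseteq> cell_sum ` fin_chains (nerve T n)"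
proof (rule chain_group_minimal[OF cell_sum_image_subgroup])
  let ?X = "nerve_topology GG n" and ?S = "cell_sum ` fin_chains (nerve T n) :: (_ \<Rightarrow> 'a) set"
  note S = cell_sum_image_subgroup[of "nerve T n"]
  have "indic U a \<in> ?S"
    if U: "compactin ?X U" "openin ?X U" "Hausdorff_space (subtopology ?X U)" for U and a :: 'a
  proof -
    define \<B> where "\<B> = {zpt xs ` W |xs W. xs \<in> nerve T n \<and> openin bpath_topology W \<and>
      openin bpath_topology (cylinder (tsrc xs) - W) \<and> W \<subseteq> cylinder (tsrc xs) \<and> zpt xs ` W \<subseteq> U}"
    have basis: "\<exists>B. B \<in> \<B> \<and> openin ?X B \<and> gs \<in> B" if gs: "gs \<in> U" for gs
    proof -
      have "gs \<in> nerve GG n" using openin_subset[OF U(2)] gs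
        by (auto simp: nerve_topology_def topspace_pullback_topology)
      then obtain xs w where xs: "xs \<in> nerve T n" "w \<in> cylinder (tsrc xs)" "gs = zpt xs w" by (rule nerve_GG_zpt)
      have c: "tchain xs" using nerve_tchain[OF xs(1)] .
      have "near w {w' \<in> cylinder (tsrc xs). zpt xs w' \<in> U}" using near_zpt[OF U(2) xs(1,2)] xs(3) gs by simp
      then obtain ts F where ts: "epath (path_src (tsrc xs)) ts" "finite F" "F \<subseteq> edges_at (path_src (ext (tsrc xs) ts))"
        "w \<in> nbhd (ext (tsrc xs) ts) F" "nbhd (ext (tsrc xs) ts) F \<subseteq> {w' \<in> cylinder (tsrc xs). zpt xs w' \<in> U}"
        by (rule near_extE[OF _ tchain_tsrc[OF c] xs(2)])
      let ?ys = "tres xs ts" and ?W = "nbhd (ext (tsrc xs) ts) F"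
      have y: "?ys \<in> nerve T n" "tsrc ?ys = ext (tsrc xs) ts" "ext (tsrc xs) ts \<in> fpaths"
        using tres_nerve[OF xs(1) ts(1)] tchain_tres[OF c ts(1)] ts(1) tchain_tsrc[OF c] by auto
      note W = openin_nbhd[OF y(3) ts(2,3)] nbhd_clopen[OF y(3) ts(2,3)]
      have z: "zpt ?ys w' = zpt xs w'" if "w' \<in> ?W" for w'
        using tact_tres(2)[OF c ts(1)] that W(3) by blast
      then have "zpt ?ys ` ?W \<subseteq> U" "gs \<in> zpt ?ys ` ?W" using ts(4,5) xs(3) by auto
      moreover have "openin ?X (zpt ?ys ` ?W)" using openin_zpt_image[OF y(1) W(1)] W(3) y(2) by simp
      moreover have "zpt ?ys ` ?W \<in> \<B>"
        unfolding \<B>_def mem_Collect_eq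
        by (rule exI[of _ ?ys], rule exI[of _ ?W]) (use calculation(1) y W in simp)
      ultimately show ?thesis by blast
    qed
    obtain \<F> where \<F>: "finite \<F>" "\<F> \<subseteq> \<B>" "U \<subseteq> \<Union>\<F>" using compactin_open_basis[OF U(1), of \<B>] basis by blast
    have "\<Union>\<F> \<subseteq> U" using \<F>(2) unfolding \<B>_def by blast
    have "indic (\<Union>\<F>) a \<in> ?S" using \<F>(1,2)
    proof (induction \<F> rule: finite_induct)
      case empty
      show ?case unfolding Union_empty indic_simps(1) by (rule add_subgroup_zero[OF S])
    next
      case (insert B \<F>)
      have "B \<in> \<B>" using insert.prems by blast
      then obtain xs W where xs: "xs \<in> nerve T n" "openin bpath_topology W" "openin bpath_topology (cylinder (tsrc xs) - W)"
        "W \<subseteq> cylinder (tsrc xs)" "zpt xs ` W \<subseteq> U" "B = zpt xs ` W" unfolding \<B>_def by blast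
      have mem: "openin ?X C \<and> compactin ?X C \<and> C \<subseteq> U" if "C \<in> \<F>" for C
      proof -
        have "C \<in> \<B>" using that insert.prems by blast
        then obtain ys V where y: "ys \<in> nerve T n" "openin bpath_topology V" "openin bpath_topology (cylinder (tsrc ys) - V)"
          "V \<subseteq> cylinder (tsrc ys)" "zpt ys ` V \<subseteq> U" "C = zpt ys ` V" unfolding \<B>_def by blast
        then show ?thesis using openin_zpt_image[OF y(1,2,4)] compactin_zpt_image[OF y(1-4)] by simp
      qed
      have op: "openin ?X (\<Union>\<F>)" using mem by (intro openin_Union) blast
      have "compactin ?X (\<Union>\<F>)" using mem insert.hyps(1) by (intro compactin_Union) blast+
      moreover have sub: "\<Union>\<F> \<subseteq> U" using mem by blast
      ultimately have "compactin (subtopology ?X U) (\<Union>\<F>)" by (simp add: compactin_subtopology)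
      then have "closedin (subtopology ?X U) (\<Union>\<F>)" using compactin_imp_closedin[OF U(3)] by blast
      then have "openin (subtopology ?X U) (topspace (subtopology ?X U) - \<Union>\<F>)" by (simp add: closedin_def)
      moreover have "topspace (subtopology ?X U) = U" using openin_subset[OF U(2)] by (auto simp: topspace_subtopology)
      ultimately have "openin ?X (U - \<Union>\<F>)" using openin_trans_full[OF _ U(2)] by simp
      moreover have "openin ?X B" using openin_zpt_image[OF xs(1,2,4)] xs(6) by simp
      ultimately have opB: "openin ?X (B \<inter> (U - \<Union>\<F>))" by blast
      let ?W = "{w \<in> cylinder (tsrc xs). zpt xs w \<in> B \<inter> (U - \<Union>\<F>)}"
      have B_mem: "zpt xs w \<in> B \<longleftrightarrow> w \<in> W" if "w \<in> cylinder (tsrc xs)" for w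
        using zpt_inj[OF nerve_tchain[OF xs(1)]] that xs(4,6) by blast
      have "cylinder (tsrc xs) - ?W = {w \<in> cylinder (tsrc xs). zpt xs w \<in> \<Union>\<F>} \<union> (cylinder (tsrc xs) - W)"
        using xs(5) B_mem by auto
      then have "openin bpath_topology (cylinder (tsrc xs) - ?W)"
        using openin_Un[OF openin_zpt_preimage[OF op xs(1)] xs(3)] by simp
      then have "indic (zpt xs ` (?W \<inter> cylinder (tsrc xs))) a \<in> ?S"
        by (rule indic_clopen[OF xs(1) openin_zpt_preimage[OF opB xs(1)]])
      moreover have "zpt xs ` (?W \<inter> cylinder (tsrc xs)) = B - \<Union>\<F>"
      proof (rule subset_antisym; rule subsetI)
        fix y assume "y \<in> B - \<Union>\<F>"
        moreover from this obtain w where "w \<in> W" "y = zpt xs w" using xs(6) by blast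
        moreover from this have "w \<in> cylinder (tsrc xs)" "y \<in> U" using xs(4,5) by blast+
        ultimately show "y \<in> zpt xs ` (?W \<inter> cylinder (tsrc xs))" by blast
      qed blast
      ultimately have "indic (B - \<Union>\<F>) a \<in> ?S" by simp
      moreover have "indic (\<Union>\<F>) a \<in> ?S" using insert by blast
      ultimately have "indic (B - \<Union>\<F>) a + indic (\<Union>\<F>) a \<in> ?S" by (rule add_subgroup_add[OF S])
      moreover have "indic (\<Union>(insert B \<F>)) a = indic (B - \<Union>\<F>) a + indic (\<Union>\<F>) a"
        using indic_simps(2)[of "B - \<Union>\<F>" "\<Union>\<F>" a] by (simp add: Diff_disjoint Int_commute)
      ultimately show ?case by (simp only:)
    qed
    moreover have "\<Union>\<F> = U" using \<F>(3) \<open>\<Union>\<F> \<subseteq> U\<close> by blast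
    ultimately show ?thesis by simp
  qed
  then show "chain_generators GG n \<subseteq> ?S" by (auto simp: chain_generators_def)
qed

lemma cell_sum_image: "cell_sum ` fin_chains (nerve T n) = carrier (chain_group (A :: 'a::ab_group_add itself) GG n)"
  using cell_sum_closed chain_group_GG_subset by blast

subsection \<open>The boundary of a cell\<close>

lemma face_pt:
  assumes "xs \<in> nerve T (Suc n)" "i \<le> Suc n"
  shows "face_pt (Suc n) i xs ` cylinder (tsrc xs) = cylinder (tsrc (face T (Suc n) i xs))"
    "inj_on (face_pt (Suc n) i xs) (cylinder (tsrc xs))"
proof -
  have "tchain xs" using nerve_tchain[OF assms(1)] .
  moreover from this have "xs \<noteq> []" by auto
  ultimately have x: "last xs \<in> Arr T" using tchain_arr last_in_set by blast
  show "face_pt (Suc n) i xs ` cylinder (tsrc xs) = cylinder (tsrc (face T (Suc n) i xs))"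
  proof (cases "i = Suc n")
    case True
    have "act (last xs) ` cylinder (pd (last xs)) = cylinder (pr (last xs))"
      using act_cylinder[OF x] act_surj[OF x] by (auto simp: image_iff) metis
    then show ?thesis using True tsrc_face[OF assms] by (simp add: face_pt_def tsrc_def)
  next
    case False
    then show ?thesis using tsrc_face[OF assms] by (simp add: face_pt_def)
  qed
  show "inj_on (face_pt (Suc n) i xs) (cylinder (tsrc xs))"
    using act_inj[OF x] by (auto simp: inj_on_def face_pt_def tsrc_def)
qed

lemma face_cell:
  assumes xs: "xs \<in> nerve T (Suc n)" and i: "i \<le> Suc n"
  shows "face GG (Suc n) i ` cell xs = cell (face T (Suc n) i xs)" "inj_on (face GG (Suc n) i) (cell xs)"
proof -
  let ?f = "face T (Suc n) i xs" and ?p = "face_pt (Suc n) i xs"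
  have *: "face GG (Suc n) i (zpt xs w) = zpt ?f (?p w)" if "w \<in> cylinder (tsrc xs)" for w
    using face_zpt[OF xs i that] .
  have "face GG (Suc n) i ` cell xs = (\<lambda>w. zpt ?f (?p w)) ` cylinder (tsrc xs)"
    unfolding cell_def image_image using * by (intro image_cong) auto
  also have "\<dots> = zpt ?f ` (?p ` cylinder (tsrc xs))" by (simp add: image_image)
  finally show "face GG (Suc n) i ` cell xs = cell ?f" unfolding face_pt(1)[OF xs i] cell_def .
  have c: "tchain ?f" using nerve_tchain[OF T.face_closed[OF xs i]] .
  show "inj_on (face GG (Suc n) i) (cell xs)"
  proof (rule inj_onI)
    fix x y assume "x \<in> cell xs" "y \<in> cell xs" and eq: "face GG (Suc n) i x = face GG (Suc n) i y"
    then obtain w w' where w: "w \<in> cylinder (tsrc xs)" "w' \<in> cylinder (tsrc xs)" "x = zpt xs w" "y = zpt xs w'"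
      by (auto simp: cell_def)
    have m: "?p w \<in> cylinder (tsrc ?f)" "?p w' \<in> cylinder (tsrc ?f)" using face_pt(1)[OF xs i] w by blast+
    have "?p w = ?p w'" using zpt_inj[OF c m] eq *[OF w(1)] *[OF w(2)] w by simp
    then show "x = y" using face_pt(2)[OF xs i] w by (auto simp: inj_on_def)
  qed
qed

lemma boundary_cell:
  assumes xs: "xs \<in> nerve T (Suc n)"
  shows "boundary GG (Suc n) (indic (cell xs) a) = (\<Sum>i\<le>Suc n. alt i (indic (cell (face T (Suc n) i xs)) a))"
  unfolding boundary_eq[OF zero_less_Suc]
proof (rule sum.cong[OF refl])
  fix i assume "i \<in> {..Suc n}"
  then have i: "i \<le> Suc n" by simp
  show "alt i (pushforward (nerve GG (Suc n)) (face GG (Suc n) i) (indic (cell xs) a)) =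
      alt i (indic (cell (face T (Suc n) i xs)) a)"
    using pushforward_indic[OF cell_nerve[OF xs] face_cell(2)[OF xs i]] face_cell(1)[OF xs i] by metis
qed

text \<open>Finitely many cells carry the function, and the face map is injective on each of
  them.\<close>

lemma finite_fibres:
  assumes h: "h \<in> fin_chains (nerve T (Suc n))" and i: "i \<le> Suc n"
  shows "finite {x \<in> nerve GG (Suc n). face GG (Suc n) i x = y \<and> cell_sum h x \<noteq> 0}"
proof -
  have fin: "finite {x \<in> cell xs. face GG (Suc n) i x = y}" if "xs \<in> nerve T (Suc n)" for xs
  proof (cases "\<exists>x\<in>cell xs. face GG (Suc n) i x = y")
    case True
    then obtain x where "x \<in> cell xs" "face GG (Suc n) i x = y" by blast
    then have "{x \<in> cell xs. face GG (Suc n) i x = y} \<subseteq> {x}"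
      using face_cell(2)[OF that i] by (auto simp: inj_on_def)
    then show ?thesis by (rule finite_subset) simp
  next
    case False
    then have "{x \<in> cell xs. face GG (Suc n) i x = y} = {}" by blast
    then show ?thesis by (simp only: finite.emptyI)
  qed
  have "cell_sum h x = 0" if "\<And>xs. h xs \<noteq> 0 \<Longrightarrow> x \<notin> cell xs" for x
    unfolding cell_sum_def lin_ext_def sum_fun_apply using that by (intro sum.neutral) (auto simp: indic_def)
  then have "{x \<in> nerve GG (Suc n). face GG (Suc n) i x = y \<and> cell_sum h x \<noteq> 0} \<subseteq>
      (\<Union>xs\<in>{xs. h xs \<noteq> 0}. {x \<in> cell xs. face GG (Suc n) i x = y})" by blast
  then show ?thesis
    by (rule finite_subset) (use fin fin_chains_supp[OF h] fin_chains_finite[OF h] in blast)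
qed

lemma boundary_cell_sum:
  fixes h :: "(('g, 'x) fpath \<times> 'g \<times> ('g, 'x) fpath) list \<Rightarrow> 'a::ab_group_add"
  assumes h: "h \<in> fin_chains (nerve T (Suc n))"
  shows "boundary GG (Suc n) (cell_sum h) = cell_sum (boundary T (Suc n) h)"
proof (rule additive_on_eqI[where F = "\<lambda>h. boundary GG (Suc n) (cell_sum h)" and
      G = "\<lambda>h. cell_sum (boundary T (Suc n) h)", OF _ _ h])
  show "additive_on (nerve T (Suc n)) (\<lambda>h :: _ \<Rightarrow> 'a. boundary GG (Suc n) (cell_sum h))"
  proof (rule additive_onI)
    fix h k :: "(('g, 'x) fpath \<times> 'g \<times> ('g, 'x) fpath) list \<Rightarrow> 'a"
    assume hk: "h \<in> fin_chains (nerve T (Suc n))" "k \<in> fin_chains (nerve T (Suc n))"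
    show "boundary GG (Suc n) (cell_sum (h + k)) = boundary GG (Suc n) (cell_sum h) + boundary GG (Suc n) (cell_sum k)"
      unfolding additive_onD[OF additive_on_cell_sum hk]
      by (rule boundary_add_general) (rule finite_fibres[OF hk(1)] finite_fibres[OF hk(2)], assumption)+
  qed
  show "additive_on (nerve T (Suc n)) (\<lambda>h :: _ \<Rightarrow> 'a. cell_sum (boundary T (Suc n) h))"
    by (rule additive_on_comp[OF additive_on_boundary additive_on_cell_sum T.boundary_closed])
  fix xs and a :: 'a assume xs: "xs \<in> nerve T (Suc n)"
  have "cell_sum (boundary T (Suc n) (single xs a)) =
      (\<Sum>i\<le>Suc n. cell_sum (alt i (single (face T (Suc n) i xs) a)))"
    unfolding boundary_single[OF xs zero_less_Suc]
    by (rule additive_on_sum[OF additive_on_cell_sum[of UNIV]]) (auto intro: fin_chains_alt)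
  also have "\<dots> = (\<Sum>i\<le>Suc n. alt i (indic (cell (face T (Suc n) i xs)) a))"
    by (rule sum.cong[OF refl]) (simp add: additive_on_alt[OF additive_on_cell_sum[of UNIV]] cell_sum_single)
  finally show "boundary GG (Suc n) (cell_sum (single xs a)) = cell_sum (boundary T (Suc n) (single xs a))"
    by (simp only: cell_sum_single boundary_cell[OF xs])
qed

end

section \<open>The kernel of the map from chains to cells\<close>

context graph_picture
begin

section \<open>Subdivision along edges\<close>

definition reg_nerve :: "nat \<Rightarrow> (('g, 'x) fpath \<times> 'g \<times> ('g, 'x) fpath) list set" where
  "reg_nerve n = {xs \<in> nerve T n. regular (path_src (tsrc xs))}"

text \<open>At a source with infinitely many edges the sum is 0 by convention. The operator is thus
  total and still compatible with all faces, since \<open>edge_act\<close> matches the edges at the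
  two ends of an arrow.\<close>

definition subdivide :: "((('g, 'x) fpath \<times> 'g \<times> ('g, 'x) fpath) list \<Rightarrow> 'a::ab_group_add) \<Rightarrow>
    (('g, 'x) fpath \<times> 'g \<times> ('g, 'x) fpath) list \<Rightarrow> 'a" where
  "subdivide = lin_ext (\<lambda>xs a. \<Sum>e\<in>edges_at (path_src (tsrc xs)). single (tres xs [e]) a)"

lemma reg_nerve_subset: "reg_nerve n \<subseteq> nerve T n"
  by (auto simp: reg_nerve_def)

lemma biadditive_subdivide: "biadditive (\<lambda>xs a. \<Sum>e\<in>edges_at (path_src (tsrc xs)). single (tres xs [e]) a)"
  by (simp add: biadditive_def sum.distrib)

lemma additive_on_subdivide: "additive_on N subdivide"
  unfolding subdivide_def by (rule additive_on_lin_ext[OF biadditive_subdivide])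

lemma subdivide_single:
  "subdivide (single xs a) = (\<Sum>e\<in>edges_at (path_src (tsrc xs)). single (tres xs [e]) a)"
  unfolding subdivide_def by (rule lin_ext_single[OF biadditive_subdivide])

lemma subdivide_closed:
  fixes h :: "(('g, 'x) fpath \<times> 'g \<times> ('g, 'x) fpath) list \<Rightarrow> 'a::ab_group_add"
  assumes "h \<in> fin_chains (nerve T n)"
  shows "subdivide h \<in> fin_chains (nerve T n)"
proof (rule additive_on_closed[OF additive_on_subdivide fin_chains_subgroup assms])
  fix xs and a :: 'a assume "xs \<in> nerve T n"
  then show "subdivide (single xs a) \<in> fin_chains (nerve T n)"
    unfolding subdivide_single using tres_nerve epath_edge by (intro fin_chains_sum fin_chains_single) blast
qed

lemma face_subdivide:
  assumes xs: "xs \<in> nerve T (Suc n)" and i: "i \<le> Suc n"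
  shows "(\<Sum>e\<in>edges_at (path_src (tsrc xs)). single (face T (Suc n) i (tres xs [e])) a) =
    (\<Sum>e\<in>edges_at (path_src (tsrc (face T (Suc n) i xs))). single (tres (face T (Suc n) i xs) [e]) a)"
proof -
  let ?f = "face T (Suc n) i xs"
  have eq: "face T (Suc n) i (tres xs [e]) = tres ?f (face_ls (Suc n) i xs [e])" if "e \<in> edges_at (path_src (tsrc xs))" for e
    using face_tres[OF xs i epath_edge[OF that]] .
  show ?thesis
  proof (cases "i = Suc n")
    case False
    then show ?thesis using eq tsrc_face[OF xs i] by (simp add: face_ls_def)
  next
    case True
    have c: "tchain xs" using nerve_tchain[OF xs] .
    moreover from this have "xs \<noteq> []" by auto
    ultimately have x: "last xs \<in> Arr T" using tchain_arr last_in_set by blast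
    \<comment> \<open>The last face moves the source along the last arrow, so subdividing before and
      after differs by the reindexing of edges under \<open>edge_act ?g\<close>.\<close>
    let ?g = "ar (last xs)"
    have g: "?g \<in> Arr G" "path_src (tsrc xs) = src G ?g" "path_src (tsrc ?f) = rng G ?g"
      using x tsrc_face[OF xs i] True by (auto simp: T_arr tsrc_def)
    have "(\<Sum>e\<in>edges_at (src G ?g). single (face T (Suc n) i (tres xs [e])) a) =
        (\<Sum>e\<in>edges_at (src G ?g). single (tres ?f [edge_act ?g e]) a)"
      using eq g(2) True by (intro sum.cong[OF refl]) (simp add: face_ls_def)
    also have "\<dots> = (\<Sum>e\<in>edges_at (rng G ?g). single (tres ?f [e]) a)"
      by (rule sum.reindex_bij_betw[OF edge_act_bij[OF g(1)]])
    finally show ?thesis unfolding g(2,3) .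
  qed
qed

lemma boundary_subdivide:
  fixes h :: "(('g, 'x) fpath \<times> 'g \<times> ('g, 'x) fpath) list \<Rightarrow> 'a::ab_group_add"
  assumes h: "h \<in> fin_chains (nerve T (Suc n))"
  shows "boundary T (Suc n) (subdivide h) = subdivide (boundary T (Suc n) h)"
proof (rule additive_on_eqI[where F = "\<lambda>h. boundary T (Suc n) (subdivide h)" and
      G = "\<lambda>h. subdivide (boundary T (Suc n) h)", OF _ _ h])
  show "additive_on (nerve T (Suc n)) (\<lambda>h :: _ \<Rightarrow> 'a. boundary T (Suc n) (subdivide h))"
    by (rule additive_on_comp[OF additive_on_subdivide additive_on_boundary subdivide_closed])
  show "additive_on (nerve T (Suc n)) (\<lambda>h :: _ \<Rightarrow> 'a. subdivide (boundary T (Suc n) h))"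
    by (rule additive_on_comp[OF additive_on_boundary additive_on_subdivide T.boundary_closed])
  fix xs and a :: 'a assume xs: "xs \<in> nerve T (Suc n)"
  let ?E = "edges_at (path_src (tsrc xs))"
  have y: "tres xs [e] \<in> nerve T (Suc n)" if "e \<in> ?E" for e using tres_nerve[OF xs epath_edge[OF that]] .
  have "boundary T (Suc n) (subdivide (single xs a)) = (\<Sum>e\<in>?E. boundary T (Suc n) (single (tres xs [e]) a))"
    unfolding subdivide_single by (rule additive_on_sum[OF additive_on_boundary[where N = UNIV]]) simp
  also have "\<dots> = (\<Sum>e\<in>?E. \<Sum>i\<le>Suc n. alt i (single (face T (Suc n) i (tres xs [e])) a))"
  proof (rule sum.cong[OF refl])
    fix e assume "e \<in> ?E"
    from boundary_single[OF y[OF this] zero_less_Suc]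
    show "boundary T (Suc n) (single (tres xs [e]) a) = (\<Sum>i\<le>Suc n. alt i (single (face T (Suc n) i (tres xs [e])) a))" .
  qed
  also have "\<dots> = (\<Sum>i\<le>Suc n. alt i (\<Sum>e\<in>?E. single (face T (Suc n) i (tres xs [e])) a))"
    unfolding alt_sum by (rule sum.swap)
  also have "\<dots> = (\<Sum>i\<le>Suc n. alt i (subdivide (single (face T (Suc n) i xs) a)))"
    by (rule sum.cong[OF refl]) (simp add: face_subdivide[OF xs] subdivide_single)
  also have "\<dots> = (\<Sum>i\<le>Suc n. subdivide (alt i (single (face T (Suc n) i xs) a)))"
    by (rule sum.cong[OF refl]) (simp add: additive_on_alt[OF additive_on_subdivide[of UNIV]])
  also have "\<dots> = subdivide (boundary T (Suc n) (single xs a))"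
    unfolding boundary_single[OF xs zero_less_Suc]
    by (rule additive_on_sum[OF additive_on_subdivide[of UNIV], symmetric]) (auto intro: fin_chains_alt)
  finally show "boundary T (Suc n) (subdivide (single xs a)) = subdivide (boundary T (Suc n) (single xs a))" .
qed

text \<open>No boundary path ends at a regular vertex, so the cylinder is the disjoint union of the
  cylinders beyond its finitely many edges.\<close>

lemma cell_subdivide:
  fixes h :: "(('g, 'x) fpath \<times> 'g \<times> ('g, 'x) fpath) list \<Rightarrow> 'a::ab_group_add"
  assumes h: "h \<in> fin_chains (reg_nerve n)"
  shows "cell_sum (subdivide h) = cell_sum h"
proof (rule additive_on_eqI[where F = "\<lambda>h. cell_sum (subdivide h)" and G = cell_sum, OF _ additive_on_cell_sum h])
  show "additive_on (reg_nerve n) (\<lambda>h :: _ \<Rightarrow> 'a. cell_sum (subdivide h))"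
    by (rule additive_on_comp[OF additive_on_subdivide additive_on_cell_sum subdivide_closed])
      (rule fin_chains_mono[OF reg_nerve_subset])
  fix xs and a :: 'a assume "xs \<in> reg_nerve n"
  then have xs: "xs \<in> nerve T n" "regular (path_src (tsrc xs))" by (auto simp: reg_nerve_def)
  have c: "tchain xs" using nerve_tchain[OF xs(1)] .
  let ?E = "edges_at (path_src (tsrc xs))"
  have sub: "cylinder (ext (tsrc xs) [e]) \<subseteq> cylinder (tsrc xs)" if "e \<in> ?E" for e
    using that by (intro cylinder_ext_subset epath_edge)
  have cell: "cell (tres xs [e]) = zpt xs ` cylinder (ext (tsrc xs) [e])" if "e \<in> ?E" for e
    using cell_tres[OF c epath_edge[OF that]] .
  have "disjoint_family_on (\<lambda>e. cell (tres xs [e])) ?E"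
    unfolding disjoint_family_on_def
  proof (intro ballI impI)
    fix e f assume ef: "e \<in> ?E" "f \<in> ?E" "e \<noteq> f"
    have "cylinder (ext (tsrc xs) [e]) \<inter> cylinder (ext (tsrc xs) [f]) = {}"
      using cylinder_edges_disjoint[OF tchain_tsrc[OF c] subset_refl] ef by (simp add: disjoint_family_on_def)
    then show "cell (tres xs [e]) \<inter> cell (tres xs [f]) = {}"
      unfolding cell[OF ef(1)] cell[OF ef(2)] using zpt_inj[OF c] sub[OF ef(1)] sub[OF ef(2)] by blast
  qed
  moreover have "finite ?E" using xs(2) by (simp add: regular_iff)
  ultimately have "indic (\<Union>e\<in>?E. cell (tres xs [e])) a = (\<Sum>e\<in>?E. indic (cell (tres xs [e])) a)"
    by (intro indic_UN_disjoint)
  moreover have "cell xs = (\<Union>e\<in>?E. cell (tres xs [e]))"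
  proof -
    have "cell xs = zpt xs ` (\<Union>e\<in>?E. cylinder (ext (tsrc xs) [e]))"
      unfolding cell_def using cylinder_regular[OF xs(2)] by simp
    also have "\<dots> = (\<Union>e\<in>?E. cell (tres xs [e]))" unfolding image_UN using cell by simp
    finally show ?thesis .
  qed
  ultimately have "indic (cell xs) a = (\<Sum>e\<in>?E. indic (cell (tres xs [e])) a)" by simp
  also have "\<dots> = cell_sum (subdivide (single xs a))"
    unfolding subdivide_single cell_sum_single[symmetric]
    by (rule additive_on_sum[OF additive_on_cell_sum[of UNIV], symmetric]) simp
  finally show "cell_sum (subdivide (single xs a)) = cell_sum (single xs a)" by (simp only: cell_sum_single)
qed

text \<open>Subdividing lengthens the source paths, so no simplex with a shortest source occurs in
  \<open>subdivide h\<close>.\<close>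

lemma subdivide_fixed:
  assumes h: "h \<in> fin_chains (nerve T n)" and eq: "subdivide h = h"
  shows "h = 0"
proof (rule ccontr)
  assume "h \<noteq> 0"
  let ?S = "{xs. h xs \<noteq> 0}"
  have "?S \<noteq> {}" using \<open>h \<noteq> 0\<close> by (auto simp: fun_eq_iff)
  then obtain xs where xs: "xs \<in> ?S" and min: "\<And>ys. ys \<in> ?S \<Longrightarrow> length (snd (tsrc xs)) \<le> length (snd (tsrc ys))"
    using ex_has_least_nat[of "\<lambda>xs. xs \<in> ?S" _ "\<lambda>xs. length (snd (tsrc xs))"] by blast
  have "h xs = subdivide h xs" using eq by simp
  also have "\<dots> = (\<Sum>ys | h ys \<noteq> 0. \<Sum>e\<in>edges_at (path_src (tsrc ys)). single (tres ys [e]) (h ys) xs)"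
    by (simp add: subdivide_def lin_ext_def sum_fun_apply)
  also have "\<dots> = 0"
  proof (rule sum.neutral, rule ballI, rule sum.neutral, rule ballI)
    fix ys e assume ys: "ys \<in> ?S" and e: "e \<in> edges_at (path_src (tsrc ys))"
    have "tsrc (tres ys [e]) = ext (tsrc ys) [e]"
      using tchain_tres[OF nerve_tchain epath_edge[OF e]] fin_chains_supp[OF h] ys by blast
    then have "tres ys [e] \<noteq> xs" using min[OF ys] by auto
    then show "single (tres ys [e]) (h ys) xs = 0" by (simp add: single_def)
  qed
  finally show False using xs by simp
qed

text \<open>The part of a chain \<open>h\<close> that is visible on the cylinder of \<open>q\<close> consists of \<open>trunc h q\<close>, the
  restrictions to \<open>q\<close> of the simplices whose source is a prefix of \<open>q\<close>, and of \<open>beyond h (ext q [f])\<close>,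
  the simplices whose source is a proper extension of \<open>q\<close>, starting with the edge \<open>f\<close>.\<close>

definition trunc where
  "trunc h q = (\<Sum>xs | h xs \<noteq> 0 \<and> (\<exists>us. q = ext (tsrc xs) us). single (trestr xs q) (h xs))"

definition beyond where
  "beyond h q = (\<Sum>xs | h xs \<noteq> 0 \<and> (\<exists>ts. tsrc xs = ext q ts). single xs (h xs))"

definition next_edges where
  "next_edges h q = {f. \<exists>xs ts. h xs \<noteq> 0 \<and> tsrc xs = ext q (f # ts)}"

definition visible where
  "visible h q = trunc h q + (\<Sum>f\<in>next_edges h q. beyond h (ext q [f]))"

section \<open>Splitting a chain along the edges at a path\<close>

lemma trestr_prefix: "tsrc xs = ext q ts \<Longrightarrow> trestr xs q = xs"
  by (simp add: trestr_def tail_def)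

lemma finite_next_edges:
  assumes "h \<in> fin_chains N"
  shows "finite (next_edges h q)"
proof -
  have "next_edges h q \<subseteq> (\<lambda>xs. hd (drop (length (snd q)) (snd (tsrc xs)))) ` {xs. h xs \<noteq> 0}"
  proof
    fix f assume "f \<in> next_edges h q"
    then obtain xs ts where xs: "h xs \<noteq> 0" "tsrc xs = ext q (f # ts)" by (auto simp: next_edges_def)
    then have "hd (drop (length (snd q)) (snd (tsrc xs))) = f" by simp
    then show "f \<in> (\<lambda>xs. hd (drop (length (snd q)) (snd (tsrc xs)))) ` {xs. h xs \<noteq> 0}" using xs(1) by blast
  qed
  then show ?thesis using fin_chains_finite[OF assms] finite_subset by blast
qed

lemma beyond_split:
  assumes h: "h \<in> fin_chains N"
  shows "beyond h q = (\<Sum>xs | h xs \<noteq> 0 \<and> tsrc xs = q. single xs (h xs)) + (\<Sum>f\<in>next_edges h q. beyond h (ext q [f]))"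
proof -
  let ?B = "\<lambda>q. {xs. h xs \<noteq> 0 \<and> (\<exists>ts. tsrc xs = ext q ts)}"
  let ?C = "{xs. h xs \<noteq> 0 \<and> tsrc xs = q}"
  have fin: "finite (?B p)" "finite ?C" for p
    using fin_chains_finite[OF h] by (auto elim!: rev_finite_subset)
  have "?B q = ?C \<union> (\<Union>f\<in>next_edges h q. ?B (ext q [f]))"
  proof (rule subset_antisym; rule subsetI)
    fix xs assume "xs \<in> ?B q"
    then obtain ts where "h xs \<noteq> 0" "tsrc xs = ext q ts" by blast
    then show "xs \<in> ?C \<union> (\<Union>f\<in>next_edges h q. ?B (ext q [f]))"
      by (cases ts) (auto simp: next_edges_def)
  next
    fix xs assume "xs \<in> ?C \<union> (\<Union>f\<in>next_edges h q. ?B (ext q [f]))"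
    then show "xs \<in> ?B q" by (auto intro: exI[of _ "[]"])
  qed
  moreover have "?C \<inter> (\<Union>f\<in>next_edges h q. ?B (ext q [f])) = {}" by auto
  moreover have disj: "\<forall>f\<in>next_edges h q. \<forall>g\<in>next_edges h q. f \<noteq> g \<longrightarrow> ?B (ext q [f]) \<inter> ?B (ext q [g]) = {}" by auto
  moreover have "finite (\<Union>f\<in>next_edges h q. ?B (ext q [f]))" using fin(1) finite_next_edges[OF h] by blast
  ultimately have "beyond h q = (\<Sum>xs\<in>?C. single xs (h xs)) + (\<Sum>xs\<in>(\<Union>f\<in>next_edges h q. ?B (ext q [f])). single xs (h xs))"
    using sum.union_disjoint[OF fin(2), of "\<Union>f\<in>next_edges h q. ?B (ext q [f])" "\<lambda>xs. single xs (h xs)"]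
    by (simp only: beyond_def)
  also have "(\<Sum>xs\<in>(\<Union>f\<in>next_edges h q. ?B (ext q [f])). single xs (h xs)) = (\<Sum>f\<in>next_edges h q. beyond h (ext q [f]))"
    unfolding beyond_def
    by (rule sum.UNION_disjoint[OF finite_next_edges[OF h]]) (use fin(1) disj in blast)+
  finally show ?thesis .
qed

text \<open>The start of the descent: summed over the vertices \<open>v\<close>, the chains on the
  right recover \<open>h\<close>.\<close>

lemma visible_root:
  assumes h: "h \<in> fin_chains N"
  shows "visible h (v, []) = beyond h (v, [])"
proof -
  have "{xs. h xs \<noteq> 0 \<and> (\<exists>us. (v, []) = ext (tsrc xs) us)} = {xs. h xs \<noteq> 0 \<and> tsrc xs = (v, [])}"
    by (auto simp: ext_def prod_eq_iff)
  moreover have "trestr xs (v, []) = xs" if "tsrc xs = (v, [])" for xs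
    using trestr_prefix[of xs "(v, [])" "[]"] that by simp
  ultimately have "trunc h (v, []) = (\<Sum>xs | h xs \<noteq> 0 \<and> tsrc xs = (v, []). single xs (h xs))"
    unfolding trunc_def by (intro sum.cong) auto
  then show ?thesis unfolding visible_def beyond_split[OF h, of "(v, [])"] by simp
qed

text \<open>One step of the descent. Simplices with source \<open>ext q [e]\<close> are counted in
  the truncated part on the left and in \<open>beyond\<close> on the right; those with shorter
  sources are restricted by one more edge.\<close>

lemma visible_ext:
  assumes h: "h \<in> fin_chains N"
  shows "visible h (ext q [e]) = push (\<lambda>xs. tres xs [e]) (trunc h q) + beyond h (ext q [e])"
proof -
  let ?B = "\<lambda>q. {xs. h xs \<noteq> 0 \<and> (\<exists>us. q = ext (tsrc xs) us)}"
  let ?C = "{xs. h xs \<noteq> 0 \<and> tsrc xs = ext q [e]}"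
  have fin: "finite (?B p)" "finite ?C" for p
    using fin_chains_finite[OF h] by (auto elim!: rev_finite_subset)
  have "?B (ext q [e]) = ?B q \<union> ?C"
  proof (rule subset_antisym; rule subsetI)
    fix xs assume "xs \<in> ?B (ext q [e])"
    then obtain us where us: "h xs \<noteq> 0" "ext q [e] = ext (tsrc xs) us" by blast
    show "xs \<in> ?B q \<union> ?C"
    proof (cases us rule: rev_cases)
      case Nil
      then show ?thesis using us by simp
    next
      case (snoc vs f)
      then have "q = ext (tsrc xs) vs" using us(2) by (auto simp: ext_def prod_eq_iff)
      then show ?thesis using us(1) by blast
    qed
  next
    fix xs assume "xs \<in> ?B q \<union> ?C"
    then show "xs \<in> ?B (ext q [e])" by (auto intro: exI[of _ "[]"])
  qed
  moreover have "?B q \<inter> ?C = {}" by auto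
  ultimately have "trunc h (ext q [e]) = (\<Sum>xs\<in>?B q. single (trestr xs (ext q [e])) (h xs)) +
      (\<Sum>xs\<in>?C. single (trestr xs (ext q [e])) (h xs))"
    unfolding trunc_def using fin by (simp add: sum.union_disjoint)
  also have "(\<Sum>xs\<in>?C. single (trestr xs (ext q [e])) (h xs)) = (\<Sum>xs\<in>?C. single xs (h xs))"
  proof (rule sum.cong[OF refl])
    fix xs assume "xs \<in> ?C"
    then have "trestr xs (ext q [e]) = xs" using trestr_prefix[of xs "ext q [e]" "[]"] by simp
    then show "single (trestr xs (ext q [e])) (h xs) = single xs (h xs)" by simp
  qed
  also have "(\<Sum>xs\<in>?B q. single (trestr xs (ext q [e])) (h xs)) =
      (\<Sum>xs\<in>?B q. push (\<lambda>xs. tres xs [e]) (single (trestr xs q) (h xs)))"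
  proof (rule sum.cong[OF refl])
    fix xs assume "xs \<in> ?B q"
    then obtain us where "q = ext (tsrc xs) us" by blast
    then show "single (trestr xs (ext q [e])) (h xs) = push (\<lambda>xs. tres xs [e]) (single (trestr xs q) (h xs))"
      by (simp add: tres_tres)
  qed
  also have "\<dots> = push (\<lambda>xs. tres xs [e]) (trunc h q)"
    unfolding trunc_def by (rule additive_on_sum[OF additive_on_push[of UNIV], symmetric]) simp
  finally show ?thesis unfolding visible_def beyond_split[OF h, of "ext q [e]"] by (simp only: add.assoc)
qed

lemma trunc_closed:
  assumes h: "h \<in> fin_chains (nerve T n)" and q: "q \<in> fpaths"
  shows "trunc h q \<in> fin_chains {xs \<in> nerve T n. tsrc xs = q}"
  unfolding trunc_def
proof (rule fin_chains_sum)
  fix xs assume "xs \<in> {xs. h xs \<noteq> 0 \<and> (\<exists>us. q = ext (tsrc xs) us)}"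
  then obtain us where xs: "h xs \<noteq> 0" "q = ext (tsrc xs) us" by blast
  have n: "xs \<in> nerve T n" using fin_chains_supp[OF h xs(1)] .
  have us: "epath (path_src (tsrc xs)) us" using q xs(2) by simp
  have "trestr xs q \<in> nerve T n \<and> tsrc (trestr xs q) = q"
    using tres_nerve[OF n us] tchain_tres[OF nerve_tchain[OF n] us] xs(2) by simp
  then show "single (trestr xs q) (h xs) \<in> fin_chains {xs \<in> nerve T n. tsrc xs = q}" by simp
qed

text \<open>With a common source the sum over edges can be taken outside, in the form produced by
  \<open>visible_ext\<close>.\<close>

lemma subdivide_trunc:
  assumes h: "k \<in> fin_chains {xs \<in> nerve T n. tsrc xs = q}"
  shows "subdivide k = (\<Sum>e\<in>edges_at (path_src q). push (\<lambda>xs. tres xs [e]) k)"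
  by (rule additive_on_eqI[OF additive_on_subdivide additive_on_sum_left[OF additive_on_push] h])
    (auto simp: subdivide_single)

text \<open>The fibres of \<open>trestr _ q\<close> are exactly the simplices through a common germ at \<open>w\<close>.\<close>

lemma trunc_eq_0:
  assumes h: "h \<in> fin_chains (nerve T n)" "cell_sum h = 0" and q: "q \<in> fpaths" "w \<in> cylinder q"
    and below: "\<And>xs. h xs \<noteq> 0 \<Longrightarrow> w \<in> cylinder (tsrc xs) \<Longrightarrow> \<exists>us. q = ext (tsrc xs) us"
    and eq: "\<And>xs ys. h xs \<noteq> 0 \<Longrightarrow> h ys \<noteq> 0 \<Longrightarrow> w \<in> cylinder (tsrc xs) \<Longrightarrow> w \<in> cylinder (tsrc ys) \<Longrightarrow>
      zpt xs w = zpt ys w \<Longrightarrow> trestr xs q = trestr ys q"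
  shows "trunc h q = 0"
proof
  fix ys
  let ?B = "{xs. h xs \<noteq> 0 \<and> (\<exists>us. q = ext (tsrc xs) us)}"
  have fin: "finite ?B" using fin_chains_finite[OF h(1)] by (auto elim!: rev_finite_subset)
  have B: "w \<in> cylinder (tsrc xs) \<and> tchain xs \<and> zpt (trestr xs q) w = zpt xs w" if xs: "xs \<in> ?B" for xs
  proof -
    obtain us where us: "h xs \<noteq> 0" "q = ext (tsrc xs) us" using xs by blast
    have c: "tchain xs" using nerve_tchain[OF fin_chains_supp[OF h(1) us(1)]] .
    have e: "epath (path_src (tsrc xs)) us" using q(1) us(2) by simp
    have w: "w \<in> cylinder (ext (tsrc xs) us)" using q(2) us(2) by simp
    then have "w \<in> cylinder (tsrc xs)" using cylinder_ext_subset[OF e] by blast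
    then show ?thesis using tact_tres(2)[OF c e w] us(2) c by simp
  qed
  have "trunc h q ys = (\<Sum>xs\<in>?B. if trestr xs q = ys then h xs else 0)"
    unfolding trunc_def sum_fun_apply by (rule sum.cong[OF refl]) (auto simp: single_def)
  also have "\<dots> = (\<Sum>xs | xs \<in> ?B \<and> trestr xs q = ys. h xs)"
    using fin by (simp add: sum.If_cases Int_def)
  also have "\<dots> = 0"
  proof (cases "\<exists>xs\<in>?B. trestr xs q = ys")
    case False
    then have "{xs. xs \<in> ?B \<and> trestr xs q = ys} = {}" by blast
    then show ?thesis by (simp only: sum.empty)
  next
    case True
    then obtain zs where zs: "zs \<in> ?B" "trestr zs q = ys" by blast
    have wz: "w \<in> cylinder (tsrc zs)" "tchain zs" "h zs \<noteq> 0" using B[OF zs(1)] zs(1) by auto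
    have "{xs. xs \<in> ?B \<and> trestr xs q = ys} = {xs. h xs \<noteq> 0 \<and> zpt zs w \<in> cell xs}"
    proof (rule subset_antisym; rule subsetI)
      fix xs assume "xs \<in> {xs. xs \<in> ?B \<and> trestr xs q = ys}"
      then have xs: "xs \<in> ?B" "trestr xs q = trestr zs q" using zs(2) by auto
      then have "zpt xs w = zpt zs w" using B[OF xs(1)] B[OF zs(1)] by simp
      moreover have "w \<in> cylinder (tsrc xs)" using B[OF xs(1)] by blast
      ultimately show "xs \<in> {xs. h xs \<noteq> 0 \<and> zpt zs w \<in> cell xs}"
        using xs(1) unfolding cell_def by (metis (mono_tags, lifting) imageI mem_Collect_eq)
    next
      fix xs assume "xs \<in> {xs. h xs \<noteq> 0 \<and> zpt zs w \<in> cell xs}"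
      then obtain w' where xs: "h xs \<noteq> 0" "w' \<in> cylinder (tsrc xs)" "zpt zs w = zpt xs w'" by (auto simp: cell_def)
      have "w = w'" using zpt_eqD[OF wz(2,1) nerve_tchain[OF fin_chains_supp[OF h(1) xs(1)]] xs(2,3)] by blast
      then have w: "w \<in> cylinder (tsrc xs)" "zpt xs w = zpt zs w" using xs by auto
      then have "trestr xs q = ys" using eq[OF xs(1) wz(3) w(1) wz(1) w(2)] zs(2) by simp
      then show "xs \<in> {xs. xs \<in> ?B \<and> trestr xs q = ys}" using below[OF xs(1) w(1)] xs(1) by blast
    qed
    then have "(\<Sum>xs | xs \<in> ?B \<and> trestr xs q = ys. h xs) = (\<Sum>xs | h xs \<noteq> 0 \<and> zpt zs w \<in> cell xs. h xs)" by simp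
    also have "\<dots> = (\<Sum>xs | h xs \<noteq> 0. if zpt zs w \<in> cell xs then h xs else 0)"
      using fin_chains_finite[OF h(1)] by (simp add: sum.If_cases Int_def)
    also have "\<dots> = cell_sum h (zpt zs w)" by (simp add: cell_sum_def lin_ext_def sum_fun_apply indic_def)
    finally show ?thesis using h(2) by simp
  qed
  finally show "trunc h q ys = 0 ys" by simp
qed

text \<open>No prefix of the boundary path \<open>FinP q\<close> is longer than \<open>q\<close>.
  Hence sources whose cylinder contains it are prefixes of \<open>q\<close>, and eventual equality
  means equality at \<open>q\<close>.\<close>

lemma trunc_singular:
  assumes h: "h \<in> fin_chains (nerve T n)" "cell_sum h = 0" and q: "q \<in> fpaths" "\<not> regular (path_src q)"
  shows "trunc h q = 0"
proof (rule trunc_eq_0[OF h q(1) FinP_in_cylinder[OF q]])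
  have c: "tchain xs" if "h xs \<noteq> 0" for xs using nerve_tchain[OF fin_chains_supp[OF h(1) that]] .
  show "\<exists>us. q = ext (tsrc xs) us" if "h xs \<noteq> 0" "FinP q \<in> cylinder (tsrc xs)" for xs
    using FinP_cylinderD[OF tchain_tsrc[OF c[OF that(1)]] that(2)] by blast
  fix xs ys assume xs: "h xs \<noteq> 0" "h ys \<noteq> 0" "FinP q \<in> cylinder (tsrc xs)" "FinP q \<in> cylinder (tsrc ys)"
    "zpt xs (FinP q) = zpt ys (FinP q)"
  have "ev_prefix (FinP q) (\<lambda>v. trestr xs v = trestr ys v)"
    using zpt_eqD[OF c[OF xs(1)] xs(3) c[OF xs(2)] xs(4,5)] by blast
  then obtain p where p: "p \<in> fpaths" "FinP q \<in> cylinder p"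
    "\<And>ts. epath (path_src p) ts \<Longrightarrow> FinP q \<in> cylinder (ext p ts) \<Longrightarrow> trestr xs (ext p ts) = trestr ys (ext p ts)"
    unfolding ev_prefix_def by blast
  obtain ts where ts: "epath (path_src p) ts" "q = ext p ts" using FinP_cylinderD[OF p(1,2)] by blast
  show "trestr xs q = trestr ys q" using p(3)[OF ts(1)] FinP_in_cylinder[OF q] unfolding ts(2) by blast
qed

lemma ev_prefix_ball:
  assumes "finite I" "p \<in> fpaths" "w \<in> cylinder p" "\<And>i. i \<in> I \<Longrightarrow> ev_prefix w (P i)"
  shows "ev_prefix w (\<lambda>q. \<forall>i\<in>I. P i q)"
  using assms(1,4)
proof (induction I rule: finite_induct)
  case empty
  then show ?case using ev_prefix_True[OF assms(2,3)] by simp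
next
  case (insert i I)
  then have "ev_prefix w (P i)" "ev_prefix w (\<lambda>q. \<forall>i\<in>I. P i q)" by auto
  from ev_prefix_conj[OF this] show ?case by (rule ev_prefix_mono) auto
qed

text \<open>\<open>h\<close> has finitely many simplices. From some length on, every source met by
  the path has been passed, no proper extension remains, and equal germs have become equal
  restrictions.\<close>

lemma ev_visible_InfP:
  assumes h: "h \<in> fin_chains (nerve T n)" "cell_sum h = 0" and s: "InfP s \<in> bpaths_at v"
  shows "ev_prefix (InfP s) (\<lambda>q. visible h q = 0)"
proof -
  let ?S = "{xs. h xs \<noteq> 0}" and ?w = "InfP s"
  have fin: "finite ?S" using fin_chains_finite[OF h(1)] .
  have c: "tchain xs" if "h xs \<noteq> 0" for xs using nerve_tchain[OF fin_chains_supp[OF h(1) that]] .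
  obtain m where m: "\<And>xs. h xs \<noteq> 0 \<Longrightarrow> length (snd (tsrc xs)) \<le> m"
    using finite_nat_set_iff_bounded_le[of "(\<lambda>xs. length (snd (tsrc xs))) ` ?S"] fin by auto
  obtain p where p: "p \<in> fpaths" "?w \<in> cylinder p" "length (snd p) = m" using InfP_long[OF s] by blast
  have 1: "ev_prefix ?w (\<lambda>q. \<exists>ts. epath (path_src p) ts \<and> q = ext p ts)" by (rule ev_prefix_ext[OF p(1,2)])
  have 2: "ev_prefix ?w (\<lambda>q. \<forall>xs\<in>{xs \<in> ?S. ?w \<in> cylinder (tsrc xs)}. \<exists>us. epath (path_src (tsrc xs)) us \<and> q = ext (tsrc xs) us)"
    using fin c by (intro ev_prefix_ball[OF _ p(1,2)] ev_prefix_tsrc) auto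
  have 3: "ev_prefix ?w (\<lambda>q. \<forall>z\<in>{z \<in> ?S \<times> ?S. ?w \<in> cylinder (tsrc (fst z)) \<and> ?w \<in> cylinder (tsrc (snd z)) \<and>
      zpt (fst z) ?w = zpt (snd z) ?w}. trestr (fst z) q = trestr (snd z) q)"
  proof (rule ev_prefix_ball[OF _ p(1,2)])
    show "finite {z \<in> ?S \<times> ?S. ?w \<in> cylinder (tsrc (fst z)) \<and> ?w \<in> cylinder (tsrc (snd z)) \<and> zpt (fst z) ?w = zpt (snd z) ?w}"
      using fin by simp
    fix z assume z: "z \<in> {z \<in> ?S \<times> ?S. ?w \<in> cylinder (tsrc (fst z)) \<and> ?w \<in> cylinder (tsrc (snd z)) \<and>
      zpt (fst z) ?w = zpt (snd z) ?w}"
    then have "h (fst z) \<noteq> 0" "h (snd z) \<noteq> 0" by auto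
    from zpt_eqD[OF c[OF this(1)] _ c[OF this(2)], of ?w ?w] z
    show "ev_prefix ?w (\<lambda>q. trestr (fst z) q = trestr (snd z) q)" by blast
  qed
  from ev_prefix_conj[OF 1 ev_prefix_conj[OF 2 3]] show ?thesis
  proof (rule ev_prefix_mono)
    fix q assume q: "q \<in> fpaths" "?w \<in> cylinder q"
      and *: "(\<exists>ts. epath (path_src p) ts \<and> q = ext p ts) \<and>
        (\<forall>xs\<in>{xs \<in> ?S. ?w \<in> cylinder (tsrc xs)}. \<exists>us. epath (path_src (tsrc xs)) us \<and> q = ext (tsrc xs) us) \<and>
        (\<forall>z\<in>{z \<in> ?S \<times> ?S. ?w \<in> cylinder (tsrc (fst z)) \<and> ?w \<in> cylinder (tsrc (snd z)) \<and>
          zpt (fst z) ?w = zpt (snd z) ?w}. trestr (fst z) q = trestr (snd z) q)"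
    obtain ts where ts: "q = ext p ts" using * by blast
    have "trunc h q = 0"
    proof (rule trunc_eq_0[OF h q])
      show "\<exists>us. q = ext (tsrc xs) us" if "h xs \<noteq> 0" "?w \<in> cylinder (tsrc xs)" for xs using * that by blast
      show "trestr xs q = trestr ys q" if "h xs \<noteq> 0" "h ys \<noteq> 0" "?w \<in> cylinder (tsrc xs)" "?w \<in> cylinder (tsrc ys)"
        "zpt xs ?w = zpt ys ?w" for xs ys
      proof -
        have "(xs, ys) \<in> {z \<in> ?S \<times> ?S. ?w \<in> cylinder (tsrc (fst z)) \<and> ?w \<in> cylinder (tsrc (snd z)) \<and>
          zpt (fst z) ?w = zpt (snd z) ?w}" using that by simp
        then show ?thesis using * by (metis (no_types, lifting) fst_conv snd_conv)
      qed
    qed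
    moreover have "next_edges h q = {}"
    proof -
      have False if "h xs \<noteq> 0" "tsrc xs = ext q (f # us)" for xs f us
        using m[OF that(1)] that(2) ts p(3) by simp
      then show ?thesis unfolding next_edges_def by blast
    qed
    ultimately show "visible h q = 0" by (simp add: visible_def)
  qed
qed

text \<open>Modulo \<open>R\<close>, the chain visible at \<open>q\<close> is the sum of those
  visible at \<open>ext q [e]\<close>, over all edges if \<open>q\<close> ends in a regular vertex
  and over \<open>next_edges h q\<close> otherwise. Both index sets are finite, and along infinite
  paths the visible chain becomes 0, so \<open>path_tree_induct\<close> applies.\<close>

lemma cell_sum_kernel:
  fixes h :: "(('g, 'x) fpath \<times> 'g \<times> ('g, 'x) fpath) list \<Rightarrow> 'a::ab_group_add"
  assumes h: "h \<in> fin_chains (nerve T n)" "cell_sum h = 0"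
  shows "\<exists>m\<in>fin_chains (reg_nerve n). h = m - subdivide m"
proof -
  define R where "R = (\<lambda>m :: _ \<Rightarrow> 'a. m - subdivide m) ` fin_chains (reg_nerve n)"
  have add: "additive_on (reg_nerve n) (\<lambda>m :: _ \<Rightarrow> 'a. m - subdivide m)"
    by (rule additive_on_minus_left[OF additive_on_id additive_on_subdivide])
  have R: "add_subgroup R"
    unfolding R_def by (rule add_subgroup_image[OF add])
  \<comment> \<open>The common summand \<open>s\<close> will be the part of \<open>h\<close> beyond
    \<open>q\<close>, and \<open>d\<close> the subdivision of the truncated part
    \<open>y\<close>.\<close>
  have cancel: "x = y + s \<Longrightarrow> z = d + s \<Longrightarrow> x = (y - d) + z" for x y z d s :: "_ \<Rightarrow> 'a" by (simp add: algebra_simps)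
  have vis: "visible h q \<in> R" if q: "q \<in> fpaths" for q
  proof (rule path_tree_induct[where P = "\<lambda>q. visible h q \<in> R", OF _ _ q])
    fix q assume q: "q \<in> fpaths"
    let ?F = "next_edges h q" and ?E = "edges_at (path_src q)"
    have F: "finite ?F" using finite_next_edges[OF h(1)] .
    have FE: "?F \<subseteq> ?E"
    proof
      fix f assume "f \<in> ?F"
      then obtain xs ts where xs: "h xs \<noteq> 0" "tsrc xs = ext q (f # ts)" by (auto simp: next_edges_def)
      have "tsrc xs \<in> fpaths" using tchain_tsrc[OF nerve_tchain[OF fin_chains_supp[OF h(1) xs(1)]]] .
      then show "f \<in> ?E" using xs(2) by (simp add: edges_at_def)
    qed
    show "\<exists>F. finite F \<and> F \<subseteq> ?E \<and> ((\<forall>e\<in>F. visible h (ext q [e]) \<in> R) \<longrightarrow> visible h q \<in> R)"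
    proof (cases "regular (path_src q)")
      case True
      then have E: "finite ?E" by (simp add: regular_iff)
      have t: "trunc h q \<in> fin_chains (reg_nerve n)"
        by (rule fin_chains_mono[OF _ trunc_closed[OF h(1) q]]) (use True in \<open>auto simp: reg_nerve_def\<close>)
      \<comment> \<open>Edges outside \<open>next_edges\<close> contribute nothing, so the sum may
        run over all edges, as it does in the subdivision.\<close>
      have "beyond h (ext q [f]) = 0" if "f \<in> ?E - ?F" for f
      proof -
        have "{xs. h xs \<noteq> 0 \<and> (\<exists>ts. tsrc xs = ext (ext q [f]) ts)} = {}" using that by (auto simp: next_edges_def)
        then show ?thesis unfolding beyond_def by (simp only: sum.empty)
      qed
      then have "(\<Sum>f\<in>?F. beyond h (ext q [f])) = (\<Sum>f\<in>?E. beyond h (ext q [f]))"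
        by (intro sum.mono_neutral_left[OF E FE]) blast
      then have "visible h q = trunc h q + (\<Sum>f\<in>?E. beyond h (ext q [f]))" by (simp only: visible_def)
      moreover have "(\<Sum>e\<in>?E. visible h (ext q [e])) = subdivide (trunc h q) + (\<Sum>f\<in>?E. beyond h (ext q [f]))"
        by (simp only: visible_ext[OF h(1)] sum.distrib subdivide_trunc[OF trunc_closed[OF h(1) q]])
      ultimately have eq: "visible h q = (trunc h q - subdivide (trunc h q)) + (\<Sum>e\<in>?E. visible h (ext q [e]))"
        by (rule cancel)
      have "trunc h q - subdivide (trunc h q) \<in> R" unfolding R_def using t by blast
      then have "visible h q \<in> R" if "\<forall>e\<in>?E. visible h (ext q [e]) \<in> R"
        unfolding eq by (rule add_subgroup_add[OF R _ add_subgroup_sum[OF R]]) (use that in blast)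
      then show ?thesis using E by blast
    next
      case False
      \<comment> \<open>Without a truncated part only the finitely many edges in
        \<open>next_edges\<close> carry anything, even if the vertex has infinitely many
        edges.\<close>
      have "trunc h q = 0" using trunc_singular[OF h q False] .
      then have eq: "visible h q = (\<Sum>e\<in>?F. visible h (ext q [e]))"
        by (simp only: visible_ext[OF h(1)] visible_def[of h q] push_simps add_0)
      have "visible h q \<in> R" if "\<forall>e\<in>?F. visible h (ext q [e]) \<in> R"
        unfolding eq by (rule add_subgroup_sum[OF R]) (use that in blast)
      then show ?thesis using F FE by blast
    qed
  next
    fix s v assume "InfP s \<in> bpaths_at v"
    then show "ev_prefix (InfP s) (\<lambda>q. visible h q \<in> R)"
      using ev_prefix_mono[OF ev_visible_InfP[OF h]] add_subgroup_zero[OF R] by metis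
  qed
  let ?S = "{xs. h xs \<noteq> 0}"
  have fin: "finite ?S" using fin_chains_finite[OF h(1)] .
  \<comment> \<open>\<open>h\<close> splits according to the range vertex of the source path, and
    each part is what is visible at the empty path of that vertex.\<close>
  have "h = (\<Sum>xs\<in>?S. single xs (h xs))" by (rule fin_chains_eq_sum[OF h(1)])
  also have "\<dots> = (\<Sum>v\<in>(\<lambda>xs. fst (tsrc xs)) ` ?S. \<Sum>xs | xs \<in> ?S \<and> fst (tsrc xs) = v. single xs (h xs))"
    by (rule sum.image_gen[OF fin])
  also have "\<dots> = (\<Sum>v\<in>(\<lambda>xs. fst (tsrc xs)) ` ?S. beyond h (v, []))"
  proof (rule sum.cong[OF refl])
    fix v
    have "(\<exists>ts. tsrc xs = ext (v, []) ts) \<longleftrightarrow> fst (tsrc xs) = v" for xs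
      by (auto simp: ext_def prod_eq_iff)
    then show "(\<Sum>xs | xs \<in> ?S \<and> fst (tsrc xs) = v. single xs (h xs)) = beyond h (v, [])"
      unfolding beyond_def by simp
  qed
  also have "\<dots> \<in> R"
  proof (rule add_subgroup_sum[OF R])
    fix v assume "v \<in> (\<lambda>xs. fst (tsrc xs)) ` ?S"
    then obtain xs where xs: "h xs \<noteq> 0" "v = fst (tsrc xs)" by blast
    have "epath v (snd (tsrc xs))"
      using tchain_tsrc[OF nerve_tchain[OF fin_chains_supp[OF h(1) xs(1)]]] xs(2) by (simp add: fpaths_iff)
    then have "(v, []) \<in> fpaths" using epath_unit by (simp add: fpaths_iff)
    then show "beyond h (v, []) \<in> R" using vis[of "(v, [])"] visible_root[OF h(1)] by simp
  qed
  finally show ?thesis unfolding R_def by blast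
qed

end

section \<open>The long exact sequence\<close>

lemma boundary_subgroupoid:
  fixes h :: "'b list \<Rightarrow> 'a::ab_group_add"
  assumes eq: "src K = src H" "rng K = rng H" "mul K = mul H" and sub: "Arr K \<subseteq> Arr H"
  shows "nerve K n \<subseteq> nerve H n" "h \<in> fin_chains (nerve K n) \<Longrightarrow> boundary K n h = boundary H n h"
proof -
  show nerve: "nerve K n \<subseteq> nerve H n" using sub by (auto simp: nerve_def unit_space_def eq)
  have face: "face K = face H" by (intro ext) (simp add: face_def eq)
  assume h: "h \<in> fin_chains (nerve K n)"
  show "boundary K n h = boundary H n h"
  proof (cases "n = 0")
    case True
    then show ?thesis by (simp add: boundary_0)
  next
    case False
    then have n: "n > 0" by simp
    have "boundary K n (single x a) = boundary H n (single x a)" if "x \<in> nerve K n" for x and a :: 'a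
      using boundary_single[OF that n, of a] boundary_single[OF subsetD[OF nerve that] n, of a] by (simp only: face)
    then show ?thesis by (rule additive_on_eqI[OF additive_on_boundary additive_on_boundary h])
  qed
qed

text \<open>\<open>pM\<close> is onto on chains, so \<open>f\<close> inherits additivity and
  compatibility with boundaries from \<open>F\<close>. For \<open>id - X\<close> this replaces a
  direct computation with \<open>X_chain\<close>.\<close>

lemma chain_map_descend:
  assumes F: "chain_map M dM N dN F" and pM: "chain_map M dM K dK pM" and pN: "chain_map N dN C dC pN"
    and square: "\<And>n m. m \<in> M n \<Longrightarrow> pN n (F n m) = f n (pM n m)"
    and surj: "\<And>n k. k \<in> K n \<Longrightarrow> \<exists>m\<in>M n. pM n m = k"
  shows "chain_map K dK C dC f"
proof -
  interpret F: chain_map M dM N dN F by (rule F)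
  interpret pM: chain_map M dM K dK pM by (rule pM)
  interpret pN: chain_map N dN C dC pN by (rule pN)
  show ?thesis
  proof unfold_locales
    fix n x assume "x \<in> K n"
    then obtain m where m: "m \<in> M n" "pM n m = x" using surj by blast
    show "f n x \<in> C n" using pN.closed[OF F.closed[OF m(1)]] square[OF m(1)] m(2) by simp
  next
    fix n x y assume "x \<in> K n" "y \<in> K n"
    then obtain m k where m: "m \<in> M n" "pM n m = x" and k: "k \<in> M n" "pM n k = y" using surj by metis
    have mk: "m - k \<in> M n" using add_subgroup_diff[OF F.C.subgroup m(1) k(1)] .
    have "f n (x - y) = pN n (F n (m - k))" using square[OF mk] pM.diff[OF m(1) k(1)] m(2) k(2) by simp
    also have "\<dots> = f n x - f n y"
      using F.diff[OF m(1) k(1)] pN.diff[OF F.closed[OF m(1)] F.closed[OF k(1)]] square[OF m(1)] square[OF k(1)] m(2) k(2) by simp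
    finally show "f n (x - y) = f n x - f n y" .
  next
    fix n x assume "x \<in> K (Suc n)"
    then obtain m where m: "m \<in> M (Suc n)" "pM (Suc n) m = x" using surj by blast
    have "dC (Suc n) (f (Suc n) x) = pN n (F n (dM (Suc n) m))"
      using square[OF m(1)] m(2) pN.comm[OF F.closed[OF m(1)]] F.comm[OF m(1)] by simp
    also have "\<dots> = f n (dK (Suc n) x)"
      using square[OF F.C.d_closed[OF m(1)]] pM.comm[OF m(1)] m(2) by simp
    finally show "dC (Suc n) (f (Suc n) x) = f n (dK (Suc n) x)" .
  qed
qed

text \<open>The laws of a complex pass along a surjection. Chains of germs inherit them in this way
  from \<open>T\<close> through \<open>cell_sum\<close>.\<close>

lemma chain_map_image:
  assumes N: "chain_complex N dN" and D: "\<And>n. D n = \<theta> ` N n"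
    and diff: "\<And>n x y. x \<in> N n \<Longrightarrow> y \<in> N n \<Longrightarrow> \<theta> (x - y) = \<theta> x - \<theta> y"
    and comm: "\<And>n x. x \<in> N (Suc n) \<Longrightarrow> dD (Suc n) (\<theta> x) = \<theta> (dN (Suc n) x)"
    and zero: "\<And>x. dD 0 x = 0"
  shows "chain_map N dN D dD (\<lambda>_. \<theta>)"
proof -
  interpret N: chain_complex N dN by (rule N)
  have sub: "x - y \<in> N n" if "x \<in> N n" "y \<in> N n" for x y n using add_subgroup_diff[OF N.subgroup that] .
  have z: "0 \<in> N n" for n using add_subgroup_zero[OF N.subgroup] .
  have \<theta>0: "\<theta> 0 = 0" using diff[OF z z] by simp
  show ?thesis
  proof unfold_locales
    fix n
    have "0 \<in> D n" using \<theta>0 z unfolding D by (metis image_eqI)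
    moreover have "x - y \<in> D n" if "x \<in> D n" "y \<in> D n" for x y
    proof -
      obtain u v where "u \<in> N n" "v \<in> N n" "x = \<theta> u" "y = \<theta> v" using \<open>x \<in> D n\<close> \<open>y \<in> D n\<close> unfolding D by blast
      then show ?thesis using diff[of u n v] sub[of u n v] unfolding D by (metis image_eqI)
    qed
    ultimately show "add_subgroup (D n)" by (auto simp: add_subgroup_def)
  next
    fix n x assume "x \<in> D (Suc n)"
    then obtain u where "u \<in> N (Suc n)" "x = \<theta> u" unfolding D by blast
    then show "dD (Suc n) x \<in> D n" using comm[of u n] N.d_closed[of u n] unfolding D by simp
  next
    fix n x y assume "x \<in> D n" "y \<in> D n"
    then obtain u v where u: "u \<in> N n" "v \<in> N n" "x = \<theta> u" "y = \<theta> v" unfolding D by blast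
    show "dD n (x - y) = dD n x - dD n y"
    proof (cases n)
      case 0
      then show ?thesis by (simp add: zero)
    next
      case (Suc m)
      have uv: "u \<in> N (Suc m)" "v \<in> N (Suc m)" using u Suc by auto
      have "dD n (x - y) = \<theta> (dN n (u - v))" using diff[OF u(1,2)] comm[OF sub[OF uv]] u(3,4) Suc by simp
      also have "\<dots> = dD n x - dD n y"
        using N.d_diff[OF uv] diff[OF N.d_closed[OF uv(1)] N.d_closed[OF uv(2)]] comm[OF uv(1)] comm[OF uv(2)] u(3,4) Suc by simp
      finally show ?thesis .
    qed
  next
    fix n x assume "x \<in> D (Suc (Suc n))"
    then obtain u where u: "u \<in> N (Suc (Suc n))" "x = \<theta> u" unfolding D by blast
    show "dD (Suc n) (dD (Suc (Suc n)) x) = 0"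
      using comm[OF u(1)] comm[OF N.d_closed[OF u(1)]] N.d_d[OF u(1)] u(2) \<theta>0 by simp
  qed (auto simp: D zero diff comm)
qed

lemma cycles_eq_cyc:
  assumes "chain_complex C (boundary G)" "\<And>n. carrier (chain_group A G n) = C n"
  shows "cycles A G n = chain_complex.cyc C (boundary G) n" "boundaries A G n = chain_complex.bd C (boundary G) n"
  by (simp_all add: cycles_def boundaries_def chain_complex.cyc_def[OF assms(1)] chain_complex.bd_def[OF assms(1)]
      assms(2) zero_fun_def)

text \<open>\<open>homology_map\<close> uses the image of a whole coset; additivity along
  \<open>B\<close> keeps this image within one coset of the boundaries.\<close>

lemma homology_map_class:
  assumes B: "add_subgroup B" and B': "add_subgroup (boundaries A H n)"
    and add: "\<And>b. b \<in> B \<Longrightarrow> \<psi> (b + c) = \<psi> b + \<psi> c" and bd: "\<And>b. b \<in> B \<Longrightarrow> \<psi> b \<in> boundaries A H n"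
  shows "homology_map A H n \<psi> (residue_class B c) = residue_class (boundaries A H n) (\<psi> c)"
proof -
  have mult: "x \<otimes>\<^bsub>chain_group A H n\<^esub> y = x + y" for x y
    by (simp add: chain_group_def fun_group_def plus_fun_def)
  have "homology_map A H n \<psi> (residue_class B c) = {b + \<psi> (b' + c) |b b'. b \<in> boundaries A H n \<and> b' \<in> B}"
    unfolding homology_map_def set_mult_def residue_class_def mult by blast
  also have "\<dots> = {b + (\<psi> b' + \<psi> c) |b b'. b \<in> boundaries A H n \<and> b' \<in> B}"
    by (intro Collect_cong ex_cong1) (auto simp: add)
  also have "\<dots> = residue_class (boundaries A H n) (\<psi> c)"
  proof (rule subset_antisym; rule subsetI)
    fix x assume "x \<in> {b + (\<psi> b' + \<psi> c) |b b'. b \<in> boundaries A H n \<and> b' \<in> B}"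
    then obtain b b' where b: "b \<in> boundaries A H n" "b' \<in> B" "x = b + (\<psi> b' + \<psi> c)" by blast
    have "b + \<psi> b' \<in> boundaries A H n" using add_subgroup_add[OF B' b(1) bd[OF b(2)]] .
    moreover have "x = (b + \<psi> b') + \<psi> c" using b(3) by (simp only: add.assoc)
    ultimately show "x \<in> residue_class (boundaries A H n) (\<psi> c)" unfolding residue_class_def by blast
  next
    fix x assume "x \<in> residue_class (boundaries A H n) (\<psi> c)"
    then obtain b where b: "b \<in> boundaries A H n" "x = b + \<psi> c" unfolding residue_class_def by blast
    have z: "0 \<in> B" using add_subgroup_zero[OF B] .
    have "b - \<psi> 0 \<in> boundaries A H n" using add_subgroup_diff[OF B' b(1) bd[OF z]] .
    moreover have "x = (b - \<psi> 0) + (\<psi> 0 + \<psi> c)" using b(2) by (simp only: add.assoc[symmetric] diff_add_cancel)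
    ultimately show "x \<in> {b + (\<psi> b' + \<psi> c) |b b'. b \<in> boundaries A H n \<and> b' \<in> B}" using z by blast
  qed
  finally show ?thesis .
qed

context graph_picture
begin

subsection \<open>Restriction to the regular vertices\<close>

lemma G_reg_simps: "Arr G_reg = {g \<in> Arr G. regular (src G g)}" "src G_reg = src G" "rng G_reg = rng G"
  "mul G_reg = mul G" "ginv G_reg = ginv G"
  using regular_invariant by (auto simp: G_reg_def restriction_def Let_def)

sublocale Greg: discrete_groupoid G_reg
  unfolding G_reg_def by (rule discrete_groupoid_restriction)

abbreviation T_reg :: "(('g, 'x) fpath \<times> 'g \<times> ('g, 'x) fpath) groupoid" where
  "T_reg \<equiv> pullback_groupoid G_reg fpaths path_src"

sublocale Treg: discrete_groupoid T_reg by (rule Greg.discrete_groupoid_pullback)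

lemma unit_G_reg: "u \<in> unit_space G_reg \<longleftrightarrow> u \<in> unit_space G \<and> regular u"
proof
  assume "u \<in> unit_space G_reg"
  then show "u \<in> unit_space G \<and> regular u" by (auto simp: unit_space_def G_reg_simps)
next
  assume u: "u \<in> unit_space G \<and> regular u"
  then have "u \<in> Arr G_reg" "src G_reg u = u" using unit_arr unit_src by (auto simp: G_reg_simps)
  then show "u \<in> unit_space G_reg" unfolding unit_space_def by (metis imageI)
qed

lemma T_reg_simps: "x \<in> Arr T_reg \<longleftrightarrow> x \<in> Arr T \<and> regular (src G (ar x))" "src T_reg = src T" "rng T_reg = rng T"
  "mul T_reg = mul T"
  by (cases x; auto simp: pullback_groupoid_simps G_reg_simps) (simp_all add: pullback_groupoid_def G_reg_simps)

text \<open>Regular vertices form an invariant set, so regularity at the source of the last arrow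
  spreads back through the tuple.\<close>

lemma tchain_regular: "tchain xs \<Longrightarrow> regular (path_src (tsrc xs)) \<Longrightarrow> x \<in> set xs \<Longrightarrow> regular (src G (ar x))"
proof (induction xs arbitrary: x)
  case (Cons y ys)
  have y: "y \<in> Arr T" using Cons.prems by simp
  show ?case
  proof (cases "ys = []")
    case True
    then show ?thesis using Cons.prems y by (simp add: tsrc_def T_arr)
  next
    case False
    then have c: "tchain ys" "pd y = pr (hd ys)" "regular (path_src (tsrc ys))" using Cons.prems by (auto simp: tsrc_Cons)
    have "hd ys \<in> set ys" using False by simp
    then have "regular (src G (ar (hd ys)))" "hd ys \<in> Arr T" using Cons.IH[OF c(1,3)] tchain_arr[OF c(1)] by auto
    then have "regular (rng G (ar (hd ys)))" using regular_invariant by (simp add: T_arr)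
    then have "regular (src G (ar y))" using y \<open>hd ys \<in> Arr T\<close> c(2) by (simp add: T_arr)
    moreover have "x = y \<or> x \<in> set ys" using Cons.prems(3) by simp
    ultimately show ?thesis using Cons.IH[OF c(1,3)] by blast
  qed
qed simp

lemma nerve_T_reg: "nerve T_reg n = reg_nerve n"
proof (cases n)
  case 0
  have "xs \<in> nerve T_reg 0 \<longleftrightarrow> xs \<in> reg_nerve 0" for xs
  proof -
    have "xs \<in> nerve T_reg 0 \<longleftrightarrow> (\<exists>p\<in>fpaths. regular (path_src p) \<and> xs = [(p, path_src p, p)])"
      unfolding Treg.nerve_0 Bex_def Greg.pullback_unit unit_G_reg using path_src_unit by blast
    also have "\<dots> \<longleftrightarrow> xs \<in> reg_nerve 0" unfolding reg_nerve_def nerve_T_0 mem_Collect_eq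
      by (metis last.simps snd_conv tsrc_def)
    finally show ?thesis .
  qed
  then show ?thesis using 0 by blast
next
  case (Suc m)
  have "xs \<in> nerve T_reg (Suc m) \<longleftrightarrow> xs \<in> nerve T (Suc m) \<and> (\<forall>x\<in>set xs. regular (src G (ar x)))" for xs
    unfolding nerve_def by (auto simp: T_reg_simps subset_iff simp del: path_src_pair)
  moreover have "(\<forall>x\<in>set xs. regular (src G (ar x))) \<longleftrightarrow> regular (path_src (tsrc xs))" if "xs \<in> nerve T (Suc m)" for xs
  proof -
    have c: "tchain xs" "xs \<noteq> []" using that by (auto simp: nerve_T_Suc)
    then have "last xs \<in> set xs" "path_src (tsrc xs) = src G (ar (last xs))"
      using tchain_arr[OF c(1), of "last xs"] by (auto simp: tsrc_def T_arr)
    then show ?thesis using tchain_regular[OF c(1)] by metis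
  qed
  ultimately show ?thesis unfolding Suc reg_nerve_def by blast
qed

lemma boundary_T_reg: "h \<in> fin_chains (nerve T_reg n) \<Longrightarrow> boundary T_reg n h = boundary T n h"
  by (rule boundary_subgroupoid(2)) (auto simp: T_reg_simps simp del: path_src_pair)

lemma boundary_G_reg:
  "nerve G_reg n \<subseteq> nerve G n" "h \<in> fin_chains (nerve G_reg n) \<Longrightarrow> boundary G_reg n h = boundary G n h"
  by (rule boundary_subgroupoid; auto simp: G_reg_simps)+

lemma chain_map_subdivide:
  "chain_map (\<lambda>n. fin_chains (nerve T_reg n) :: (_ \<Rightarrow> 'a::ab_group_add) set) (boundary T_reg)
     (\<lambda>n. fin_chains (nerve T n)) (boundary T) (\<lambda>n m. m - subdivide m)"
proof -
  interpret M: chain_complex "\<lambda>n. fin_chains (nerve T_reg n) :: (_ \<Rightarrow> 'a) set" "boundary T_reg" by (rule Treg.chain_complex_fin)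
  interpret N: chain_complex "\<lambda>n. fin_chains (nerve T n) :: (_ \<Rightarrow> 'a) set" "boundary T" by (rule T.chain_complex_fin)
  have sub: "m \<in> fin_chains (nerve T n)" if "m \<in> fin_chains (nerve T_reg n)" for m :: "_ \<Rightarrow> 'a" and n
    using fin_chains_mono[OF reg_nerve_subset] that unfolding nerve_T_reg by blast
  show ?thesis
  proof unfold_locales
    fix n and x :: "_ \<Rightarrow> 'a" assume "x \<in> fin_chains (nerve T_reg n)"
    then show "x - subdivide x \<in> fin_chains (nerve T n)" using sub subdivide_closed fin_chains_diff by blast
  next
    fix n and x y :: "_ \<Rightarrow> 'a" assume "x \<in> fin_chains (nerve T_reg n)" "y \<in> fin_chains (nerve T_reg n)"
    then show "x - y - subdivide (x - y) = x - subdivide x - (y - subdivide y)"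
      using additive_on_diff[OF additive_on_minus_left[OF additive_on_id additive_on_subdivide]] by blast
  next
    fix n and x :: "_ \<Rightarrow> 'a" assume x: "x \<in> fin_chains (nerve T_reg (Suc n))"
    show "boundary T (Suc n) (x - subdivide x) = boundary T_reg (Suc n) x - subdivide (boundary T_reg (Suc n) x)"
      unfolding boundary_T_reg[OF x] N.d_diff[OF sub[OF x] subdivide_closed[OF sub[OF x]]] boundary_subdivide[OF sub[OF x]] ..
  qed
qed

lemma chain_map_cell_sum:
  "chain_map (\<lambda>n. fin_chains (nerve T n) :: (_ \<Rightarrow> 'a::ab_group_add) set) (boundary T)
     (\<lambda>n. carrier (chain_group (A :: 'a itself) GG n)) (boundary GG) (\<lambda>_. cell_sum)"
  by (rule chain_map_image[OF T.chain_complex_fin cell_sum_image[symmetric]])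
    (simp_all only: additive_on_diff[OF additive_on_cell_sum] boundary_cell_sum boundary_0)

subsection \<open>Projection to chains of the groupoid\<close>

sublocale P: pullback_equivalence G fpaths path_src "\<lambda>v. (v, [])"
  by unfold_locales (simp add: fpaths_iff path_src_def)

sublocale Preg: pullback_equivalence G_reg fpaths path_src "\<lambda>v. (v, [])"
  by unfold_locales (simp add: fpaths_iff path_src_def unit_G_reg)

abbreviation ars :: "(('g, 'x) fpath \<times> 'g \<times> ('g, 'x) fpath) list \<Rightarrow> 'g list" where
  "ars \<equiv> map P.proj"

lemma proj_eq: "P.proj x = ar x"
  by (simp add: P.proj_def split: prod.splits)

text \<open>Restricting along one edge and forgetting paths produces the tuple in the chain map of
  \<open>X_reg\<close>. The second conjunct carries the induction: it tracks the edge as it passes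
  the arrows to the right.\<close>

lemma ars_tres: "ars (tres xs [e]) = tuple_res (ars xs) e \<and> tlact xs [e] = [foldr edge_act (ars xs) e]"
  by (induction xs) (auto simp: proj_eq)

definition edge_tuple :: "nat \<Rightarrow> 'g list \<Rightarrow> 'x \<Rightarrow> 'g list" where
  "edge_tuple n gs e = (if n = 0 then [sanc X e] else tuple_res gs e)"

lemma biadditive_edge_tuple:
  "biadditive (\<lambda>gs a. \<Sum>e\<in>edges_at (src G (last gs)). single (edge_tuple n gs e) a)"
  by (simp add: biadditive_def sum.distrib)

lemma nerve_G_reg_last:
  assumes "gs \<in> nerve G_reg n"
  shows "regular (src G (last gs))"
proof -
  have "last gs \<in> Arr G_reg"
  proof (cases n)
    case 0
    then show ?thesis using assms Greg.nerve_0 Greg.unit_arr by auto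
  next
    case (Suc m)
    then have "gs \<noteq> []" "set gs \<subseteq> Arr G_reg" using assms by (auto simp: nerve_def)
    then show ?thesis using last_in_set by blast
  qed
  then show ?thesis by (simp add: G_reg_simps)
qed

text \<open>\<open>X_chain\<close> collects its terms by their value \<open>y\<close>. At a regular
  vertex the edges are finite in number, so the inner sum is the value at \<open>y\<close> of a
  finite sum of simplices.\<close>

lemma X_chain_eq:
  fixes h :: "'g list \<Rightarrow> 'a::ab_group_add"
  assumes h: "h \<in> fin_chains (nerve G_reg n)"
  shows "X_chain n h = lin_ext (\<lambda>gs a. \<Sum>e\<in>edges_at (src G (last gs)). single (edge_tuple n gs e) a) h"
proof
  fix y
  have "{gs. gs \<in> nerve G_reg n \<and> h gs \<noteq> 0} = {gs. h gs \<noteq> 0}" using fin_chains_supp[OF h] by blast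
  then have "X_chain n h y = (\<Sum>gs | h gs \<noteq> 0. \<Sum>e | e \<in> E \<inter> X_reg \<and> ranc X e = src G (last gs) \<and> edge_tuple n gs e = y. h gs)"
    by (simp only: X_chain_def edge_tuple_def)
  also have "\<dots> = (\<Sum>gs | h gs \<noteq> 0. \<Sum>e\<in>edges_at (src G (last gs)). single (edge_tuple n gs e) (h gs) y)"
  proof (rule sum.cong[OF refl])
    fix gs assume "gs \<in> {gs. h gs \<noteq> 0}"
    then have r: "regular (src G (last gs))" using nerve_G_reg_last fin_chains_supp[OF h] by blast
    let ?E = "edges_at (src G (last gs))"
    have fin: "finite ?E" using r by (simp add: regular_iff)
    have "{e. e \<in> E \<inter> X_reg \<and> ranc X e = src G (last gs) \<and> edge_tuple n gs e = y} = {e \<in> ?E. edge_tuple n gs e = y}"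
      using r E_Pts by (auto simp: edges_at_def X_reg_def)
    then have "(\<Sum>e | e \<in> E \<inter> X_reg \<and> ranc X e = src G (last gs) \<and> edge_tuple n gs e = y. h gs) =
        (\<Sum>e\<in>{e \<in> ?E. edge_tuple n gs e = y}. h gs)" by (simp only:)
    also have "\<dots> = (\<Sum>e\<in>?E. if edge_tuple n gs e = y then h gs else 0)" using fin by (simp only: sum.inter_filter)
    also have "\<dots> = (\<Sum>e\<in>?E. single (edge_tuple n gs e) (h gs) y)" by (rule sum.cong) (auto simp: single_def)
    finally show "(\<Sum>e | e \<in> E \<inter> X_reg \<and> ranc X e = src G (last gs) \<and> edge_tuple n gs e = y. h gs) =
      (\<Sum>e\<in>?E. single (edge_tuple n gs e) (h gs) y)" .
  qed
  also have "\<dots> = lin_ext (\<lambda>gs a. \<Sum>e\<in>edges_at (src G (last gs)). single (edge_tuple n gs e) a) h y"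
    by (simp add: lin_ext_def sum_fun_apply)
  finally show "X_chain n h y = lin_ext (\<lambda>gs a. \<Sum>e\<in>edges_at (src G (last gs)). single (edge_tuple n gs e) a) h y" .
qed

lemma additive_on_X_chain: "additive_on (nerve G_reg n) (X_chain n :: ('g list \<Rightarrow> 'a::ab_group_add) \<Rightarrow> _)"
proof (rule additive_onI)
  fix h k :: "'g list \<Rightarrow> 'a" assume hk: "h \<in> fin_chains (nerve G_reg n)" "k \<in> fin_chains (nerve G_reg n)"
  show "X_chain n (h + k) = X_chain n h + X_chain n k"
    unfolding X_chain_eq[OF hk(1)] X_chain_eq[OF hk(2)] X_chain_eq[OF fin_chains_add[OF hk]]
    by (rule lin_ext_add[OF biadditive_edge_tuple hk])
qed

lemma ars_nerve_reg: "xs \<in> nerve T_reg n \<Longrightarrow> ars xs \<in> nerve G_reg n"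
  by (rule Preg.proj.nerve)

lemma push_ars_subdivide:
  fixes m :: "_ \<Rightarrow> 'a::ab_group_add"
  assumes m: "m \<in> fin_chains (nerve T_reg n)"
  shows "push ars (subdivide m) = X_chain n (push ars m)"
proof (rule additive_on_eqI[where F = "\<lambda>m. push ars (subdivide m)" and G = "\<lambda>m. X_chain n (push ars m)", OF _ _ m])
  show "additive_on (nerve T_reg n) (\<lambda>m :: _ \<Rightarrow> 'a. push ars (subdivide m))"
    by (rule additive_on_comp[OF additive_on_subdivide additive_on_push subdivide_closed])
      (rule fin_chains_mono[OF reg_nerve_subset], simp only: nerve_T_reg)
  show "additive_on (nerve T_reg n) (\<lambda>m :: _ \<Rightarrow> 'a. X_chain n (push ars m))"
    by (rule additive_on_comp[OF additive_on_push additive_on_X_chain push_closed[OF _ ars_nerve_reg]])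
  fix xs and a :: 'a assume xs: "xs \<in> nerve T_reg n"
  have gs: "ars xs \<in> nerve G_reg n" using ars_nerve_reg[OF xs] .
  have xT: "xs \<in> nerve T n" using xs reg_nerve_subset unfolding nerve_T_reg by blast
  have c: "tchain xs" using nerve_tchain[OF xT] .
  then have ne: "xs \<noteq> []" by auto
  have "last xs \<in> Arr T" using tchain_arr[OF c last_in_set[OF ne]] .
  then have v: "path_src (tsrc xs) = src G (last (ars xs))" using ne by (simp add: last_map proj_eq tsrc_def T_arr)
  have t: "ars (tres xs [e]) = edge_tuple n (ars xs) e" if "e \<in> edges_at (path_src (tsrc xs))" for e
  proof (cases "n = 0")
    case True
    \<comment> \<open>In degree 0 the entry is a unit, whose restriction along \<open>e\<close> is
      the unit \<open>sanc X e\<close>.\<close>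
    then obtain p where p: "p \<in> fpaths" "xs = [(p, path_src p, p)]" using xT nerve_T_0 by blast
    then have "e \<in> E" "ranc X e = path_src p" using that by (auto simp: edges_at_def tsrc_def)
    then have "edge_res (path_src p) e = sanc X e" by (rule edge_act_unit(2))
    then show ?thesis using True p(2) by (simp add: edge_tuple_def ars_tres proj_eq)
  next
    case False
    then show ?thesis by (simp add: edge_tuple_def ars_tres)
  qed
  have "push ars (subdivide (single xs a)) = (\<Sum>e\<in>edges_at (path_src (tsrc xs)). push ars (single (tres xs [e]) a))"
    unfolding subdivide_single by (rule additive_on_sum[OF additive_on_push[where N = UNIV]]) simp
  also have "\<dots> = (\<Sum>e\<in>edges_at (path_src (tsrc xs)). single (edge_tuple n (ars xs) e) a)"
    by (rule sum.cong[OF refl]) (simp only: push_simps t)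
  also have "\<dots> = X_chain n (single (ars xs) a)"
    unfolding X_chain_eq[OF fin_chains_single[OF gs]] lin_ext_single[OF biadditive_edge_tuple] v ..
  finally show "push ars (subdivide (single xs a)) = X_chain n (push ars (single xs a))" by (simp only: push_simps)
qed

subsection \<open>The map id - H(X_reg)\<close>

lemma push_ars_surj:
  fixes k :: "'g list \<Rightarrow> 'a::ab_group_add"
  assumes "k \<in> fin_chains (nerve G_reg n)"
  shows "\<exists>m\<in>fin_chains (nerve T_reg n). push ars m = k"
proof
  show "push (map Preg.incl) k \<in> fin_chains (nerve T_reg n)" by (rule push_closed[OF assms Preg.incl.nerve])
  have "push ars (push (map Preg.incl) k) = push (\<lambda>gs. ars (map Preg.incl gs)) k" by (rule push_push[OF assms])
  also have "\<dots> = k"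
    by (rule push_id[OF assms]) (simp add: Preg.proj_incl comp_def)
  finally show "push ars (push (map Preg.incl) k) = k" .
qed

lemma square:
  fixes m :: "_ \<Rightarrow> 'a::ab_group_add"
  assumes "m \<in> fin_chains (nerve T_reg n)"
  shows "push ars (m - subdivide m) = push ars m - X_chain n (push ars m)"
proof -
  have "m \<in> fin_chains (nerve T n)" using fin_chains_mono[OF reg_nerve_subset] assms unfolding nerve_T_reg by blast
  then show ?thesis
    using additive_on_diff[OF additive_on_push[where f = ars] _ subdivide_closed] push_ars_subdivide[OF assms] by metis
qed

lemma chain_map_id_minus_X:
  "chain_map (\<lambda>n. fin_chains (nerve G_reg n) :: (_ \<Rightarrow> 'a::ab_group_add) set) (boundary G_reg)
     (\<lambda>n. fin_chains (nerve G n)) (boundary G) (\<lambda>n k. k - X_chain n k)"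
proof (rule chain_map_descend)
  show "chain_map (\<lambda>n. fin_chains (nerve T_reg n) :: (_ \<Rightarrow> 'a) set) (boundary T_reg)
      (\<lambda>n. fin_chains (nerve T n)) (boundary T) (\<lambda>n m. m - subdivide m)" by (rule chain_map_subdivide)
  show "chain_map (\<lambda>n. fin_chains (nerve T_reg n) :: (_ \<Rightarrow> 'a) set) (boundary T_reg)
      (\<lambda>n. fin_chains (nerve G_reg n)) (boundary G_reg) (\<lambda>_. push ars)" by (rule Preg.proj.push_chain_map)
  show "chain_map (\<lambda>n. fin_chains (nerve T n) :: (_ \<Rightarrow> 'a) set) (boundary T)
      (\<lambda>n. fin_chains (nerve G n)) (boundary G) (\<lambda>_. push ars)" by (rule P.proj.push_chain_map)
qed (rule square push_ars_surj, assumption)+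

lemma id_minus_X_class:
  fixes A :: "'a::ab_group_add itself" and k :: "'g list \<Rightarrow> 'a"
  assumes k: "k \<in> cycles A G_reg n"
  shows "id_minus_X A n (residue_class (boundaries A G_reg n) k) = residue_class (boundaries A G n) (k - X_chain n k)"
proof -
  interpret f: chain_map "\<lambda>n. fin_chains (nerve G_reg n) :: (_ \<Rightarrow> 'a) set" "boundary G_reg"
    "\<lambda>n. fin_chains (nerve G n)" "boundary G" "\<lambda>n k. k - X_chain n k" by (rule chain_map_id_minus_X)
  note C = cycles_eq_cyc[OF f.C.chain_complex_axioms, of A, OF Greg.chain_group_eq_fin_chains]
  note D = cycles_eq_cyc[OF f.D.chain_complex_axioms, of A, OF chain_group_eq_fin_chains]
  have B: "add_subgroup (boundaries A G_reg n)" "add_subgroup (boundaries A G n)" "add_subgroup (cycles A G n)"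
    using f.C.bd f.D.bd f.D.cyc by (simp_all only: C D)
  have bd: "b \<in> boundaries A G n" if "b \<in> boundaries A G_reg n" for b
    using that fin_chains_mono[OF boundary_G_reg(1)] boundary_G_reg(2)
    unfolding boundaries_def Greg.chain_group_eq_fin_chains chain_group_eq_fin_chains by blast
  have fin: "b \<in> fin_chains (nerve G_reg n)" if "b \<in> boundaries A G_reg n \<or> b \<in> cycles A G_reg n" for b
    using that f.C.bd_cyc[of n] unfolding C f.C.cyc_def by blast
  \<comment> \<open>Obtained as the difference of \<open>b\<close> and
    \<open>b - X_chain n b\<close>: the first bounds in \<open>G\<close> by inclusion, the second
    because \<open>id - X\<close> is a chain map. For cycles the same argument is used
    below.\<close>
  have X_bd: "X_chain n b \<in> boundaries A G n" if b: "b \<in> boundaries A G_reg n" for b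
  proof -
    have "b - X_chain n b \<in> boundaries A G n" using f.map_bd b unfolding C D by blast
    from add_subgroup_diff[OF B(2) bd[OF b] this] show ?thesis by simp
  qed
  have incl: "incl_map A n (residue_class (boundaries A G_reg n) k) = residue_class (boundaries A G n) k"
    unfolding incl_map_def using homology_map_class[where \<psi> = "\<lambda>h. h" and c = k, OF B(1,2) _ bd] by blast
  have X: "X_map A n (residue_class (boundaries A G_reg n) k) = residue_class (boundaries A G n) (X_chain n k)"
    unfolding X_map_def
  proof (rule homology_map_class[OF B(1,2) _ X_bd])
    fix b assume b: "b \<in> boundaries A G_reg n"
    show "X_chain n (b + k) = X_chain n b + X_chain n k"
      by (rule additive_onD[OF additive_on_X_chain]) (use fin b k in blast)+
  qed
  have "k \<in> cycles A G n"
    using k fin_chains_mono[OF boundary_G_reg(1)] boundary_G_reg(2)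
    unfolding cycles_def Greg.chain_group_eq_fin_chains chain_group_eq_fin_chains by fastforce
  moreover have "k - X_chain n k \<in> cycles A G n" using f.map_cyc k unfolding C D by blast
  ultimately have "k - (k - X_chain n k) \<in> cycles A G n" by (rule add_subgroup_diff[OF B(3)])
  then have Xk: "X_chain n k \<in> cycles A G n" by simp
  show ?thesis
    unfolding id_minus_X_def incl X homology_eq_quotient_group inv_quotient_group[OF B(3,2) Xk]
      quotient_group_simps(3)[OF B(2)] by simp
qed

lemma long_exact_sequence_homology:
  fixes A :: "'a::ab_group_add itself"
  shows "\<exists>\<iota> \<delta>.
     (\<forall>n. group_hom (homology A G_reg n) (homology A G n) (id_minus_X A n) \<and>
          group_hom (homology A G n) (homology A GG n) (\<iota> n) \<and>
          group_hom (homology A GG (Suc n)) (homology A G_reg n) (\<delta> n)) \<and>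
     (\<forall>n. kernel (homology A G_reg n) (homology A G n) (id_minus_X A n) = \<delta> n ` carrier (homology A GG (Suc n))) \<and>
     (\<forall>n. kernel (homology A G n) (homology A GG n) (\<iota> n) = id_minus_X A n ` carrier (homology A G_reg n)) \<and>
     (\<forall>n. kernel (homology A GG (Suc n)) (homology A G_reg n) (\<delta> n) = \<iota> (Suc n) ` carrier (homology A G (Suc n))) \<and>
     \<iota> 0 ` carrier (homology A G 0) = carrier (homology A GG 0)"
proof -
  let ?M = "\<lambda>n. fin_chains (nerve T_reg n) :: (_ \<Rightarrow> 'a) set" and ?N = "\<lambda>n. fin_chains (nerve T n) :: (_ \<Rightarrow> 'a) set"
    and ?K = "\<lambda>n. fin_chains (nerve G_reg n) :: (_ \<Rightarrow> 'a) set" and ?C = "\<lambda>n. fin_chains (nerve G n) :: (_ \<Rightarrow> 'a) set"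
    and ?D = "\<lambda>n. carrier (chain_group A GG n)"
  interpret E: modelled_short_exact ?M "boundary T_reg" ?N "boundary T" ?D "boundary GG" ?K "boundary G_reg" ?C "boundary G"
    "\<lambda>n m. m - subdivide m" "\<lambda>_. cell_sum" "\<lambda>n k. k - X_chain n k" "\<lambda>_. push ars" "\<lambda>_. push ars"
  proof (intro modelled_short_exact.intro modelled_short_exact_axioms.intro)
    show "chain_map ?M (boundary T_reg) ?N (boundary T) (\<lambda>n m. m - subdivide m)" by (rule chain_map_subdivide)
    show "chain_map ?N (boundary T) ?D (boundary GG) (\<lambda>_. cell_sum)" by (rule chain_map_cell_sum)
    show "chain_map ?K (boundary G_reg) ?C (boundary G) (\<lambda>n k. k - X_chain n k)" by (rule chain_map_id_minus_X)
    show "surj_quasi_iso ?M (boundary T_reg) ?K (boundary G_reg) (\<lambda>_. push ars)"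
      by (rule Preg.proj_quasi_iso)
    show "surj_quasi_iso ?N (boundary T) ?C (boundary G) (\<lambda>_. push ars)" by (rule P.proj_quasi_iso)
  next
    fix n and m :: "_ \<Rightarrow> 'a" assume m: "m \<in> fin_chains (nerve T_reg n)"
    then have reg: "m \<in> fin_chains (reg_nerve n)" unfolding nerve_T_reg .
    then have mT: "m \<in> fin_chains (nerve T n)" by (rule fin_chains_mono[OF reg_nerve_subset])
    show "m = 0" if "m - subdivide m = 0" using subdivide_fixed[OF mT] that by simp
    show "cell_sum (m - subdivide m) = 0"
      using additive_on_diff[OF additive_on_cell_sum mT subdivide_closed[OF mT]] cell_subdivide[OF reg] by simp
    show "push ars (m - subdivide m) = push ars m - X_chain n (push ars m)" by (rule square[OF m])
  next
    fix n and y :: "_ \<Rightarrow> 'a" assume "y \<in> fin_chains (nerve T n)" "cell_sum y = 0"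
    then show "\<exists>m\<in>fin_chains (nerve T_reg n). y = m - subdivide m" unfolding nerve_T_reg by (rule cell_sum_kernel)
  next
    fix n d assume "d \<in> ?D n"
    then show "\<exists>y\<in>fin_chains (nerve T n). cell_sum y = d" unfolding cell_sum_image[symmetric] by blast
  qed
  note K = cycles_eq_cyc[OF E.f.C.chain_complex_axioms, of A, OF Greg.chain_group_eq_fin_chains]
  note C = cycles_eq_cyc[OF E.f.D.chain_complex_axioms, of A, OF chain_group_eq_fin_chains]
  note D = cycles_eq_cyc[OF E.\<Theta>.D.chain_complex_axioms, of A, OF refl]
  have \<phi>: "id_minus_X A n (residue_class (E.f.C.bd n) k) = residue_class (E.f.D.bd n) (k - X_chain n k)"
    if "k \<in> E.f.C.cyc n" for n k
    using id_minus_X_class[of k A n] that unfolding K C by blast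
  show ?thesis
    using E.long_exact_sequence[where \<phi> = "id_minus_X A", OF \<phi>]
    unfolding homology_eq_quotient_group K C D .
qed

end

theorem theorem5p1:
  fixes G :: "'g groupoid" and X :: "('g, 'x) correspondence" and E :: "'x set"
    and A :: "'a::ab_group_add itself"
  assumes "self_similar_action G X"
    and "self_similar_action.transversal G X E"
  shows "let Hreg = homology A (self_similar_action.G_reg G X);
             H = homology A G;
             HX = homology A (graph_picture.germ_groupoid G X E);
             \<phi> = graph_picture.id_minus_X G X E A
         in \<exists>\<iota> \<delta>.
           (\<forall>n. group_hom (Hreg n) (H n) (\<phi> n) \<and>
                group_hom (H n) (HX n) (\<iota> n) \<and>
                group_hom (HX (Suc n)) (Hreg n) (\<delta> n)) \<and>
           (\<forall>n. kernel (Hreg n) (H n) (\<phi> n) = \<delta> n ` carrier (HX (Suc n))) \<and>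
           (\<forall>n. kernel (H n) (HX n) (\<iota> n) = \<phi> n ` carrier (Hreg n)) \<and>
           (\<forall>n. kernel (HX (Suc n)) (Hreg n) (\<delta> n) = \<iota> (Suc n) ` carrier (H (Suc n))) \<and>
           \<iota> 0 ` carrier (H 0) = carrier (HX 0)"
proof -
  interpret graph_picture G X E by (intro graph_picture.intro graph_picture_axioms.intro assms)
  show ?thesis unfolding Let_def by (rule long_exact_sequence_homology)
qed

end
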